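(* For the $L$-shape arc $\gamma_0$ defined in the context, there exist a family of adjusted Fejér points $\mathbf z_n^{**}=\{z_{n,k}^{**}\}_{k=0}^n\subset\gamma_0$, namely the family constructed in the context, and two constants $c_1>0$, $c_2>0$, such that the Lebesgue constants $L_{\mathbf z_n^{**}}$ of $\mathbf z_n^{**}$ on $\gamma_0$ satisfy $$c_1\log^2(n)\le L_{\mathbf z_n^{**}}\le c_2\log^2(n)\qquad\text{for all integers } n\ge2.$$
   Context: The arc: $\gamma_0=\{(-1+i)x: x\in[0,27^{1/4}/\sqrt2]\}\cup\{(-1-i)x: x\in[0,27^{1/4}/\sqrt2]\}\subset\mathbb C$. The exterior conformal map of $\{|w|>1\}$ onto $\mathbb C\setminus\gamma_0$ is $\psi_0(w)=\left(w-\frac1w\right)\left(\frac{w-1}{w+1}\right)^{1/2}$, with the branch of the square root that tends to $1$ as $w\to\infty$; it is extended continuously to $|w|=1$, and the extension maps $|w|=1$ onto $\gamma_0$. The map $J:[\frac{2\pi}3,\pi]\to[0,\frac{2\pi}3]$ is defined by $\psi_0(e^{it})=\psi_0(e^{iJ(t)})$. Angles: for $0\le k\le\lfloor n/2\rfloor$, $\theta_{n,k}=\frac{2k\pi}{n+1}$ if $n$ is even and $\theta_{n,k}=\frac{(2k+1)\pi}{n+1}$ if $n$ is odd; for $\lfloor n/2\rfloor<k\le n$, $\theta_{n,k}=-\theta_{n,\,2\lfloor n/2\rfloor+1-k}$. Adjusted angles $\tilde\theta^*_{n,k}$ (a minimum over an empty set is $+\infty$): (1) For $0\le\theta_{n,j}\le\frac{2\pi}3$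 (with $k$ ranging over indices with $\frac{2\pi}3<\theta_{n,k}<\pi$): $\tilde\theta^*_{n,j}=\theta_{n,j}$ if $\min_{k}|\theta_{n,j}-J(\theta_{n,k})|\ge\frac{2\pi}{3(n+1)}$; $\tilde\theta^*_{n,j}=J(\theta_{n,k})+\frac{2\pi}{3(n+1)}$ if there is $k$ with $\theta_{n,j}-\frac{2\pi}{3(n+1)}<J(\theta_{n,k})\le\theta_{n,j}$; $\tilde\theta^*_{n,j}=J(\theta_{n,k})-\frac{2\pi}{3(n+1)}$ if there is $k$ with $\theta_{n,j}<J(\theta_{n,k})<\theta_{n,j}+\frac{2\pi}{3(n+1)}$. (2) For $\frac{2\pi}3<\theta_{n,k}<\pi$ (with $j$ ranging over indices with $0\le\theta_{n,j}\le\frac{2\pi}3$): $\tilde\theta^*_{n,k}=J(\theta_{n,k})$ if $\min_j|\theta_{n,j}-J(\theta_{n,k})|\ge\frac{2\pi}{3(n+1)}$; $\tilde\theta^*_{n,k}=\theta_{n,j}-\frac{2\pi}{3(n+1)}$ if there is $j$ with $\theta_{n,j}-\frac{2\pi}{3(n+1)}<J(\theta_{n,k})\le\theta_{n,j}$; $\tilde\theta^*_{n,k}=\theta_{n,j}+\frac{2\pi}{3(n+1)}$ if there is $j$ with $\theta_{n,j}<J(\theta_{n,k})<\theta_{n,j}+\frac{2\pi}{3(n+1)}$. (3) For $\lfloor n/2\rfloor<k\le n$: $\tilde\theta^*_{n,k}=-\tilde\theta^*_{n,\,2\lfloor n/2\rfloor+1-k}$. Adjusted Fejér points: $z_{n,k}^{**}=\psi_0(e^{i\tilde\theta^*_{n,k}})$,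 $k=0,\dots,n$. Lebesgue constant: for distinct points $\mathbf z_n=\{z_{n,k}\}_{k=0}^n$ on a compact set $X\subset\mathbb C$, $L_{\mathbf z_n}$ is the operator norm (sup-norm on $X$) of the linear operator sending $f\in C(X)$ to the polynomial of degree $\le n$ that interpolates $f$ at $\mathbf z_n$; equivalently $L_{\mathbf z_n}=\max_{z\in X}\sum_{j=0}^n|\ell_{n,j}(z)|$ with $\ell_{n,j}(z)=\prod_{k\ne j,\,0\le k\le n}\frac{z-z_{n,k}}{z_{n,j}-z_{n,k}}$. Here $X=\gamma_0$. *)

theory Defs
  imports "HOL-Analysis.Analysis" "HOL-Computational_Algebra.Polynomial"
begin

definition gamma0 :: "complex set" where
  "gamma0 =
     (\<lambda>x::real. (-1 + \<i>) * of_real x) ` {0 .. 27 powr (1/4) / sqrt 2} \<union>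
     (\<lambda>x::real. (-1 - \<i>) * of_real x) ` {0 .. 27 powr (1/4) / sqrt 2}"

text \<open>
  For \<open>norm w > 1\<close> the quotient \<open>(w - 1) / (w + 1)\<close> lies in the right half plane, so the
  principal root is the branch that tends to 1 at infinity.  The formula also gives the
  continuous extension to the unit circle; at \<open>w = -1\<close> this uses \<open>x / 0 = 0\<close>, the correct
  value there being 0.  The lemmas below confirm this.
\<close>

definition psi0 :: "complex \<Rightarrow> complex" where
  "psi0 w = (w - 1 / w) * csqrt ((w - 1) / (w + 1))"

lemma psi0_quotient_right_half_plane:
  assumes "norm w > 1"
  shows "Re ((w - 1) / (w + 1)) > 0"
proof -
  have n: "1 < (Re w)\<^sup>2 + (Im w)\<^sup>2"
    using assms power_strict_mono[of 1 "norm w" 2] by (simp add: cmod_power2)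
  have "w + 1 \<noteq> 0"
    using assms by (auto simp: add_eq_0_iff2)
  hence "0 < (Re w + 1)\<^sup>2 + (Im w)\<^sup>2"
    by (metis complex_neq_0 plus_complex.simps one_complex.simps add.right_neutral)
  thus ?thesis
    using n by (simp add: Re_divide power2_eq_square algebra_simps zero_less_divide_iff)
qed

lemma norm_psi0:
  assumes "w \<noteq> 0"
  shows "norm (psi0 w) = norm (w - 1) * sqrt (norm (w - 1) * norm (w + 1)) / norm w"
proof (cases "w = -1")
  case True
  thus ?thesis by (simp add: psi0_def)
next
  case False
  hence p: "norm (w + 1) > 0" by (simp add: add_eq_0_iff2)
  have "w - 1 / w = (w - 1) * (w + 1) / w"
    using assms by (simp add: field_simps)
  hence "norm (psi0 w) = norm (w - 1) * (norm (w + 1) * sqrt (norm (w - 1) / norm (w + 1))) / norm w"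
    by (simp add: psi0_def norm_mult norm_divide)
  also have "norm (w + 1) * sqrt (norm (w - 1) / norm (w + 1)) = sqrt (norm (w - 1) * norm (w + 1))"
    using p by (simp add: real_sqrt_divide real_sqrt_mult field_simps)
  finally show ?thesis .
qed

lemma continuous_on_psi0: "continuous_on {w. norm w \<ge> 1} psi0"
  unfolding continuous_on_eq_continuous_within
proof safe
  fix w :: complex assume w: "1 \<le> norm w"
  hence w0: "w \<noteq> 0" by auto
  show "continuous (at w within {w. 1 \<le> norm w}) psi0"
  proof (cases "w = 1 \<or> w = -1")
    case True
    have "((\<lambda>v. norm (v - 1) * sqrt (norm (v - 1) * norm (v + 1)) / norm v)
             \<longlongrightarrow> norm (w - 1) * sqrt (norm (w - 1) * norm (w + 1)) / norm w) (at w)"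
      using w0 by (intro tendsto_intros) auto
    moreover have "\<forall>\<^sub>F v in at w. v \<noteq> 0"
      using w0 by (auto simp: eventually_at_filter intro: eventually_mono[OF t1_space_nhds])
    hence "\<forall>\<^sub>F v in at w.
        norm (v - 1) * sqrt (norm (v - 1) * norm (v + 1)) / norm v = norm (psi0 v)"
      by eventually_elim (simp add: norm_psi0)
    ultimately have "((\<lambda>v. norm (psi0 v)) \<longlongrightarrow> norm (psi0 w)) (at w)"
      unfolding norm_psi0[OF w0] by (rule Lim_transform_eventually)
    moreover have "psi0 w = 0"
      using True by (auto simp: psi0_def)
    ultimately have "(psi0 \<longlongrightarrow> psi0 w) (at w)"
      by (simp add: tendsto_norm_zero_iff)
    thus ?thesis
      by (simp add: continuous_within Lim_at_imp_Lim_at_within)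
  next
    case False
    have w1: "w + 1 \<noteq> 0" using False by (auto simp: add_eq_0_iff2)
    have "(w - 1) / (w + 1) \<notin> \<real>\<^sub>\<le>\<^sub>0"
    proof
      assume "(w - 1) / (w + 1) \<in> \<real>\<^sub>\<le>\<^sub>0"
      then obtain r :: real where r: "r \<le> 0" "(w - 1) / (w + 1) = of_real r"
        by (auto elim!: nonpos_Reals_cases)
      have "w - 1 = of_real r * (w + 1)"
        using r w1 by (simp add: field_simps)
      hence "w * of_real (1 - r) = of_real (1 + r)"
        by (simp add: algebra_simps)
      hence e: "norm w * (1 - r) = \<bar>1 + r\<bar>"
        using r by (metis abs_of_nonneg diff_ge_0_iff_ge norm_mult norm_of_real order_trans zero_le_one)
      have "1 - r \<le> norm w * (1 - r)"
        using w r by (simp add: mult_le_cancel_right1)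
      hence "r = 0" using e r by linarith
      hence "w = 1" using r w1 by auto
      thus False using False by simp
    qed
    hence "isCont (\<lambda>v. (v - 1 / v) * csqrt ((v - 1) / (v + 1))) w"
      using w0 w1 by (intro continuous_intros isCont_o2[OF _ continuous_at_csqrt]) auto
    hence "isCont psi0 w"
      by (simp add: psi0_def[abs_def])
    thus ?thesis by (rule continuous_at_imp_continuous_at_within)
  qed
qed

text \<open>
  On \<open>[0, pi]\<close> the modulus of \<open>psi0 (cis t)\<close> increases strictly up to \<open>2 * pi / 3\<close> and decreases
  strictly afterwards, from 0 and back to 0, so the description is unique.
\<close>

definition J :: "real \<Rightarrow> real" where
  "J t = (THE s. s \<in> {0 .. 2 * pi / 3} \<and> psi0 (cis t) = psi0 (cis s))"

definition theta_upper :: "nat \<Rightarrow> nat \<Rightarrow> real" where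
  "theta_upper n k =
     (if even n then 2 * real k * pi / (real n + 1)
      else (2 * real k + 1) * pi / (real n + 1))"

definition theta :: "nat \<Rightarrow> nat \<Rightarrow> real" where
  "theta n k =
     (if k \<le> n div 2 then theta_upper n k
      else - theta_upper n (2 * (n div 2) + 1 - k))"

definition inner_idx :: "nat \<Rightarrow> nat set" where
  "inner_idx n = {j. j \<le> n \<and> 0 \<le> theta n j \<and> theta n j \<le> 2 * pi / 3}"

definition outer_idx :: "nat \<Rightarrow> nat set" where
  "outer_idx n = {k. k \<le> n \<and> 2 * pi / 3 < theta n k \<and> theta n k < pi}"

definition gap :: "nat \<Rightarrow> real" where
  "gap n = 2 * pi / (3 * (real n + 1))"

text \<open>
  A minimum being at least \<open>gap n\<close> is written as a bounded quantifier, which is true for an empty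
  index set, as is the convention that the empty minimum is infinite.  At most one index satisfies
  each of the conditions under \<open>SOME\<close>: neighbouring angles \<open>theta n j\<close> are \<open>3 * gap n\<close> apart, and
  the values \<open>J (theta n k)\<close> are at least that far apart since \<open>J\<close> expands distances.
\<close>

definition adjusted_inner :: "nat \<Rightarrow> nat \<Rightarrow> real" where
  "adjusted_inner n j =
     (let below = (\<lambda>k. k \<in> outer_idx n \<and> theta n j - gap n < J (theta n k) \<and> J (theta n k) \<le> theta n j);
          above = (\<lambda>k. k \<in> outer_idx n \<and> theta n j < J (theta n k) \<and> J (theta n k) < theta n j + gap n)
      in if \<forall>k\<in>outer_idx n. \<bar>theta n j - J (theta n k)\<bar> \<ge> gap n then theta n j
         else if \<exists>k. below k then J (theta n (SOME k. below k)) + gap n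
         else J (theta n (SOME k. above k)) - gap n)"

definition adjusted_outer :: "nat \<Rightarrow> nat \<Rightarrow> real" where
  "adjusted_outer n k =
     (let below = (\<lambda>j. j \<in> inner_idx n \<and> theta n j - gap n < J (theta n k) \<and> J (theta n k) \<le> theta n j);
          above = (\<lambda>j. j \<in> inner_idx n \<and> theta n j < J (theta n k) \<and> J (theta n k) < theta n j + gap n)
      in if \<forall>j\<in>inner_idx n. \<bar>theta n j - J (theta n k)\<bar> \<ge> gap n then J (theta n k)
         else if \<exists>j. below j then theta n (SOME j. below j) - gap n
         else theta n (SOME j. above j) + gap n)"

definition adjusted_upper :: "nat \<Rightarrow> nat \<Rightarrow> real" where
  "adjusted_upper n k = (if k \<in> inner_idx n then adjusted_inner n k else adjusted_outer n k)"

definition adjusted_theta :: "nat \<Rightarrow> nat \<Rightarrow> real" where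
  "adjusted_theta n k =
     (if k \<le> n div 2 then adjusted_upper n k
      else - adjusted_upper n (2 * (n div 2) + 1 - k))"

definition adjusted_fejer :: "nat \<Rightarrow> nat \<Rightarrow> complex" where
  "adjusted_fejer n k = psi0 (cis (adjusted_theta n k))"

text \<open>
  The nodes are \<open>z 0, ..., z n\<close>.  The interpolating polynomial exists uniquely when they are
  distinct.
\<close>

definition interp_poly :: "nat \<Rightarrow> (nat \<Rightarrow> complex) \<Rightarrow> (complex \<Rightarrow> complex) \<Rightarrow> complex poly" where
  "interp_poly n z f = (THE p. degree p \<le> n \<and> (\<forall>k\<le>n. poly p (z k) = f (z k)))"

definition sup_norm :: "complex set \<Rightarrow> (complex \<Rightarrow> complex) \<Rightarrow> real" where
  "sup_norm X f = (SUP x\<in>X. norm (f x))"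

text \<open>
  The operator norm of interpolation on \<open>C(X)\<close>, as the supremum over the unit ball.  Elements of
  \<open>C(X)\<close> are represented by functions continuous on \<open>X\<close>, whose values off \<open>X\<close> play no role when
  the nodes lie in \<open>X\<close>.  Meant for compact nonempty \<open>X\<close> and distinct nodes in \<open>X\<close>, where both
  suprema are over nonempty bounded sets.
\<close>

definition lebesgue_constant :: "complex set \<Rightarrow> nat \<Rightarrow> (nat \<Rightarrow> complex) \<Rightarrow> real" where
  "lebesgue_constant X n z =
     (SUP f\<in>{f. continuous_on X f \<and> sup_norm X f \<le> 1}. sup_norm X (poly (interp_poly n z f)))"

end

theory Submission imports Defs "HOL-Complex_Analysis.Complex_Analysis" begin

text \<open>
  The upper half of the unit circle is wrapped twice around the upper arm: \<open>[0, tip]\<close> runs from the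
  corner to the tip (inner angles), and \<open>[tip, pi]\<close> runs back (outer angles). Points of the arm are
  labelled by their inner angle \<open>s\<close>; \<open>K s\<close> is the outer angle of the same point. The lower arm is the
  mirror image, and its nodes contribute no more than those of the upper arm.

  The absolute value of a fundamental polynomial is the product of the distances to all nodes
  (\<open>wst\<close>), divided by the distance to its own node and by the derivative there (\<open>vv\<close>). For the Fejer
  points this product is, up to constants, \<open>DD n s * DD n (K s)\<close>: each side of the arc contributes the
  distance of its angle to the lattice of nodes (\<open>node_prod_lower\<close>, \<open>node_prod_upper\<close>). This follows by
  evaluating a quartic at roots of unity; the two roots off the circle are compensated by an integral
  computed with Jensen's formula. It degenerates when an inner node and a folded outer node
  almost coincide, and the adjustment spreads such pairs. As \<open>ln (abs (rho s - rho x))\<close> is concave in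
  \<open>x\<close> on either side of \<open>s\<close>, all spreads together change the product by a constant factor only
  (\<open>spread_log_sum\<close>, \<open>spread_mirror_sum\<close>, \<open>wst_upper\<close>).

  At an inner node \<open>p\<close> the derivative still contains \<open>DD n (K p)\<close>. Near the corner \<open>K\<close> contracts with
  slope of order \<open>p^2\<close> (\<open>K_diff\<close>). Around a folded outer node \<open>b\<close> there is therefore a long row of inner
  nodes \<open>p\<close> whose outer angle is almost a lattice point, and the inverse of the derivative at \<open>p\<close> is
  enlarged by \<open>gap n / (b^2 * abs (p - b))\<close> (\<open>vv_bound\<close>). Summation over the row gives one
  logarithm (\<open>double_sum_bound\<close>), summation over the outer nodes, weighted by the nodal product, a second
  one (\<open>outer_sum_bound\<close>). Both are attained: at a suitable point near the corner the \<open>m\<close>-th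
  inner node next to the \<open>i\<close>-th outer node contributes at least a multiple of \<open>1 / (i * m)\<close>, for \<open>i\<close> and \<open>m\<close>
  up to a power of \<open>n\<close> (\<open>Lam_lower_core\<close>).
\<close>

section \<open>Moduli on the arc\<close>

abbreviation (input) adj :: "nat => nat => real" where "adj \<equiv> adjusted_upper"
abbreviation (input) fej :: "nat => nat => complex" where "fej \<equiv> adjusted_fejer"
abbreviation (input) thu :: "nat => nat => real" where "thu \<equiv> theta_upper"
abbreviation NN :: "nat => real" where "NN n \<equiv> real n + 1"

text \<open>The upper half of the unit circle is sent to the upper arm; the modulus at angle
  \<open>t\<close> is \<open>rho t\<close>, with square \<open>rsq t\<close>, and the end of the
  arm is reached at \<open>tip\<close>.\<close>
definition tip :: real where "tip = 2 * pi / 3"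

definition rsq :: "real => real" where "rsq t = 16 * sin (t/2) ^ 3 * cos (t/2)"

definition rho :: "real => real" where "rho t = sqrt (rsq t)"

lemma tip_bounds: "2 < tip" "tip < 2.1" "0 < tip" "tip < pi"
 using pi_approx pi_gt_zero by (auto simp: tip_def)

lemma cos_half_ge: assumes "0 <= x" "x <= tip" shows "cos (x/2) \<ge> 1/2"
proof -
 have "cos (pi/3) <= cos (x/2)"
  using assms by (intro cos_monotone_0_pi_le) (auto simp: tip_def)
 thus ?thesis by (simp add: cos_60)
qed

lemma sin_half_bounds: assumes "0 <= x" "x <= tip"
 shows "x/4 <= sin (x/2)" "sin (x/2) <= x/2"
proof -
 have c: "cos (x/2) \<ge> 1/2" by (rule cos_half_ge[OF assms])
 have "x/2 < pi/2" using assms tip_bounds by linarith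
 hence "abs (x/2) <= abs (tan (x/2))" using assms by (intro abs_tan_ge) auto
 moreover have s: "sin (x/2) \<ge> 0" using assms tip_bounds by (intro sin_ge_zero) auto
 ultimately have "x/2 <= sin (x/2) / cos (x/2)" using c assms by (simp add: tan_def)
 hence "x/2 * cos (x/2) <= sin (x/2)" using c by (simp add: field_simps)
 moreover have "x/2 * (1/2) <= x/2 * cos (x/2)" using c assms by (intro mult_left_mono) auto
 ultimately show "x/4 <= sin (x/2)" by simp
 show "sin (x/2) <= x/2" using assms by (intro sin_x_le_x) auto
qed

lemma sin_ge_half_arg: assumes "0 <= u" "u <= pi/2" shows "u/2 <= sin u"
proof (cases "u <= pi/3")
 case True
 thus ?thesis using sin_half_bounds(1)[of "2*u"] assms by (simp add: tip_def)
next
 case False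
 have "sin (pi/3) <= sin u"
  using False assms by (intro sin_monotone_2pi_le) auto
 hence "sqrt 3 / 2 <= sin u" by (simp add: sin_60)
 moreover have "1.7 <= sqrt 3" by (rule real_le_rsqrt) (simp add: power2_eq_square)
 moreover have "u/2 <= 0.8" using assms pi_approx by simp
 ultimately show ?thesis by linarith
qed

definition drsq :: "real => real" where "drsq t = 8 * sin (t/2) ^ 2 * (4 * cos (t/2) ^ 2 - 1)"

lemma rsq_deriv: "(rsq has_real_derivative drsq t) (at t within A)"
proof -
 have e: "16 * (3 * sin (t/2) ^ 2 * (cos (t/2) / 2) * cos (t/2) + sin (t/2) ^ 3 * (- sin (t/2) / 2)) = drsq t"
 proof -
  have "16 * (3 * sin (t/2) ^ 2 * (cos (t/2) / 2) * cos (t/2) + sin (t/2) ^ 3 * (- sin (t/2) / 2))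
   = 8 * sin (t/2) ^ 2 * (3 * cos (t/2) ^ 2 - sin (t/2) ^ 2)" by algebra
  thus ?thesis by (simp add: drsq_def sin_squared_eq)
 qed
 show ?thesis
  unfolding rsq_def[abs_def] e[symmetric]
  by (auto intro!: derivative_eq_intros simp: power2_eq_square power3_eq_cube algebra_simps)
qed

lemma isCont_rsq: "isCont rsq t" using rsq_deriv DERIV_isCont by blast

lemma continuous_on_rsq: "continuous_on A rsq"
 by (intro continuous_at_imp_continuous_on ballI isCont_rsq)

lemma drsq_factor: "drsq t = 8 * sin (t/2) ^ 2 * (4 * sin ((tip + t) / 2) * sin ((tip - t) / 2))"
proof -
 have "4 * cos (t/2) ^ 2 - 1 = 1 + 2 * cos (2 * (t/2))"
  unfolding cos_double_cos by simp
 also have "... = 2 * (cos t - cos tip)" 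
  by (simp add: tip_def cos_120)
 also have "... = 4 * sin ((tip + t) / 2) * sin ((tip - t) / 2)"
  by (subst cos_diff_cos) (simp add: algebra_simps)
 finally show ?thesis by (simp add: drsq_def)
qed

lemma drsq_bounds: assumes "0 <= x" "x <= tip"
 shows "x^2 * (tip - x) / 4 <= drsq x" "drsq x <= 4 * (x^2 * (tip - x))"
proof -
 note sh = sin_half_bounds[OF assms]
 define a where "a = sin ((tip + x) / 2)"
 define b where "b = sin ((tip - x) / 2)"
 have b: "(tip - x)/4 <= b" "b <= (tip - x)/2"
  unfolding b_def using sin_half_bounds[of "tip - x"] assms by auto
 have a: "1/2 <= a"
 proof (cases "(tip + x)/2 <= pi/2")
  case True
  have "sin (pi/3) <= a" unfolding a_def
   using True assms by (intro sin_monotone_2pi_le) (auto simp: tip_def)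
  moreover have "1 <= sqrt (3::real)" by simp
  ultimately show ?thesis unfolding sin_60 by linarith
 next
  case False
  have "sin (pi/3) <= sin (pi - (tip + x)/2)"
   using False assms by (intro sin_monotone_2pi_le) (auto simp: tip_def field_simps)
  moreover have "1 <= sqrt (3::real)" by simp
  moreover have "sin (pi - (tip + x)/2) = a" by (simp add: a_def)
  ultimately show ?thesis unfolding sin_60 by linarith
 qed
 have a1: "a <= 1" by (simp add: a_def)
 have e: "drsq x = 32 * (sin (x/2) ^ 2 * (a * b))"
  by (simp add: drsq_factor a_def b_def)
 have "(x/4)^2 * (1/2 * ((tip - x)/4)) <= sin (x/2) ^ 2 * (a * b)"
  using sh a b assms by (intro mult_mono power_mono) auto
 thus "x^2 * (tip - x) / 4 <= drsq x" unfolding e by (simp add: power2_eq_square field_simps)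
 have "sin (x/2) ^ 2 * (a * b) <= (x/2)^2 * (1 * ((tip - x)/2))"
  using sh a a1 b assms by (intro mult_mono power_mono) auto
 thus "drsq x <= 4 * (x^2 * (tip - x))" unfolding e by (simp add: power2_eq_square field_simps)
qed

lemma drsq_neg: assumes "tip < t" "t < pi" shows "drsq t < 0"
proof -
 have "sin (t/2) > 0" using assms tip_bounds by (intro sin_gt_zero) auto
 moreover have "sin ((tip + t)/2) > 0" using assms tip_bounds by (intro sin_gt_zero) auto
 moreover have "sin ((t - tip)/2) > 0" using assms tip_bounds by (intro sin_gt_zero) auto
 hence "sin ((tip - t)/2) < 0"
  by (metis minus_diff_eq minus_divide_left neg_0_less_iff_less sin_minus)
 ultimately show ?thesis unfolding drsq_factor
  by (simp add: mult_pos_neg)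
qed

lemma rsq_0 [simp]: "rsq 0 = 0" and rsq_pi_eq [simp]: "rsq pi = 0"
 by (auto simp: rsq_def)

lemma rsq_tip: "rsq tip = 3 * sqrt 3"
 by (simp add: rsq_def tip_def sin_60 cos_60 power3_eq_cube)

text \<open>An antiderivative of \<open>x^2 * (tip - x)\<close>, to which the derivative of
  \<open>rsq\<close> is comparable: \<open>rsq\<close> vanishes to third order at the corner and
  has a simple critical point at the tip.\<close>
definition cubq :: "real => real" where "cubq x = tip * x^3 / 3 - x^4 / 4"

lemma cubq_deriv: "(cubq has_real_derivative x^2 * (tip - x)) (at x within A)"
 unfolding cubq_def[abs_def]
 by (auto intro!: derivative_eq_intros simp: power2_eq_square power3_eq_cube power4_eq_xxxx algebra_simps)

lemma cubq_diff: assumes "0 <= x" "x <= s" "s <= tip"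
 shows "(s - x) * (s + x)^2 * (2*tip - s - x) / 12 <= cubq s - cubq x"
  "cubq s - cubq x <= (s - x) * (s + x)^2 * (2*tip - s - x)"
proof -
 define a where "a = tip - s"
 define d where "d = s - x"
 have tt: "tip = x + d + a" "s = x + d" by (auto simp: a_def d_def)
 have nn: "a \<ge> 0" "d \<ge> 0" "x \<ge> 0" using assms by (auto simp: a_def d_def)
 have e: "cubq s - cubq x = d * (d * (s^2 + 2 * s * x + 3*x^2) / 12 + a * (s^2 + s * x + x^2) / 3)"
  unfolding cubq_def tt by (simp add: field_simps power2_eq_square power3_eq_cube power4_eq_xxxx)
 have "d * ((s+x)^2 * (2*a + d) / 12) <= d * (d * (s^2 + 2 * s * x + 3*x^2) / 12 + a * (s^2 + s * x + x^2) / 3)"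
 proof (rule mult_left_mono)
  have 1: "(s+x)^2 * d <= (s^2 + 2 * s * x + 3*x^2) * d"
   using nn by (intro mult_right_mono) (auto simp: power2_eq_square algebra_simps)
  have "0 <= (s - x)^2" by simp
  hence "3 * (s+x)^2 <= 4 * (s^2 + s * x + x^2)" by (simp add: power2_eq_square algebra_simps)
  moreover have "0 <= s^2 + s * x + x^2" using nn tt(2) by simp
  ultimately have "2 * (s+x)^2 <= 4 * (s^2 + s * x + x^2)" by (smt (verit) zero_le_power2)
  hence 2: "2 * (s+x)^2 * a <= 4 * (s^2 + s * x + x^2) * a"
   using nn by (intro mult_right_mono) auto
  have "(s+x)^2 * (2*a + d) = (s+x)^2 * d + 2 * (s+x)^2 * a" by (simp add: algebra_simps)
  thus "(s+x)^2 * (2*a + d) / 12 <= d * (s^2 + 2 * s * x + 3*x^2) / 12 + a * (s^2 + s * x + x^2) / 3"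
   using 1 2 unfolding mult.commute[of d] mult.commute[of a] by linarith
 qed (use nn in auto)
 moreover have eq: "2*tip - s - x = 2*a + d" by (simp add: tt)
 have "(s - x) * (s + x)^2 * (2*tip - s - x) / 12 = d * ((s+x)^2 * (2*a + d) / 12)"
  unfolding eq d_def by simp
 ultimately show "(s - x) * (s + x)^2 * (2*tip - s - x) / 12 <= cubq s - cubq x"
  unfolding e by linarith
 have "d * (d * (s^2 + 2 * s * x + 3*x^2) / 12 + a * (s^2 + s * x + x^2) / 3) <= d * ((s+x)^2 * (2*a + d))"
 proof (rule mult_left_mono)
  have sx: "0 <= s * x" "0 <= s" using nn tt(2) by auto
  have 1: "(s^2 + 2 * s * x + 3*x^2) * d <= (3 * (s+x)^2) * d"
   using nn sx by (intro mult_right_mono) (auto simp: power2_eq_square algebra_simps)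
  have 2: "(s^2 + s * x + x^2) * a <= (s+x)^2 * a"
   using nn sx by (intro mult_right_mono) (auto simp: power2_eq_square algebra_simps)
  have "0 <= (s+x)^2 * d" "0 <= (s+x)^2 * a" using nn by auto
  moreover have "(s+x)^2 * (2*a + d) = (s+x)^2 * d + 2 * ((s+x)^2 * a)" by (simp add: algebra_simps)
  moreover have "3 * (s+x)^2 * d = 3 * ((s+x)^2 * d)" by simp
  ultimately show "d * (s^2 + 2 * s * x + 3*x^2) / 12 + a * (s^2 + s * x + x^2) / 3 <= (s+x)^2 * (2*a + d)"
   using 1 2 unfolding mult.commute[of d] mult.commute[of a] by linarith
 qed (use nn in auto)
 moreover have "(s - x) * (s + x)^2 * (2*tip - s - x) = d * ((s+x)^2 * (2*a + d))"
  unfolding eq d_def by simp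
 ultimately show "cubq s - cubq x <= (s - x) * (s + x)^2 * (2*tip - s - x)"
  unfolding e by linarith
qed

lemma rsq_diff_bounds_ordered: assumes "0 <= x" "x <= s" "s <= tip"
 shows "(s - x) * (s + x)^2 * (2*tip - s - x) / 48 <= rsq s - rsq x"
  "rsq s - rsq x <= 4 * ((s - x) * (s + x)^2 * (2*tip - s - x))"
proof -
 have "rsq x - cubq x / 4 <= rsq s - cubq s / 4"
 proof (rule DERIV_nonneg_imp_nondecreasing[OF assms(2)])
  fix u assume u: "x <= u" "u <= s"
  show "\<exists>y. ((%u. rsq u - cubq u / 4) has_real_derivative y) (at u) \<and> 0 <= y"
   using drsq_bounds(1)[of u] u assms
   by (intro exI[of _ "drsq u - u^2 * (tip - u) / 4"] conjI DERIV_diff rsq_deriv DERIV_cdivide cubq_deriv) auto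
 qed
 thus "(s - x) * (s + x)^2 * (2*tip - s - x) / 48 <= rsq s - rsq x"
  using cubq_diff(1)[OF assms] by simp
 have "4 * cubq x - rsq x <= 4 * cubq s - rsq s"
 proof (rule DERIV_nonneg_imp_nondecreasing[OF assms(2)])
  fix u assume u: "x <= u" "u <= s"
  show "\<exists>y. ((%u. 4 * cubq u - rsq u) has_real_derivative y) (at u) \<and> 0 <= y"
   using drsq_bounds(2)[of u] u assms
   by (intro exI[of _ "4 * (u^2 * (tip - u)) - drsq u"] conjI DERIV_diff rsq_deriv DERIV_cmult cubq_deriv) auto
 qed
 thus "rsq s - rsq x <= 4 * ((s - x) * (s + x)^2 * (2*tip - s - x))"
  using cubq_diff(2)[OF assms] by simp
qed

lemma rsq_diff_bounds: assumes "x \<in> {0..tip}" "s \<in> {0..tip}"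
 shows "abs (s - x) * (s + x)^2 * (2*tip - s - x) / 48 <= abs (rsq s - rsq x)"
  "abs (rsq s - rsq x) <= 4 * (abs (s - x) * (s + x)^2 * (2*tip - s - x))"
proof -
 have "0 <= 2*tip - s - x" using assms by auto
 hence nn: "0 <= (s + x)^2 * (2*tip - s - x)"
  by (intro mult_nonneg_nonneg) auto
 have "abs (s - x) * (s + x)^2 * (2*tip - s - x) / 48 <= abs (rsq s - rsq x) \<and>
   \<bar>rsq s - rsq x\<bar> <= 4 * (\<bar>s - x\<bar> * (s + x)^2 * (2*tip - s - x))"
 proof (cases "x <= s")
  case True
  have "0 <= (s - x) * ((s + x)^2 * (2*tip - s - x))" by (rule mult_nonneg_nonneg[OF _ nn]) (use True in simp)
  with rsq_diff_bounds_ordered[of x s] True assms have "rsq x <= rsq s" by (simp add: mult_ac)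
  with rsq_diff_bounds_ordered[of x s] True assms show ?thesis by auto
 next
  case False
  have "0 <= (x - s) * ((s + x)^2 * (2*tip - s - x))" by (rule mult_nonneg_nonneg[OF _ nn]) (use False in simp)
  moreover have c: "2*tip - x - s = 2*tip - s - x" "x + s = s + x" by auto
  ultimately have "rsq s <= rsq x" using rsq_diff_bounds_ordered[of s x, unfolded c] False assms
   by (simp add: mult_ac)
  with rsq_diff_bounds_ordered[of s x, unfolded c] False assms show ?thesis by auto
 qed
 thus "abs (s - x) * (s + x)^2 * (2*tip - s - x) / 48 <= abs (rsq s - rsq x)"
  "abs (rsq s - rsq x) <= 4 * (abs (s - x) * (s + x)^2 * (2*tip - s - x))" by auto
qed

lemma rsq_bounds: assumes "s \<in> {0..tip}"
 shows "s^3 / 24 <= rsq s" "rsq s <= 17 * s^3"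
proof -
 have "s^3 * 2 <= s^3 * (2*tip - s)" using assms tip_bounds by (intro mult_left_mono) auto
 thus "s^3 / 24 <= rsq s" using rsq_diff_bounds_ordered(1)[of 0 s] assms
  by (simp add: power2_eq_square power3_eq_cube)
 have "s^3 * (2*tip - s) <= s^3 * 4.2" using assms tip_bounds by (intro mult_left_mono) auto
 moreover have "0 <= s^3" using assms by simp
 moreover have "rsq s <= 4 * (s^3 * (2*tip - s))" using rsq_diff_bounds_ordered(2)[of 0 s] assms
  by (simp add: power2_eq_square power3_eq_cube)
 ultimately show "rsq s <= 17 * s^3" by linarith
qed

lemma rsq_strict_mono: assumes "0 <= x" "x < s" "s <= tip" shows "rsq x < rsq s"
proof -
 have "0 < (s - x) * (s + x)^2 * (2*tip - s - x)"
  using assms by (intro mult_pos_pos) (auto simp: algebra_simps)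
 hence "0 < (s - x) * (s + x)^2 * (2*tip - s - x) / 48" by simp
 thus ?thesis using rsq_diff_bounds_ordered(1)[of x s] assms by linarith
qed

lemma rsq_strict_antimono: assumes "tip <= x" "x < s" "s <= pi" shows "rsq s < rsq x"
 using assms by (intro DERIV_neg_imp_decreasing_open[where f = rsq])
  (auto intro!: exI[of _ "drsq _"] rsq_deriv drsq_neg continuous_on_rsq)

lemma rsq_nonneg: assumes "0 <= t" "t <= pi" shows "0 <= rsq t"
 using assms by (auto simp: rsq_def intro!: mult_nonneg_nonneg sin_ge_zero cos_ge_zero)

lemma rsq_pos: assumes "0 < t" "t < pi" shows "0 < rsq t"
 using assms by (auto simp: rsq_def intro!: mult_pos_pos sin_gt_zero cos_gt_zero_pi)

lemma rsq_le_tip: assumes "0 <= t" "t <= pi" shows "rsq t <= rsq tip"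
 using assms rsq_strict_mono[of t tip] rsq_strict_antimono[of tip t] by (cases t tip rule: linorder_cases) auto

lemma rho_0 [simp]: "rho 0 = 0" and rho_pi [simp]: "rho pi = 0"
 by (auto simp: rho_def)

lemma rho_sq: assumes "0 <= t" "t <= pi" shows "rho t ^ 2 = rsq t"
 using rsq_nonneg[OF assms] by (simp add: rho_def)

lemma rho_nonneg: assumes "0 <= t" "t <= pi" shows "0 <= rho t"
 using rsq_nonneg[OF assms] by (simp add: rho_def)

lemma rho_pos: assumes "0 < t" "t < pi" shows "0 < rho t"
 using rsq_pos[OF assms] by (simp add: rho_def)

lemma rho_strict_mono: assumes "0 <= x" "x < s" "s <= tip" shows "rho x < rho s"
 using rsq_strict_mono[OF assms] by (simp add: rho_def)

lemma rho_mono: assumes "0 <= x" "x <= s" "s <= tip" shows "rho x <= rho s"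
 using rho_strict_mono[of x s] assms by (cases "x = s") auto

lemma rho_antimono: assumes "tip <= x" "x <= s" "s <= pi" shows "rho s <= rho x"
 using rsq_strict_antimono[of x s] assms by (cases "x = s") (auto simp: rho_def)

lemma rho_le_tip: assumes "0 <= t" "t <= pi" shows "rho t <= rho tip"
 using rsq_le_tip[OF assms] by (simp add: rho_def)

lemma isCont_rho: "isCont rho t"
 unfolding rho_def[abs_def] by (rule isCont_o2[OF isCont_rsq isCont_real_sqrt])

lemma continuous_on_rho: "continuous_on A rho"
 by (intro continuous_at_imp_continuous_on ballI isCont_rho)

lemma rho_inj: assumes "x \<in> {0..tip}" "s \<in> {0..tip}" "rho x = rho s" shows "x = s"
 using rho_strict_mono[of x s] rho_strict_mono[of s x] assms
 by (cases x s rule: linorder_cases) auto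

lemma rho_tip: "rho tip = 27 powr (1/4)"
proof -
 have "rho tip = sqrt (3 * sqrt 3)" by (simp add: rho_def rsq_tip)
 also have "3 * sqrt 3 = sqrt (27::real)"
  by (rule real_sqrt_unique[symmetric]) (auto simp: power2_eq_square)
 also have "sqrt (sqrt 27) = (27::real) powr (1/4)"
  by (simp add: powr_half_sqrt[symmetric] powr_powr)
 finally show ?thesis .
qed

text \<open>Up to constants, \<open>mu x * (tip - x)\<close> is the derivative of
  \<open>rho\<close> at \<open>x\<close>.\<close>
definition mu :: "real => real" where "mu x = x^2 / rho x"

lemma rho_diff: "rho s ^ 2 = rsq s ==> rho x ^ 2 = rsq x ==> \<bar>rho s - rho x\<bar> * (rho s + rho x) = \<bar>rsq s - rsq x\<bar>"
 if "rho s \<ge> 0" "rho x \<ge> 0" 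
proof -
 assume a: "rho s ^ 2 = rsq s" "rho x ^ 2 = rsq x"
 have "rsq s - rsq x = (rho s - rho x) * (rho s + rho x)"
  unfolding a[symmetric] by (simp add: power2_eq_square algebra_simps)
 thus ?thesis using that by (simp add: abs_mult)
qed

lemma rho_ratio: assumes "0 < x" "x <= s" "s <= tip" shows "rho s / rho x <= 21 * (s/x)^2"
proof -
 have x0: "0 < rsq x" using rsq_pos[of x] assms tip_bounds by auto
 have "rsq s / rsq x <= (17 * s^3) / (x^3/24)"
  using rsq_bounds[of s] rsq_bounds[of x] assms x0 by (intro frac_le) auto
 also have "... = 408 * (s/x)^3" by (simp add: power_divide)
 also have "... <= 441 * (s/x)^4"
 proof -
  have "(s/x)^3 <= (s/x)^4" using assms by (intro power_increasing) auto
  moreover have "0 <= (s/x)^3" using assms by simp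
  ultimately show ?thesis by linarith
 qed
 finally have "sqrt (rsq s / rsq x) <= sqrt ((21 * (s/x)^2)^2)"
  by (intro real_sqrt_le_mono) (simp add: power_mult_distrib flip: power_mult)
 also have "... = 21 * (s/x)^2" by (rule real_sqrt_unique) auto
 finally have "sqrt (rsq s / rsq x) <= 21 * (s/x)^2" .
 thus ?thesis using assms by (simp add: rho_def real_sqrt_divide)
qed

text \<open>The factor \<open>2 * tip - s - x\<close> keeps track of the square root behaviour at
  the tip, where the slope of \<open>rho\<close> degenerates.\<close>
lemma rho_diff_lower: assumes "s \<in> {0..tip}" "0 < x" "x <= tip"
 shows "abs (s - x) * mu x * (2*tip - s - x) / 2200 <= abs (rho s - rho x)"
proof -
 have rx: "0 < rho x" using rho_pos[of x] assms tip_bounds by auto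
 have rs: "0 <= rho s" using rho_nonneg[of s] assms tip_bounds by auto
 have k: "mu x * (rho s + rho x) <= 22 * (s + x)^2"
 proof (cases "s <= x")
  case True
  hence "rho s <= rho x" using rho_mono[of s x] assms by auto
  hence "x^2 * (rho s + rho x) <= x^2 * (2 * rho x)" by (intro mult_left_mono) auto
  also have "... <= (22 * (s+x)^2) * rho x"
  proof -
   have "x^2 <= (s+x)^2" using assms by (intro power_mono) auto
   moreover have "0 <= (s+x)^2" by simp
   ultimately have "2 * x^2 <= 22 * (s+x)^2" by linarith
   hence "2 * x^2 * rho x <= 22 * (s+x)^2 * rho x" using rx by (intro mult_right_mono) auto
   thus ?thesis by (simp add: mult_ac)
  qed
  finally show ?thesis using rx by (simp add: mu_def field_simps)
 next
  case False
  have "mu x * (rho s + rho x) = x^2 * (rho s / rho x) + x^2" using rx by (simp add: mu_def field_simps)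
  also have "... <= x^2 * (21 * (s/x)^2) + x^2"
   using rho_ratio[of x s] False assms by (intro add_right_mono mult_left_mono) auto
  also have "... = 21 * s^2 + x^2" using assms by (simp add: power_divide)
  also have "... <= 22 * (s^2 + x^2)" by simp
  also have "... <= 22 * (s + x)^2" using assms by (simp add: power2_eq_square algebra_simps)
  finally show ?thesis .
 qed
 have "abs (s - x) * (2*tip - s - x) / 48 * (mu x * (rho s + rho x)) <= abs (s - x) * (2*tip - s - x) / 48 * (22 * (s+x)^2)"
  using k assms by (intro mult_left_mono) auto
 also have "... = 22 * (abs (s - x) * (s + x)^2 * (2*tip - s - x) / 48)" by simp
 also have "... <= 22 * abs (rsq s - rsq x)" using rsq_diff_bounds(1)[of x s] assms by auto
 also have "... = 22 * abs (rho s - rho x) * (rho s + rho x)"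
  using rho_diff[of s x] rx rs rho_sq[of s] rho_sq[of x] assms tip_bounds by auto
 finally have "(abs (s - x) * (2*tip - s - x) / 48 * mu x) * (rho s + rho x) <= (22 * abs (rho s - rho x)) * (rho s + rho x)"
  by (simp add: mult_ac)
 hence "abs (s - x) * (2*tip - s - x) / 48 * mu x <= 22 * abs (rho s - rho x)"
  using rx rs by (simp add: mult_le_cancel_right)
 moreover have "0 <= abs (s - x) * mu x * (2*tip - s - x)" using assms rx by (auto simp: mu_def)
 ultimately show ?thesis by (simp add: mult_ac)
qed

lemma rho_diff_upper: assumes "s \<in> {0..tip}" "x \<in> {0..tip}"
 shows "abs (rho s - rho x) * (rho s + rho x) <= 4 * (abs (s - x) * (s + x)^2 * (2*tip - s - x))"
 using rho_diff[of s x] rho_nonneg[of s] rho_nonneg[of x] rho_sq[of s] rho_sq[of x]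
  rsq_diff_bounds(2)[of x s] assms tip_bounds by auto

section \<open>The two arms\<close>

lemma psi0_cis: assumes "0 <= t" "t <= pi"
 shows "psi0 (cis t) = of_real (rho t) * cis (3*pi/4)"
proof (cases "t = 0 \<or> t = pi")
 case True
 thus ?thesis by (auto simp: psi0_def)
next
 case False
 hence t: "0 < t" "t < pi" using assms by auto
 define s where "s = sin (t/2)"
 define c where "c = cos (t/2)"
 have s: "s > 0" using t by (auto simp: s_def intro!: sin_gt_zero)
 have c: "c > 0" using t by (auto simp: c_def intro!: cos_gt_zero_pi)
 have sc: "s^2 + c^2 = 1" by (simp add: s_def c_def)
 have st: "sin t = 2 * s * c" unfolding s_def c_def using sin_double[of "t/2"] by simp
 have ct: "cos t = 1 - 2 * s^2" unfolding s_def using cos_double_sin[of "t/2"] by simp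
 have ct2: "cos t = 2 * c^2 - 1" unfolding c_def using cos_double_cos[of "t/2"] by simp
 have w1: "cis t - 1 = 2 * \<i> * s * Complex c s"
  by (simp add: complex_eq_iff st ct power2_eq_square)
 have w2: "cis t + 1 = 2 * c * Complex c s"
  by (simp add: complex_eq_iff st ct2 power2_eq_square)
 have nz: "Complex c s ~= 0" using s by (simp add: complex_eq_iff)
 have q: "(cis t - 1) / (cis t + 1) = \<i> * of_real (s/c)"
 proof -
  have "(2 * \<i> * of_real s * C) / (2 * of_real c * C) = \<i> * of_real (s/c)" if "C ~= 0" for C :: complex
   using that c by simp
  from this[OF nz] show ?thesis unfolding w1 w2 by (simp only: of_real_mult of_real_numeral)
 qed
 have csq: "csqrt (\<i> * of_real (s/c)) = of_real (sqrt (s/c)) * cis (pi/4)"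
 proof (rule csqrt_unique)
  have "(of_real (sqrt (s/c)) * cis (pi/4))\<^sup>2 = of_real ((sqrt (s/c))^2) * cis (pi/2)"
   unfolding power_mult_distrib Complex.DeMoivre by simp
  thus "(of_real (sqrt (s/c)) * cis (pi/4))\<^sup>2 = \<i> * of_real (s/c)"
   using s c by (simp add: mult.commute)
  show "0 < Re (of_real (sqrt (s/c)) * cis (pi/4)) \<or> Re (of_real (sqrt (s/c)) * cis (pi/4)) = 0 \<and> 0 <= Im (of_real (sqrt (s/c)) * cis (pi/4))"
   using s c by (simp add: cos_45)
 qed
 have d: "cis t - 1 / cis t = 2 * \<i> * of_real (2 * s * c)"
  by (simp add: divide_inverse complex_eq_iff st)
 have r: "2 * (2 * s * c) * sqrt (s/c) = rho t"
  unfolding rho_def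
 proof (rule real_sqrt_unique[symmetric])
  have "(2 * (2 * s * c) * sqrt (s / c))\<^sup>2 = 16 * s^2 * c^2 * (s/c)"
   using s c by (simp add: power_mult_distrib)
  also have "... = rsq t" using s c
   by (simp add: rsq_def s_def[symmetric] c_def[symmetric] power2_eq_square power3_eq_cube)
  finally show "(2 * (2 * s * c) * sqrt (s / c))\<^sup>2 = rsq t" .
 qed (use s c in simp)
 have "psi0 (cis t) = of_real (2 * (2 * s * c) * sqrt (s/c)) * (\<i> * cis (pi/4))"
  unfolding psi0_def q csq d by simp
 also have "\<i> * cis (pi/4) = cis (3*pi/4)"
 proof -
  have "pi/2 + pi/4 = 3*pi/4" by simp
  thus ?thesis unfolding cis_pi_half[symmetric] cis_mult by metis
 qed
 finally show ?thesis unfolding r .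
qed

lemma cis_minus_pi: "cis (-pi) = -1"
 by (simp add: complex_eq_iff)

lemma psi0_cis_neg: assumes "0 <= t" "t <= pi"
 shows "psi0 (cis (-t)) = of_real (rho t) * cis (-3*pi/4)"
proof (cases "t = 0 \<or> t = pi")
 case True
 thus ?thesis by (auto simp: psi0_def cis_minus_pi)
next
 case False
 hence t: "0 < t" "t < pi" using assms by auto
 have "cis t + 1 ~= 0"
 proof
  assume "cis t + 1 = 0"
  hence "sin t = 0" by (simp add: complex_eq_iff)
  thus False using t sin_gt_zero[of t] by simp
 qed
 have s: "sin t > 0" using t by (intro sin_gt_zero)
 have "(cos t + 1)^2 + (sin t)^2 > 0" using s by (intro add_nonneg_pos) auto
 hence "Im ((cis t - 1) / (cis t + 1)) ~= 0"
  using s by (simp add: Im_divide; simp add: algebra_simps)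
 hence "(cis t - 1) / (cis t + 1) \<notin> \<real>\<^sub>\<le>\<^sub>0" by (auto elim!: nonpos_Reals_cases)
 hence "cnj (psi0 (cis t)) = psi0 (cnj (cis t))"
  by (simp add: psi0_def cnj_csqrt)
 thus ?thesis using psi0_cis[OF assms] by (simp add: cis_cnj)
qed

definition arm :: "real => complex" where "arm s = of_real (rho s) * cis (3*pi/4)"

lemma norm_arm_diff: "0 <= rho s ==> 0 <= rho x ==> norm (arm s - arm x) = abs (rho s - rho x)"
 by (simp add: arm_def norm_mult flip: left_diff_distrib of_real_diff)

lemma cos_135: "cos (3*pi/4) = - sqrt 2 / 2"
 using cos_pi_minus[of "pi/4"] by (simp add: cos_45)

lemma sin_135: "sin (3*pi/4) = sqrt 2 / 2"
 using sin_pi_minus[of "pi/4"] by (simp add: sin_45)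

lemma norm_arm_cnj_diff: "norm (arm s - cnj (arm x)) = sqrt (rho s ^ 2 + rho x ^ 2)"
proof -
 have "arm s - cnj (arm x) = cis (3*pi/4) * Complex (rho s) (- rho x)"
  unfolding complex_eq_iff arm_def by (simp add: cos_135 sin_135; simp add: algebra_simps)
 thus ?thesis by (simp add: norm_mult complex_norm)
qed

lemma cis_135: "cis (3*pi/4) = (-1 + \<i>) / of_real (sqrt 2)"
proof -
 have "cis (3*pi/4) * of_real (sqrt 2) = -1 + \<i>"
  by (simp add: complex_eq_iff cos_135 sin_135)
 moreover have "of_real (sqrt 2) ~= (0::complex)" by simp
 ultimately show ?thesis by (metis nonzero_mult_div_cancel_right)
qed

lemma gamma0_arm: "gamma0 = arm ` {0..tip} \<union> cnj ` arm ` {0..tip}"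
proof -
 have e: "rho ` {0..tip} = {0..27 powr (1/4)}"
 proof (intro equalityI subsetI)
  fix y assume "y \<in> rho ` {0..tip}"
  thus "y \<in> {0..27 powr (1/4)}"
   using rho_nonneg rho_le_tip tip_bounds by (auto simp flip: rho_tip)
 next
  fix y assume y: "y \<in> {0..27 powr (1/4)::real}"
  have "\<exists>x. 0 <= x \<and> x <= tip \<and> rho x = y"
   using y tip_bounds by (intro IVT' continuous_on_rho) (auto simp: rho_tip)
  thus "y \<in> rho ` {0..tip}" by auto
 qed
 have s: "{0..27 powr (1/4) / sqrt 2} = (%r. r / sqrt 2) ` {0..27 powr (1/4)::real}"
 proof (intro equalityI subsetI)
  fix x :: real assume x: "x \<in> {0..27 powr (1/4) / sqrt 2}"
  hence "x * sqrt 2 \<in> {0..27 powr (1/4)}" by (auto simp: pos_le_divide_eq)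
  moreover have "x = (x * sqrt 2) / sqrt 2" by simp
  ultimately show "x \<in> (%r. r / sqrt 2) ` {0..27 powr (1/4)::real}" by blast
 next
  fix x :: real assume "x \<in> (%r. r / sqrt 2) ` {0..27 powr (1/4)::real}"
  thus "x \<in> {0..27 powr (1/4) / sqrt 2}" by (auto intro: divide_right_mono)
 qed
 have 1: "(%x::real. (-1 + \<i>) * of_real x) ` {0 .. 27 powr (1/4) / sqrt 2} = arm ` {0..tip}"
  unfolding s e[symmetric] image_image arm_def cis_135 by (intro image_cong) auto
 have 2: "(%x::real. (-1 - \<i>) * of_real x) ` {0 .. 27 powr (1/4) / sqrt 2} = cnj ` arm ` {0..tip}"
  unfolding s e[symmetric] image_image arm_def cis_135 by (intro image_cong) auto
 show ?thesis unfolding gamma0_def 1 2 ..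
qed

section \<open>The fold of the arc\<close>

lemma fold_ex: assumes "0 <= s" "s <= tip" shows "\<exists>t. tip <= t \<and> t <= pi \<and> rsq t = rsq s"
 using assms rsq_nonneg[of s] rsq_le_tip[of s] tip_bounds
 by (intro IVT2' continuous_on_rsq) auto

text \<open>\<open>K\<close> is the inverse of \<open>J\<close>: the angles \<open>s\<close> and
  \<open>K s\<close> parametrize the two sides of the same point of the arm.\<close>
definition K :: "real => real" where "K s = (SOME t. tip <= t \<and> t <= pi \<and> rsq t = rsq s)"

lemma K: assumes "0 <= s" "s <= tip" shows "tip <= K s" "K s <= pi" "rsq (K s) = rsq s"
 using someI_ex[OF fold_ex[OF assms]] unfolding K_def by auto

lemma rho_K: assumes "0 <= s" "s <= tip" shows "rho (K s) = rho s"
 using K[OF assms] by (simp add: rho_def)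

lemma K_unique: assumes "0 <= s" "s <= tip" "tip <= t" "t <= pi" "rsq t = rsq s" shows "K s = t"
 using K[OF assms(1,2)] assms rsq_strict_antimono[of t "K s"] rsq_strict_antimono[of "K s" t]
 by (cases t "K s" rule: linorder_cases) auto

lemma K_0 [simp]: "K 0 = pi" using tip_bounds by (intro K_unique) auto
lemma K_tip [simp]: "K tip = tip" using tip_bounds by (intro K_unique) auto

lemma J_ex: assumes "tip <= t" "t <= pi" shows "\<exists>s. 0 <= s \<and> s <= tip \<and> rsq s = rsq t"
 using assms rsq_nonneg[of t] rsq_le_tip[of t] tip_bounds
 by (intro IVT' continuous_on_rsq) auto

lemma J_eq: assumes "0 <= s" "s <= tip" shows "J (K s) = s"
 unfolding J_def
proof (rule the_equality)
 have k: "0 <= K s" "K s <= pi" using K[OF assms] tip_bounds by auto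
 show "s \<in> {0..2 * pi / 3} \<and> psi0 (cis (K s)) = psi0 (cis s)"
  using assms tip_bounds k by (simp add: psi0_cis rho_K) (simp add: tip_def)
 fix x assume x: "x \<in> {0..2 * pi / 3} \<and> psi0 (cis (K s)) = psi0 (cis x)"
 hence "x \<in> {0..tip}" by (simp add: tip_def)
 moreover have "psi0 (cis x) = of_real (rho x) * cis (3*pi/4)"
  using \<open>x \<in> {0..tip}\<close> tip_bounds by (intro psi0_cis) auto
 hence "of_real (rho (K s)) * cis (3*pi/4) = of_real (rho x) * cis (3*pi/4)"
  using x psi0_cis[OF k] by metis
 hence "rho s = rho x" unfolding rho_K[OF assms] by simp
 ultimately show "x = s" using rho_inj[of s x] assms by auto
qed

lemma J: assumes "tip <= t" "t <= pi" shows "0 <= J t" "J t <= tip" "K (J t) = t"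
proof -
 obtain s where s: "0 <= s" "s <= tip" "rsq s = rsq t" using J_ex[OF assms] by auto
 hence "K s = t" using assms by (intro K_unique) auto
 thus "0 <= J t" "J t <= tip" "K (J t) = t" using J_eq[OF s(1,2)] s by auto
qed

lemma K_strict_antimono: assumes "0 <= x" "x < s" "s <= tip" shows "K s < K x"
proof (rule ccontr)
 assume "\<not> K s < K x"
 hence le: "K x <= K s" by simp
 have x: "tip <= K x" "rsq (K x) = rsq x" and s: "K s <= pi" "rsq (K s) = rsq s"
  using K[of x] K[of s] assms by auto
 have "rsq (K s) <= rsq (K x)"
 proof (cases "K x = K s")
  case False
  with le have "K x < K s" by simp
  from rsq_strict_antimono[OF x(1) this s(1)] show ?thesis by simp
 qed simp
 thus False using rsq_strict_mono[OF assms] unfolding x(2) s(2) by simp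
qed

lemma rsq_inj_outer: "inj_on rsq {tip..pi}"
proof (rule inj_onI)
 fix x y assume "x \<in> {tip..pi}" "y \<in> {tip..pi}" "rsq x = rsq y"
 thus "x = y" using rsq_strict_antimono[of x y] rsq_strict_antimono[of y x]
  by (cases x y rule: linorder_cases) auto
qed

lemma continuous_on_K: "continuous_on {0..tip} K"
proof -
 have img: "rsq ` {tip..pi} = {0..rsq tip}"
 proof (intro equalityI subsetI)
  fix y assume "y \<in> rsq ` {tip..pi}"
  thus "y \<in> {0..rsq tip}" using rsq_nonneg rsq_le_tip tip_bounds by auto
 next
  fix y assume "y \<in> {0..rsq tip}"
  hence "\<exists>t. tip <= t \<and> t <= pi \<and> rsq t = y" using tip_bounds by (intro IVT2' continuous_on_rsq) auto
  thus "y \<in> rsq ` {tip..pi}" by auto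
 qed
 have inj: "inj_on rsq {tip..pi}" by (rule rsq_inj_outer)
 have "continuous_on (rsq ` {tip..pi}) (the_inv_into {tip..pi} rsq)"
  by (rule continuous_on_inv_into[OF continuous_on_rsq compact_Icc inj])
 moreover have "rsq s \<in> rsq ` {tip..pi}" if "s \<in> {0..tip}" for s
  using K[of s] that by (intro image_eqI[of _ _ "K s"]) auto
 ultimately have "continuous_on {0..tip} (%s. the_inv_into {tip..pi} rsq (rsq s))"
  by (intro continuous_on_compose2[OF _ continuous_on_rsq, of "rsq ` {tip..pi}"]) blast+
 moreover have "the_inv_into {tip..pi} rsq (rsq s) = K s" if "s \<in> {0..tip}" for s
  using that K[of s] by (intro the_inv_into_f_eq inj) auto
 ultimately show ?thesis by (rule continuous_on_eq)
qed

text \<open>Half-angle cotangents turn the fold into an algebraic relation.\<close>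
definition ycot :: "real => real" where "ycot t = cot (t/2)"

lemma rsq_ycot: assumes "0 < t" "t < pi" shows "rsq t = 16 * ycot t / (1 + ycot t ^ 2)^2" "ycot t > 0"
proof -
 have s: "sin (t/2) > 0" using assms by (intro sin_gt_zero) auto
 have c: "cos (t/2) > 0" using assms by (intro cos_gt_zero_pi) auto
 show "ycot t > 0" using s c by (simp add: ycot_def cot_def)
 have "1 + ycot t ^ 2 = 1 / sin (t/2) ^ 2"
  using s by (simp add: ycot_def cot_def power_divide field_simps)
 thus "rsq t = 16 * ycot t / (1 + ycot t ^ 2)^2"
  using s by (simp add: rsq_def ycot_def cot_def power_divide field_simps power2_eq_square power3_eq_cube)
qed

lemma drsq_ycot: assumes "0 < t" "t < pi" shows "drsq t = rsq t * (3 * ycot t - 1 / ycot t) / 2"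
proof -
 define s where "s = sin (t/2)"
 define c where "c = cos (t/2)"
 have s: "s > 0" using assms by (auto simp: s_def intro!: sin_gt_zero)
 have c: "c > 0" using assms by (auto simp: c_def intro!: cos_gt_zero_pi)
 have sc: "s^2 = 1 - c^2" by (simp add: s_def c_def sin_squared_eq)
 have "rsq t * (3 * ycot t - 1 / ycot t) / 2 = 8 * s^2 * (3 * c^2 - s^2)"
  using s c by (simp add: rsq_def ycot_def cot_def s_def[symmetric] c_def[symmetric] field_simps power2_eq_square power3_eq_cube)
 also have "... = drsq t" unfolding drsq_def s_def[symmetric] c_def[symmetric] by (simp add: sc)
 finally show ?thesis ..
qed

lemma ycot_antimono: assumes "0 < x" "x < s" "s < pi" shows "ycot s < ycot x"
proof -
 have "tan (x/2) < tan (s/2)" using assms by (intro tan_monotone) auto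
 moreover have "0 < tan (x/2)" using assms by (intro tan_gt_zero) auto
 ultimately show ?thesis unfolding ycot_def cot_altdef by (rule less_imp_inverse_less)
qed

lemma ycot_bounds: assumes "0 < s" "s <= tip" shows "1 / s <= ycot s" "ycot s <= 2 / s"
proof -
 have c: "cos (s/2) \<ge> 1/2" using assms by (intro cos_half_ge) auto
 have sp: "sin (s/2) > 0" using assms tip_bounds by (intro sin_gt_zero) auto
 have "sin (s/2) <= s/2" using assms by (intro sin_half_bounds) auto
 hence "1/2 / (s/2) <= cos (s/2) / sin (s/2)" using c sp assms by (intro frac_le) auto
 thus "1 / s <= ycot s" by (simp add: ycot_def cot_def)
 have "s/2 < pi/2" using assms tip_bounds by linarith
 hence "abs (s/2) <= abs (tan (s/2))" using assms by (intro abs_tan_ge) auto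
 hence "s/2 <= sin (s/2) / cos (s/2)" using c sp assms by (simp add: tan_def)
 hence "s/2 * cos (s/2) <= sin (s/2)" using c by (simp add: field_simps)
 thus "ycot s <= 2 / s" using assms sp by (simp add: ycot_def cot_def field_simps)
qed

lemma ycot_tip: "ycot tip = 1 / sqrt 3"
 by (simp add: ycot_def cot_def tip_def sin_60 cos_60 divide_simps)

text \<open>Equal moduli mean \<open>y1 / (1 + y1^2)^2 = y2 / (1 + y2^2)^2\<close> for the two
  cotangents; after division by \<open>y1 - y2\<close> this is an equation between their product
  and their sum. It shows that the product is small of order \<open>s^2\<close>, which is the
  contraction of \<open>K\<close> near the corner.\<close>
lemma ycot_relation: assumes "0 < s" "s < tip"
 defines "p \<equiv> ycot s * ycot (K s)" and "S \<equiv> ycot s + ycot (K s)"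
 shows "p * S^2 = (1 - p)^2" "0 < p" "p <= 1/3" "0 < S" "p <= 1 / ycot s ^ 2" "1 / (9 * ycot s ^ 2) <= p"
  "0 < ycot (K s)" "ycot (K s) < ycot s" "tip < K s" "K s < pi"
  "rsq s = 16 / (S * (1/p - p))"
proof -
 define a where "a = ycot s"
 define b where "b = ycot (K s)"
 show k: "tip < K s" "K s < pi"
  using K_strict_antimono[of s tip] K_strict_antimono[of 0 s] assms by auto
 have a: "a > 0" using rsq_ycot(2)[of s] assms tip_bounds by (auto simp: a_def)
 have b: "b > 0" using rsq_ycot(2)[of "K s"] k tip_bounds by (auto simp: b_def)
 have ab: "b < a" unfolding a_def b_def using assms k by (intro ycot_antimono) auto
 have P: "rsq s = 16 * a / (1 + a^2)^2" using rsq_ycot(1)[of s] assms tip_bounds by (auto simp: a_def)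
 have "rsq (K s) = 16 * b / (1 + b^2)^2" using rsq_ycot(1)[of "K s"] k tip_bounds by (auto simp: b_def)
 hence "16 * a / (1 + a^2)^2 = 16 * b / (1 + b^2)^2" using P K(3)[of s] assms by auto
 moreover have nz: "1 + a^2 > 0" "1 + b^2 > 0" by (intro add_pos_nonneg; simp)+
 ultimately have "a * (1 + b^2)^2 = b * (1 + a^2)^2" by (simp add: divide_simps split: if_splits)
 hence "(a - b) * (1 - 2 * (a*b) - (a*b) * ((a+b)^2 - a*b)) = 0" by (simp add: field_simps power2_eq_square)
 hence e: "1 - 2 * (a*b) - (a*b) * ((a+b)^2 - a*b) = 0" using ab by simp
 thus e1: "p * S^2 = (1 - p)^2" unfolding p_def S_def a_def[symmetric] b_def[symmetric]
  by (simp add: power2_eq_square algebra_simps)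
 show p: "0 < p" and S: "0 < S" using a b by (auto simp: p_def S_def a_def b_def)
 have "4 * p <= S^2"
 proof -
  have "0 <= (a - b)^2" by simp
  thus ?thesis by (simp add: p_def S_def a_def b_def power2_eq_square algebra_simps)
 qed
 hence "p * (4 * p) <= p * S^2" using p by (intro mult_left_mono) auto
 hence "(2 * p)^2 <= (1 - p)^2" unfolding e1 by (simp add: power2_eq_square)
 hence "abs (2 * p) <= abs (1 - p)" by (simp add: abs_le_square_iff)
 thus p3: "p <= 1/3" using p by linarith
 have "p * a^2 <= p * S^2" using p a b by (intro mult_left_mono power_mono) (auto simp: S_def a_def b_def)
 also have "... <= 1" unfolding e1 using p p3 by (simp add: power_le_one)
 finally show "p <= 1 / ycot s ^ 2" using a by (simp add: a_def field_simps)
 have "(2/3)^2 <= (1-p)^2" using p3 by (intro power_mono) auto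
 also have "... = p * S^2" using e1 ..
 also have "... <= p * (2*a)^2" using ab a b p by (intro mult_left_mono power_mono) (auto simp: S_def a_def b_def)
 finally show "1 / (9 * ycot s ^ 2) <= p" using a by (simp add: a_def field_simps power2_eq_square)
 show "0 < ycot (K s)" "ycot (K s) < ycot s" using b ab by (auto simp: a_def b_def)
 have "a * (S * (1/p - p)) = (1 + a^2)^2"
 proof -
  have "p * (a * (S * (1/p - p))) = a * (S * (1 - p^2))" using p by (simp add: field_simps power2_eq_square)
  also have "... = p * (1 + a^2)^2"
  proof -
   have "a * (S * (1 - p^2)) - p * (1 + a^2)^2 = a^2 * (1 - 2 * (a*b) - (a*b) * ((a+b)^2 - a*b))"
    unfolding p_def S_def a_def[symmetric] b_def[symmetric] by (simp add: algebra_simps power2_eq_square)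
   thus ?thesis unfolding e by simp
  qed
  finally show ?thesis using p by simp
 qed
 hence "(1 + a^2)^2 / a = S * (1/p - p)" using a by (simp add: field_simps)
 thus "rsq s = 16 / (S * (1/p - p))" unfolding P using a by (metis divide_divide_eq_right)
qed

definition dK :: "real => real" where "dK s = drsq s / drsq (K s)"

lemma K_deriv: assumes "0 < s" "s < tip" shows "(K has_real_derivative dK s) (at s)"
proof -
 define g where "g = (%y. the_inv_into {tip..pi} rsq y)"
 have inj: "inj_on rsq {tip..pi}" by (rule rsq_inj_outer)
 have k: "tip < K s" "K s < pi" using ycot_relation[OF assms] by auto
 have gr: "g (rsq t) = t" if "t \<in> {tip..pi}" for t
  unfolding g_def using that by (intro the_inv_into_f_eq inj) auto
 have gK: "g (rsq u) = K u" if "u \<in> {0..tip}" for u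
  using gr[of "K u"] K[of u] that by auto
 have img: "rsq (g y) = y" if "0 < y" "y < rsq tip" for y
 proof -
  have "\<exists>t. tip <= t \<and> t <= pi \<and> rsq t = y" using that tip_bounds by (intro IVT2' continuous_on_rsq) auto
  thus ?thesis using gr by auto
 qed
 have "(g has_real_derivative inverse (drsq (K s))) (at (rsq s))"
 proof (rule DERIV_inverse_function[where f = rsq and a = 0 and b = "rsq tip"])
  show "(rsq has_real_derivative drsq (K s)) (at (g (rsq s)))"
  proof -
   have "g (rsq s) = K s" using gK[of s] assms by simp
   thus ?thesis by (simp add: rsq_deriv)
  qed
  show "drsq (K s) ~= 0" using drsq_neg[of "K s"] k by auto
  show "0 < rsq s" using assms tip_bounds by (intro rsq_pos) auto
  show "rsq s < rsq tip" using assms by (intro rsq_strict_mono) auto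
  show "\<And>y. 0 < y ==> y < rsq tip ==> rsq (g y) = y" by (rule img)
  have "isCont g (rsq (K s))"
  proof (rule isCont_inverse_function[where d = "min (K s - tip) (pi - K s)" and f = rsq and x = "K s"])
   show "0 < min (K s - tip) (pi - K s)" using k by simp
   fix z assume "abs (z - K s) <= min (K s - tip) (pi - K s)"
   hence "z \<in> {tip..pi}" unfolding abs_le_iff by simp
   thus "g (rsq z) = z" by (rule gr)
  qed (rule isCont_rsq)
  thus "isCont g (rsq s)" using K(3)[of s] assms by simp
 qed
 from DERIV_chain2[OF this rsq_deriv] 
 have "((%u. g (rsq u)) has_real_derivative inverse (drsq (K s)) * drsq s) (at s)" .
 hence d: "((%u. g (rsq u)) has_real_derivative dK s) (at s)"
  by (simp add: dK_def divide_inverse mult.commute)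
 show ?thesis
  by (rule has_field_derivative_transform_within_open[OF d, of "{0<..<tip}"])
    (use assms gK in auto)
qed

lemma cot_slope_upper:
 fixes a b p :: real
 assumes a: "1 <= a" and b: "0 < b" "b = p / a" and p: "0 < p" "p <= 1 / a^2" and v: "3/4 <= 1 - 3 * b^2"
  and u: "0 < 3 * a^2 - 1"
 shows "(b/a) * ((3 * a^2 - 1) / (1 - 3 * b^2)) <= 4 * (1/a)^2"
proof -
 have "b <= 1/a^2/a" unfolding b using p a by (intro divide_right_mono) auto
 hence "b / a <= 1/a^2/a/a" using a by (intro divide_right_mono) auto
 moreover have "(3 * a^2 - 1) / (1 - 3 * b^2) <= (3 * a^2)/(3/4)"
  using v u a by (intro frac_le) auto
 ultimately have "(b/a) * ((3 * a^2 - 1) / (1 - 3 * b^2)) <= (1/a^2/a/a) * ((3 * a^2)/(3/4))"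
  by (rule mult_mono) (use v u a in auto)
 also have "... = 4 * (1/a)^2" using a by (simp add: field_simps power2_eq_square)
 finally show ?thesis .
qed

lemma cot_slope_lower:
 fixes a b p c :: real
 assumes c: "c > 0" "c^2 = 1/3" and a: "c < a" and b: "0 < b" "b < c" and bp: "b = p / a"
  and p: "1 / (9 * a^2) <= p" and ab: "2 * c <= a + b"
 shows "1/9 * (1/a^2) <= (b/a) * ((3 * a^2 - 1) / (1 - 3 * b^2))"
proof -
 have a0: "a > 0" using a c by linarith
 have b_a: "1/(9*a^2)/a/a <= b/a" unfolding bp using p a0 by (intro divide_right_mono) auto
 have "b^2 < c^2" using b by (intro power_strict_mono) auto
 hence v: "0 < 1 - 3 * b^2" "1 - 3 * b^2 <= 1" using c by auto
 show ?thesis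
 proof (cases "1 <= a")
  case True
  have "1 <= a^2" using True by simp
  hence "2 * a^2 <= 3 * a^2 - 1" by simp
  hence "2 * a^2 / 1 <= (3 * a^2 - 1) / (1 - 3 * b^2)" using v by (intro frac_le) auto
  hence "(1/(9*a^2)/a/a) * (2 * a^2 / 1) <= (b/a) * ((3 * a^2 - 1) / (1 - 3 * b^2))"
   using b_a a0 b by (intro mult_mono) auto
  moreover have "(1/(9*a^2)/a/a) * (2 * a^2 / 1) = 2/9 * (1/a^2)" using a0 by (simp add: field_simps power2_eq_square)
  moreover have "1/9 * (1/a^2) <= 2/9 * (1/a^2)" using a0 by (intro mult_right_mono) auto
  ultimately show ?thesis by linarith
 next
  case False
  have "1 - 3 * b^2 = 3 * ((c - b) * (c + b))"
   using c(2) by (simp add: power2_eq_square algebra_simps)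
  also have "... <= 3 * ((a - c) * (a + c))"
   using ab a b c by (intro mult_left_mono mult_mono) auto
  also have "... = 3 * a^2 - 1" using c(2) by (simp add: power2_eq_square algebra_simps)
  finally have "1 <= (3 * a^2 - 1) / (1 - 3 * b^2)" using v by simp
  hence 1: "(1/(9*a^2)/a/a) * 1 <= (b/a) * ((3 * a^2 - 1) / (1 - 3 * b^2))"
   using b_a a0 b by (intro mult_mono) auto
  have "a^2 <= 1" using False a0 by (simp add: power_le_one)
  hence "1/a^2 \<ge> 1" using a0 by (simp add: field_simps)
  hence "1/9 * ((1/a^2) * 1) <= 1/9 * ((1/a^2) * (1/a^2))"
   using a0 by (intro mult_left_mono) auto
  moreover have "1/(9*a^2)/a/a = 1/9 * ((1/a^2) * (1/a^2))" using a0 by (simp add: field_simps power2_eq_square)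
  ultimately show ?thesis using 1 by linarith
 qed
qed

lemma dK_bounds: assumes "0 < s" "s < tip"
 shows "-1 <= dK s" "-(4 * s^2) <= dK s" "dK s <= -(s^2 / 162)"
proof -
 define c where "c = 1 / sqrt (3::real)"
 have c: "c > 0" "c^2 = 1/3" by (simp_all add: c_def power_divide)
 define a where "a = ycot s"
 define b where "b = ycot (K s)"
 define p where "p = a * b"
 note r = ycot_relation[OF assms, folded a_def b_def, folded p_def]
 have b: "b > 0" and ba': "b < a" using r(7,8) by blast+
 have a: "a > 0" using b ba' by linarith
 have ba: "b = p / a" using a by (simp add: p_def)
 have rs: "rsq s > 0" using assms tip_bounds by (intro rsq_pos) auto
 have a3: "c < a" unfolding a_def c_def ycot_tip[symmetric] using assms tip_bounds by (intro ycot_antimono) auto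
 have b3: "b < c" unfolding b_def c_def ycot_tip[symmetric] using r(9,10) tip_bounds by (intro ycot_antimono) auto
 have a3': "1/3 < a^2" using power_strict_mono[OF a3, of 2] c by simp
 have b3': "b^2 < 1/3" using power_strict_mono[OF b3, of 2] b c by simp
 define u where "u = 3 * a^2 - 1"
 define v where "v = 1 - 3 * b^2"
 have u: "u > 0" and v: "v > 0" "v <= 1" using a3' b3' by (auto simp: u_def v_def)
 have "drsq s = rsq s * (3 * a - 1/a) / 2"
  unfolding a_def by (rule drsq_ycot) (use assms tip_bounds in auto)
 moreover have "3 * a - 1/a = u / a" using a by (simp add: u_def field_simps power2_eq_square)
 ultimately have d1: "drsq s = rsq s / 2 * (u / a)" by simp
 have "drsq (K s) = rsq s * (3 * b - 1/b) / 2"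
  unfolding b_def using drsq_ycot[of "K s"] r(9,10) tip_bounds K(3)[of s] assms by simp
 moreover have "3 * b - 1/b = - (v / b)" using b by (simp add: v_def field_simps power2_eq_square)
 ultimately have d2: "drsq (K s) = - (rsq s / 2 * (v / b))" by simp
 have dK: "dK s = - ((b / a) * (u / v))"
 proof -
  have "x / 2 * (u / a) / (- (x / 2 * (v / b))) = - ((b / a) * (u / v))" if "x > 0" for x :: real
   using that a b v by (simp add: divide_simps)
  from this[OF rs] show ?thesis unfolding dK_def d1 d2 .
 qed
 have "3 * p * (a + b) <= 1 * (a + b)" using r(3) a b by (intro mult_right_mono) auto
 hence "b * u <= a * v" by (simp add: u_def v_def p_def power2_eq_square algebra_simps)
 hence "(b/a) * (u/v) <= 1" using a v by (simp add: field_simps)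
 thus m1: "-1 <= dK s" unfolding dK by simp
 have ys: "1/s <= a" "a <= 2/s" using ycot_bounds[of s] assms by (auto simp: a_def)
 have a1s: "1/a <= s" "s <= 2/a" using ys assms a by (auto simp: field_simps)
 show "-(4 * s^2) <= dK s"
 proof (cases "2 <= a")
  case False
  hence "1/2 < 1/a" using a by (simp add: field_simps)
  hence "(1/2)^2 <= s^2" using a1s by (intro power_mono) auto
  hence "1 <= 4 * s^2" by (simp add: power2_eq_square)
  thus ?thesis using m1 by linarith
 next
  case True
  have "2^2 <= a^2" using True by (intro power_mono) auto
  hence "1/a^2 <= 1/4" using a by (simp add: field_simps)
  hence "p <= 1/4" using r(5) by linarith
  hence "b <= 1/4 / 2" unfolding ba using True r(2) by (intro frac_le) auto
  hence "b^2 <= (1/8)^2" using b by (intro power_mono) auto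
  hence "3/4 <= 1 - 3 * b^2" by (simp add: power2_eq_square)
  hence "(b/a) * (u/v) <= 4 * (1/a)^2"
   unfolding u_def v_def using True b ba r(2,5) u by (intro cot_slope_upper[where p = p]) (auto simp: u_def)
  also have "... <= 4 * s^2" using a1s a by (intro mult_left_mono power_mono) auto
  finally show ?thesis unfolding dK by simp
 qed
 have "(2*c)^2 <= (a+b)^2"
 proof -
  have "(2/3)^2 <= (1-p)^2" using r(3) by (intro power_mono) auto
  also have "... = p * (a+b)^2" using r(1) by simp
  also have "... <= 1/3 * (a+b)^2" using r(3) by (intro mult_right_mono) auto
  finally show ?thesis using c(2) by (simp add: power2_eq_square)
 qed
 hence ab: "2 * c <= a + b" by (rule power2_le_imp_le) (use a b in auto)
 have "s^2 <= (2/a)^2" using a1s assms by (intro power_mono) auto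
 hence s2: "s^2 / 162 <= 4/162 * (1/a^2)" by (simp add: power_divide)
 also have "... <= 1/9 * (1/a^2)" using a by (intro mult_right_mono) auto
 also have "... <= (b/a) * (u/v)"
  unfolding u_def v_def using c a3 b b3 ba r(6) ab by (rule cot_slope_lower)
 finally show "dK s <= -(s^2 / 162)" unfolding dK by simp
qed

lemma K_diff_ordered: assumes "0 <= x" "x < s" "s <= tip"
 shows "K x - K s <= s - x" "K x - K s <= 2 * ((s - x) * (s + x)^2)" "(s - x) * (s + x)^2 / 648 <= K x - K s"
proof -
 have cK: "continuous_on {x..s} K" by (rule continuous_on_subset[OF continuous_on_K]) (use assms in auto)
 have "K x + x <= K s + s"
 proof (rule DERIV_nonneg_imp_increasing_open[where f = "%u. K u + u"])
  fix u assume u: "x < u" "u < s"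
  show "\<exists>y. ((%u. K u + u) has_real_derivative y) (at u) \<and> 0 <= y"
   using dK_bounds(1)[of u] u assms by (intro exI[of _ "dK u + 1"] conjI DERIV_add K_deriv DERIV_ident) auto
 qed (use assms cK in \<open>auto intro!: continuous_intros\<close>)
 thus "K x - K s <= s - x" by simp
 have c3: "((%u. u^3 * c) has_real_derivative 3 * c * u^2) (at u)" for u c :: real
  by (auto intro!: derivative_eq_intros)
 have "K x + x^3 * (4/3) <= K s + s^3 * (4/3)"
 proof (rule DERIV_nonneg_imp_increasing_open[where f = "%u. K u + u^3 * (4/3)"])
  fix u assume u: "x < u" "u < s"
  show "\<exists>y. ((%u. K u + u^3 * (4/3)) has_real_derivative y) (at u) \<and> 0 <= y"
   using dK_bounds(2)[of u] u assms by (intro exI[of _ "dK u + 3 * (4/3) * u^2"] conjI DERIV_add K_deriv c3) auto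
 qed (use assms cK in \<open>auto intro!: continuous_intros\<close>)
 hence 1: "K x - K s <= (s^3 - x^3) * (4/3)" by (simp add: algebra_simps)
 have c: "s^3 - x^3 = (s - x) * (s^2 + s * x + x^2)" by (simp add: power2_eq_square power3_eq_cube algebra_simps)
 have sx: "0 <= s * x" using assms by auto
 have "(s - x) * (s^2 + s * x + x^2) <= (s - x) * (s + x)^2"
  using assms sx by (intro mult_left_mono) (auto simp: power2_eq_square algebra_simps)
 moreover have "0 <= (s - x) * (s + x)^2" using assms by auto
 ultimately show "K x - K s <= 2 * ((s - x) * (s + x)^2)" using 1 unfolding c by linarith
 have "- K x - x^3 * (1/486) <= - K s - s^3 * (1/486)"
 proof (rule DERIV_nonneg_imp_increasing_open[where f = "%u. - K u - u^3 * (1/486)"])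
  fix u assume u: "x < u" "u < s"
  show "\<exists>y. ((%u. - K u - u^3 * (1/486)) has_real_derivative y) (at u) \<and> 0 <= y"
   using dK_bounds(3)[of u] u assms by (intro exI[of _ "- dK u - 3 * (1/486) * u^2"] conjI DERIV_diff DERIV_minus K_deriv c3) auto
 qed (use assms cK in \<open>auto intro!: continuous_intros\<close>)
 hence 2: "(s^3 - x^3) / 486 <= K x - K s" by (simp add: diff_divide_distrib)
 have "0 <= (s - x)^2" by simp
 hence "3/4 * (s + x)^2 <= s^2 + s * x + x^2" by (simp add: power2_eq_square algebra_simps)
 hence "(s - x) * (3/4 * (s + x)^2) <= (s - x) * (s^2 + s * x + x^2)" using assms by (intro mult_left_mono) auto
 moreover have "(s - x) * (3/4 * (s + x)^2) = 3/4 * ((s - x) * (s + x)^2)" by simp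
 ultimately show "(s - x) * (s + x)^2 / 648 <= K x - K s" using 2 unfolding c by linarith
qed

text \<open>\<open>K\<close> is a contraction with slope of order \<open>s^2\<close>. This is the
  source of the squared logarithm: equally spaced outer angles are pulled back to points whose
  spacing grows like \<open>s^-2\<close> near the corner.\<close>
lemma K_diff: assumes "x \<in> {0..tip}" "s \<in> {0..tip}"
 shows "abs (K s - K x) <= abs (s - x)" "abs (K s - K x) <= 2 * (abs (s - x) * (s + x)^2)"
  "abs (s - x) * (s + x)^2 / 648 <= abs (K s - K x)"
proof -
 have "\<bar>K s - K x\<bar> <= \<bar>s - x\<bar> \<and> \<bar>K s - K x\<bar> <= 2 * (\<bar>s - x\<bar> * (s + x)^2) \<and> \<bar>s - x\<bar> * (s + x)^2 / 648 <= \<bar>K s - K x\<bar>"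
 proof (cases x s rule: linorder_cases)
  case less
  have "K s < K x" using less assms by (intro K_strict_antimono) auto
  thus ?thesis using K_diff_ordered[of x s] less assms by auto
 next
  case greater
  have "K x < K s" using greater assms by (intro K_strict_antimono) auto
  thus ?thesis using K_diff_ordered[of s x] greater assms by (auto simp: add.commute)
 qed auto
 thus "abs (K s - K x) <= abs (s - x)" "abs (K s - K x) <= 2 * (abs (s - x) * (s + x)^2)"
  "abs (s - x) * (s + x)^2 / 648 <= abs (K s - K x)" by auto
qed

section \<open>Lattice products and the preimages of a point\<close>

definition sgnN :: "nat => complex" where "sgnN n = (if even n then 1 else -1)"

lemma norm_sgnN [simp]: "norm (sgnN n) = 1" by (simp add: sgnN_def)

lemma prod_unity_roots: assumes "N > 0"
 shows "(\<Prod>k<N. X - cis (2 * pi * real k / real N)) = X ^ N - 1"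
proof -
 define f where "f = (%k. cis (2 * pi * real k / real N))"
 have bij: "bij_betw f {..<N} {z. z ^ N = 1}"
  unfolding f_def by (rule Complex.bij_betw_roots_unity[OF assms])
 define q where "q = (\<Prod>k<N. [:- f k, 1:])"
 define p :: "complex poly" where "p = monom 1 N - 1"
 have dq: "degree q = N" unfolding q_def by (subst degree_prod_eq_sum_degree) auto
 have lq: "lead_coeff q = 1" unfolding q_def by (subst lead_coeff_prod) auto
 have dp: "degree p <= N" unfolding p_def by (rule degree_diff_le) (auto simp: degree_monom_le)
 have "p = q"
 proof (rule poly_eqI_degree_lead_coeff[of _ N _ "{z. z ^ N = 1}"])
  have "coeff p N = 1" using assms by (simp add: p_def coeff_diff)
  thus "coeff p N = coeff q N" using lq dq by simp
  show "card {z::complex. z ^ N = 1} \<ge> N" using bij_betw_same_card[OF bij] by simp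
  fix z :: complex assume "z \<in> {z. z ^ N = 1}"
  hence z: "z ^ N = 1" "z \<in> f ` {..<N}" using bij by (auto simp: bij_betw_def)
  thus "poly p z = poly q z" by (auto simp: p_def q_def poly_monom poly_prod)
 qed (use dp dq in auto)
 hence "poly p X = poly q X" by simp
 thus ?thesis by (simp add: p_def q_def poly_monom poly_prod f_def)
qed

lemma cis_theta: assumes "k <= n"
 shows "cis (theta n k) = cis ((2 * real k + (if even n then 0 else 1)) * pi / NN n)"
proof (cases "k <= n div 2")
 case True
 thus ?thesis by (simp add: theta_def theta_upper_def)
next
 case False
 have le: "k <= 2 * (n div 2) + 1" using assms by presburger
 have np: "real n + 1 ~= 0" by simp
 have eq: "theta n k = (2 * real k + (if even n then 0 else 1)) * pi / NN n - 2 * pi"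
 proof (cases "even n")
  case True
  then obtain m where n: "n = 2 * m" by (auto elim: evenE)
  have "real (2 * m + 1 - k) = 2 * real m + 1 - real k" using le n by (simp add: of_nat_diff)
  thus ?thesis using False True np by (simp add: theta_def theta_upper_def n field_simps)
 next
  case odd: False
  then obtain m where n: "n = 2 * m + 1" by (auto elim: oddE)
  have "real (2 * m + 1 - k) = 2 * real m + 1 - real k" using le n by (simp add: of_nat_diff)
  thus ?thesis using False odd np by (simp add: theta_def theta_upper_def n field_simps)
 qed
 show ?thesis unfolding eq by (simp add: cis_divide[symmetric])
qed

lemma prod_theta: "(\<Prod>k\<le>n. X - cis (theta n k)) = X ^ (n + 1) - sgnN n"
proof -
 define \<zeta> where "\<zeta> = cis ((if even n then 0 else 1) * pi / NN n)"
 have z0: "\<zeta> ~= 0" by (simp add: \<zeta>_def)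
 have zN: "\<zeta> ^ (n+1) = sgnN n"
  unfolding \<zeta>_def Complex.DeMoivre sgnN_def by (simp add: add.commute)
 have c: "cis (theta n k) = \<zeta> * cis (2 * pi * real k / real (n+1))" if "k <= n" for k
  unfolding cis_theta[OF that] \<zeta>_def cis_mult by (simp add: add_divide_distrib algebra_simps)
 have "(\<Prod>k\<le>n. X - cis (theta n k)) = (\<Prod>k<n+1. \<zeta> * (X / \<zeta> - cis (2 * pi * real k / real (n+1))))"
  unfolding lessThan_Suc_atMost Suc_eq_plus1[symmetric] using z0 by (intro prod.cong) (auto simp: c right_diff_distrib)
 also have "... = \<zeta> ^ (n+1) * ((X / \<zeta>) ^ (n+1) - 1)"
  by (subst prod.distrib, subst prod_unity_roots) auto
 also have "... = X ^ (n+1) - \<zeta> ^ (n+1)"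
  using z0 by (simp add: power_divide right_diff_distrib)
 finally show ?thesis unfolding zN .
qed

text \<open>The distance of \<open>x\<close> to the lattice of Fejer angles, measured in lattice
  units and saturating at 1.\<close>
definition DD :: "nat => real => real" where
 "DD n x = (if even n then \<bar>sin (NN n * x / 2)\<bar> else \<bar>cos (NN n * x / 2)\<bar>)"

lemma norm_cis_diff_1: "norm (cis a - 1) = 2 * abs (sin (a/2))"
proof -
 have "norm (cis a - 1) ^ 2 = (cos a - 1)^2 + (sin a)^2" by (simp add: cmod_power2)
 also have "... = 2 - 2 * cos (2 * (a/2))" using sin_cos_squared_add[of a] by (simp add: power2_eq_square algebra_simps)
 also have "... = (2 * abs (sin (a/2)))^2" unfolding cos_double_sin by (simp add: power_mult_distrib)
 finally show ?thesis by (rule power2_eq_imp_eq) auto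
qed

lemma norm_cis_pow: "norm (cis x ^ (n+1) - sgnN n) = 2 * DD n x"
proof (cases "even n")
 case True
 have "cis x ^ (n+1) = cis (NN n * x)" unfolding Complex.DeMoivre by (simp add: add.commute)
 thus ?thesis using True norm_cis_diff_1[of "NN n * x"] by (simp add: sgnN_def DD_def)
next
 case False
 have "cis x ^ (n+1) = cis (NN n * x)" unfolding Complex.DeMoivre by (simp add: add.commute)
 moreover have "cis (NN n * x) + 1 = - (cis (NN n * x + pi) - 1)"
  by (simp add: cis_mult[symmetric])
 ultimately have "norm (cis x ^ (n+1) - sgnN n) = 2 * abs (sin ((NN n * x + pi) / 2))"
  using False norm_cis_diff_1[of "NN n * x + pi"] by (simp add: sgnN_def norm_minus_commute)
 also have "(NN n * x + pi) / 2 = NN n * x / 2 + pi/2" by (simp add: add_divide_distrib)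
 also have "sin (NN n * x / 2 + pi/2) = cos (NN n * x / 2)" by (simp add: sin_add)
 finally show ?thesis using False by (simp add: DD_def)
qed

lemma DD_shift: "DD n x = abs (sin (NN n * (x - thu n k) / 2))"
proof (cases "even n")
 case True
 have e: "NN n * (x - thu n k) / 2 = NN n * x / 2 - real k * pi"
  using True by (simp add: theta_upper_def field_simps)
 show ?thesis unfolding e using True by (simp add: DD_def sin_diff abs_mult)
next
 case False
 have e: "NN n * (x - thu n k) / 2 = (NN n * x / 2 - pi / 2) - real k * pi"
  using False by (simp add: theta_upper_def field_simps)
 have "abs (sin (NN n * (x - thu n k) / 2)) = abs (sin (NN n * x / 2 - pi / 2))"
  unfolding e by (subst sin_diff) (simp add: abs_mult)
 also have "... = abs (cos (NN n * x / 2))" by (subst sin_diff) simp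
 finally show ?thesis using False by (simp add: DD_def)
qed

lemma DD_bounds: "0 <= DD n x" "DD n x <= 1" by (auto simp: DD_def)

lemma DD_upper: "DD n x <= NN n / 2 * abs (x - thu n k)"
 unfolding DD_shift[of n x k] using abs_sin_x_le_abs_x[of "NN n * (x - thu n k) / 2"]
 by (simp add: abs_mult)

lemma DD_lower: assumes "abs (x - thu n k) <= pi / NN n"
 shows "NN n / 4 * abs (x - thu n k) <= DD n x"
proof -
 define u where "u = NN n * abs (x - thu n k) / 2"
 have "u / 2 <= sin u"
  using assms by (intro sin_ge_half_arg) (auto simp: u_def field_simps)
 also have "sin u <= abs (sin u)" by simp
 also have "abs (sin u) = DD n x"
 proof (cases "x - thu n k \<ge> 0")
  case True
  thus ?thesis unfolding DD_shift[of n x k] u_def by simp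
 next
  case False
  hence "u = - (NN n * (x - thu n k) / 2)" by (simp add: u_def field_simps)
  thus ?thesis unfolding DD_shift[of n x k] by (simp only: sin_minus abs_minus_cancel)
 qed
 finally show ?thesis by (simp add: u_def)
qed

lemma cis_ycot: assumes "0 < t" "t < pi"
 shows "cis t = (of_real (ycot t) + \<i>) / (of_real (ycot t) - \<i>)"
proof -
 have s: "sin (t/2) ~= 0" using sin_gt_zero[of "t/2"] assms by auto
 have h: "cis (t/2) * cis (t/2) = cis t" unfolding cis_mult by simp
 have 1: "of_real (ycot t) + \<i> = cis (t/2) / of_real (sin (t/2))"
  using s by (simp add: ycot_def cot_def complex_eq_iff Re_divide_of_real Im_divide_of_real)
 have 2: "of_real (ycot t) - \<i> = cnj (cis (t/2)) / of_real (sin (t/2))"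
  using s by (simp add: ycot_def cot_def complex_eq_iff Re_divide_of_real Im_divide_of_real)
 have "cis (t/2) / cnj (cis (t/2)) = cis t" by (simp add: cis_cnj cis_divide)
 thus ?thesis unfolding 1 2 using s by simp
qed

lemma cayley_diff: fixes y w :: complex assumes "y ~= \<i>"
 shows "w - (y + \<i>) / (y - \<i>) = ((w - 1) * y - \<i> * (w + 1)) / (y - \<i>)"
proof -
 have "y - \<i> ~= 0" using assms by simp
 thus ?thesis by (simp add: divide_simps) (simp add: algebra_simps)
qed

text \<open>\<open>chi x = x * psi0 (1/x)\<close>; it extends continuously to the closed disc,
  which moves the exterior map into the unit disc.\<close>
definition chi :: "complex => complex" where
 "chi x = (1 - x^2) * csqrt ((1 - x) / (1 + x))"

lemma arm_sq: assumes "0 <= s" "s <= pi" shows "arm s ^ 2 = - \<i> * of_real (rsq s)"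
proof -
 have "arm s ^ 2 = of_real (rho s ^ 2) * cis (3*pi/4) ^ 2" by (simp add: arm_def power_mult_distrib)
 also have "cis (3*pi/4) ^ 2 = cis (pi/2) * cis pi" unfolding Complex.DeMoivre cis_mult by (simp add: field_simps)
 also have "... = - \<i>" by simp
 finally show ?thesis using rho_sq[OF assms] by simp
qed

text \<open>Squaring \<open>psi0 w = arm s\<close> gives a quartic. Two roots are the points of
  the circle on the two sides of the arc. The others are exchanged by reflection in the circle,
  and \<open>v\<close>, the one outside, is the preimage of \<open>- arm s\<close>; it stays away
  from the circle by an amount proportional to \<open>s\<close>. It is found from the quadratic
  that remains for the half-angle cotangents.\<close>
lemma quartic_factor: assumes s: "0 < s" "s < tip"
 obtains v where "\<And>w. (w - 1)^3 * (w + 1) - arm s ^ 2 * w^2 = (w - cis s) * (w - cis (K s)) * (w - v) * (w - 1 / cnj v)"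
  "1 + s/20 <= norm v" "norm (1 - 1/v) <= 2 * s" "chi (1/v) + arm s * (1/v) = 0"
proof -
 define a where "a = ycot s"
 define b where "b = ycot (K s)"
 define p where "p = a * b"
 define S where "S = a + b"
 note r = ycot_relation[OF s, folded a_def b_def, folded p_def S_def]
 have p: "0 < p" "p <= 1/3" and S: "0 < S" and pS: "p * S^2 = (1-p)^2" using r(1-4) by auto
 have aS: "a > 0" using r(7,8) by linarith
 have rs: "0 < rsq s" using s tip_bounds by (intro rsq_pos) auto
 define \<kappa> where "\<kappa> = S * (1/p - p)"
 have kP: "rsq s * \<kappa> = 16" 
 proof -
  have "p * p < 1" using mult_strict_mono[of p 1 p 1] p by auto
  hence "\<kappa> > 0" using S p by (auto simp: \<kappa>_def field_simps)
  moreover have "rsq s = 16 / \<kappa>" using r(11) by (simp only: \<kappa>_def)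
  ultimately show ?thesis by simp
 qed
 define \<eta> where "\<eta> = sqrt ((1+p) * (3-p) / (4*p))"
 have e2: "\<eta>^2 = (1+p) * (3-p) / (4*p)" using p by (simp add: \<eta>_def)
 have e0: "\<eta> > 0" using p by (simp add: \<eta>_def)
 have S2: "S^2 = (1-p)^2 / p" using pS p by (simp add: field_simps)
 have mod: "S^2 / 4 + \<eta>^2 = 1/p" unfolding S2 e2 using p by (simp add: field_simps power2_eq_square)
 define y where "y = Complex (- S/2) \<eta>"
 have ysum: "y + cnj y = - of_real S" by (simp add: y_def complex_eq_iff)
 have yprod: "y * cnj y = of_real (1/p)"
  using mod by (simp add: y_def complex_eq_iff power2_eq_square algebra_simps)
 have ny: "norm y ^ 2 = 1/p" using mod by (simp add: y_def cmod_power2 power_divide)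
 have yi: "y ~= \<i>" "cnj y ~= \<i>" "y ~= - \<i>" "y ~= 0" using S by (auto simp: y_def complex_eq_iff)
 define v where "v = (y + \<i>) / (y - \<i>)"
 have yi': "y - \<i> ~= 0" "y + \<i> ~= 0" using yi by (auto simp: add_eq_0_iff2)
 have v0: "v ~= 0" using yi' by (simp add: v_def)
 have cv: "1 / cnj v = (cnj y + \<i>) / (cnj y - \<i>)"
  by (simp add: v_def)
 have ai: "complex_of_real a ~= \<i>" "complex_of_real b ~= \<i>" by (auto simp: complex_eq_iff)
 have ca: "cis s = (of_real a + \<i>) / (of_real a - \<i>)" unfolding a_def by (rule cis_ycot) (use s tip_bounds in auto)
 have cb: "cis (K s) = (of_real b + \<i>) / (of_real b - \<i>)" unfolding b_def by (rule cis_ycot) (use r tip_bounds in auto)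
 define P where "P = complex_of_real p"
 define SS where "SS = complex_of_real S"
 have P0: "P ~= 0" using p by (simp add: P_def)
 have rel: "SS^2 = 1/P - 2 + P"
 proof -
  have "S^2 = 1/p - 2 + p" unfolding S2 using p by (simp add: field_simps power2_eq_square)
  hence "complex_of_real (S^2) = complex_of_real (1/p - 2 + p)" by (rule arg_cong)
  thus ?thesis by (simp add: SS_def P_def)
 qed
 have absum: "of_real a + of_real b = SS" "of_real a * of_real b = P" by (auto simp: SS_def P_def S_def p_def)
 have ys: "y + cnj y = - SS" "y * cnj y = 1/P" using ysum yprod by (auto simp: SS_def P_def)
 have pair: "(A * u - B) * (A * u' - B) = A^2 * (u * u') - A * B * (u + u') + B^2" for A B u u' :: complex
  by (simp add: algebra_simps power2_eq_square)
 have kS: "of_real \<kappa> = SS * (1/P - P)" by (simp add: \<kappa>_def SS_def P_def)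
 have k0: "complex_of_real \<kappa> ~= 0" using kP by auto
 have den: "(of_real a - \<i>) * (of_real b - \<i>) * ((y - \<i>) * (cnj y - \<i>)) = - \<i> * of_real \<kappa>"
 proof -
  have "(of_real a - \<i>) * (of_real b - \<i>) = P - \<i> * SS - 1"
   using pair[of 1 "of_real a" \<i> "of_real b"] absum by simp
  moreover have "(y - \<i>) * (cnj y - \<i>) = 1/P + \<i> * SS - 1"
   using pair[of 1 y \<i> "cnj y"] ys by simp
  moreover have "(P - \<i> * SS - 1) * (1/P + \<i> * SS - 1) = (2 - P - 1/P + SS^2) - \<i> * (SS * (1/P - P))"
   using P0 by (simp add: algebra_simps power2_eq_square)
  ultimately show ?thesis unfolding rel kS by simp
 qed
 have fac: "(w - 1)^3 * (w + 1) - arm s ^ 2 * w^2 = (w - cis s) * (w - cis (K s)) * (w - v) * (w - 1 / cnj v)" for w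
 proof -
  define A where "A = w - 1"
  define B where "B = \<i> * (w + 1)"
  have "(w - cis s) * (w - cis (K s)) * (w - v) * (w - 1 / cnj v) =
    ((A * of_real a - B) * (A * of_real b - B)) * ((A * y - B) * (A * cnj y - B)) / 
    ((of_real a - \<i>) * (of_real b - \<i>) * ((y - \<i>) * (cnj y - \<i>)))"
   unfolding ca cb cv 
   unfolding v_def cayley_diff[OF ai(1)] cayley_diff[OF ai(2)] cayley_diff[OF yi(1)] cayley_diff[OF yi(2)] A_def B_def
   by (simp only: times_divide_times_eq mult.assoc)
  also have "((A * of_real a - B) * (A * of_real b - B)) * ((A * y - B) * (A * cnj y - B)) =
    (A^2 * P - A * B * SS + B^2) * (A^2 * (1/P) + A * B * SS + B^2)"
   unfolding pair absum ys by simp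
  also have "... = A^4 - of_real \<kappa> * A^3 * B + A^2 * B^2 * (P + 1/P - SS^2) + B^4"
   unfolding kS using P0 by (simp add: algebra_simps power2_eq_square power3_eq_cube power4_eq_xxxx)
  also have "P + 1/P - SS^2 = 2" unfolding rel by simp
  also have "A^4 - of_real \<kappa> * A^3 * B + A^2 * B^2 * 2 + B^4 = (A^2 + B^2)^2 - of_real \<kappa> * A^3 * B"
   by (simp add: algebra_simps power2_eq_square power4_eq_xxxx)
  also have "A^2 + B^2 = - 4 * w" unfolding A_def B_def by (simp add: power2_eq_square algebra_simps)
  also note den
  finally have "(w - cis s) * (w - cis (K s)) * (w - v) * (w - 1 / cnj v) =
    ((- 4 * w)^2 - of_real \<kappa> * A^3 * B) / (- \<i> * of_real \<kappa>)" .
  also have "... = A^3 * (w + 1) + \<i> * (16 / of_real \<kappa>) * w^2"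
   using k0 by (simp add: B_def field_simps power2_eq_square)
  also have "16 / complex_of_real \<kappa> = of_real (rsq s)"
  proof -
   have "\<kappa> ~= 0" using kP by auto
   hence "16 / \<kappa> = rsq s" using kP by (simp add: field_simps)
   hence "complex_of_real (16 / \<kappa>) = of_real (rsq s)" by simp
   thus ?thesis by simp
  qed
  finally show ?thesis using arm_sq[of s] s tip_bounds by (simp add: A_def)
 qed
 have e_low: "2 / (3*p) <= \<eta>^2"
 proof -
  have "p * p <= p * 1" using p by (intro mult_left_mono) auto
  moreover have "(1+p) * (3-p) = 3 + 2 * p - p * p" by (simp add: algebra_simps)
  ultimately have "8/3 <= (1+p) * (3-p)" using p by linarith
  hence "8/3 / (4*p) <= (1+p) * (3-p) / (4*p)" using p by (intro divide_right_mono) auto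
  thus ?thesis unfolding e2 by simp
 qed
 define m where "m = sqrt p"
 have m: "m > 0" "m^2 = p" using p by (auto simp: m_def)
 have em: "0.8 / m <= \<eta>"
 proof (rule power2_le_imp_le)
  have "(0.8/m)^2 = 0.64 / p" using m by (simp add: power_divide)
  also have "... <= 2 / (3*p)" using p by (simp add: field_simps)
  also note e_low
  finally show "(0.8/m)^2 <= \<eta>^2" .
 qed (use e0 in auto)
 have ms: "s / 6 <= m"
 proof (rule power2_le_imp_le)
  have "a <= 2/s" unfolding a_def by (rule ycot_bounds) (use s in auto)
  hence "s <= 2/a" using aS s by (simp add: field_simps)
  hence "(s/6)^2 <= ((2/a)/6)^2" using s by (intro power_mono) auto
  also have "... = 1/(9*a^2)" by (simp add: power_divide power2_eq_square)
  also have "... <= p" by (rule r)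
  finally show "(s/6)^2 <= m^2" unfolding m .
 qed (use m in auto)
 have ms2: "m <= s"
 proof (rule power2_le_imp_le)
  have "1/s <= a" unfolding a_def by (rule ycot_bounds) (use s in auto)
  hence "1/a <= s" using aS s by (simp add: field_simps)
  hence "(1/a)^2 <= s^2" using aS by (intro power_mono) auto
  moreover have "p <= (1/a)^2" using r(5) by (simp add: power_divide)
  ultimately show "m^2 <= s^2" unfolding m by linarith
 qed (use s in auto)
 have nv: "norm v ^ 2 = 1 + 4 * \<eta> / norm (y - \<i>)^2"
 proof -
  have "norm (y + \<i>)^2 = norm (y - \<i>)^2 + 4 * \<eta>"
   unfolding cmod_power2 y_def by (simp add: power2_eq_square algebra_simps)
  moreover have "norm (y - \<i>)^2 ~= 0" using yi' by simp
  moreover have "norm v ^ 2 = norm (y + \<i>)^2 / norm (y - \<i>)^2" by (simp add: v_def norm_divide power_divide)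
  ultimately show ?thesis by (simp add: add_divide_distrib)
 qed
 have v_low: "1 + s/20 <= norm v"
 proof (rule power2_le_imp_le)
  have "norm (y - \<i>)^2 <= 2 * (norm y ^ 2 + 1)"
  proof -
   have "norm (y - \<i>)^2 + norm (y + \<i>)^2 = 2 * (norm y ^ 2 + 1)"
    unfolding cmod_power2 y_def by (simp add: power2_eq_square algebra_simps)
   thus ?thesis by (smt (verit) zero_le_power2)
  qed
  also have "... <= 2 * (1/p + 1/(3*p))" unfolding ny using p by (simp add: field_simps)
  also have "... = 8 / (3*p)" using p by (simp add: field_simps)
  finally have d: "norm (y - \<i>)^2 <= 8 / (3 * m^2)" using m by simp
  have "4 * (0.8/m) / (8/(3*m^2)) <= 4 * \<eta> / norm (y - \<i>)^2"
   using em m d e0 yi' by (intro frac_le) auto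
  moreover have "4 * (0.8/m) / (8/(3*m^2)) = 1.2 * m" using m(1) by (simp add: field_simps power2_eq_square)
  ultimately have "1 + 1.2 * (s/6) <= norm v ^ 2" unfolding nv using ms by linarith
  moreover have "(1 + s/20)^2 <= 1 + 1.2 * (s/6)"
  proof -
   have "s * s <= s * 2.1" using s tip_bounds by (intro mult_left_mono) auto
   moreover have "(1 + s/20)^2 = 1 + s/10 + s * s / 400" by (simp add: power2_eq_square algebra_simps)
   ultimately show ?thesis using s by linarith
  qed
  ultimately show "(1 + s/20)^2 <= norm v ^ 2" by linarith
 qed auto
 have one_v: "1/v = (y - \<i>) / (y + \<i>)" by (simp add: v_def)
 have v_near: "norm (1 - 1/v) <= 2 * s"
 proof -
  have e: "1 - 1/v = 2 * \<i> / (y + \<i>)" unfolding one_v using yi' by (simp add: field_simps)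
  have "norm y ^ 2 <= norm (y + \<i>)^2"
   unfolding cmod_power2 y_def using e0 by (simp add: power2_eq_square algebra_simps)
  hence "norm y <= norm (y + \<i>)" by (rule power2_le_imp_le) auto
  moreover have "norm y = 1/m"
  proof -
   have "norm y ^ 2 = (1/m)^2" unfolding ny using m by (simp add: power_divide)
   thus ?thesis by (rule power2_eq_imp_eq) (use m in auto)
  qed
  ultimately have "2 / norm (y + \<i>) <= 2 / (1/m)" using m by (intro divide_left_mono) (use yi' in auto)
  thus ?thesis unfolding e norm_divide using ms2 m by (simp add: norm_mult)
 qed
 have quart: "(y^2 + 1)^2 = of_real \<kappa> * y"
 proof -
  have q: "y^2 = - SS * y - 1/P"
  proof -
   have "y^2 = y * (y + cnj y) - y * cnj y" by (simp add: power2_eq_square algebra_simps)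
   thus ?thesis unfolding ys by (simp add: algebra_simps)
  qed
  have "(y^2 + 1)^2 - of_real \<kappa> * y = (y^2 + SS * y + 1/P) * (y^2 - SS * y + P) + (2 - P - 1/P + SS^2) * y^2"
   unfolding kS using P0 by (simp add: algebra_simps power2_eq_square)
  also have "y^2 + SS * y + 1/P = 0" unfolding q by simp
  also have "2 - P - 1/P + SS^2 = 0" unfolding rel by simp
  finally show ?thesis by simp
 qed
 define R where "R = arm s * (y^2 + 1) / 4"
 have "Re R > 0"
 proof -
  define \<alpha> where "\<alpha> = (1 - p^2) / (2*p)"
  have y2: "y^2 + 1 = Complex (-\<alpha>) (- (S * \<eta>))"
  proof -
   have "S^2/4 - \<eta>^2 + 1 = - \<alpha>" unfolding S2 e2 \<alpha>_def using p by (simp add: field_simps power2_eq_square)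
   thus ?thesis by (simp add: y_def complex_eq_iff power2_eq_square)
  qed
  have "p^2 < 1" using p by (simp add: power_less_one_iff)
  hence \<alpha>: "\<alpha> > 0" using p by (simp add: \<alpha>_def)
  have "R = of_real (rho s) * ((-1 + \<i>) / of_real (sqrt 2)) * Complex (-\<alpha>) (- (S * \<eta>)) / 4"
   unfolding R_def y2 arm_def cis_135 by simp
  also have "... = of_real (rho s / sqrt 2 / 4) * ((-1 + \<i>) * Complex (-\<alpha>) (- (S * \<eta>)))" by simp
  finally have "Re R = rho s / sqrt 2 / 4 * (\<alpha> + S * \<eta>)" by simp
  moreover have "0 < \<alpha> + S * \<eta>" using \<alpha> S e0 by (intro add_pos_pos mult_pos_pos)
  moreover have "0 < rho s" using s tip_bounds by (intro rho_pos) auto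
  ultimately show ?thesis by simp
 qed
 hence R0: "R ~= 0" by auto
 have R2: "R^2 = - \<i> * y"
 proof -
  have "R^2 = arm s ^ 2 * (y^2 + 1)^2 / 16" by (simp add: R_def power_divide power_mult_distrib)
  also have "... = - \<i> * of_real (rsq s * \<kappa>) * y / 16" unfolding quart using arm_sq[of s] s tip_bounds by simp
  finally show ?thesis unfolding kP by simp
 qed
 have csq: "csqrt (\<i> / y) = 1 / R"
 proof (rule csqrt_unique)
  show "(1/R)^2 = \<i> / y" using yi by (simp add: power_divide R2 field_simps)
  have "Re (1/R) = Re R / norm R ^ 2" by (simp add: Re_divide cmod_power2)
  thus "0 < Re (1/R) \<or> Re (1/R) = 0 \<and> 0 <= Im (1/R)" using \<open>Re R > 0\<close> R0 by simp
 qed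
 have "chi (1/v) + arm s * (1/v) = 0"
 proof -
  have q: "(1 - 1/v) / (1 + 1/v) = \<i> / y"
  proof -
   have "1 - 1/v = 2 * \<i> / (y + \<i>)" "1 + 1/v = 2 * y / (y + \<i>)" unfolding one_v using yi' by (simp_all add: field_simps)
   thus ?thesis using yi' yi by simp
  qed
  have x2: "1 - (1/v)^2 = 4 * \<i> * y / (y + \<i>)^2"
  proof -
   have "(y + \<i>)^2 - (y - \<i>)^2 = 4 * \<i> * y" by (simp add: power2_eq_square algebra_simps)
   moreover have "1 - (A / B)^2 = (B^2 - A^2) / B^2" if "B ~= 0" for A B :: complex
    using that by (simp add: power_divide diff_divide_distrib)
   from this[OF yi'(2), of "y - \<i>"] have "1 - ((y - \<i>) / (y + \<i>))^2 = ((y + \<i>)^2 - (y - \<i>)^2) / (y + \<i>)^2" .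
   ultimately show ?thesis unfolding one_v by (simp only:)
  qed
  have "arm s * R * (y + \<i>) * (y - \<i>) = - 4 * \<i> * y"
  proof -
   have e: "(y + \<i>) * (y - \<i>) = y^2 + 1" by (simp add: algebra_simps power2_eq_square)
   have "arm s * R * (y + \<i>) * (y - \<i>) = arm s * R * (y^2 + 1)" unfolding mult.assoc e ..
   also have "... = arm s ^ 2 * ((y^2 + 1) * (y^2 + 1)) / 4"
    by (simp add: R_def power2_eq_square)
   also have "(y^2 + 1) * (y^2 + 1) = of_real \<kappa> * y" using quart by (simp add: power2_eq_square)
   also have "arm s ^ 2 * (of_real \<kappa> * y) / 4 = - \<i> * of_real (rsq s * \<kappa>) * y / 4" using arm_sq[of s] s tip_bounds by simp
   finally show ?thesis unfolding kP by (simp add: mult.assoc)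
  qed
  moreover have "A * C = D / (R * B)" if "A * R * B * C = D" "R ~= 0" "B ~= 0" for A B C D R :: complex
  proof -
   have "R * B * (A * C) = D" using that(1) by (simp add: mult_ac)
   thus ?thesis using that by (metis mult_eq_0_iff nonzero_mult_div_cancel_left)
  qed
  ultimately have k: "arm s * (y - \<i>) = - 4 * \<i> * y / (R * (y + \<i>))"
   using R0 yi'(2) by blast
  have "chi (1/v) = 4 * \<i> * y / (y + \<i>)^2 * (1/R)" unfolding chi_def q csq x2 ..
  moreover have "arm s * (1/v) = - 4 * \<i> * y / (R * (y + \<i>)) / (y + \<i>)"
   unfolding one_v times_divide_eq_right k ..
  moreover have "D / B^2 * (1 / R) = D / (R * B) / B" for D B :: complex
   by (simp add: power2_eq_square mult_ac)
  ultimately show ?thesis by simp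
 qed
 with fac v_low v_near show ?thesis by (rule that)
qed

text \<open>The same equation for a point of modulus \<open>rho s\<close> on the real axis: by
  symmetry two roots are real and the others conjugate.\<close>
lemma real_quartic_factor: assumes s: "0 < s" "s < tip"
 obtains u1 u2 :: real and u where "1 + s/4 <= u1" "u2 < -1" "norm u ^ 2 = 1 / (u1 * abs (u2))" "norm (u - 1) <= 6 * s"
  "\<And>w. (w - 1)^3 * (w + 1) - of_real (rsq s) * w^2 = (w - of_real u1) * (w - of_real u2) * (w - u) * (w - cnj u)"
proof -
 define P where "P = rsq s"
 have P: "P > 0" unfolding P_def using s tip_bounds by (intro rsq_pos) auto
 have Pb: "s^3 / 24 <= P" "P <= 17 * s^3" using rsq_bounds[of s] s by (auto simp: P_def)
 define f where "f = (%w::real. (w - 1)^3 * (w + 1) - P * w^2)"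
 have cf: "continuous_on A f" for A unfolding f_def by (intro continuous_intros)
 have big: "P * (3+P)^2 <= (2+P)^3 * (4+P)"
 proof -
  have "(2+P)^3 * (4+P) - P * (3+P)^2 = P^4 + 9 * P^3 + 30 * P^2 + 47 * P + 32"
   by (simp add: power2_eq_square power3_eq_cube power4_eq_xxxx algebra_simps)
  moreover have "0 <= P^4 + 9 * P^3 + 30 * P^2 + 47 * P + 32" using P by simp
  ultimately show ?thesis by linarith
 qed
 have "f 1 <= 0" using P by (simp add: f_def)
 moreover have "0 <= f (3+P)" using big by (simp add: f_def algebra_simps)
 ultimately obtain u1 where u1: "1 <= u1" "f u1 = 0" using IVT'[of f 1 0 "3+P"] P cf by auto
 have big2: "P * (3+P)^2 <= (4+P)^3 * (2+P)"
 proof -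
  have "(2+P)^3 * (4+P) = (2+P) * (4+P) * (2+P)^2" by (simp add: power2_eq_square power3_eq_cube)
  also have "... <= (2+P) * (4+P) * (4+P)^2" using P by (intro mult_left_mono power_mono) auto
  also have "... = (4+P)^3 * (2+P)" by (simp add: power2_eq_square power3_eq_cube)
  finally show ?thesis using big by linarith
 qed
 have "f (-(3+P)) = (4+P)^3 * (2+P) - P * (3+P)^2" by (simp add: f_def power2_eq_square power3_eq_cube algebra_simps)
 hence "0 <= f (-(3+P))" using big2 by simp
 moreover have fm1: "f (-1) < 0" using P by (simp add: f_def)
 ultimately obtain u2 where u2: "u2 <= -1" "f u2 = 0" using IVT2'[of f "-1" 0 "-(3+P)"] P cf by auto
 have u2': "u2 < -1" using u2 fm1 by (cases "u2 = -1") auto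
 have u1low: "1 + s/4 <= u1"
 proof (rule ccontr)
  assume n: "\<not> 1 + s/4 <= u1"
  define \<alpha> where "\<alpha> = u1 - 1"
  have al: "0 <= \<alpha>" "\<alpha> < s/4" using u1 n by (auto simp: \<alpha>_def)
  have "\<alpha>^3 * (2 + \<alpha>) = P * (1 + \<alpha>)^2" using u1(2) by (simp add: f_def \<alpha>_def algebra_simps)
  moreover have "P * ((2 + \<alpha>) / 2) <= P * (1 + \<alpha>)^2"
   using P al by (intro mult_left_mono) (auto simp: power2_eq_square algebra_simps)
  ultimately have "P / 2 * (2 + \<alpha>) <= \<alpha>^3 * (2 + \<alpha>)" by (simp add: mult_ac)
  hence "P / 2 <= \<alpha>^3" using al by (simp add: mult_le_cancel_right)
  moreover have "\<alpha>^3 <= (s/4)^3" using al by (intro power_mono) auto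
  moreover have "(s/4)^3 < s^3/48" using s by (simp add: power_divide)
  ultimately show False using Pb by linarith
 qed
 have u1': "u1 > 1" using u1low s by linarith
 define A where "A = u1 + u2 - 2"
 define B where "B = - 1 / (u1 * u2)"
 have B: "B = 1 / (u1 * abs (u2))" using u2' by (simp add: B_def)
 have B1: "0 < B" "B < 1"
 proof -
  have "1 * 1 < u1 * abs (u2)" using u1' u2' by (intro mult_strict_mono) auto
  thus "0 < B" "B < 1" unfolding B by auto
 qed
 define c2 where "c2 = - P - (B + u1 * u2 - (u1 + u2) * A)"
 define c1 where "c1 = 2 - (u1 * u2 * A - (u1 + u2) * B)"
 have uuB: "u1 * u2 * B = -1" using u1' u2' by (simp add: B_def)
 have fe: "f w = (w - u1) * (w - u2) * (w^2 + A * w + B) + (c2 * w^2 + c1 * w)" for w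
 proof -
  have "(w - u1) * (w - u2) * (w^2 + A * w + B) = w^4 + (A - (u1+u2)) * w^3 + (B + u1 * u2 - (u1+u2) * A) * w^2 + (u1 * u2 * A - (u1+u2) * B) * w + u1 * u2 * B"
   by (simp add: algebra_simps power2_eq_square power3_eq_cube power4_eq_xxxx)
  also have "A - (u1 + u2) = -2" by (simp add: A_def)
  finally show ?thesis unfolding uuB f_def c1_def c2_def by (simp add: algebra_simps power2_eq_square power3_eq_cube power4_eq_xxxx)
 qed
 have "c2 * u1^2 + c1 * u1 = 0" "c2 * u2^2 + c1 * u2 = 0" using fe[of u1] fe[of u2] u1 u2 by auto
 hence "u1 * (c2 * u1 + c1) = 0" "u2 * (c2 * u2 + c1) = 0" by (auto simp: power2_eq_square algebra_simps)
 hence c: "c2 * u1 + c1 = 0" "c2 * u2 + c1 = 0" using u1' u2' by auto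
 have "c2 * (u1 - u2) = (c2 * u1 + c1) - (c2 * u2 + c1)" by (simp add: algebra_simps)
 hence "c2 * (u1 - u2) = 0" unfolding c by simp
 hence c2: "c2 = 0" using u1' u2' by simp
 hence c1: "c1 = 0" using c by simp
 have fe': "f w = (w - u1) * (w - u2) * (w^2 + A * w + B)" for w using fe[of w] c1 c2 by simp
 have disc: "A^2 < 4 * B"
 proof (rule ccontr)
  assume "\<not> A^2 < 4 * B"
  hence d: "A^2/4 - B \<ge> 0" by simp
  define D where "D = sqrt (A^2/4 - B)"
  have D: "D^2 = A^2/4 - B" "D \<ge> 0" using d by (auto simp: D_def)
  define x where "x = (if A \<ge> 0 then - A/2 + D else - A/2 - D)"
  define x' where "x' = (if A \<ge> 0 then - A/2 - D else - A/2 + D)"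
  have xr: "x^2 + A * x + B = 0"
   using D(1) by (auto simp: x_def power2_eq_square algebra_simps)
  have "x * x' = B" using D(1) by (auto simp: x_def x'_def power2_eq_square algebra_simps)
  moreover have xx: "abs (x) <= abs (x')" using D(2) by (auto simp: x_def x'_def abs_if)
  ultimately have "abs (x) * abs (x) <= B" using mult_left_mono[OF xx, of "abs (x)"] B1 by (simp add: abs_mult[symmetric])
  hence "abs (x)^2 < 1^2" using B1 by (simp add: power2_eq_square)
  hence x1: "abs (x) < 1" by (rule power_less_imp_less_base) simp
  have "f x = 0" using fe'[of x] xr by simp
  moreover have "f x < 0"
  proof -
   have "(x - 1)^3 < 0" using x1 by (simp add: power_less_zero_eq abs_less_iff)
   hence "(x - 1)^3 * (x + 1) < 0" using x1 by (intro mult_neg_pos) auto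
   moreover have "0 <= P * x^2" using P by simp
   ultimately show ?thesis by (simp add: f_def)
  qed
  ultimately show False by simp
 qed
 define u where "u = Complex (- A/2) (sqrt (B - A^2/4))"
 have im2: "(sqrt (B - A^2/4))^2 = B - A^2/4" using disc by simp
 have nu: "norm u ^ 2 = B" unfolding cmod_power2 u_def using im2 by (simp add: power_divide)
 have quad: "(w - u) * (w - cnj u) = w^2 + of_real A * w + of_real B" for w
 proof -
  have "u + cnj u = - of_real A" by (simp add: u_def complex_eq_iff)
  moreover have "u * cnj u = of_real B" unfolding complex_norm_square[symmetric] of_real_power[symmetric] nu ..
  moreover have "(w - u) * (w - cnj u) = w^2 - (u + cnj u) * w + u * cnj u" by (simp add: algebra_simps power2_eq_square)
  ultimately show ?thesis by simp
 qed
 have fac: "(w - 1)^3 * (w + 1) - of_real (rsq s) * w^2 = (w - of_real u1) * (w - of_real u2) * (w - u) * (w - cnj u)" for w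
 proof -
  have "B + u1 * u2 - (u1 + u2) * A = - P" "u1 * u2 * A - (u1 + u2) * B = 2" "A = u1 + u2 - 2" "u1 * u2 * B = -1"
   using c1 c2 uuB by (auto simp: c1_def c2_def A_def)
  hence r: "complex_of_real (B + u1 * u2 - (u1 + u2) * A) = of_real (- P)" "complex_of_real (u1 * u2 * A - (u1 + u2) * B) = of_real 2"
    "complex_of_real (A - (u1 + u2)) = of_real (- 2)" "complex_of_real (u1 * u2 * B) = of_real (-1)" by simp_all
  have gen: "(w - a) * (w - b) * (w^2 + AA * w + BB) = w^4 + (AA - (a+b)) * w^3 + (BB + a * b - (a+b) * AA) * w^2 + (a * b * AA - (a+b) * BB) * w + a * b * BB" for a b AA BB :: complex
   by (simp add: algebra_simps power2_eq_square power3_eq_cube power4_eq_xxxx)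
  have "(w - of_real u1) * (w - of_real u2) * ((w - u) * (w - cnj u)) = w^4 + of_real (A - (u1+u2)) * w^3 + of_real (B + u1 * u2 - (u1+u2) * A) * w^2 + of_real (u1 * u2 * A - (u1+u2) * B) * w + of_real (u1 * u2 * B)"
   unfolding quad gen by simp
  also have "... = w^4 + of_real (-2) * w^3 + of_real (- P) * w^2 + of_real 2 * w + of_real (-1)" unfolding r ..
  also have "... = (w - 1)^3 * (w + 1) - of_real (rsq s) * w^2"
   unfolding P_def by (simp add: algebra_simps power2_eq_square power3_eq_cube power4_eq_xxxx)
  finally show ?thesis by (simp only: mult.assoc)
 qed
 have "norm (u - 1) <= 6 * s"
 proof (rule power2_le_imp_le)
  have "- of_real P = (1 - of_real u1) * (1 - of_real u2) * (1 - u) * (1 - cnj u)"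
   using fac[of 1] by (simp add: P_def)
  hence "norm (- complex_of_real P) = norm ((1 - complex_of_real u1) * (1 - of_real u2) * (1 - u) * (1 - cnj u))" by (rule arg_cong)
  moreover have "norm (1 - complex_of_real x) = abs (1 - x)" for x
  proof -
   have "1 - complex_of_real x = of_real (1 - x)" by simp
   thus ?thesis by (simp only: norm_of_real)
  qed
  ultimately have "P = (u1 - 1) * (1 - u2) * (norm (1 - u) * norm (1 - cnj u))"
   using P u1' u2' by (simp add: norm_mult)
  moreover have "norm (1 - cnj u) = norm (1 - u)"
   using complex_mod_cnj[of "1 - u"] by simp
  ultimately have e: "P = (u1 - 1) * (1 - u2) * norm (u - 1)^2" by (simp add: power2_eq_square norm_minus_commute)
  have "s/4 * 2 * norm (u - 1)^2 <= (u1 - 1) * (1 - u2) * norm (u - 1)^2"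
   using u1low u2' s by (intro mult_right_mono mult_mono) auto
  hence "s/2 * norm (u-1)^2 <= 17 * s^3" using e Pb by simp
  hence "s/2 * norm (u-1)^2 <= s/2 * (34 * s^2)" by (simp add: power2_eq_square power3_eq_cube)
  hence "norm (u-1)^2 <= 34 * s^2" using s by (simp add: mult_le_cancel_left)
  also have "... <= (6 * s)^2" by (simp add: power_mult_distrib)
  finally show "norm (u - 1)^2 <= (6 * s)^2" .
 qed (use s in auto)
 with u1low u2' nu[unfolded B] fac show ?thesis using that by blast
qed

section \<open>Means of logarithms and Riemann sums\<close>

lemma log_mean_value:
 fixes H :: "complex => complex"
 assumes cont: "continuous_on (cball 0 1) H" and hol: "H holomorphic_on ball 0 1"
  and nz: "\<And>x. x \<in> cball 0 1 ==> H x ~= 0"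
 shows "((%t. ln (norm (H (cis (2 * pi * t))))) has_integral ln (norm (H 0))) {0..1}"
proof -
 obtain g where g: "continuous_on (cball 0 1) g" "\<And>x. x \<in> cball 0 1 ==> H x = exp (g x)"
  using continuous_logarithm_on_cball[OF cont nz] by metis
 obtain g' where g': "g' holomorphic_on ball 0 1" "\<And>x. x \<in> ball 0 1 ==> exp (g' x) = H x"
 proof -
  have "simply_connected (ball (0::complex) 1)" by (intro convex_imp_simply_connected convex_ball)
  thus ?thesis using simply_connected_eq_holomorphic_log[of "ball 0 1"] hol nz that
   by (metis ball_subset_cball open_ball subsetD)
 qed
 have gc: "continuous_on (ball 0 1) (%x. g x - g' x)"
  by (rule continuous_on_diff[OF continuous_on_subset[OF g(1) ball_subset_cball]
     holomorphic_on_imp_continuous_on[OF g'(1)]])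
 have diff: "\<exists>n::int. g x - g' x = of_real (2 * n * pi) * \<i>" if "x \<in> ball 0 1" for x
 proof -
  have "exp (g x) = exp (g' x)" using g(2)[of x] g'(2)[of x] that by auto
  then obtain n :: int where "g x = g' x + of_int (2 * n) * pi * \<i>" unfolding exp_eq by auto
  thus ?thesis by (intro exI[of _ n]) simp
 qed
 have "(%x. g x - g' x) constant_on ball 0 1"
 proof (rule continuous_discrete_range_constant[OF _ gc])
  show "connected (ball (0::complex) 1)" by simp
  fix x :: complex assume x: "x \<in> ball 0 1"
  show "\<exists>e>0. \<forall>y. y \<in> ball 0 1 \<and> g y - g' y ~= g x - g' x --> e <= norm (g y - g' y - (g x - g' x))"
  proof (intro exI[of _ "2 * pi"] conjI allI impI)
   fix y assume y: "y \<in> ball 0 1 \<and> g y - g' y ~= g x - g' x"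
   obtain m :: int where m: "g x - g' x = of_real (2 * real_of_int m * pi) * \<i>" using diff[OF x] by blast
   obtain n :: int where n: "g y - g' y = of_real (2 * real_of_int n * pi) * \<i>" using diff[of y] y by blast
   note mn = m n
   hence "m ~= n" using y by auto
   hence "1 <= abs (real_of_int (n - m))" by linarith
   hence "2 * pi * 1 <= 2 * pi * abs (real_of_int (n - m))" by (intro mult_left_mono) auto
   also have "... = abs (2 * pi * real_of_int (n - m))" by (simp only: abs_mult abs_numeral abs_of_pos[OF pi_gt_zero])
   also have "... = norm (of_real (2 * pi * real_of_int (n - m)) * \<i>)"
    unfolding norm_mult norm_of_real by simp
   also have "of_real (2 * pi * real_of_int (n - m)) * \<i> = g y - g' y - (g x - g' x)"
    unfolding mn by (simp add: algebra_simps)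
   finally show "2 * pi <= norm (g y - g' y - (g x - g' x))" by simp
  qed auto
 qed
 then obtain c where c: "\<And>x. x \<in> ball 0 1 ==> g x - g' x = c" by (auto simp: constant_on_def)
 have "(%x. g' x + c) holomorphic_on ball 0 1" using g'(1) by (intro holomorphic_intros)
 hence gh: "g holomorphic_on ball 0 1"
  by (rule holomorphic_transform) (use c in \<open>auto simp: algebra_simps\<close>)
 have "((%u. g u / (u - 0)) has_contour_integral (2 * of_real pi * \<i> * g 0)) (circlepath 0 1)"
  by (rule Cauchy_integral_circlepath) (use g gh in auto)
 hence "((%t. g (circlepath 0 1 t) / circlepath 0 1 t * vector_derivative (circlepath 0 1) (at t within {0..1}))
   has_integral (2 * of_real pi * \<i> * g 0)) {0..1}"
  unfolding has_contour_integral_def by simp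
 hence "((%t. g (cis (2 * pi * t)) * (2 * of_real pi * \<i>)) has_integral (2 * of_real pi * \<i> * g 0)) {0..1}"
 proof (rule has_integral_eq[rotated])
  fix t :: real assume t: "t \<in> {0..1}"
  have e: "circlepath 0 1 t = cis (2 * pi * t)" by (simp add: circlepath cis_conv_exp mult_ac)
  have "vector_derivative (circlepath 0 1) (at t within {0..1}) = 2 * of_real pi * \<i> * cis (2 * pi * t)"
   using vector_derivative_circlepath01[of t 0 1] t by (simp add: cis_conv_exp mult_ac)
  thus "g (circlepath 0 1 t) / circlepath 0 1 t * vector_derivative (circlepath 0 1) (at t within {0..1}) =
    g (cis (2 * pi * t)) * (2 * of_real pi * \<i>)" unfolding e by simp
 qed
 hence "((%t. g (cis (2 * pi * t)) * (2 * of_real pi * \<i>) * (1 / (2 * of_real pi * \<i>))) has_integral (2 * of_real pi * \<i> * g 0) * (1 / (2 * of_real pi * \<i>))) {0..1}"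
  by (rule has_integral_mult_left)
 hence "((%t. g (cis (2 * pi * t))) has_integral g 0) {0..1}" by simp
 hence "((%t. Re (g (cis (2 * pi * t)))) has_integral Re (g 0)) {0..1}"
  by (rule has_integral_Re)
 moreover have "Re (g x) = ln (norm (H x))" if "x \<in> cball 0 1" for x
  using g(2)[OF that] by simp
 ultimately show ?thesis by simp
qed

lemma has_integral_fold_circle:
 fixes f :: "real => real"
 assumes c: "continuous_on UNIV f" and i: "((%t. f (2 * pi * t)) has_integral I) {0..1}"
  and per: "\<And>t. f (t + 2 * pi) = f t"
 shows "((%t. f t + f (- t)) has_integral (2 * pi * I)) {0..pi}"
proof -
 have ii: "f integrable_on {a..b}" for a b
  by (rule integrable_continuous_real) (rule continuous_on_subset[OF c], simp)
 have f1: "(f has_integral integral {0..2*pi} f) {0..2*pi}" by (intro integrable_integral ii)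
 have "((%t. f (2 * pi * t + 0)) has_integral (1 / abs (2 * pi)) *\<^sub>R integral {0..2*pi} f) ((%x. (1 / (2 * pi)) *\<^sub>R x + - ((1 / (2 * pi)) *\<^sub>R 0)) ` cbox 0 (2*pi))"
  using has_integral_affinity[of f "integral {0..2*pi} f" 0 "2*pi" "2*pi" 0] f1 by simp
 moreover have "(%x. (1 / (2 * pi)) *\<^sub>R x + - ((1 / (2 * pi)) *\<^sub>R 0)) ` cbox 0 (2*pi) = {0..1::real}"
  by (simp add: image_affinity_atLeastAtMost[of "1/(2*pi)" 0 0 "2*pi", simplified])
 ultimately have "((%t. f (2 * pi * t)) has_integral integral {0..2*pi} f / (2 * pi)) {0..1}" by simp
 hence "integral {0..2*pi} f / (2 * pi) = I" using i has_integral_unique by blast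
 hence I: "integral {0..2*pi} f = 2 * pi * I" by (simp add: field_simps)
 have split: "integral {0..pi} f + integral {pi..2*pi} f = integral {0..2*pi} f"
  by (rule Henstock_Kurzweil_Integration.integral_combine) (use ii in auto)
 have sh: "integral {pi..2*pi} f = integral {-pi..0} (%t. f (t + 2*pi))"
  using integral_shift_Icc_real[where a = "-pi" and b = 0 and c = "2*pi" and f = f] by (simp add: o_def add.commute)
 have "((%t. f (- t)) has_integral integral {-pi..0} f) {0..pi}"
 proof -
  have "((%t. f (- t)) has_integral integral {-pi..0} f) {-0..-(-pi)}"
   unfolding has_integral_reflect_real by (rule integrable_integral[OF ii])
  thus ?thesis by simp
 qed
 hence "((%t. f t + f (- t)) has_integral (integral {0..pi} f + integral {-pi..0} f)) {0..pi}"
  by (intro has_integral_add integrable_integral ii)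
 thus ?thesis using split sh per I by simp
qed

text \<open>Monotonicity alone bounds the error of a midpoint sum by one step times the total
  variation, with no smoothness at the corner.\<close>
lemma midpoint_sum_mono:
 fixes g :: "real => real"
 assumes h: "h > 0" and mono: "\<And>x y. a <= x ==> x <= y ==> y <= a + real m * h ==> g x <= g y"
  and int: "g integrable_on {a..a + real m * h}"
 shows "abs (h * (\<Sum>i<m. g (a + (real i + 1/2) * h)) - integral {a..a + real m * h} g) <= h * (g (a + real m * h) - g a)"
 using mono int
proof (induction m)
 case 0
 thus ?case by simp
next
 case (Suc m)
 define b where "b = a + real m * h"
 have bs: "a + real (Suc m) * h = b + h" by (simp add: b_def algebra_simps)
 have ab: "a <= b" using h by (simp add: b_def)
 have i1: "g integrable_on {a..b}" by (rule integrable_on_subinterval[OF Suc.prems(2)]) (use ab h bs in auto)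
 have i2: "g integrable_on {b..b+h}" by (rule integrable_on_subinterval[OF Suc.prems(2)]) (use ab h bs in auto)
 have IH: "abs (h * (\<Sum>i<m. g (a + (real i + 1/2) * h)) - integral {a..b} g) <= h * (g b - g a)"
  unfolding b_def by (rule Suc.IH) (use Suc.prems(1) i1 h in \<open>auto simp: b_def algebra_simps\<close>)
 have spl: "integral {a..b} g + integral {b..b+h} g = integral {a..b+h} g"
  by (rule Henstock_Kurzweil_Integration.integral_combine) (use ab h Suc.prems(2) bs in auto)
 have m: "g b <= g x" "g x <= g (b + h)" if "x \<in> {b..b+h}" for x
  using that Suc.prems(1)[of b x] Suc.prems(1)[of x "b+h"] ab h bs by auto
 have "integral {b..b+h} (%x. g b) <= integral {b..b+h} g"
  by (rule integral_le) (use i2 m in auto)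
 hence l: "h * g b <= integral {b..b+h} g" using h by simp
 have "integral {b..b+h} g <= integral {b..b+h} (%x. g (b+h))"
  by (rule integral_le) (use i2 m in auto)
 hence u: "integral {b..b+h} g <= h * g (b+h)" using h by simp
 have mid: "a + (real m + 1/2) * h = b + h/2" by (simp add: b_def algebra_simps)
 have "h * g b <= h * g (b+h/2)" "h * g (b+h/2) <= h * g (b+h)" using m[of "b+h/2"] h by auto
 hence "abs (h * g (b + h/2) - integral {b..b+h} g) <= h * g (b+h) - h * g b" using l u by linarith
 thus ?case unfolding bs using IH spl[symmetric] by (simp add: mid distrib_left right_diff_distrib)
qed

section \<open>The equilibrium integral\<close>

lemma psi0_arm: assumes "0 <= t" "t <= pi" shows "psi0 (cis t) = arm t" "psi0 (cis (-t)) = cnj (arm t)"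
 using psi0_cis[OF assms] psi0_cis_neg[OF assms] by (auto simp: arm_def cis_cnj)

lemma arm_K: assumes "0 <= s" "s <= tip" shows "arm (K s) = arm s"
 using rho_K[OF assms] by (simp add: arm_def)

lemma psi0_sq: assumes "w ~= 0" shows "psi0 w ^ 2 = (w - 1)^3 * (w + 1) / w^2"
proof (cases "w = -1")
 case False
 hence w: "w + 1 ~= 0" by (auto simp: add_eq_0_iff2)
 have "w - 1/w = (w - 1) * (w + 1) / w" using assms by (simp add: field_simps)
 hence "psi0 w = ((w - 1) * (w + 1) / w) * csqrt ((w - 1) / (w + 1))" unfolding psi0_def by (simp only:)
 hence "psi0 w ^ 2 = ((w - 1) * (w + 1) / w)^2 * ((w - 1) / (w + 1))"
  by (simp only: power_mult_distrib[of _ "csqrt _"] power2_csqrt)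
 also have "... = (w - 1)^3 * (w + 1) / w^2"
 proof -
  have "(A * B / C)^2 * (A / B) = A^3 * B / C^2" if "B ~= 0" for A B C :: complex
   using that by (simp add: power2_eq_square power3_eq_cube)
  from this[OF w] show ?thesis .
 qed
 finally show ?thesis .
qed (simp add: psi0_def)

lemma cayley_inverse: fixes x :: complex assumes "x ~= 0" shows "(1/x - 1) / (1/x + 1) = (1 - x) / (1 + x)"
proof -
 have "1/x - 1 = (1 - x) / x" "1/x + 1 = (1 + x) / x" using assms by (simp_all add: field_simps)
 thus ?thesis using assms by simp
qed

lemma chi_psi0: assumes "x ~= 0" shows "chi x = x * psi0 (1/x)"
proof -
 have "(1/x - 1) / (1/x + 1) = (1 - x) / (1 + x)" by (rule cayley_inverse[OF assms])
 moreover have "x * (1/x - x) = 1 - x^2" using assms by (simp add: field_simps power2_eq_square)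
 ultimately show ?thesis by (simp add: chi_def psi0_def mult.assoc[symmetric])
qed

lemma chi_sq: "chi x ^ 2 = (1 - x)^3 * (1 + x)"
proof (cases "1 + x = 0")
 case True
 have "x = (1 + x) - 1" by simp
 hence "x = -1" unfolding True by simp
 thus ?thesis by (simp add: chi_def)
next
 case False
 have "chi x ^ 2 = (1 - x^2)^2 * ((1 - x) / (1 + x))" by (simp add: chi_def power_mult_distrib)
 also have "1 - x^2 = (1 - x) * (1 + x)" by (simp add: power2_eq_square algebra_simps)
 also have "((1 - x) * (1 + x))^2 * ((1 - x) / (1 + x)) = (1 - x)^3 * (1 + x)"
  using False by (simp add: power2_eq_square power3_eq_cube)
 finally show ?thesis .
qed

lemma chi_holomorphic: "chi holomorphic_on ball 0 1"
proof -
 have "(1 - x) / (1 + x) \<notin> \<real>\<^sub>\<le>\<^sub>0 \<and> 1 + x ~= 0" if "x \<in> ball 0 1" for x :: complex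
 proof (cases "x = 0")
  case True thus ?thesis by simp
 next
  case False
  have "norm (1/x) > 1" using that False by (simp add: norm_divide field_simps)
  from psi0_quotient_right_half_plane[OF this]
  have r: "Re ((1 - x) / (1 + x)) > 0" unfolding cayley_inverse[OF False] .
  have x: "1 + x ~= 0" using that by (auto simp: add_eq_0_iff)
  from r x show ?thesis by (auto elim!: nonpos_Reals_cases)
 qed
 thus ?thesis unfolding chi_def[abs_def] by (intro holomorphic_intros) auto
qed

lemma chi_continuous: "continuous_on (cball 0 1) chi"
proof -
 have "continuous_on (cball 0 1 - {0}) (%x. x * psi0 (1/x))"
  by (intro continuous_intros continuous_on_compose2[OF continuous_on_psi0])
    (auto simp: norm_divide field_simps)
 hence 1: "continuous_on (cball 0 1 - {0}) chi"
  by (rule continuous_on_eq) (auto simp: chi_psi0)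
 have 2: "continuous_on (ball 0 1) chi" by (rule holomorphic_on_imp_continuous_on[OF chi_holomorphic])
 have un: "ball (0::complex) 1 \<union> (cball 0 1 - {0}) = cball 0 1" by auto
 have "continuous_on (ball (0::complex) 1 \<union> (cball 0 1 - {0})) chi"
 proof (rule continuous_on_Un_local_open[OF _ _ 2 1])
  show "openin (top_of_set (ball 0 1 \<union> (cball 0 1 - {0}))) (ball (0::complex) 1)"
   unfolding un by (rule open_subset) auto
  show "openin (top_of_set (ball 0 1 \<union> (cball 0 1 - {0}))) (cball 0 1 - {0::complex})"
   unfolding un by (simp add: openin_delete)
 qed
 thus ?thesis unfolding un .
qed

text \<open>With \<open>z\<close> and \<open>a\<close> on the upper arm of moduli \<open>S\<close>
  and \<open>r\<close>, this is \<open>ln (norm (z + a) * norm (z + cnj a) / norm (S^2 -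
  a^2))\<close>. It is bounded and unimodal in \<open>r\<close>, unlike its three terms.\<close>
definition Eng :: "real => real => real" where
 "Eng S r = ln (S + r) + ln (S^2 + r^2) / 2 - ln (S^4 + r^4) / 2"

lemma reflect_norm: assumes "norm x = 1" "v ~= 0" shows "norm (1 - x / cnj v) = norm (1 - v * x) / norm v"
proof -
 have x: "x * cnj x = 1" using assms by (metis complex_norm_square of_real_1 one_power2)
 have "norm (1 - v * x) = norm (x * (cnj x - v))" using x by (simp add: algebra_simps)
 also have "... = norm (cnj (cnj x - v))" using assms by (simp add: norm_mult del: complex_cnj_diff)
 also have "... = norm (cnj v - x)" by (simp add: norm_minus_commute)
 also have "cnj v - x = cnj v * (1 - x / cnj v)" using assms by (simp add: field_simps)
 finally show ?thesis using assms by (simp add: norm_mult)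
qed

text \<open>Both products behind \<open>Eng\<close> are boundary values of functions with explicit
  zeros, so Jensen's formula evaluates their logarithmic means; the only zero inside the disc
  comes from the preimage \<open>v\<close> of \<open>- arm s\<close>.\<close>
lemma equilibrium:
 assumes s: "0 < s" "s < tip"
  and vfac: "\<And>w. (w - 1)^3 * (w + 1) - arm s ^ 2 * w^2 = (w - cis s) * (w - cis (K s)) * (w - v) * (w - 1 / cnj v)"
  and v1: "1 < norm v" and vz: "chi (1/v) + arm s * (1/v) = 0"
  and u1: "1 < u1" and u2: "u2 < -1" and u: "norm u < 1"
  and ufac: "\<And>w. (w - 1)^3 * (w + 1) - of_real (rsq s) * w^2 = (w - of_real u1) * (w - of_real u2) * (w - u) * (w - cnj u)"
 shows "((%t. Eng (rho s) (rho t)) has_integral (2 * pi * (ln (norm v) - ln (u1 * abs (u2)) / 2))) {0..pi}"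
proof -
 define z where "z = arm s"
 define P where "P = rsq s"
 define G where "G = (%x. chi x + z * x)"
 define Gm where "Gm = (%x. chi x - z * x)"
 define Rr where "Rr = (%x. (1 - cis s * x) * (1 - cis (K s) * x) * (1 - x / cnj v))"
 have Sp: "rho s > 0" using s tip_bounds by (intro rho_pos) auto
 have z0: "z ~= 0" using Sp by (simp add: z_def arm_def)
 have v0: "v ~= 0" using v1 by auto
 have GG: "G x * Gm x = (1 - v * x) * Rr x" for x
 proof (cases "x = 0")
  case True thus ?thesis by (simp add: G_def Gm_def Rr_def chi_def)
 next
  case False
  have "G x * Gm x = chi x ^ 2 - z^2 * x^2" by (simp add: G_def Gm_def power2_eq_square algebra_simps)
  also have "... = x^4 * ((1/x - 1)^3 * (1/x + 1) - z^2 * (1/x)^2)"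
  proof -
   have "x^4 * ((1/x - 1)^3 * (1/x + 1)) = (x * (1/x - 1))^3 * (x * (1/x + 1))"
    by (simp add: power_mult_distrib power3_eq_cube power4_eq_xxxx)
   moreover have "x * (1/x - 1) = 1 - x" "x * (1/x + 1) = 1 + x" using False by (simp_all add: field_simps)
   ultimately have "x^4 * ((1/x - 1)^3 * (1/x + 1)) = chi x ^ 2" unfolding chi_sq by (simp only:)
   moreover have "x^4 * (z^2 * (1/x)^2) = z^2 * x^2" using False by (simp add: power2_eq_square power4_eq_xxxx)
   ultimately show ?thesis unfolding right_diff_distrib by (simp only:)
  qed
  also have "... = x^4 * ((1/x - cis s) * (1/x - cis (K s)) * (1/x - v) * (1/x - 1 / cnj v))"
   unfolding z_def vfac ..
  also have "... = (x * (1/x - cis s)) * (x * (1/x - cis (K s))) * (x * (1/x - v)) * (x * (1/x - 1 / cnj v))"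
   by (simp add: power4_eq_xxxx)
  also have "... = (1 - v * x) * Rr x"
  proof -
   have f: "x * (1/x - a) = 1 - a * x" for a using False by (simp add: right_diff_distrib)
   show ?thesis unfolding f Rr_def by simp
  qed
  finally show ?thesis .
 qed
 define x0 where "x0 = 1/v"
 have x0: "norm x0 < 1" "x0 ~= 0" "v * x0 = 1" using v1 v0 by (auto simp: x0_def norm_divide)
 have Gx0: "G x0 = 0" using vz by (simp add: G_def x0_def z_def)
 have kk: "tip < K s" "K s < pi" using ycot_relation[OF s] by auto
 have cis_case: "G (cis (-t)) ~= 0" if "t \<in> {s, K s}" for t
 proof -
  have t: "0 <= t" "t <= pi" "arm t = z" using that s kk tip_bounds arm_K[of s] by (auto simp: z_def)
  have "chi (cis (-t)) = cis (-t) * z" using chi_psi0[of "cis (-t)"] psi0_arm(1)[of t] t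
   by (simp add: divide_inverse)
  hence "G (cis (-t)) = 2 * z * cis (-t)" by (simp add: G_def)
  thus ?thesis using z0 by simp
 qed
 have Gnz: "G x ~= 0" if x: "x \<in> cball 0 1" "x ~= x0" for x
 proof
  assume G: "G x = 0"
  hence "(1 - v * x) * Rr x = 0" using GG[of x] by simp
  moreover have "1 - v * x ~= 0" using x(2) v0 by (auto simp: x0_def field_simps)
  moreover have "1 - x / cnj v ~= 0"
  proof
   assume "1 - x / cnj v = 0"
   hence "x = cnj v" using v0 by (simp add: field_simps)
   thus False using x v1 by simp
  qed
  ultimately have "1 - cis s * x = 0 \<or> 1 - cis (K s) * x = 0" unfolding Rr_def mult_eq_0_iff by blast
  then obtain t where t: "t \<in> {s, K s}" "1 - cis t * x = 0" by blast
  have "cis (-t) * (cis t * x) = x" by (simp add: mult.assoc[symmetric] cis_mult)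
  moreover have "cis t * x = 1" using t(2) by simp
  ultimately have "x = cis (-t)" by (metis mult.right_neutral)
  thus False using cis_case[OF t(1)] G by simp
 qed
 have Ghol: "G holomorphic_on ball 0 1" unfolding G_def by (intro holomorphic_intros chi_holomorphic)
 have Gmhol: "Gm holomorphic_on ball 0 1" unfolding Gm_def by (intro holomorphic_intros chi_holomorphic)
 have Gcont: "continuous_on (cball 0 1) G" unfolding G_def by (intro continuous_intros chi_continuous)
 have dG: "deriv G x0 ~= 0"
 proof
  assume d: "deriv G x0 = 0"
  have x0b: "x0 \<in> ball 0 1" using x0 by simp
  have 1: "(G has_field_derivative 0) (at x0)" using holomorphic_derivI[OF Ghol open_ball x0b] d by simp
  have 2: "(Gm has_field_derivative deriv Gm x0) (at x0)" by (rule holomorphic_derivI[OF Gmhol open_ball x0b])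
  have 3: "((%x. G x * Gm x) has_field_derivative 0) (at x0)" using DERIV_mult[OF 1 2] Gx0 by simp
  have "Rr holomorphic_on UNIV" unfolding Rr_def using v0 by (intro holomorphic_intros) auto
  hence "Rr field_differentiable at x0" by (rule holomorphic_on_imp_differentiable_at) auto
  then obtain D where D: "(Rr has_field_derivative D) (at x0)" by (auto simp: field_differentiable_def)
  have "((%x. 1 - v * x) has_field_derivative - v) (at x0)" by (auto intro!: derivative_eq_intros)
  from DERIV_mult[OF this D] have "((%x. (1 - v * x) * Rr x) has_field_derivative - v * Rr x0) (at x0)"
   using x0 by simp
  from DERIV_unique[OF this 3[unfolded GG]] have "- v * Rr x0 = 0" .
  hence "Rr x0 = 0" using v0 by simp
  have ne: "1 - w * x0 ~= 0" if "norm w <= 1" for w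
  proof
   assume "1 - w * x0 = 0"
   hence "norm (w * x0) = 1" by simp
   moreover have "norm w * norm x0 <= 1 * norm x0" using that by (intro mult_right_mono) auto
   ultimately show False using x0 by (simp add: norm_mult)
  qed
  have "norm (1 / cnj v) <= 1" using v1 by (simp add: norm_divide divide_le_eq)
  hence "1 - cis s * x0 ~= 0" "1 - cis (K s) * x0 ~= 0" "1 - 1 / cnj v * x0 ~= 0"
   using ne[of "cis s"] ne[of "cis (K s)"] ne[of "1 / cnj v"] by simp_all
  hence "Rr x0 ~= 0" unfolding Rr_def by simp
  with \<open>Rr x0 = 0\<close> show False by simp
 qed
 define D where "D = (%x. if x = x0 then deriv G x0 else (G x - G x0) / (x - x0))"
 have Dhol: "D holomorphic_on ball 0 1" unfolding D_def
  by (rule pole_lemma_open[OF Ghol open_ball])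
 have Dcont: "continuous_on (cball 0 1) D"
 proof -
  have "continuous_on (cball 0 1 - {x0}) (%x. (G x - G x0) / (x - x0))"
   by (intro continuous_intros continuous_on_subset[OF Gcont]) auto
  hence 1: "continuous_on (cball 0 1 - {x0}) D" by (rule continuous_on_eq) (auto simp: D_def)
  have 2: "continuous_on (ball 0 1) D" by (rule holomorphic_on_imp_continuous_on[OF Dhol])
  have un: "ball (0::complex) 1 \<union> (cball 0 1 - {x0}) = cball 0 1" using x0 by auto
  have "continuous_on (ball (0::complex) 1 \<union> (cball 0 1 - {x0})) D"
  proof (rule continuous_on_Un_local_open[OF _ _ 2 1])
   show "openin (top_of_set (ball 0 1 \<union> (cball 0 1 - {x0}))) (ball (0::complex) 1)"
    unfolding un by (rule open_subset) auto
   show "openin (top_of_set (ball 0 1 \<union> (cball 0 1 - {x0}))) (cball 0 1 - {x0})"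
    unfolding un by (simp add: openin_delete)
  qed
  thus ?thesis unfolding un .
 qed
 have Dnz: "D x ~= 0" if "x \<in> cball 0 1" for x using dG Gnz[OF that] Gx0 by (simp add: D_def)
 define H1 where "H1 = (%x. D x * (- 1 / v) * (1 - x / cnj v))"
 define H2 where "H2 = (%x. (1 - x / of_real u1) * (1 - x / of_real u2) * ((1 - u * x) * (1 - cnj u * x)))"
 define H where "H = (%x. H1 x ^ 2 / H2 x)"
 have one_minus: "1 - a * x ~= 0" if "norm a < 1" "x \<in> cball 0 1" for a x :: complex
 proof
  assume "1 - a * x = 0"
  hence "norm (a * x) = 1" by simp
  moreover have "norm a * norm x <= norm a * 1" using that by (intro mult_left_mono) auto
  ultimately show False using that by (simp add: norm_mult)
 qed
 have "norm (1 / cnj v) < 1" "norm (1 / complex_of_real u1) < 1" "norm (1 / complex_of_real u2) < 1"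
 proof -
  have "1 / abs (u2) < 1" using u2 by (subst divide_less_eq) auto
  thus "norm (1 / complex_of_real u2) < 1" by (simp add: norm_divide)
 qed (use v1 u1 in \<open>simp_all add: norm_divide divide_less_eq\<close>)
 from this[THEN one_minus] have nz1: "1 - x / cnj v ~= 0" "1 - x / of_real u1 ~= 0" "1 - x / of_real u2 ~= 0"
  if "x \<in> cball 0 1" for x using that by auto
 have H2nz: "H2 x ~= 0" if "x \<in> cball 0 1" for x
  unfolding H2_def using one_minus[OF u that] one_minus[of "cnj u", OF _ that] nz1[OF that] u by auto
 have H1nz: "H1 x ~= 0" if "x \<in> cball 0 1" for x
  unfolding H1_def using Dnz[OF that] nz1(1)[OF that] v0 by auto
 have Hnz: "H x ~= 0" if "x \<in> cball 0 1" for x using H1nz[OF that] H2nz[OF that] by (simp add: H_def)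
 have H2c: "continuous_on A H2" for A unfolding H2_def using u1 u2 by (intro continuous_intros) auto
 have Hcont: "continuous_on (cball 0 1) H"
  unfolding H_def H1_def using H2nz v0 by (intro continuous_intros Dcont H2c) auto
 have Hhol: "H holomorphic_on ball 0 1"
 proof -
  have "H2 holomorphic_on ball 0 1" unfolding H2_def using u1 u2 by (intro holomorphic_intros) auto
  thus ?thesis unfolding H_def H1_def using H2nz v0 by (intro holomorphic_intros Dhol) auto
 qed
 have "H 0 = 1" using Gx0 x0 v0 by (simp add: H_def H1_def H2_def D_def x0_def G_def chi_def)
 hence mean: "((%t. ln (norm (H (cis (2 * pi * t))))) has_integral 0) {0..1}"
  using log_mean_value[OF Hcont Hhol Hnz] by simp
 define f where "f = (%t. ln (norm (H (cis t))))"
 have "continuous_on UNIV f"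
  unfolding f_def using Hnz by (intro continuous_intros continuous_on_compose2[OF Hcont]) auto
 moreover have "f (t + 2 * pi) = f t" for t by (simp add: f_def cis_mult[symmetric])
 ultimately have I0: "((%t. f t + f (- t)) has_integral 0) {0..pi}"
  using has_integral_fold_circle[of f 0] mean by (simp add: f_def)
 have fx: "ln (norm (H x)) = 2 * ln (norm (G x)) - ln (norm (chi x ^ 2 - of_real P * x^2)) - 2 * ln (norm v) + ln (u1 * abs (u2))"
   and fx_nz: "norm (G x) > 0" "norm (chi x ^ 2 - of_real P * x^2) > 0" if x: "norm x = 1" for x
 proof -
  have xb: "x \<in> cball 0 1" and xx0: "x ~= x0" and x0': "x ~= 0" using x x0 by auto
  have "D x = G x / (x - x0)" using xx0 Gx0 by (simp add: D_def)
  hence "D x * (- 1 / v) = G x / ((x - x0) * (- v))" by simp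
  also have "(x - x0) * (- v) = 1 - v * x" using x0(3) by (simp add: algebra_simps)
  finally have "D x * (- 1 / v) = G x / (1 - v * x)" .
  hence "norm (H1 x) = norm (G x) / norm (1 - v * x) * norm (1 - x / cnj v)"
   unfolding H1_def by (simp add: norm_mult norm_divide)
  moreover have "norm (1 - v * x) ~= 0" using xx0 v0 by (auto simp: x0_def field_simps)
  ultimately have n1: "norm (H1 x) = norm (G x) / norm v" unfolding reflect_norm[OF x v0] by simp
  have q: "chi x ^ 2 - of_real P * x^2 = (1 - of_real u1 * x) * (1 - of_real u2 * x) * ((1 - u * x) * (1 - cnj u * x))"
  proof -
   have "x^4 * ((1/x - 1)^3 * (1/x + 1)) = (x * (1/x - 1))^3 * (x * (1/x + 1))"
    by (simp add: power_mult_distrib power3_eq_cube power4_eq_xxxx)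
   moreover have "x * (1/x - 1) = 1 - x" "x * (1/x + 1) = 1 + x" using x0' by (simp_all add: field_simps)
   ultimately have "x^4 * ((1/x - 1)^3 * (1/x + 1)) = chi x ^ 2" unfolding chi_sq by (simp only:)
   moreover have "x^4 * (of_real P * (1/x)^2) = of_real P * x^2" using x0' by (simp add: power2_eq_square power4_eq_xxxx)
   ultimately have "chi x ^ 2 - of_real P * x^2 = x^4 * ((1/x - 1)^3 * (1/x + 1) - of_real P * (1/x)^2)"
    unfolding right_diff_distrib by (simp only:)
   also have "... = (x * (1/x - of_real u1)) * (x * (1/x - of_real u2)) * ((x * (1/x - u)) * (x * (1/x - cnj u)))"
    unfolding P_def ufac by (simp add: power4_eq_xxxx)
   moreover have f: "x * (1/x - a) = 1 - a * x" for a using x0' by (simp add: right_diff_distrib)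
   ultimately show ?thesis unfolding f by simp
  qed
  have "norm (1 - x / of_real u1) = norm (1 - of_real u1 * x) / u1" "norm (1 - x / of_real u2) = norm (1 - of_real u2 * x) / abs (u2)"
   using reflect_norm[OF x, of "of_real u1"] reflect_norm[OF x, of "of_real u2"] u1 u2 by auto
  hence n2: "norm (H2 x) = norm (chi x ^ 2 - of_real P * x^2) / (u1 * abs (u2))"
   unfolding q by (simp add: H2_def norm_mult)
  show p1: "norm (G x) > 0" using Gnz[OF xb xx0] by simp
  show p2: "norm (chi x ^ 2 - of_real P * x^2) > 0"
   using H2nz[OF xb] n2 by auto
  have "u1 * abs (u2) > 0" by (rule mult_pos_pos) (use u1 u2 in linarith)+
  with v0 have p3: "norm v > 0" "u1 * abs (u2) > 0" by (simp, blast)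
  have "norm (H x) = (norm (G x) / norm v)^2 / (norm (chi x ^ 2 - of_real P * x^2) / (u1 * abs (u2)))"
   by (simp add: H_def norm_divide norm_power n1 n2)
  also have "ln ... = ln ((norm (G x) / norm v)^2) - ln (norm (chi x ^ 2 - of_real P * x^2) / (u1 * abs (u2)))"
   by (rule ln_divide_pos) (use p1 p2 p3 in \<open>auto intro!: divide_pos_pos\<close>)
  also have "ln ((norm (G x) / norm v)^2) = 2 * (ln (norm (G x)) - ln (norm v))"
   using p1 p3 by (simp add: ln_realpow ln_div)
  also have "ln (norm (chi x ^ 2 - of_real P * x^2) / (u1 * abs (u2))) = ln (norm (chi x ^ 2 - of_real P * x^2)) - ln (u1 * abs (u2))"
   by (rule ln_divide_pos) (use p2 p3 in auto)
  finally show "ln (norm (H x)) = 2 * ln (norm (G x)) - ln (norm (chi x ^ 2 - of_real P * x^2)) - 2 * ln (norm v) + ln (u1 * abs (u2))" by simp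
 qed
 have nG: "norm (G (cis t)) = norm (psi0 (cis (-t)) + z)" "norm (chi (cis t) ^ 2 - of_real P * cis t ^ 2) = norm (psi0 (cis (-t))^2 - of_real P)" for t
 proof -
  have c: "chi (cis t) = cis t * psi0 (cis (-t))" using chi_psi0[of "cis t"] by (simp add: divide_inverse)
  have "G (cis t) = cis t * (psi0 (cis (-t)) + z)" unfolding G_def c by (simp add: algebra_simps)
  thus "norm (G (cis t)) = norm (psi0 (cis (-t)) + z)" by (simp add: norm_mult)
  have "chi (cis t) ^ 2 - of_real P * cis t ^ 2 = cis t ^ 2 * (psi0 (cis (-t))^2 - of_real P)"
   unfolding c by (simp add: power_mult_distrib right_diff_distrib mult_ac)
  thus "norm (chi (cis t) ^ 2 - of_real P * cis t ^ 2) = norm (psi0 (cis (-t))^2 - of_real P)" by (simp add: norm_mult norm_power)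
 qed
 have "f t + f (- t) = 2 * Eng (rho s) (rho t) - (4 * ln (norm v) - 2 * ln (u1 * abs (u2)))" if t: "t \<in> {0..pi}" for t
 proof -
  have r0: "rho t \<ge> 0" using t by (intro rho_nonneg) auto
  have a1: "norm (cnj (arm t) + z) = sqrt (rho s ^ 2 + rho t ^ 2)"
  proof -
   have "cnj (arm t) + z = cis (3*pi/4) * Complex (rho s) (rho t)"
    unfolding complex_eq_iff arm_def z_def by (simp add: cos_135 sin_135; simp add: algebra_simps)
   thus ?thesis by (simp add: norm_mult complex_norm)
  qed
  have a2: "norm (arm t + z) = rho s + rho t"
   unfolding arm_def z_def using r0 Sp by (simp add: norm_mult flip: distrib_right of_real_add)
  have sq: "norm (\<i> * of_real x - complex_of_real P) = sqrt (x^2 + P^2)" for x by (simp add: cmod_def)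
  have P4: "P^2 = rho s ^ 4" unfolding P_def using rho_sq[of s] s tip_bounds by (simp flip: power_mult add: numeral_eq_Suc)
  have r4: "rsq t ^ 2 = rho t ^ 4" using rho_sq[of t] t by (simp flip: power_mult add: numeral_eq_Suc)
  have b1: "norm (arm t ^ 2 - of_real P) = sqrt (rho s ^ 4 + rho t ^ 4)"
   using arm_sq[of t] t sq[of "- rsq t"] P4 r4 by (simp add: add.commute)
  have b2: "norm (cnj (arm t) ^ 2 - of_real P) = sqrt (rho s ^ 4 + rho t ^ 4)"
  proof -
   have "cnj (arm t) ^ 2 = \<i> * of_real (rsq t)" using arm_sq[of t] t by (metis atLeastAtMost_iff complex_cnj_complex_of_real complex_cnj_i complex_cnj_minus complex_cnj_mult complex_cnj_power minus_minus)
   thus ?thesis using sq[of "rsq t"] P4 r4 by (simp add: add.commute)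
  qed
  have p: "psi0 (cis (-t)) = cnj (arm t)" "psi0 (cis (-(-t))) = arm t" using psi0_arm[of t] t by auto
  have c1: "norm (cis t) = 1" "norm (cis (-t)) = 1" by auto
  have l1: "f t = 2 * ln (sqrt (rho s ^ 2 + rho t ^ 2)) - ln (sqrt (rho s ^ 4 + rho t ^ 4)) - 2 * ln (norm v) + ln (u1 * abs (u2))"
   unfolding f_def fx[OF c1(1)] nG p a1 b2 ..
  have l2: "f (-t) = 2 * ln (rho s + rho t) - ln (sqrt (rho s ^ 4 + rho t ^ 4)) - 2 * ln (norm v) + ln (u1 * abs (u2))"
   unfolding f_def fx[OF c1(2)] nG p a2 b1 ..
  have "rho s ^ 2 + rho t ^ 2 > 0" "rho s ^ 4 + rho t ^ 4 > 0" using Sp by (auto intro!: add_pos_nonneg)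
  thus ?thesis unfolding l1 l2 Eng_def by (simp add: ln_sqrt)
 qed
 from has_integral_eq[OF this I0]
 have "((%t. 2 * Eng (rho s) (rho t) - (4 * ln (norm v) - 2 * ln (u1 * abs (u2)))) has_integral 0) {0..pi}" .
 moreover have "((%t. 4 * ln (norm v) - 2 * ln (u1 * abs (u2))) has_integral (pi * (4 * ln (norm v) - 2 * ln (u1 * abs (u2))))) {0..pi}"
  using has_integral_const_real[of "4 * ln (norm v) - 2 * ln (u1 * abs (u2))" 0 pi] by simp
 ultimately have "((%t. 2 * Eng (rho s) (rho t)) has_integral (pi * (4 * ln (norm v) - 2 * ln (u1 * abs (u2))))) {0..pi}"
  using has_integral_add[of "%t. 2 * Eng (rho s) (rho t) - (4 * ln (norm v) - 2 * ln (u1 * abs (u2)))" 0 "{0..pi}"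
    "%t. 4 * ln (norm v) - 2 * ln (u1 * abs (u2))"] by simp
 from has_integral_mult_right[OF this, of "1/2"] show ?thesis by (simp add: algebra_simps)
qed

section \<open>The energy of the lattice\<close>

lemma Eng_deriv: assumes "S > 0" "r > 0"
 shows "(Eng S has_real_derivative (1/(S+r) + r/(S^2+r^2) - 2 * r^3/(S^4+r^4))) (at r)"
proof -
 have "S^2 + r^2 > 0" "S^4 + r^4 > 0" "S + r > 0" using assms by (auto intro!: add_pos_nonneg)
 hence d: "((%r. ln (S + r)) has_real_derivative 1/(S+r)) (at r)"
  "((%r. ln (S^2 + r^2)) has_real_derivative 2 * r/(S^2+r^2)) (at r)"
  "((%r. ln (S^4 + r^4)) has_real_derivative 4 * r^3/(S^4+r^4)) (at r)"
  by (auto intro!: derivative_eq_intros)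
 from DERIV_diff[OF DERIV_add[OF d(1) DERIV_cdivide[OF d(2), of 2]] DERIV_cdivide[OF d(3), of 2]]
 have "((%r. ln (S + r) + ln (S^2 + r^2) / 2 - ln (S^4 + r^4) / 2) has_real_derivative
   (1/(S+r) + (2 * r/(S^2+r^2)) / 2 - (4 * r^3/(S^4+r^4)) / 2)) (at r)" .
 moreover have "1/(S+r) + 2 * r / A / 2 - 4 * q / B / 2 = 1/(S+r) + r/A - 2 * q / B" for A B q :: real by simp
 ultimately show ?thesis unfolding Eng_def[abs_def] by (simp only:)
qed

lemma Eng_cont: assumes "S > 0" shows "continuous_on {0..} (Eng S)"
proof -
 have "S^2 + r^2 > 0" "S^4 + r^4 > 0" for r using assms by (auto intro!: add_pos_nonneg)
 thus ?thesis unfolding Eng_def[abs_def] using assms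
  by (intro continuous_intros) (auto simp: less_imp_neq[symmetric] add_pos_nonneg)
qed

lemma Eng_slope_parts: fixes S r :: real assumes "S > 0" "r > 0"
 shows "r <= S ==> r^3 / (S^4+r^4) <= r / (S^2+r^2)" "r <= S ==> r^3 / (S^4+r^4) <= 1 / (S+r)"
  "S <= r ==> r / (S^2+r^2) <= r^3 / (S^4+r^4)" "S <= r ==> 1 / (S+r) <= r^3 / (S^4+r^4)"
proof -
 have p: "S^2 + r^2 > 0" "S^4 + r^4 > 0" "S + r > 0" using assms by (auto intro!: add_pos_nonneg)
 have e1: "r^3 * (S^2+r^2) = r * (r^2 * S^2 + r^4)" "r * (S^4 + r^4) = r * (S^2 * S^2 + r^4)"
  by (simp_all add: algebra_simps power2_eq_square power3_eq_cube power4_eq_xxxx)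
 have e2: "r^3 * (S+r) = r^3 * S + r^4" "S^4 = S^3 * S"
  by (simp_all add: algebra_simps power3_eq_cube power4_eq_xxxx)
 show "r^3 / (S^4+r^4) <= r / (S^2+r^2)" if "r <= S"
 proof -
  have "r^2 * S^2 <= S^2 * S^2" using that assms by (intro mult_right_mono power_mono) auto
  hence "r^3 * (S^2+r^2) <= r * (S^4 + r^4)" unfolding e1 using assms by (intro mult_left_mono add_right_mono) auto
  thus ?thesis using p by (simp add: divide_le_eq pos_le_divide_eq mult.commute)
 qed
 show "r^3 / (S^4+r^4) <= 1 / (S+r)" if "r <= S"
 proof -
  have "r^3 * S <= S^3 * S" using that assms by (intro mult_right_mono power_mono) auto
  hence "r^3 * (S+r) <= S^4 + r^4" unfolding e2 by simp
  thus ?thesis using p by (simp add: divide_le_eq pos_le_divide_eq mult.commute)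
 qed
 show "r / (S^2+r^2) <= r^3 / (S^4+r^4)" if "S <= r"
 proof -
  have "S^2 * S^2 <= r^2 * S^2" using that assms by (intro mult_right_mono power_mono) auto
  hence "r * (S^4 + r^4) <= r^3 * (S^2+r^2)" unfolding e1 using assms by (intro mult_left_mono add_right_mono) auto
  thus ?thesis using p by (simp add: divide_le_eq pos_le_divide_eq mult.commute)
 qed
 show "1 / (S+r) <= r^3 / (S^4+r^4)" if "S <= r"
 proof -
  have "S^3 * S <= r^3 * S" using that assms by (intro mult_right_mono power_mono) auto
  hence "S^4 + r^4 <= r^3 * (S+r)" unfolding e2 by simp
  thus ?thesis using p by (simp add: divide_le_eq pos_le_divide_eq mult.commute)
 qed
qed

lemma Eng_incr: assumes "S > 0" "0 <= x" "x <= y" "y <= S" shows "Eng S x <= Eng S y"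
proof (cases "x = y")
 case False
 show ?thesis
 proof (rule DERIV_nonneg_imp_increasing_open[where f = "Eng S"])
  show "x <= y" by fact
  fix r assume r: "x < r" "r < y"
  hence r': "0 < r" "r <= S" using assms by auto
  show "\<exists>d. (Eng S has_real_derivative d) (at r) \<and> 0 <= d"
   using Eng_deriv[OF assms(1) r'(1)] Eng_slope_parts(1,2)[OF assms(1) r'(1) r'(2)]
   by (intro exI[of _ "1/(S+r) + r/(S^2+r^2) - 2 * r^3/(S^4+r^4)"] conjI) auto
 qed (use assms in \<open>auto intro: continuous_on_subset[OF Eng_cont]\<close>)
qed simp

lemma Eng_decr: assumes "S > 0" "S <= x" "x <= y" shows "Eng S y <= Eng S x"
proof (cases "x = y")
 case False
 have "- Eng S x <= - Eng S y"
 proof (rule DERIV_nonneg_imp_increasing_open[where f = "%r. - Eng S r"])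
  show "x <= y" by fact
  fix r assume r: "x < r" "r < y"
  show "\<exists>d. ((%r. - Eng S r) has_real_derivative d) (at r) \<and> 0 <= d"
  proof -
   have r': "0 < r" "S <= r" using r assms by auto
   show ?thesis
    using DERIV_minus[OF Eng_deriv[OF assms(1) r'(1)]] Eng_slope_parts(3,4)[OF assms(1) r'(1) r'(2)]
    by (intro exI[of _ "- (1/(S+r) + r/(S^2+r^2) - 2 * r^3/(S^4+r^4))"] conjI) auto
  qed
 qed (use assms in \<open>auto intro!: continuous_intros intro: continuous_on_subset[OF Eng_cont]\<close>)
 thus ?thesis by simp
qed simp

lemma Eng_bounds: assumes "S > 0" "r \<ge> 0" shows "0 <= Eng S r" "Eng S r <= ln 2"
proof -
 have e0: "Eng S 0 = 0" using assms by (simp add: Eng_def ln_realpow)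
 have eS: "Eng S S = ln 2"
 proof -
  have "S + S = 2 * S" "S^2 + S^2 = 2 * S^2" "S^4 + S^4 = 2 * S^4" by auto
  thus ?thesis unfolding Eng_def using assms by (simp add: ln_mult ln_realpow field_simps)
 qed
 show "Eng S r <= ln 2"
  using Eng_incr[of S r S] Eng_decr[of S S r] eS assms by (cases "r <= S") auto
 have p: "S^2 + r^2 > 0" "S^4 + r^4 > 0" "S + r > 0" using assms by (auto intro!: add_pos_nonneg)
 have "S^4 + r^4 <= (S + r)^2 * (S^2 + r^2)"
 proof -
  have "(S + r)^2 * (S^2 + r^2) = S^4 + r^4 + 2 * (S^2 * r^2) + 2 * (S^3 * r) + 2 * (S * r^3)"
   by (simp add: algebra_simps power2_eq_square power3_eq_cube power4_eq_xxxx)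
  moreover have "0 <= S^2 * r^2" "0 <= S^3 * r" "0 <= S * r^3" using assms by auto
  ultimately show ?thesis by linarith
 qed
 hence "ln (S^4 + r^4) <= ln ((S + r)^2 * (S^2 + r^2))" using p by simp
 also have "... = 2 * ln (S + r) + ln (S^2 + r^2)" using p by (simp add: ln_mult ln_realpow)
 finally show "0 <= Eng S r" by (simp add: Eng_def)
qed

lemma midpoint_sum_antimono:
 fixes g :: "real => real"
 assumes h: "h > 0" and mono: "\<And>x y. a <= x ==> x <= y ==> y <= a + real m * h ==> g y <= g x"
  and int: "g integrable_on {a..a + real m * h}"
 shows "abs (h * (\<Sum>i<m. g (a + (real i + 1/2) * h)) - integral {a..a + real m * h} g) <= h * (g a - g (a + real m * h))"
proof -
 have "abs (h * (\<Sum>i<m. - g (a + (real i + 1/2) * h)) - integral {a..a + real m * h} (%x. - g x)) <= h * (- g (a + real m * h) - - g a)"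
  by (rule midpoint_sum_mono[OF h]) (use mono int in \<open>auto intro: integrable_neg\<close>)
 thus ?thesis by (simp add: sum_negf algebra_simps abs_minus_commute)
qed

text \<open>The sum over the lattice is a midpoint sum of a function that increases and then
  decreases on each side of the fold, so it differs from the integral by a bounded number of
  steps, uniformly in \<open>S\<close>.\<close>
lemma energy_sum: assumes S: "S > 0" and h: "h > 0" and a: "0 <= a" "a <= h/2" "a + real m * h = pi"
 shows "abs (h * (\<Sum>i<m. Eng S (rho (a + (real i + 1/2) * h))) - integral {0..pi} (%t. Eng S (rho t))) <= 5 * ln 2 * h"
proof -
 define lo where "lo = (%r. Eng S (min r S))"
 define hi where "hi = (%r. Eng S (max r S))"
 define L where "L = (%t. rho (min t tip))"
 define R where "R = (%t. rho (max t tip))"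
 have dec: "Eng S r = lo r + hi r - Eng S S" for r by (auto simp: lo_def hi_def min_def max_def)
 have dec2: "f (rho t) = f (L t) + f (R t) - f (rho tip)" for f :: "real => real" and t
  by (auto simp: L_def R_def min_def max_def)
 have Lm: "L x <= L y" if "0 <= x" "x <= y" for x y
  unfolding L_def using that tip_bounds by (intro rho_mono) auto
 have Rm: "R y <= R x" if "x <= y" "y <= pi" for x y
  unfolding R_def using that tip_bounds by (intro rho_antimono) auto
 have L0: "0 <= L x" "0 <= R x" if "0 <= x" "x <= pi" for x
  unfolding L_def R_def using that tip_bounds by (auto intro!: rho_nonneg)
 have lom: "lo x <= lo y" "hi y <= hi x" if "0 <= x" "x <= y" for x y
 proof -
  show "lo x <= lo y" unfolding lo_def using that S by (intro Eng_incr) auto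
  show "hi y <= hi x" unfolding hi_def using that S by (intro Eng_decr) auto
 qed
 have lob: "0 <= lo x" "lo x <= ln 2" "0 <= hi x" "hi x <= ln 2" if "0 <= x" for x
  unfolding lo_def hi_def using that S by (auto intro!: Eng_bounds)
 have cL: "continuous_on {0..pi} L" "continuous_on {0..pi} R"
  unfolding L_def R_def
  by (auto intro!: continuous_on_compose2[OF continuous_on_rho[of UNIV]] continuous_intros)
 have clo: "continuous_on {0..} lo" "continuous_on {0..} hi"
  unfolding lo_def hi_def using S by (auto intro!: continuous_on_compose2[OF Eng_cont] continuous_intros)
 have c4: "continuous_on {0..pi} (%t. lo (L t))" "continuous_on {0..pi} (%t. lo (R t))"
   "continuous_on {0..pi} (%t. hi (L t))" "continuous_on {0..pi} (%t. hi (R t))"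
  using L0 by (auto intro!: continuous_on_compose2[OF clo(1) cL(1)] continuous_on_compose2[OF clo(1) cL(2)]
    continuous_on_compose2[OF clo(2) cL(1)] continuous_on_compose2[OF clo(2) cL(2)])
 have sub: "{a..pi} \<subseteq> {0..pi}" using a by auto
 have i4: "(%t. lo (L t)) integrable_on {a..pi}" "(%t. lo (R t)) integrable_on {a..pi}"
   "(%t. hi (L t)) integrable_on {a..pi}" "(%t. hi (R t)) integrable_on {a..pi}"
  by (auto intro!: integrable_continuous_real continuous_on_subset[OF c4(1) sub] continuous_on_subset[OF c4(2) sub]
    continuous_on_subset[OF c4(3) sub] continuous_on_subset[OF c4(4) sub])
 have api: "a <= pi" using a(3) h by (metis le_add_same_cancel1 less_imp_le mult_nonneg_nonneg of_nat_0_le_iff)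
 define t where "t = (%i. a + (real i + 1/2) * h)"
 have osc: "h * (x - y) <= ln 2 * h" if "x <= ln 2" "0 <= y" for x y
  using mult_left_mono[of "x - y" "ln 2" h] that h by simp
 have up: "abs (h * (\<Sum>i<m. g (t i)) - integral {a..pi} g) <= ln 2 * h"
  if "\<And>x y. 0 <= x ==> x <= y ==> y <= pi ==> g x <= g y" "0 <= g a" "g pi <= ln 2" "g integrable_on {a..pi}" for g
 proof -
  have "abs (h * (\<Sum>i<m. g (t i)) - integral {a..pi} g) <= h * (g pi - g a)"
   using midpoint_sum_mono[OF h, of a m g] that a(1) unfolding a(3) t_def by auto
  also have "... <= ln 2 * h" by (rule osc) (use that in auto)
  finally show ?thesis .
 qed
 have down: "abs (h * (\<Sum>i<m. g (t i)) - integral {a..pi} g) <= ln 2 * h"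
  if "\<And>x y. 0 <= x ==> x <= y ==> y <= pi ==> g y <= g x" "0 <= g pi" "g a <= ln 2" "g integrable_on {a..pi}" for g
 proof -
  have "abs (h * (\<Sum>i<m. g (t i)) - integral {a..pi} g) <= h * (g a - g pi)"
   using midpoint_sum_antimono[OF h, of a m g] that a(1) unfolding a(3) t_def by auto
  also have "... <= ln 2 * h" by (rule osc) (use that in auto)
  finally show ?thesis .
 qed
 note La = L0[of a, OF a(1) api] and Lp = L0[of pi, OF pi_ge_zero order_refl]
 have b1: "abs (h * (\<Sum>i<m. lo (L (t i))) - integral {a..pi} (%t. lo (L t))) <= ln 2 * h"
  by (rule up) (use lom(1) Lm L0 lob La Lp i4 in auto)
 have b2: "abs (h * (\<Sum>i<m. lo (R (t i))) - integral {a..pi} (%t. lo (R t))) <= ln 2 * h"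
  by (rule down) (use lom(1) Rm L0 lob La Lp i4 in auto)
 have b3: "abs (h * (\<Sum>i<m. hi (L (t i))) - integral {a..pi} (%t. hi (L t))) <= ln 2 * h"
  by (rule down) (use lom(2) Lm L0 lob La Lp i4 in auto)
 have b4: "abs (h * (\<Sum>i<m. hi (R (t i))) - integral {a..pi} (%t. hi (R t))) <= ln 2 * h"
  by (rule up) (use lom(2) Rm L0 lob La Lp i4 in auto)
 define c where "c = lo (rho tip) + hi (rho tip) + Eng S S"
 have e: "Eng S (rho t) = lo (L t) + lo (R t) + (hi (L t) + hi (R t)) - c" for t
  unfolding dec[of "rho t"] dec2[of lo t] dec2[of hi t] c_def by simp
 have mh: "h * real m = pi - a" using a(3) by (simp add: mult.commute)
 have s: "h * (\<Sum>i<m. Eng S (rho (t i))) = h * (\<Sum>i<m. lo (L (t i))) + h * (\<Sum>i<m. lo (R (t i))) + (h * (\<Sum>i<m. hi (L (t i))) + h * (\<Sum>i<m. hi (R (t i)))) - (pi - a) * c"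
  unfolding e mh[symmetric] by (simp add: sum.distrib sum_subtractf algebra_simps)
 have i: "integral {a..pi} (%t. Eng S (rho t)) = integral {a..pi} (%t. lo (L t)) + integral {a..pi} (%t. lo (R t)) + (integral {a..pi} (%t. hi (L t)) + integral {a..pi} (%t. hi (R t))) - (pi - a) * c"
 proof -
  have "((%t. lo (L t) + lo (R t) + (hi (L t) + hi (R t)) - c) has_integral
   (integral {a..pi} (%t. lo (L t)) + integral {a..pi} (%t. lo (R t)) + (integral {a..pi} (%t. hi (L t)) + integral {a..pi} (%t. hi (R t))) - (pi - a) * c)) {a..pi}"
   using has_integral_const_real[of c a pi] api
   by (intro has_integral_diff has_integral_add integrable_integral i4) simp
  thus ?thesis unfolding e by (rule integral_unique)
 qed
 have main: "abs (h * (\<Sum>i<m. Eng S (rho (t i))) - integral {a..pi} (%t. Eng S (rho t))) <= 4 * (ln 2 * h)"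
  unfolding s i using b1 b2 b3 b4 by linarith
 have cE: "continuous_on {0..pi} (%t. Eng S (rho t))"
  by (rule continuous_on_compose2[OF Eng_cont[OF S] continuous_on_rho]) (auto intro: rho_nonneg)
 have iE: "(%t. Eng S (rho t)) integrable_on {0..pi}" by (rule integrable_continuous_real[OF cE])
 have iEa: "(%t. Eng S (rho t)) integrable_on {0..a}" by (rule integrable_on_subinterval[OF iE]) (use api in auto)
 have spl: "integral {0..a} (%t. Eng S (rho t)) + integral {a..pi} (%t. Eng S (rho t)) = integral {0..pi} (%t. Eng S (rho t))"
  by (rule Henstock_Kurzweil_Integration.integral_combine) (use a api iE in auto)
 have Eb: "0 <= Eng S (rho x)" "Eng S (rho x) <= ln 2" if "x \<in> {0..a}" for x
  using that api by (auto intro!: Eng_bounds S rho_nonneg)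
 have "integral {0..a} (%t. Eng S (rho t)) <= integral {0..a} (%t. ln 2)"
  by (rule integral_le) (use iEa Eb in auto)
 hence "integral {0..a} (%t. Eng S (rho t)) <= a * ln 2" using a by simp
 moreover have "a * ln 2 <= h * ln 2" using a h by (intro mult_right_mono) auto
 moreover have "0 <= integral {0..a} (%t. Eng S (rho t))" by (rule integral_nonneg) (use iEa Eb in auto)
 moreover have "5 * ln 2 * h = 4 * (ln 2 * h) + h * ln 2" by simp
 ultimately show ?thesis using main spl unfolding t_def by linarith
qed

text \<open>For even \<open>n\<close> the corner is a node and is its own mirror image, so index 0
  occurs only on the upper side.\<close>
definition lo_idx :: "nat => nat" where "lo_idx n = 2 * (n div 2) + 1 - n"

abbreviation mirrored :: "nat => nat set" where "mirrored n \<equiv> {lo_idx n..n div 2}"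

lemma lo_idx: "lo_idx n = (if even n then 1 else 0)"
 by (auto simp: lo_idx_def elim!: evenE oddE)

lemma prod_split_index:
 fixes f :: "nat => 'a :: comm_monoid_mult"
 shows "(\<Prod>k\<le>n. f k) = (\<Prod>k\<le>n div 2. f k) * (\<Prod>k\<in>mirrored n. f (2 * (n div 2) + 1 - k))"
proof -
 have "{..n} = {..n div 2} \<union> {n div 2<..n}" by auto
 moreover have "prod f ({..n div 2} \<union> {n div 2<..n}) = prod f {..n div 2} * prod f {n div 2<..n}"
  by (rule prod.union_disjoint) auto
 ultimately have "(\<Prod>k\<le>n. f k) = (\<Prod>k\<le>n div 2. f k) * (\<Prod>k\<in>{n div 2<..n}. f k)" by (simp only:)
 also have "(\<Prod>k\<in>{n div 2<..n}. f k) = (\<Prod>k\<in>mirrored n. f (2 * (n div 2) + 1 - k))"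
  by (rule prod.reindex_bij_witness[of _ "%k. 2 * (n div 2) + 1 - k" "%k. 2 * (n div 2) + 1 - k"])
    (auto simp: lo_idx_def)
 finally show ?thesis .
qed

lemma prod_theta_split:
 fixes g :: "real => 'a :: comm_monoid_mult"
 shows "(\<Prod>k\<le>n. g (theta n k)) = (\<Prod>k\<le>n div 2. g (thu n k)) * (\<Prod>k\<in>mirrored n. g (- thu n k))"
proof -
 have 1: "(\<Prod>k\<le>n div 2. g (theta n k)) = (\<Prod>k\<le>n div 2. g (thu n k))"
  by (rule prod.cong) (auto simp: theta_def)
 have 2: "(\<Prod>k\<in>mirrored n. g (theta n (2 * (n div 2) + 1 - k))) = (\<Prod>k\<in>mirrored n. g (- thu n k))"
 proof (rule prod.cong)
  fix k assume "k \<in> mirrored n"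
  hence "\<not> 2 * (n div 2) + 1 - k <= n div 2" "2 * (n div 2) + 1 - (2 * (n div 2) + 1 - k) = k" by auto
  thus "g (theta n (2 * (n div 2) + 1 - k)) = g (- thu n k)" by (simp only: theta_def if_False)
 qed simp
 show ?thesis using prod_split_index[where n = n and f = "%k. g (theta n k)"] unfolding 1 2 .
qed

lemma prod_upper_split:
 fixes g :: "nat => 'a :: comm_monoid_mult"
 shows "(\<Prod>k\<le>n div 2. g k) = (if even n then g 0 else 1) * (\<Prod>k\<in>mirrored n. g k)"
proof (cases "even n")
 case True
 have "{..n div 2} = insert 0 {1..n div 2}" by auto
 thus ?thesis using True by (simp add: lo_idx)
next
 case False
 have "{..n div 2} = {0..n div 2}" by auto
 thus ?thesis using False by (simp add: lo_idx)
qed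

lemma theta_upper_0: "even n ==> thu n 0 = 0" by (simp add: theta_upper_def)

lemma theta_upper_range: assumes "k <= n div 2"
 shows "0 <= thu n k" "thu n k <= pi - pi / NN n"
  "lo_idx n <= k ==> pi / NN n <= thu n k"
proof -
 have k: "2 * real k + (if even n then 0 else 1) <= real n"
  using assms by (auto elim!: evenE oddE)
 have e: "pi - pi / NN n = real n * pi / NN n" by (simp add: field_simps)
 have t: "thu n k = (2 * real k + (if even n then 0 else 1)) * pi / NN n" by (simp add: theta_upper_def)
 show "0 <= thu n k" by (auto simp: theta_upper_def)
 have "(2 * real k + (if even n then 0 else 1)) * pi <= real n * pi" using k by (intro mult_right_mono) auto
 thus "thu n k <= pi - pi / NN n" unfolding e t by (intro divide_right_mono) auto
 assume "lo_idx n <= k"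
 hence "1 <= 2 * real k + (if even n then 0 else 1)" by (auto simp: lo_idx split: if_splits)
 hence "1 * pi <= (2 * real k + (if even n then 0 else 1)) * pi" by (intro mult_right_mono) auto
 hence "pi <= (2 * real k + (if even n then 0 else 1)) * pi" by simp
 thus "pi / NN n <= thu n k" unfolding t by (intro divide_right_mono) auto
qed

section \<open>The nodal product of the Fejer points\<close>

definition node_prod :: "nat => real => real" where
 "node_prod n s = (\<Prod>k\<le>n. norm (arm s - psi0 (cis (theta n k))))"

lemma norm_theta_prod: "(\<Prod>k\<le>n. norm (cis (theta n k) - v)) = norm (v ^ (n+1) - sgnN n)"
proof -
 have "(\<Prod>k\<le>n. norm (cis (theta n k) - v)) = norm (\<Prod>k\<le>n. v - cis (theta n k))"
  by (simp add: prod_norm[symmetric] norm_minus_commute)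
 thus ?thesis unfolding prod_theta .
qed

lemma norm_sgnN_power: "norm (1 - sgnN n * inverse v ^ (n+1)) * norm v ^ (n+1) = norm (v ^ (n+1) - sgnN n)" if "v ~= 0"
proof -
 have "v ^ (n+1) - sgnN n = v ^ (n+1) * (1 - sgnN n * inverse v ^ (n+1))"
  using that by (simp add: algebra_simps power_inverse)
 thus ?thesis by (simp add: norm_mult norm_power mult.commute)
qed

lemma energy_lattice: assumes S: "S > 0" and I: "integral {0..pi} (%t. Eng S (rho t)) = 2 * pi * c"
 shows "abs ((\<Sum>k\<in>mirrored n. Eng S (rho (thu n k))) - NN n * c) <= 5 * ln 2"
proof -
 define h where "h = 2 * pi / NN n"
 have h: "h > 0" by (simp add: h_def)
 define a where "a = (if even n then h/2 else 0)"
 define m where "m = n div 2 + 1 - lo_idx n"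
 have np: "real n + 1 > 0" by simp
 have "a + real m * h = NN n / 2 * h"
 proof (cases "even n")
  case True
  then obtain j where "n = 2 * j" by (auto elim: evenE)
  thus ?thesis using True by (simp add: a_def m_def lo_idx algebra_simps)
 next
  case False
  then obtain j where "n = 2 * j + 1" by (auto elim: oddE)
  thus ?thesis using False by (simp add: a_def m_def lo_idx algebra_simps)
 qed
 hence am: "a + real m * h = pi" by (simp add: h_def)
 have t: "thu n (i + lo_idx n) = a + (real i + 1/2) * h" for i
 proof -
  have "thu n k = (real k + (if even n then 0 else 1/2)) * h" for k
   by (simp add: theta_upper_def h_def add_divide_distrib distrib_right)
  thus ?thesis by (simp add: lo_idx a_def algebra_simps)
 qed
 have "(\<Sum>k\<in>mirrored n. Eng S (rho (thu n k))) = (\<Sum>i<m. Eng S (rho (thu n (i + lo_idx n))))"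
  by (rule sum.reindex_bij_witness[of _ "%i. i + lo_idx n" "%k. k - lo_idx n"]) (auto simp: m_def)
 hence e: "(\<Sum>k\<in>mirrored n. Eng S (rho (thu n k))) = (\<Sum>i<m. Eng S (rho (a + (real i + 1/2) * h)))"
  unfolding t .
 have "abs (h * (\<Sum>i<m. Eng S (rho (a + (real i + 1/2) * h))) - 2 * pi * c) <= 5 * ln 2 * h"
  using energy_sum[OF S h _ _ am] h unfolding I by (simp add: a_def)
 moreover have "2 * pi * c = h * (NN n * c)" by (simp add: h_def)
 ultimately have "h * abs ((\<Sum>i<m. Eng S (rho (a + (real i + 1/2) * h))) - NN n * c) <= h * (5 * ln 2)"
 proof -
  assume 1: "abs (h * (\<Sum>i<m. Eng S (rho (a + (real i + 1/2) * h))) - 2 * pi * c) <= 5 * ln 2 * h"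
   and 2: "2 * pi * c = h * (NN n * c)"
  have 3: "h * x - h * y = h * (x - y)" for x y :: real by (simp add: right_diff_distrib)
  show ?thesis using 1 unfolding 2 3 abs_mult using h by (simp add: mult.commute)
 qed
 thus ?thesis unfolding e using h by (simp only: mult_le_cancel_left_pos)
qed

lemma sqrt_prod: "sqrt (\<Prod>k\<in>A. f k) = (\<Prod>k\<in>A. sqrt (f k))"
 by (induction A rule: infinite_finite_induct) (auto simp: real_sqrt_mult)

text \<open>The product over \<open>- arm s\<close> is traded for one over squares, which roots of
  unity evaluate, at the price of the energy sum.\<close>
lemma reflected_prod:
 assumes s: "0 < s" "s < tip"
 shows "(\<Prod>k\<le>n. norm (arm s + psi0 (cis (theta n k)))) =
  sqrt (\<Prod>k\<le>n. norm (psi0 (cis (theta n k))^2 - of_real (rsq s))) * exp (\<Sum>k\<in>mirrored n. Eng (rho s) (rho (thu n k)))"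
proof -
 define S where "S = rho s"
 have S: "S > 0" unfolding S_def using s tip_bounds by (intro rho_pos) auto
 define P where "P = rsq s"
 have PS: "P = S^2" unfolding P_def S_def using rho_sq[of s] s tip_bounds by auto
 define g where "g = (%t. norm (arm s + psi0 (cis t)))"
 define q where "q = (%t. norm (psi0 (cis t)^2 - of_real P))"
 have pair: "g t * g (-t) = sqrt (q t * q (-t)) * exp (Eng S (rho t))" if t: "0 <= t" "t <= pi" for t
 proof -
  define r where "r = rho t"
  have r: "r \<ge> 0" unfolding r_def using t by (rule rho_nonneg)
  have g1: "g t = S + r"
   unfolding g_def psi0_arm[OF t] arm_def S_def r_def using r S
   by (simp add: norm_mult S_def r_def flip: distrib_right of_real_add)
  have g2: "g (-t) = sqrt (S^2 + r^2)"
  proof -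
   have "arm s + cnj (arm t) = cis (3*pi/4) * Complex (rho s) (rho t)"
    unfolding complex_eq_iff arm_def by (simp add: cos_135 sin_135; simp add: algebra_simps)
   thus ?thesis unfolding g_def psi0_arm[OF t] by (simp add: norm_mult complex_norm S_def r_def)
  qed
  have sq: "norm (\<i> * of_real x - complex_of_real P) = sqrt (x^2 + P^2)" for x by (simp add: cmod_def)
  have r2: "rsq t = r^2" unfolding r_def using rho_sq[OF t] by simp
  have q1: "q t = sqrt (S^4 + r^4)"
   unfolding q_def psi0_arm[OF t] using arm_sq[OF t] sq[of "- rsq t"] by (simp add: r2 PS add.commute flip: power_mult)
  have c: "cnj (arm t) ^ 2 = \<i> * of_real (rsq t)"
  proof -
   have "cnj (arm t) ^ 2 = cnj (arm t ^ 2)" by simp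
   also have "... = \<i> * of_real (rsq t)" unfolding arm_sq[OF t] by simp
   finally show ?thesis .
  qed
  have q2: "q (-t) = sqrt (S^4 + r^4)"
   unfolding q_def psi0_arm[OF t] c using sq[of "rsq t"] by (simp add: r2 PS add.commute flip: power_mult)
  have p: "S + r > 0" "S^2 + r^2 > 0" "S^4 + r^4 > 0" using S r by (auto intro!: add_pos_nonneg)
  have "exp (Eng S r) = exp (ln (S + r)) * exp (ln (sqrt (S^2+r^2))) / exp (ln (sqrt (S^4+r^4)))"
   unfolding Eng_def exp_add[symmetric] exp_diff[symmetric] using p by (simp add: ln_sqrt)
  also have "... = (S + r) * sqrt (S^2 + r^2) / sqrt (S^4 + r^4)" using p by simp
  finally show ?thesis unfolding g1 g2 q1 q2 using p by (simp add: r_def[symmetric])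
 qed
 have g0: "g 0 = S" "q 0 = S^2" using S by (auto simp: g_def q_def psi0_def PS arm_def norm_mult S_def norm_power)
 have gprod: "(\<Prod>k\<le>n. g (theta n k)) = (if even n then S else 1) * (\<Prod>k\<in>mirrored n. g (thu n k) * g (- thu n k))"
  unfolding prod_theta_split[where g = g] prod_upper_split[where n = n and g = "%k. g (thu n k)"]
  by (simp add: prod.distrib theta_upper_0 g0)
 have qprod: "(\<Prod>k\<le>n. q (theta n k)) = (if even n then S^2 else 1) * (\<Prod>k\<in>mirrored n. q (thu n k) * q (- thu n k))"
  unfolding prod_theta_split[where g = q] prod_upper_split[where n = n and g = "%k. q (thu n k)"]
  by (simp add: prod.distrib theta_upper_0 g0)
 have rng: "0 <= thu n k" "thu n k <= pi" if "k \<in> mirrored n" for k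
  using theta_upper_range(1,2)[of k n] that pi_ge_zero by (auto intro: order_trans)
 have "(\<Prod>k\<in>mirrored n. g (thu n k) * g (- thu n k)) =
   (\<Prod>k\<in>mirrored n. sqrt (q (thu n k) * q (- thu n k)) * exp (Eng S (rho (thu n k))))"
  by (intro prod.cong refl pair rng)
 also have "... = sqrt (\<Prod>k\<in>mirrored n. q (thu n k) * q (- thu n k)) * exp (\<Sum>k\<in>mirrored n. Eng S (rho (thu n k)))"
  unfolding sqrt_prod exp_sum[OF finite_atLeastAtMost] prod.distrib[symmetric] ..
 finally have "(\<Prod>k\<le>n. g (theta n k)) = sqrt (\<Prod>k\<le>n. q (theta n k)) * exp (\<Sum>k\<in>mirrored n. Eng S (rho (thu n k)))"
  unfolding gprod qprod using S by (simp add: real_sqrt_mult)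
 thus ?thesis by (simp add: g_def q_def S_def P_def)
qed

lemma bernoulli_inverse: fixes c :: real assumes "0 <= c" shows "1 / (1 + c) ^ m <= 1 / (1 + real m * c)"
proof -
 have "1 + real m * c <= (1 + c) ^ m" using Bernoulli_inequality[of c m] assms by simp
 thus ?thesis using assms by (intro divide_left_mono) (auto intro!: mult_pos_pos add_pos_nonneg)
qed

text \<open>The product over \<open>psi0 w - arm s\<close> times the product over \<open>psi0 w +
  arm s\<close> is the quartic evaluated at the lattice, hence a product of four factors
  \<open>root^N - sign\<close>. The two roots on the circle give the \<open>DD\<close> factors;
  the powers of \<open>norm v\<close> cancel against the equilibrium integral, and what remains is
  close to 1 once \<open>(n + 1) * s\<close> is not small.\<close>
lemma node_prod_formula:
 assumes s: "0 < s" "s < tip"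
 obtains X X1 X2 X3 E :: real where
  "node_prod n s = 4 * DD n s * DD n (K s) * X^2 / (sqrt (X1 * X2) * X3 * exp E)" "abs (E) <= 5 * ln 2"
  "0 <= X" "X <= 2" "even n ==> X <= 2 * (NN n * s)" 
  "1 - 1 / (1 + NN n * s / 20) <= X"
  "X1 <= 2" "1 - 1 / (1 + NN n * s / 4) <= X1" "odd n ==> 1 <= X1"
  "1 <= X2" "X2 <= 2" "X3 <= 2" "(1 - 1 / (1 + NN n * s / 4)) / 2 <= X3"
  "odd n ==> 2 - 6 * (NN n * s) <= X3"
proof -
 obtain v where v: "\<And>w. (w - 1)^3 * (w + 1) - arm s ^ 2 * w^2 = (w - cis s) * (w - cis (K s)) * (w - v) * (w - 1 / cnj v)"
  "1 + s/20 <= norm v" "norm (1 - 1/v) <= 2 * s" "chi (1/v) + arm s * (1/v) = 0"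
  using quartic_factor[OF s] by blast
 obtain u1 u2 :: real and u where u: "1 + s/4 <= u1" "u2 < -1" "norm u ^ 2 = 1 / (u1 * abs (u2))" "norm (u - 1) <= 6 * s"
  "\<And>w. (w - 1)^3 * (w + 1) - of_real (rsq s) * w^2 = (w - of_real u1) * (w - of_real u2) * (w - u) * (w - cnj u)"
  using real_quartic_factor[OF s] by blast
 define N where "N = n + 1"
 have rN: "real n + 1 = real N" by (simp add: N_def)
 have v1: "1 < norm v" using v(2) s by linarith
 have v0: "v ~= 0" using v1 by auto
 have u1: "1 < u1" using u(1) s by linarith
 have uu: "1 < u1 * abs (u2)" using mult_strict_mono[of 1 u1 1 "abs (u2)"] u1 u(2) by auto
 have nu: "norm u < 1"
 proof -
  have "norm u ^ 2 < 1 ^ 2" unfolding u(3) using uu by (simp add: divide_less_eq)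
  thus ?thesis by (rule power_less_imp_less_base) simp
 qed
 define c where "c = ln (norm v) - ln (u1 * abs (u2)) / 2"
 have Int: "integral {0..pi} (%t. Eng (rho s) (rho t)) = 2 * pi * c"
  unfolding c_def by (rule integral_unique[OF equilibrium[OF s v(1) v1 v(4) u1 u(2) nu u(5)]])
 have S: "rho s > 0" using s tip_bounds by (intro rho_pos) auto
 define En where "En = (\<Sum>k\<in>mirrored n. Eng (rho s) (rho (thu n k)))"
 define E where "E = En - real N * c"
 have E: "abs (E) <= 5 * ln 2" unfolding E_def En_def rN[symmetric] by (rule energy_lattice[OF S Int])
 define Y where "Y = (\<Prod>k\<le>n. norm (arm s + psi0 (cis (theta n k))))"
 define Z where "Z = (\<Prod>k\<le>n. norm (psi0 (cis (theta n k))^2 - of_real (rsq s)))"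
 have YZ: "Y = sqrt Z * exp En" unfolding Y_def Z_def En_def by (rule reflected_prod[OF s])
 have one: "norm (psi0 (cis t)^2 - a) = norm ((cis t - 1)^3 * (cis t + 1) - a * cis t ^ 2)" for t a
 proof -
  have "psi0 (cis t)^2 - a = ((cis t - 1)^3 * (cis t + 1) - a * cis t ^ 2) / cis t ^ 2"
   using psi0_sq[of "cis t"] by (simp add: diff_divide_distrib)
  thus ?thesis by (simp add: norm_divide norm_power)
 qed
 define X where "X = norm (1 - sgnN n * inverse v ^ N)"
 define X1 where "X1 = norm (1 - sgnN n * inverse (of_real u1) ^ N)"
 define X2 where "X2 = norm (1 - sgnN n * inverse (of_real u2) ^ N)"
 define X3 where "X3 = norm (u ^ N - sgnN n)"
 have cnjsg: "cnj (sgnN n) = sgnN n" by (simp add: sgnN_def)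
 have X3': "norm (cnj u ^ N - sgnN n) = X3"
 proof -
  have "cnj u ^ N - sgnN n = cnj (u ^ N - sgnN n)" by (simp add: cnjsg)
  thus ?thesis unfolding X3_def by (simp only: complex_mod_cnj)
 qed
 have X': "norm ((1 / cnj v) ^ N - sgnN n) = X"
 proof -
  have "(1 / cnj v) ^ N - sgnN n = - sgnN n * cnj (1 - sgnN n * inverse v ^ N)"
   by (simp add: cnjsg divide_inverse) (simp add: sgnN_def algebra_simps)
  hence "norm ((1 / cnj v) ^ N - sgnN n) = norm (sgnN n) * norm (cnj (1 - sgnN n * inverse v ^ N))"
   by (simp only: norm_mult norm_minus_cancel)
  thus ?thesis unfolding X_def by (simp only: complex_mod_cnj norm_sgnN mult_1)
 qed
 have WY: "node_prod n s * Y = 4 * DD n s * DD n (K s) * (X * norm v ^ N) * X"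
 proof -
  have "node_prod n s * Y = (\<Prod>k\<le>n. norm (psi0 (cis (theta n k))^2 - arm s ^ 2))"
   unfolding node_prod_def Y_def prod.distrib[symmetric] norm_mult[symmetric]
   by (intro prod.cong refl, subst norm_minus_commute) (simp add: power2_eq_square algebra_simps)
  also have "... = (\<Prod>k\<le>n. norm (cis (theta n k) - cis s) * norm (cis (theta n k) - cis (K s)) * norm (cis (theta n k) - v) * norm (cis (theta n k) - 1 / cnj v))"
   unfolding one v(1) norm_mult ..
  also have "... = norm (cis s ^ N - sgnN n) * norm (cis (K s) ^ N - sgnN n) * norm (v ^ N - sgnN n) * norm ((1 / cnj v) ^ N - sgnN n)"
   unfolding prod.distrib norm_theta_prod N_def ..
  also have "norm (v ^ N - sgnN n) = X * norm v ^ N" unfolding X_def N_def norm_sgnN_power[OF v0] ..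
  also note X'
  also have "norm (cis s ^ N - sgnN n) = 2 * DD n s" unfolding N_def by (rule norm_cis_pow)
  also have "norm (cis (K s) ^ N - sgnN n) = 2 * DD n (K s)" unfolding N_def by (rule norm_cis_pow)
  finally show ?thesis by simp
 qed
 have Zf: "Z = (X1 * u1 ^ N) * (X2 * abs (u2) ^ N) * (X3 * X3)"
 proof -
  have "Z = (\<Prod>k\<le>n. norm (cis (theta n k) - of_real u1) * norm (cis (theta n k) - of_real u2) * norm (cis (theta n k) - u) * norm (cis (theta n k) - cnj u))"
   unfolding Z_def one u(5) norm_mult ..
  also have "... = norm (of_real u1 ^ N - sgnN n) * norm (of_real u2 ^ N - sgnN n) * norm (u ^ N - sgnN n) * norm (cnj u ^ N - sgnN n)"
   unfolding prod.distrib norm_theta_prod N_def ..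
  also have "norm (of_real u1 ^ N - sgnN n) = X1 * u1 ^ N"
   using norm_sgnN_power[of "of_real u1" n] u1 by (simp add: X1_def N_def)
  also have "norm (of_real u2 ^ N - sgnN n) = X2 * abs (u2) ^ N"
   using norm_sgnN_power[of "of_real u2" n] u(2) by (simp add: X2_def N_def)
  finally show ?thesis unfolding X3' by (simp add: X3_def)
 qed
 have small: "norm (sgnN n * inverse x ^ N) <= 1" if "1 <= norm x" for x
  using that by (simp add: norm_mult norm_power norm_inverse power_le_one inverse_le_1_iff)
 have le2: "norm (1 - sgnN n * inverse x ^ N) <= 2" if "1 <= norm x" for x
  using norm_triangle_ineq4[of 1 "sgnN n * inverse x ^ N"] small[OF that] by simp
 have X0: "0 <= X" and Xle: "X <= 2" using le2[of v] v1 by (auto simp: X_def)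
 have X1le: "X1 <= 2" using le2[of "of_real u1"] u1 by (auto simp: X1_def)
 have X2le: "X2 <= 2" using le2[of "of_real u2"] u(2) by (auto simp: X2_def)
 have X3le: "X3 <= 2"
 proof -
  have "norm u ^ N <= 1" using nu by (intro power_le_one) auto
  thus ?thesis unfolding X3_def using norm_triangle_ineq4[of "u ^ N" "sgnN n"] by (simp add: norm_power)
 qed
 have Xeven: "X <= 2 * (NN n * s)" if "even n"
 proof -
  have "norm (1 ^ N - inverse v ^ N) <= real N * norm (1 - inverse v)"
   by (rule norm_power_diff) (use v1 in \<open>auto simp: norm_inverse inverse_le_1_iff\<close>)
  also have "... <= real N * (2 * s)" using v(3) by (intro mult_left_mono) (auto simp: divide_inverse)
  finally show ?thesis using that unfolding X_def rN by (simp add: sgnN_def mult_ac)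
 qed
 have low: "1 - 1 / norm x ^ N <= norm (1 - sgnN n * inverse x ^ N)" for x
  using norm_triangle_ineq2[of 1 "sgnN n * inverse x ^ N"] by (simp add: norm_mult norm_power norm_divide power_divide inverse_eq_divide)
 have pw: "1 / y ^ N <= 1 / (1 + real N * d)" if "1 + d <= y" "0 <= d" for y d :: real
 proof -
  have "1 / y ^ N <= 1 / (1 + d) ^ N" using that by (intro divide_left_mono power_mono mult_pos_pos zero_less_power) auto
  thus ?thesis using bernoulli_inverse[of d N] that by linarith
 qed
 have Xlow: "1 - 1 / (1 + NN n * s / 20) <= X"
  using low[of v] pw[of "s/20" "norm v"] v(2) s unfolding X_def rN by simp
 have X1low: "1 - 1 / (1 + NN n * s / 4) <= X1"
  using low[of "of_real u1"] pw[of "s/4" u1] u(1) u1 s unfolding X1_def rN by simp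
 have X1odd: "1 <= X1" if "odd n"
 proof -
  have "1 - sgnN n * inverse (complex_of_real u1) ^ N = of_real (1 + inverse u1 ^ N)" using that by (simp add: sgnN_def)
  hence "X1 = abs (1 + inverse u1 ^ N)" unfolding X1_def by (simp only: norm_of_real)
  thus ?thesis using u1 by simp
 qed
 have X2low: "1 <= X2"
 proof (cases "even n")
  case True
  have "1 - sgnN n * inverse (complex_of_real u2) ^ N = of_real (1 - inverse u2 ^ N)" using True by (simp add: sgnN_def)
  hence "X2 = abs (1 - inverse u2 ^ N)" unfolding X2_def by (simp only: norm_of_real)
  moreover have "inverse u2 ^ N < 0" using u(2) True unfolding power_less_zero_eq by (simp add: N_def)
  ultimately show ?thesis by linarith
 next
  case False
  have "1 - sgnN n * inverse (complex_of_real u2) ^ N = of_real (1 + inverse u2 ^ N)" using False by (simp add: sgnN_def)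
  hence "X2 = abs (1 + inverse u2 ^ N)" unfolding X2_def by (simp only: norm_of_real)
  moreover have "even N" using False by (simp add: N_def)
  hence "inverse u2 ^ N \<ge> 0" by (rule zero_le_even_power)
  ultimately show ?thesis by simp
 qed
 have X3low: "(1 - 1 / (1 + NN n * s / 4)) / 2 <= X3"
 proof -
  define r where "r = norm u ^ N"
  have r: "0 <= r" "r <= 1" unfolding r_def using nu by (auto intro: power_le_one)
  have "r^2 = (1 / (u1 * abs (u2))) ^ N" unfolding r_def u(3)[symmetric] by (simp add: power_mult[symmetric] mult.commute)
  also have "... <= (1 / u1) ^ N"
  proof (rule power_mono)
   have "u1 * 1 <= u1 * abs (u2)" using u1 u(2) by (intro mult_left_mono) auto
   thus "1 / (u1 * abs (u2)) <= 1 / u1" using u1 by (intro frac_le) auto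
   show "0 <= 1 / (u1 * abs (u2))" using uu by simp
  qed
  also have "... = 1 / u1 ^ N" by (simp add: power_divide)
  also have "... <= 1 / (1 + real N * (s/4))" by (rule pw) (use u(1) s in auto)
  finally have "1 - 1 / (1 + real N * s / 4) <= 1 - r^2" by simp
  also have "... = (1 - r) * (1 + r)" by (simp add: power2_eq_square algebra_simps)
  also have "... <= (1 - r) * 2" using r by (intro mult_left_mono) auto
  finally have "(1 - 1 / (1 + NN n * s / 4)) / 2 <= 1 - r" unfolding rN by simp
  also have "... <= X3" unfolding X3_def r_def using norm_triangle_ineq2[of "sgnN n" "u ^ N"] by (simp add: norm_power norm_minus_commute)
  finally show ?thesis .
 qed
 have X3odd: "2 - 6 * (NN n * s) <= X3" if "odd n"
 proof -
  have "norm (u ^ N - 1 ^ N) <= real N * norm (u - 1)" by (rule norm_power_diff) (use nu in auto)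
  also have "... <= real N * (6 * s)" using u(4) by (intro mult_left_mono) auto
  finally have "norm (u ^ N - 1) <= real N * (6 * s)" by simp
  moreover have "2 <= norm (u ^ N + 1) + norm (u ^ N - 1)"
   using norm_triangle_ineq4[of "u ^ N + 1" "u ^ N - 1"] by simp
  ultimately show ?thesis using that unfolding X3_def rN by (simp add: sgnN_def)
 qed
 have posX1: "0 < X1" 
 proof -
  have "1 / (1 + NN n * s / 4) < 1" using s by (simp add: divide_less_eq add_pos_pos)
  thus ?thesis using X1low by linarith
 qed
 have posX3: "0 < X3"
 proof -
  have "1 / (1 + NN n * s / 4) < 1" using s by (simp add: divide_less_eq add_pos_pos)
  hence "0 < (1 - 1 / (1 + NN n * s / 4)) / 2" by simp
  thus ?thesis using X3low by (rule less_le_trans)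
 qed
 have Yf: "Y = sqrt (X1 * X2) * X3 * exp E * norm v ^ N"
 proof -
  have pos: "u1 * abs (u2) > 0" using uu by linarith
  have "exp (real N * c) = exp (real N * ln (norm v)) / exp (real N * ln (u1 * abs (u2)) / 2)"
   unfolding c_def exp_diff[symmetric] by (simp add: right_diff_distrib)
  also have "exp (real N * ln (norm v)) = norm v ^ N" using v0 by (simp add: exp_of_nat_mult)
  also have "exp (real N * ln (u1 * abs (u2)) / 2) = sqrt ((u1 * abs (u2)) ^ N)"
  proof (rule real_sqrt_unique[symmetric])
   have "(exp (real N * ln (u1 * abs (u2)) / 2))^2 = exp (real N * ln (u1 * abs (u2)))"
    unfolding power2_eq_square exp_add[symmetric] by simp
   thus "(exp (real N * ln (u1 * abs (u2)) / 2))^2 = (u1 * abs (u2)) ^ N" using pos by (simp add: exp_of_nat_mult)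
  qed simp
  finally have ec: "exp (real N * c) = norm v ^ N / sqrt ((u1 * abs (u2)) ^ N)" .
  have "Z = (X1 * X2) * ((u1 * abs (u2)) ^ N) * X3^2" unfolding Zf by (simp add: power_mult_distrib power2_eq_square)
  hence sz: "sqrt Z = sqrt (X1 * X2) * sqrt ((u1 * abs (u2)) ^ N) * X3" using posX3 by (simp add: real_sqrt_mult)
  have "exp En = exp E * exp (real N * c)" by (simp add: E_def exp_add[symmetric])
  hence En': "exp En = exp E * (norm v ^ N / sqrt ((u1 * abs (u2)) ^ N))" unfolding ec .
  have "A * q * x * (e * (w / q)) = A * x * e * w" if "q > 0" for A q x e w :: real using that by simp
  moreover have "sqrt ((u1 * abs (u2)) ^ N) > 0" using pos by simp
  ultimately show ?thesis unfolding YZ sz En' by blast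
 qed
 have "node_prod n s = 4 * DD n s * DD n (K s) * X^2 / (sqrt (X1 * X2) * X3 * exp E)"
 proof -
  have q: "sqrt (X1 * X2) * X3 * exp E > 0" using posX1 X2low posX3 by simp
  have "norm v ^ N > 0" using v0 by simp
  moreover have "node_prod n s * (sqrt (X1 * X2) * X3 * exp E) * norm v ^ N = 4 * DD n s * DD n (K s) * X^2 * norm v ^ N"
   using WY unfolding Yf by (simp add: power2_eq_square mult_ac)
  ultimately have "node_prod n s * (sqrt (X1 * X2) * X3 * exp E) = 4 * DD n s * DD n (K s) * X^2"
   using v0 by simp
  thus ?thesis using q by (metis less_irrefl nonzero_mult_div_cancel_right)
 qed
 from this E X0 Xle Xeven Xlow X1le X1low X1odd X2low X2le X3le X3low X3odd
 show ?thesis by (rule that)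
qed

lemma exp_5ln2: "abs (E) <= 5 * ln 2 ==> exp E <= 32" "abs (E) <= 5 * ln 2 ==> 1/32 <= exp (E::real)"
proof -
 have e: "exp (5 * ln 2) = (32::real)"
 proof -
  have "5 * ln 2 = ln ((2::real)^5)" unfolding ln_realpow by simp
  thus ?thesis by simp
 qed
 show "abs (E) <= 5 * ln 2 ==> exp E <= 32" unfolding e[symmetric] by simp
 assume "abs (E) <= 5 * ln 2"
 hence "exp (- (5 * ln 2)) <= exp E" by simp
 thus "1/32 <= exp E" unfolding exp_minus e by simp
qed

lemma node_prod_lower:
 assumes s: "0 < s" "s < tip" and far: "1 <= NN n * s"
 shows "DD n s * DD n (K s) / 14112 <= node_prod n s"
proof -
 obtain X X1 X2 X3 E :: real where f:
  "node_prod n s = 4 * DD n s * DD n (K s) * X^2 / (sqrt (X1 * X2) * X3 * exp E)" "abs (E) <= 5 * ln 2"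
  "0 <= X" "1 - 1 / (1 + NN n * s / 20) <= X"
  "X1 <= 2" "1 - 1 / (1 + NN n * s / 4) <= X1" "1 <= X2" "X2 <= 2" "X3 <= 2" "(1 - 1 / (1 + NN n * s / 4)) / 2 <= X3"
  using node_prod_formula[OF s, of n] by metis
 have "1 / (1 + NN n * s / 20) <= 1 / (1 + 1/20)" using far by (intro divide_left_mono mult_pos_pos) auto
 hence X: "1/21 <= X" using f(4) by simp
 have "1 / (1 + NN n * s / 4) < 1" using far by (simp add: divide_less_eq)
 hence "0 < 1 - 1 / (1 + NN n * s / 4)" "0 < (1 - 1 / (1 + NN n * s / 4)) / 2" by simp_all
 hence p: "0 < X1" "0 < X3" using f(6,10) by (blast intro: less_le_trans)+
 have "sqrt (X1 * X2) <= sqrt (2 * 2)" using f p by (intro real_sqrt_le_mono mult_mono) auto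
 hence sq: "sqrt (X1 * X2) <= 2" by simp
 have "sqrt (X1 * X2) * X3 * exp E <= 2 * 2 * 32" using sq f p exp_5ln2[OF f(2)] by (intro mult_mono) auto
 hence d: "sqrt (X1 * X2) * X3 * exp E <= 128" by simp
 have d0: "0 < sqrt (X1 * X2) * X3 * exp E" using p f by simp
 have "(1/21)^2 <= X^2" using X by (intro power_mono) auto
 hence "4 * DD n s * DD n (K s) * (1/21)^2 / 128 <= 4 * DD n s * DD n (K s) * X^2 / (sqrt (X1 * X2) * X3 * exp E)"
  using DD_bounds d d0 by (intro frac_le mult_left_mono mult_nonneg_nonneg) auto
 thus ?thesis unfolding f(1) by (simp add: power2_eq_square)
qed

text \<open>For even \<open>n\<close> and small \<open>(n + 1) * s\<close> the denominators
  degenerate, but then \<open>X\<close> does so as well.\<close>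
lemma node_prod_upper:
 assumes s: "0 < s" "s < tip"
 shows "node_prod n s <= 25600 * (DD n s * DD n (K s))"
proof -
 define x where "x = NN n * s"
 have x: "x > 0" using s by (simp add: x_def)
 obtain X X1 X2 X3 E :: real where f:
  "node_prod n s = 4 * DD n s * DD n (K s) * X^2 / (sqrt (X1 * X2) * X3 * exp E)" "abs (E) <= 5 * ln 2"
  "0 <= X" "X <= 2" "even n ==> X <= 2 * x" 
  "1 - 1 / (1 + x / 4) <= X1" "odd n ==> 1 <= X1"
  "1 <= X2" "(1 - 1 / (1 + x / 4)) / 2 <= X3" "odd n ==> 2 - 6 * x <= X3"
  using node_prod_formula[OF s, of n, folded x_def] by metis
 define q where "q = 1 - 1 / (1 + x / 4)"
 have q: "q = x / (4 + x)" using x by (simp add: q_def field_simps)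
 have q01: "0 < q" "q <= 1" unfolding q using x by (auto simp: divide_le_eq)
 have X1q: "q <= X1" and X3q: "q / 2 <= X3" using f by (auto simp: q_def)
 have X4: "X^2 <= 4" using power_mono[OF f(4) f(3), of 2] by simp
 have p: "0 < X1" "0 < X3" "0 < X2" using X1q X3q q01 f(8) by linarith+
 have key: "X^2 <= 200 * (sqrt (X1 * X2) * X3)"
 proof (cases "even n")
  case True
  have "q * q <= X1 * X2" using X1q f(8) q01 p by (intro mult_mono) auto
  hence "sqrt (q * q) <= sqrt (X1 * X2)" by (rule real_sqrt_le_mono)
  hence "q <= sqrt (X1 * X2)" using q01 by simp
  hence "q * (q / 2) <= sqrt (X1 * X2) * X3" using X3q q01 p by (intro mult_mono) auto
  moreover have "X^2 <= 100 * (q * q)"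
  proof (cases "x <= 1")
   case True
   have "x / 5 <= q" unfolding q using True x by (intro divide_left_mono) auto
   hence "(x/5) * (x/5) <= q * q" using x by (intro mult_mono) auto
   moreover have "X^2 <= (2 * x)^2" using f(3,5) \<open>even n\<close> by (intro power_mono) auto
   ultimately show ?thesis by (simp add: power2_eq_square)
  next
   case False
   hence "1/5 <= q" unfolding q using x by (simp add: field_simps)
   hence "(1/5) * (1/5) <= q * q" by (intro mult_mono) auto
   thus ?thesis using X4 by simp
  qed
  ultimately show ?thesis by simp
 next
  case False
  have "1 * 1 <= X1 * X2" using f(7,8) False by (intro mult_mono) auto
  hence s1: "1 <= sqrt (X1 * X2)" by simp
  have "1/50 <= X3"
  proof (cases "x <= 1/6")
   case True
   have "2 - 6 * x <= X3" using f(10) False by auto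
   thus ?thesis using True by linarith
  next
   case False
   hence "1/25 <= q" unfolding q using x by (simp add: field_simps)
   thus ?thesis using X3q by simp
  qed
  hence "1 * (1/50) <= sqrt (X1 * X2) * X3" using s1 p by (intro mult_mono) auto
  thus ?thesis using X4 by simp
 qed
 define B where "B = sqrt (X1 * X2) * X3"
 have B: "B > 0" using p by (simp add: B_def)
 have e: "1/32 <= exp E" by (rule exp_5ln2[OF f(2)])
 have "B * (1/32) <= B * exp E" using B e by (intro mult_left_mono) auto
 hence "X^2 / (B * exp E) <= (200 * B) / (B * (1/32))" using key B by (intro frac_le) (auto simp: B_def)
 also have "... = 6400" using B by simp
 finally have r: "X^2 / (B * exp E) <= 6400" .
 have "node_prod n s = 4 * (DD n s * DD n (K s)) * (X^2 / (B * exp E))" unfolding f(1) B_def by simp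
 also have "... <= 4 * (DD n s * DD n (K s)) * 6400" using r DD_bounds by (intro mult_left_mono mult_nonneg_nonneg) auto
 finally show ?thesis by simp
qed

section \<open>The adjusted angles\<close>

definition inner_node :: "nat => nat => bool" where "inner_node n k \<longleftrightarrow> k <= n div 2 \<and> thu n k <= tip"
definition outer_node :: "nat => nat => bool" where "outer_node n k \<longleftrightarrow> k <= n div 2 \<and> tip < thu n k"

text \<open>All unadjusted nodes of the upper arm are recorded by their inner angle, the outer
  ones after folding.\<close>
definition raw :: "nat => nat => real" where
 "raw n k = (if inner_node n k then thu n k else J (thu n k))"

text \<open>The adjustment moves exactly the pairs of an inner and a folded outer node closer than
  \<open>gap n\<close>; each is moved away from the other, to the distance \<open>gap n\<close>
  from the old position of its partner, so that the pair is spread symmetrically.\<close>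
definition matched :: "nat => nat => nat => bool" where
 "matched n j k \<longleftrightarrow> inner_node n j \<and> outer_node n k \<and> \<bar>raw n j - raw n k\<bar> < gap n"

definition side :: "nat => nat => nat => real" where
 "side n j k = (if raw n k <= raw n j then 1 else -1)"

lemma gap_pos: "gap n > 0" by (simp add: gap_def)

lemma gap_N: "gap n * NN n = tip"
proof -
 have "2 * pi / (3 * x) * x = 2 * pi / 3" if "x ~= 0" for x :: real using that by simp
 from this[of "real n + 1"] show ?thesis unfolding gap_def tip_def by linarith
qed

lemma gap_pi: "pi / NN n = 3/2 * gap n"
proof -
 have "pi / x = 3/2 * (2 * pi / (3 * x))" for x :: real by simp
 from this[of "real n + 1"] show ?thesis unfolding gap_def .
qed

lemma theta_upper_diff: "thu n k - thu n j = 3 * gap n * (real k - real j)"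
proof -
 have "(2 * real k + c) * pi / x - (2 * real j + c) * pi / x = 3 * (2 * pi / (3 * x)) * (real k - real j)" for x c :: real
  by (simp add: diff_divide_distrib[symmetric] algebra_simps)
 from this[of 0 "real n + 1"] this[of 1 "real n + 1"] show ?thesis unfolding gap_def theta_upper_def by simp
qed

lemma theta_lower_neg: assumes "n div 2 < k" "k <= n" shows "theta n k < 0"
proof -
 have "lo_idx n <= 2 * (n div 2) + 1 - k" "2 * (n div 2) + 1 - k <= n div 2" using assms by (auto simp: lo_idx_def)
 from theta_upper_range(3)[OF this(2) this(1)] have "0 < thu n (2 * (n div 2) + 1 - k)"
  by (rule less_le_trans[rotated]) simp
 thus ?thesis using assms by (simp add: theta_def)
qed

lemma theta_upper_less_pi: "k <= n div 2 ==> thu n k < pi"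
 using theta_upper_range(2)[of k n] gap_pos[of n] unfolding gap_pi by linarith

lemma inner_idx_iff: "k \<in> inner_idx n \<longleftrightarrow> inner_node n k"
proof (cases "k <= n div 2")
 case True
 have "k <= n" using True by linarith
 thus ?thesis using True theta_upper_range(1)[OF True] by (simp add: inner_idx_def inner_node_def theta_def tip_def)
next
 case False
 thus ?thesis using theta_lower_neg[of n k] by (auto simp: inner_idx_def inner_node_def)
qed

lemma outer_idx_iff: "k \<in> outer_idx n \<longleftrightarrow> outer_node n k"
proof (cases "k <= n div 2")
 case True
 have "k <= n" using True by linarith
 thus ?thesis using True theta_upper_less_pi[OF True] by (simp add: outer_idx_def outer_node_def theta_def tip_def)
next
 case False
 thus ?thesis using theta_lower_neg[of n k] tip_bounds by (auto simp: outer_idx_def outer_node_def tip_def)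
qed

lemma inner_or_outer: "k <= n div 2 ==> inner_node n k \<or> outer_node n k" by (auto simp: inner_node_def outer_node_def)
lemma not_inner_outer: "inner_node n k ==> outer_node n k ==> False" by (auto simp: inner_node_def outer_node_def)

lemma raw_inner: "inner_node n k ==> raw n k = thu n k" by (simp add: raw_def)
lemma raw_outer: "outer_node n k ==> raw n k = J (thu n k)" by (auto simp: raw_def dest: not_inner_outer)

lemma outer_facts: assumes "outer_node n k"
 shows "0 <= raw n k" "raw n k <= tip" "K (raw n k) = thu n k" "3/2 * gap n <= raw n k" "raw n k < tip"
proof -
 have t: "tip < thu n k" "thu n k <= pi - 3/2 * gap n"
  using assms theta_upper_range(2)[of k n] unfolding gap_pi by (auto simp: outer_node_def)
 hence t': "tip <= thu n k" "thu n k <= pi" using gap_pos[of n] by auto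
 show r: "0 <= raw n k" "raw n k <= tip" "K (raw n k) = thu n k"
  unfolding raw_outer[OF assms] using J[OF t'] by auto
 have "abs (K (raw n k) - K 0) <= abs (raw n k - 0)" using r tip_bounds by (intro K_diff(1)) auto
 thus "3/2 * gap n <= raw n k" using t r by simp
 show "raw n k < tip" using r t by (cases "raw n k = tip") auto
qed

lemma raw_range: assumes "k <= n div 2" shows "0 <= raw n k" "raw n k <= tip"
 using inner_or_outer[OF assms] outer_facts(1,2)[of n k] theta_upper_range(1)[OF assms] by (auto simp: raw_def inner_node_def)

lemma rho_raw: assumes "k <= n div 2" shows "rho (raw n k) = rho (thu n k)"
proof (cases "inner_node n k")
 case False
 hence o: "outer_node n k" using inner_or_outer[OF assms] by auto
 show ?thesis using rho_K[of "raw n k"] outer_facts[OF o] by simp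
qed (simp add: raw_def)

lemma raw_inner_sep: assumes "inner_node n j" "inner_node n k" "j ~= k" shows "3 * gap n <= abs (raw n j - raw n k)"
proof -
 have "1 <= abs (real j - real k)" using assms(3) by linarith
 hence "3 * gap n * 1 <= 3 * gap n * abs (real j - real k)" using gap_pos[of n] by (intro mult_left_mono) auto
 thus ?thesis using assms theta_upper_diff[of n j k] gap_pos[of n] by (simp add: raw_inner abs_mult)
qed

lemma raw_outer_sep: assumes "outer_node n j" "outer_node n k" "j ~= k" shows "3 * gap n <= abs (raw n j - raw n k)"
proof -
 have "1 <= abs (real j - real k)" using assms(3) by linarith
 hence "3 * gap n * 1 <= 3 * gap n * abs (real j - real k)" using gap_pos[of n] by (intro mult_left_mono) auto
 hence "3 * gap n <= abs (K (raw n j) - K (raw n k))"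
  unfolding outer_facts(3)[OF assms(1)] outer_facts(3)[OF assms(2)] using theta_upper_diff[of n j k] gap_pos[of n] by (simp add: abs_mult)
 also have "... <= abs (raw n j - raw n k)"
  using outer_facts[OF assms(1)] outer_facts[OF assms(2)] by (intro K_diff(1)) auto
 finally show ?thesis .
qed

lemma matched_unique: "matched n j k ==> matched n j k' ==> k = k'"  "matched n j k ==> matched n j' k ==> j = j'"
proof -
 show "matched n j k ==> matched n j k' ==> k = k'"
  using raw_outer_sep[of n k k'] gap_pos[of n] unfolding matched_def by linarith
 show "matched n j k ==> matched n j' k ==> j = j'"
  using raw_inner_sep[of n j j'] gap_pos[of n] unfolding matched_def by linarith
qed

lemma adjusted_unmatched:
 assumes "inner_node n j" "\<And>k. \<not> matched n j k" shows "adj n j = raw n j"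
proof -
 have "\<forall>k\<in>outer_idx n. \<bar>theta n j - J (theta n k)\<bar> \<ge> gap n"
 proof
  fix k assume "k \<in> outer_idx n"
  hence o: "outer_node n k" by (simp add: outer_idx_iff)
  have "theta n k = thu n k" "theta n j = thu n j" using o assms(1) by (auto simp: theta_def outer_node_def inner_node_def)
  thus "abs (theta n j - J (theta n k)) \<ge> gap n" using assms(2)[of k] o assms(1) by (simp add: matched_def raw_inner raw_outer)
 qed
 moreover have "theta n j = raw n j" using assms(1) by (auto simp: raw_inner theta_def inner_node_def)
 ultimately show ?thesis using assms(1) by (simp add: adjusted_upper_def inner_idx_iff adjusted_inner_def)
qed

lemma adjusted_unmatched_outer:
 assumes "outer_node n k" "\<And>j. \<not> matched n j k" shows "adj n k = raw n k"
proof -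
 have "\<forall>j\<in>inner_idx n. \<bar>theta n j - J (theta n k)\<bar> \<ge> gap n"
 proof
  fix j assume "j \<in> inner_idx n"
  hence o: "inner_node n j" by (simp add: inner_idx_iff)
  have "theta n k = thu n k" "theta n j = thu n j" using o assms(1) by (auto simp: theta_def outer_node_def inner_node_def)
  thus "abs (theta n j - J (theta n k)) \<ge> gap n" using assms(2)[of j] o assms(1) by (simp add: matched_def raw_inner raw_outer)
 qed
 moreover have "J (theta n k) = raw n k" using assms(1) by (auto simp: raw_outer theta_def outer_node_def)
 moreover have "k \<notin> inner_idx n" using assms(1) not_inner_outer by (auto simp: inner_idx_iff)
 ultimately show ?thesis by (simp add: adjusted_upper_def adjusted_outer_def)
qed

lemma theta_eq_raw: "inner_node n j ==> theta n j = raw n j" "outer_node n k ==> J (theta n k) = raw n k"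
 by (auto simp: raw_inner raw_outer theta_def inner_node_def outer_node_def)

lemma adjusted_matched:
 assumes m: "matched n j k"
 shows "adj n j = raw n k + side n j k * gap n" "adj n k = raw n j - side n j k * gap n"
proof -
 have ij: "inner_node n j" and ok: "outer_node n k" and d: "abs (raw n j - raw n k) < gap n" using m by (auto simp: matched_def)
 have ji: "j \<in> inner_idx n" "k \<notin> inner_idx n" "k \<in> outer_idx n" using ij ok not_inner_outer by (auto simp: inner_idx_iff outer_idx_iff)
 have ne: "\<not> (\<forall>k\<in>outer_idx n. \<bar>theta n j - J (theta n k)\<bar> \<ge> gap n)" "\<not> (\<forall>j\<in>inner_idx n. \<bar>theta n j - J (theta n k)\<bar> \<ge> gap n)"
 proof -
  have "abs (theta n j - J (theta n k)) < gap n" using d ij ok by (simp add: theta_eq_raw)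
  thus "\<not> (\<forall>k\<in>outer_idx n. \<bar>theta n j - J (theta n k)\<bar> \<ge> gap n)" "\<not> (\<forall>j\<in>inner_idx n. \<bar>theta n j - J (theta n k)\<bar> \<ge> gap n)"
   using ji by (meson not_le)+
 qed
 define below where "below = (%k. k \<in> outer_idx n \<and> theta n j - gap n < J (theta n k) \<and> J (theta n k) <= theta n j)"
 define above where "above = (%k. k \<in> outer_idx n \<and> theta n j < J (theta n k) \<and> J (theta n k) < theta n j + gap n)"
 define below' where "below' = (%j. j \<in> inner_idx n \<and> theta n j - gap n < J (theta n k) \<and> J (theta n k) <= theta n j)"
 define above' where "above' = (%j. j \<in> inner_idx n \<and> theta n j < J (theta n k) \<and> J (theta n k) < theta n j + gap n)"
 have b: "below k' \<longleftrightarrow> k' = k \<and> raw n k <= raw n j" for k'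
 proof
  assume "below k'"
  hence "matched n j k'" "raw n k' <= raw n j" using ij gap_pos[of n] unfolding below_def matched_def outer_idx_iff by (auto simp: theta_eq_raw)
  thus "k' = k \<and> raw n k <= raw n j" using matched_unique(1)[OF m] by auto
 qed (use d ij ok in \<open>auto simp: below_def outer_idx_iff theta_eq_raw\<close>)
 have a: "above k' \<longleftrightarrow> k' = k \<and> raw n j < raw n k" for k'
 proof
  assume "above k'"
  hence "matched n j k'" "raw n j < raw n k'" using ij gap_pos[of n] unfolding above_def matched_def outer_idx_iff by (auto simp: theta_eq_raw)
  thus "k' = k \<and> raw n j < raw n k" using matched_unique(1)[OF m] by auto
 qed (use d ij ok in \<open>auto simp: above_def outer_idx_iff theta_eq_raw\<close>)
 have b': "below' j' \<longleftrightarrow> j' = j \<and> raw n k <= raw n j" for j'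
 proof
  assume "below' j'"
  hence "matched n j' k" "raw n k <= raw n j'" using ok gap_pos[of n] unfolding below'_def matched_def inner_idx_iff by (auto simp: theta_eq_raw)
  thus "j' = j \<and> raw n k <= raw n j" using matched_unique(2)[OF m] by auto
 qed (use d ij ok in \<open>auto simp: below'_def inner_idx_iff theta_eq_raw\<close>)
 have a': "above' j' \<longleftrightarrow> j' = j \<and> raw n j < raw n k" for j'
 proof
  assume "above' j'"
  hence "matched n j' k" "raw n j' < raw n k" using ok gap_pos[of n] unfolding above'_def matched_def inner_idx_iff by (auto simp: theta_eq_raw)
  thus "j' = j \<and> raw n j < raw n k" using matched_unique(2)[OF m] by auto
 qed (use d ij ok in \<open>auto simp: above'_def inner_idx_iff theta_eq_raw\<close>)
 have i: "adj n j = (if \<exists>k. below k then J (theta n (SOME k. below k)) + gap n else J (theta n (SOME k. above k)) - gap n)"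
  unfolding adjusted_upper_def adjusted_inner_def Let_def below_def above_def using ji(1) ne(1) by (simp only: if_True if_False)
 have o: "adj n k = (if \<exists>j. below' j then theta n (SOME j. below' j) - gap n else theta n (SOME j. above' j) + gap n)"
  unfolding adjusted_upper_def adjusted_outer_def Let_def below'_def above'_def using ji(2) ne(2) by (simp only: if_True if_False)
 show "adj n j = raw n k + side n j k * gap n" "adj n k = raw n j - side n j k * gap n"
  unfolding i o b a b' a' side_def by (auto simp: theta_eq_raw ij ok)
qed

lemma side_abs: "abs (side n j k) = 1" "side n j k = 1 \<or> side n j k = -1" "side n j k * (raw n j - raw n k) = abs (raw n j - raw n k)"
 by (auto simp: side_def)

lemma matched_tip: assumes "matched n j k"
 shows "3/2 * gap n <= raw n j" "3/2 * gap n <= raw n k" "raw n j <= tip - gap n" "raw n k <= tip - gap n"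
  "adj n j <= tip - gap n / 2" "adj n k <= tip - gap n / 2"
  "gap n / 2 <= adj n j" "gap n / 2 <= adj n k"
proof -
 have ij: "inner_node n j" and ok: "outer_node n k" and d: "abs (raw n j - raw n k) < gap n" using assms by (auto simp: matched_def)
 have g: "gap n > 0" by (rule gap_pos)
 show k: "3/2 * gap n <= raw n k" using outer_facts[OF ok] by auto
 show j: "3/2 * gap n <= raw n j"
 proof (cases "lo_idx n <= j")
  case True
  thus ?thesis using theta_upper_range(3)[of j n] ij by (simp add: gap_pi raw_inner inner_node_def)
 next
  case False
  hence "even n" "j = 0" by (auto simp: lo_idx split: if_splits)
  hence "raw n j = 0" using ij by (simp add: raw_inner theta_upper_0)
  thus ?thesis using d k g by simp
 qed
 have "abs (K (raw n k) - K tip) <= abs (raw n k - tip)" using outer_facts[OF ok] tip_bounds by (intro K_diff(1)) auto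
 hence kb: "thu n k - tip <= tip - raw n k" using outer_facts[OF ok] by simp
 have jk: "thu n j < thu n k" using ij ok by (auto simp: inner_node_def outer_node_def)
 hence "0 < 3 * gap n * (real k - real j)" using theta_upper_diff[of n k j] by linarith
 hence "0 < real k - real j" using g by (simp add: zero_less_mult_iff)
 hence "j < k" by simp
 hence "1 <= real k - real j" by linarith
 hence "3 * gap n * 1 <= 3 * gap n * (real k - real j)" using g by (intro mult_left_mono) auto
 hence sep: "3 * gap n <= thu n k - raw n j" using theta_upper_diff[of n k j] ij by (simp add: raw_inner)
 show "raw n j <= tip - gap n" "raw n k <= tip - gap n" using sep kb d by linarith+
 note am = adjusted_matched[OF assms]
 have "side n j k = 1 \<or> side n j k = -1" by (rule side_abs)
 moreover have "side n j k = 1 ==> raw n k <= raw n j" "side n j k = -1 ==> raw n j < raw n k"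
  by (auto simp: side_def split: if_splits)
 ultimately show "adj n j <= tip - gap n / 2" "adj n k <= tip - gap n / 2"
  "gap n / 2 <= adj n j" "gap n / 2 <= adj n k"
  unfolding am using sep kb d j k g by auto
qed

lemma matched_close: assumes "matched n j k"
 shows "abs (adj n j - raw n j) <= gap n" "abs (adj n k - raw n k) <= gap n"
  "abs (adj n j - raw n k) = gap n" "abs (adj n k - raw n j) = gap n"
  "adj n j ~= raw n j" "adj n k ~= raw n k"
  "gap n <= abs (adj n j - adj n k)"
proof -
 note am = adjusted_matched[OF assms]
 have d: "abs (raw n j - raw n k) < gap n" using assms by (auto simp: matched_def)
 have g: "gap n > 0" by (rule gap_pos)
 have "side n j k = 1 \<or> side n j k = -1" by (rule side_abs)
 moreover have "side n j k = 1 ==> raw n k <= raw n j" "side n j k = -1 ==> raw n j < raw n k"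
  by (auto simp: side_def split: if_splits)
 ultimately show "abs (adj n j - raw n j) <= gap n" "abs (adj n k - raw n k) <= gap n"
  "abs (adj n j - raw n k) = gap n" "abs (adj n k - raw n j) = gap n"
  "adj n j ~= raw n j" "adj n k ~= raw n k"
  "gap n <= abs (adj n j - adj n k)"
  unfolding am using d g by auto
qed

definition free :: "nat => nat => bool" where
 "free n k \<longleftrightarrow> (\<forall>j. \<not> matched n j k \<and> \<not> matched n k j)"

lemma adjusted_free: "k <= n div 2 ==> free n k ==> adj n k = raw n k"
 using inner_or_outer[of k n] adjusted_unmatched[of n k] adjusted_unmatched_outer[of n k] by (auto simp: free_def)

lemma not_free: assumes "\<not> free n k" obtains j where "matched n j k" | j where "matched n k j"
 using assms by (auto simp: free_def)

lemma adjusted_raw_close: assumes "k <= n div 2" shows "abs (adj n k - raw n k) <= gap n"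
proof (cases "free n k")
 case True
 thus ?thesis using adjusted_free[OF assms True] gap_pos[of n] by simp
next
 case False
 thus ?thesis by (rule not_free) (auto dest: matched_close)
qed

text \<open>In a pair the two moves add up. Nodes of different pairs stay apart because inner
  nodes, and likewise folded outer nodes, are \<open>3 * gap n\<close> apart.\<close>
lemma adjusted_sep_inner_outer: assumes "inner_node n j" "outer_node n k" shows "gap n <= abs (adj n j - adj n k)"
proof (cases "matched n j k")
 case True
 thus ?thesis by (rule matched_close)
next
 case nm: False
 have jl: "j <= n div 2" and kl: "k <= n div 2" using assms by (auto simp: inner_node_def outer_node_def)
 have g: "gap n > 0" by (rule gap_pos)
 show ?thesis
 proof (cases "\<exists>k'. matched n j k'")
  case True
  then obtain k' where k': "matched n j k'" by auto
  have "k' ~= k" using k' nm by auto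
  hence "3 * gap n <= abs (raw n k' - raw n k)" using k' assms(2) by (intro raw_outer_sep) (auto simp: matched_def)
  moreover have "abs (adj n j - raw n k') = gap n" by (rule matched_close(3)[OF k'])
  moreover have "abs (adj n k - raw n k) <= gap n" by (rule adjusted_raw_close[OF kl])
  ultimately show ?thesis by linarith
 next
  case False
  hence fj: "adj n j = raw n j" using assms(1) by (intro adjusted_unmatched) auto
  show ?thesis
  proof (cases "\<exists>j'. matched n j' k")
   case True
   then obtain j' where j': "matched n j' k" by auto
   have "j' ~= j" using j' nm by auto
   hence "3 * gap n <= abs (raw n j' - raw n j)" using j' assms(1) by (intro raw_inner_sep) (auto simp: matched_def)
   moreover have "abs (adj n k - raw n j') = gap n" by (rule matched_close(4)[OF j'])
   ultimately show ?thesis unfolding fj using g by linarith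
  next
   case False
   hence fk: "adj n k = raw n k" using assms(2) by (intro adjusted_unmatched_outer) auto
   show ?thesis using nm assms unfolding fj fk by (simp add: matched_def)
  qed
 qed
qed

lemma adjusted_sep: assumes "i <= n div 2" "k <= n div 2" "i ~= k"
 shows "gap n <= abs (adj n i - adj n k)"
proof -
 have c: "abs (adj n i - raw n i) <= gap n" "abs (adj n k - raw n k) <= gap n"
  using assms by (auto intro: adjusted_raw_close)
 consider "inner_node n i" "inner_node n k" | "outer_node n i" "outer_node n k" | "inner_node n i" "outer_node n k" | "outer_node n i" "inner_node n k"
  using inner_or_outer assms by blast
 thus ?thesis
 proof cases
  case 1
  thus ?thesis using raw_inner_sep[OF 1 assms(3)] c by linarith
 next
  case 2
  thus ?thesis using raw_outer_sep[OF 2 assms(3)] c by linarith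
 next
  case 3
  thus ?thesis by (rule adjusted_sep_inner_outer)
 next
  case 4
  thus ?thesis using adjusted_sep_inner_outer[OF 4(2,1)] by (simp add: abs_minus_commute)
 qed
qed

lemma adjusted_range: assumes "k <= n div 2"
 shows "0 <= adj n k" "adj n k <= tip" "lo_idx n <= k ==> gap n / 2 <= adj n k"
proof -
 have g: "gap n > 0" by (rule gap_pos)
 have "0 <= adj n k \<and> adj n k <= tip \<and> (lo_idx n <= k --> gap n / 2 <= adj n k)"
 proof (cases "free n k")
  case True
  have r: "gap n / 2 <= raw n k" if "lo_idx n <= k"
   using inner_or_outer[OF assms] theta_upper_range(3)[OF assms that] outer_facts(4)[of n k] g
   unfolding gap_pi by (auto simp: raw_inner)
  show ?thesis unfolding adjusted_free[OF assms True] using raw_range[OF assms] r by auto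
 next
  case False
  thus ?thesis
  proof (rule not_free)
   fix j assume "matched n j k"
   from matched_tip(6,8)[OF this] show ?thesis using g by linarith
  next
   fix j assume "matched n k j"
   from matched_tip(5,7)[OF this] show ?thesis using g by linarith
  qed
 qed
 thus "0 <= adj n k" "adj n k <= tip" "lo_idx n <= k ==> gap n / 2 <= adj n k" by auto
qed

lemma adjusted_0: assumes "even n" shows "adj n 0 = 0" "free n 0" "inner_node n 0"
proof -
 show i: "inner_node n 0" using assms tip_bounds by (simp add: inner_node_def theta_upper_0)
 have r: "raw n 0 = 0" using i assms by (simp add: raw_inner theta_upper_0)
 show f: "free n 0"
 proof (rule ccontr)
  assume "\<not> free n 0"
  thus False by (rule not_free) (use matched_tip(1,2)[of n] r gap_pos[of n] in force)+
 qed
 show "adj n 0 = 0" using adjusted_free[OF _ f] r by simp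
qed

lemma adjusted_fejer_upper: "k <= n div 2 ==> fej n k = arm (adj n k)"
 using psi0_arm(1)[of "adj n k"] adjusted_range[of k n] tip_bounds
 by (simp add: adjusted_fejer_def adjusted_theta_def)

lemma adjusted_fejer_lower: assumes "k <= n div 2" "lo_idx n <= k"
 shows "fej n (2 * (n div 2) + 1 - k) = cnj (arm (adj n k))"
proof -
 have "\<not> 2 * (n div 2) + 1 - k <= n div 2" "2 * (n div 2) + 1 - (2 * (n div 2) + 1 - k) = k" using assms by auto
 thus ?thesis using psi0_arm(2)[of "adj n k"] adjusted_range[OF assms(1)] tip_bounds
  by (simp only: adjusted_fejer_def adjusted_theta_def if_False)
qed

lemma lower_index: assumes "n div 2 < k" "k <= n"
 obtains i where "i <= n div 2" "lo_idx n <= i" "k = 2 * (n div 2) + 1 - i"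
 by (rule that[of "2 * (n div 2) + 1 - k"]) (use assms in \<open>auto simp: lo_idx_def\<close>)

lemma arm_inj: "x \<in> {0..tip} ==> y \<in> {0..tip} ==> arm x = arm y ==> x = y"
 using rho_inj[of x y] by (auto simp: arm_def)

lemma arm_ne_cnj: assumes "0 < x" "x <= tip" shows "arm y ~= cnj (arm x)"
proof
 assume "arm y = cnj (arm x)"
 hence "sqrt (rho y ^ 2 + rho x ^ 2) = 0" using norm_arm_cnj_diff[of y x] by simp
 hence "rho x = 0" by (simp add: sum_power2_eq_zero_iff)
 thus False using rho_pos[of x] assms tip_bounds by auto
qed

lemma adjusted_fejer_inj: "inj_on (fej n) {..n}"
proof -
 have g: "gap n > 0" by (rule gap_pos)
 have eq: "i = k" if "i <= n div 2" "k <= n div 2" "adj n i = adj n k" for i k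
  using adjusted_sep[OF that(1,2)] that(3) g by force
 have up: "i = k" if "i <= n div 2" "k <= n div 2" "arm (adj n i) = arm (adj n k)" for i k
  using arm_inj[OF _ _ that(3)] adjusted_range that by (intro eq) auto
 have ul: "arm (adj n i) ~= cnj (arm (adj n k))" if "k <= n div 2" "lo_idx n <= k" for i k
  using adjusted_range[OF that(1)] that(2) g by (intro arm_ne_cnj) auto
 show ?thesis
 proof (rule inj_onI)
  fix a b assume a: "a \<in> {..n}" and b: "b \<in> {..n}" and e: "fej n a = fej n b"
  show "a = b"
  proof (cases "a <= n div 2"; cases "b <= n div 2")
   assume ab: "a <= n div 2" "b <= n div 2"
   thus ?thesis using e up by (simp add: adjusted_fejer_upper)
  next
   assume ab: "a <= n div 2" "\<not> b <= n div 2"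
   then obtain i where i: "i <= n div 2" "lo_idx n <= i" "b = 2 * (n div 2) + 1 - i" using lower_index[of n b] b by auto
   show ?thesis using e ul[OF i(1,2), of a] adjusted_fejer_upper[OF ab(1)] adjusted_fejer_lower[OF i(1,2)] unfolding i(3) by simp
  next
   assume ab: "\<not> a <= n div 2" "b <= n div 2"
   then obtain i where i: "i <= n div 2" "lo_idx n <= i" "a = 2 * (n div 2) + 1 - i" using lower_index[of n a] a by auto
   show ?thesis using e ul[OF i(1,2), of b] adjusted_fejer_upper[OF ab(2)] adjusted_fejer_lower[OF i(1,2)] unfolding i(3) by simp
  next
   assume ab: "\<not> a <= n div 2" "\<not> b <= n div 2"
   obtain i where i: "i <= n div 2" "lo_idx n <= i" "a = 2 * (n div 2) + 1 - i" using lower_index[of n a] a ab by auto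
   obtain k where k: "k <= n div 2" "lo_idx n <= k" "b = 2 * (n div 2) + 1 - k" using lower_index[of n b] b ab by auto
   have "cnj (arm (adj n i)) = cnj (arm (adj n k))"
    using e adjusted_fejer_lower[OF i(1,2)] adjusted_fejer_lower[OF k(1,2)] unfolding i(3) k(3) by simp
   hence "i = k" using i k by (intro up) auto
   thus ?thesis using i k by simp
  qed
 qed
qed

lemma adjusted_fejer_subset: "fej n ` {..n} \<subseteq> gamma0"
proof
 fix z assume "z \<in> fej n ` {..n}"
 then obtain a where a: "a <= n" "z = fej n a" by auto
 show "z \<in> gamma0"
 proof (cases "a <= n div 2")
  case True
  thus ?thesis using a adjusted_range[OF True] by (simp add: adjusted_fejer_upper gamma0_arm)
 next
  case False
  then obtain i where i: "i <= n div 2" "lo_idx n <= i" "a = 2 * (n div 2) + 1 - i" using lower_index[of n a] a by auto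
  have "z = cnj (arm (adj n i))" using a(2) adjusted_fejer_lower[OF i(1,2)] unfolding i(3) by simp
  thus ?thesis using adjusted_range[OF i(1)] by (simp add: gamma0_arm)
 qed
qed

section \<open>Concavity of the logarithmic kernel\<close>

text \<open>The logarithmic derivative of \<open>rsq\<close>.\<close>
definition qq :: "real => real" where "qq x = (3 * ycot x - 1 / ycot x) / 2"

lemma qq_drsq: assumes "0 < x" "x < pi" shows "drsq x = qq x * rsq x"
 using drsq_ycot[OF assms] by (simp add: qq_def)

lemma rho_deriv: assumes "0 < x" "x < pi" shows "(rho has_real_derivative (qq x * rho x / 2)) (at x)"
proof -
 have p: "rsq x > 0" by (rule rsq_pos[OF assms])
 have "((%x. sqrt (rsq x)) has_real_derivative (inverse (sqrt (rsq x)) / 2 * drsq x)) (at x)"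
  by (rule DERIV_chain2[OF DERIV_real_sqrt[OF p] rsq_deriv])
 moreover have "inverse (sqrt (rsq x)) / 2 * drsq x = qq x * sqrt (rsq x) / 2"
 proof -
  have "drsq x = qq x * (sqrt (rsq x) * sqrt (rsq x))" using qq_drsq[OF assms] p by simp
  moreover have "inverse r / 2 * (c * (r * r)) = c * r / 2" if "r > 0" for r c :: real using that by simp
  moreover have "sqrt (rsq x) > 0" using p by simp
  ultimately show ?thesis by metis
 qed
 ultimately show ?thesis unfolding rho_def[abs_def] by simp
qed

lemma ycot_pos: "0 < x ==> x < pi ==> 0 < ycot x" using rsq_ycot(2) by blast

lemma ycot_ge: assumes "0 < x" "x <= tip" shows "1 / sqrt 3 <= ycot x"
 using ycot_antimono[of x tip] assms tip_bounds by (cases "x = tip") (auto simp: ycot_tip)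

lemma qq_antimono: assumes "0 < x" "x <= y" "y <= tip" shows "qq y <= qq x"
proof (cases "x = y")
 case False
 have "ycot y < ycot x" using False assms tip_bounds by (intro ycot_antimono) auto
 moreover have "0 < ycot y" using assms tip_bounds by (intro ycot_pos) auto
 ultimately have "1 / ycot x <= 1 / ycot y" "ycot y <= ycot x" by (auto intro: divide_left_mono)
 thus ?thesis by (simp add: qq_def)
qed simp

lemma qq_nonneg: assumes "0 < x" "x <= tip" shows "0 <= qq x"
proof -
 have y: "0 < ycot x" using assms tip_bounds by (intro ycot_pos) auto
 have "(1 / sqrt 3)^2 <= (ycot x)^2" using ycot_ge[OF assms] by (intro power_mono) auto
 hence "1 <= 3 * (ycot x)^2" by (simp add: power_divide)
 hence "1 / ycot x <= 3 * ycot x" using y by (simp add: field_simps power2_eq_square)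
 thus ?thesis by (simp add: qq_def)
qed

lemma qq_upper: assumes "0 < x" "x <= tip" shows "qq x <= 3 / x"
proof -
 have "qq x <= 3/2 * ycot x" using ycot_pos[of x] assms tip_bounds by (simp add: qq_def)
 also have "... <= 3/2 * (2/x)" using ycot_bounds(2)[OF assms] by (intro mult_left_mono) auto
 finally show ?thesis by simp
qed

text \<open>The derivative of \<open>ln (abs (rho s - rho x))\<close> with respect to
  \<open>x\<close>.\<close>
definition lgd :: "real => real => real" where "lgd s x = (qq x / 2) * (rho x / (rho x - rho s))"

lemma lgd_antimono_right: assumes "0 <= s" "s < x" "x <= y" "y <= tip" shows "lgd s y <= lgd s x" "0 <= lgd s y"
proof -
 have r: "rho s < rho x" "rho x <= rho y" "0 <= rho s"
  using rho_strict_mono[of s x] rho_mono[of x y] rho_nonneg[of s] assms tip_bounds by auto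
 have e: "rho z / (rho z - rho s) = 1 + rho s / (rho z - rho s)" if "rho s < rho z" for z
  using that by (simp add: field_simps)
 have "rho s / (rho y - rho s) <= rho s / (rho x - rho s)"
  using r by (intro divide_left_mono mult_pos_pos) auto
 hence "rho y / (rho y - rho s) <= rho x / (rho x - rho s)" using e r by simp
 moreover have "qq y <= qq x" "0 <= qq y" using qq_antimono[of x y] qq_nonneg[of y] assms by auto
 moreover have "0 <= rho y / (rho y - rho s)" using r by simp
 ultimately have a: "rho y / (rho y - rho s) <= rho x / (rho x - rho s)" "qq y / 2 <= qq x / 2" "0 <= qq x / 2" "0 <= qq y / 2" "0 <= rho y / (rho y - rho s)"
  by auto
 show "lgd s y <= lgd s x" unfolding lgd_def by (rule mult_mono[OF a(2,1,3,5)])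
 show "0 <= lgd s y" unfolding lgd_def by (rule mult_nonneg_nonneg[OF a(4,5)])
qed

lemma ycot_deriv: assumes "0 < x" "x < pi" shows "(ycot has_real_derivative (- (1 + ycot x ^ 2) / 2)) (at x)"
proof -
 have s: "sin (x/2) ~= 0" using sin_gt_zero[of "x/2"] assms by auto
 have "((%x. cot (x/2)) has_real_derivative (- inverse ((sin (x/2))\<^sup>2) * (1/2))) (at x)"
  by (rule DERIV_chain2[where f = cot and g = "%x. x/2", OF DERIV_cot[OF s]]) (auto intro!: derivative_eq_intros)
 moreover have "1 + ycot x ^ 2 = inverse (sin (x/2) ^ 2)"
  using s by (simp add: ycot_def cot_def power_divide field_simps)
 ultimately show ?thesis unfolding ycot_def[abs_def] by (simp add: ycot_def)
qed

lemma octic: fixes w :: real assumes "1 <= w" shows "14 * w^4 + 3 <= w^8 + 8 * w^5 + 8 * w"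
proof -
 define e where "e = w - 1"
 have e: "e \<ge> 0" "w = 1 + e" using assms by (auto simp: e_def)
 have "w^8 + 8 * w^5 + 8 * w - (14 * w^4 + 3) = e^2 * (24 + 80 * e + 96 * e^2 + 64 * e^3 + 28 * e^4 + 8 * e^5 + e^6)"
  unfolding e(2) by (simp add: eval_nat_numeral algebra_simps)
 moreover have "0 <= e^2 * (24 + 80 * e + 96 * e^2 + 64 * e^3 + 28 * e^4 + 8 * e^5 + e^6)" using e by simp
 ultimately show ?thesis by linarith
qed

text \<open>The concavity to the left of \<open>s\<close> is worst when \<open>s\<close> is the
  tip. In the variable \<open>w = sqrt (sqrt 3 * ycot x)\<close> that case becomes a polynomial
  inequality with a double root at 1.\<close>
lemma rho_defect: assumes x: "0 < x" "x <= tip"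
 defines "Y \<equiv> ycot x ^ 2"
 shows "2 * (3 * Y + 1) * (1 + Y) * (1 - rho x / rho tip) <= (3 * Y - 1)^2"
proof -
 define y where "y = ycot x"
 have y: "0 < y" "1/sqrt 3 <= y" unfolding y_def using ycot_pos[of x] ycot_ge[OF x] x tip_bounds by auto
 define w where "w = sqrt (sqrt 3 * y)"
 have w2: "w^2 = sqrt 3 * y" using y by (simp add: w_def)
 have w0: "0 <= w" by (simp add: w_def y less_imp_le)
 have "1 <= sqrt 3 * y" using y(2) by (simp add: divide_le_eq mult.commute)
 hence w1: "1 <= w" by (simp add: w_def)
 have w4: "w^4 = 3 * Y"
 proof -
  have "w^4 = (w^2)^2" by simp
  also have "... = 3 * y^2" unfolding w2 by (simp add: power_mult_distrib)
  finally show ?thesis by (simp add: Y_def y_def)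
 qed
 have Y0: "Y \<ge> 0" "1 + Y > 0" by (auto simp: Y_def add_pos_nonneg)
 have M: "rho tip > 0" "rho tip ^ 2 = 3 * sqrt 3"
  using rho_pos[of tip] rho_sq[of tip] tip_bounds by (auto simp: rsq_tip)
 have R: "rho x / rho tip = 4 * w / (3 * (1 + Y))"
 proof (rule power2_eq_imp_eq)
  have "rho x ^ 2 = 16 * y / (1 + Y)^2"
   using rho_sq[of x] rsq_ycot(1)[of x] x tip_bounds by (auto simp: Y_def y_def)
  hence "(rho x / rho tip)^2 = 16 * y / (1 + Y)^2 / (3 * sqrt 3)" using M by (simp add: power_divide)
  also have "... = (16 / (9 * (1 + Y)^2)) * (sqrt 3 * y)"
  proof -
   have "16 * y / A / (3 * t) = (16 / (9 * A)) * (t * y)" if "t * t = 3" "t > 0" "A > 0" for t A :: real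
   proof -
    have "(16 / (9 * A)) * (t * y) = 16 * y * (t * t) / (9 * A * t)" using that by (simp add: field_simps)
    also have "... = 16 * y / A / (3 * t)" unfolding that(1) using that by (simp add: field_simps)
    finally show ?thesis by simp
   qed
   from this[of "sqrt 3" "(1 + Y)^2"] show ?thesis using Y0 by simp
  qed
  also have "... = (4 * w / (3 * (1 + Y)))^2"
  proof -
   have "(16 / (9 * b^2)) * w^2 = (4 * w / (3 * b))^2" for b :: real by (simp add: power_divide power_mult_distrib)
   from this[of "1 + Y"] show ?thesis unfolding w2 .
  qed
  finally show "(rho x / rho tip)^2 = (4 * w / (3 * (1 + Y)))^2" .
  show "0 <= rho x / rho tip" using rho_nonneg[of x] M x tip_bounds by simp
 qed (use w0 Y0 in simp)
 have "2 * (3 * Y + 1) * (1 + Y) * (rho x / rho tip) = 8/3 * (w * (w^4 + 1))"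
 proof -
  have "2 * (a + 1) * b * (4 * w / (3 * b)) = 8/3 * (w * (a + 1))" if "b > 0" for a b :: real
   using that by (simp add: field_simps)
  from this[OF Y0(2)] show ?thesis unfolding R w4 .
 qed
 moreover have "14 * w^4 + 3 <= (w^4)^2 + 8 * (w * (w^4 + 1))"
 proof -
  have "(w^4)^2 = w^8" "w * (w^4 + 1) = w^5 + w" by (simp_all add: eval_nat_numeral algebra_simps)
  thus ?thesis using octic[OF w1] by simp
 qed
 hence "14 * (3 * Y) + 3 <= (3 * Y)^2 + 8 * (w * (w^4 + 1))" unfolding w4 .
 moreover have "2 * (3 * Y + 1) * (1 + Y) * (1 - rho x / rho tip) = 2 * (3 * Y + 1) * (1 + Y) - 2 * (3 * Y + 1) * (1 + Y) * (rho x / rho tip)"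
  by (simp add: right_diff_distrib)
 moreover have "2 * (3 * Y + 1) * (1 + Y) = 6 * Y^2 + 8 * Y + 2" "(3 * Y - 1)^2 = 9 * Y^2 - 6 * Y + 1" "(3*Y)^2 = 9 * Y^2"
  by (simp_all add: power2_eq_square algebra_simps)
 ultimately show ?thesis by linarith
qed

text \<open>To the right of \<open>s\<close> both factors of \<open>lgd s\<close> decrease. To the
  left they compete, and the sign of the derivative is decided by
  \<open>rho_defect\<close>.\<close>
lemma lgd_antimono_left: assumes s: "s <= tip" and xy: "0 < x" "x <= y" "y < s" shows "lgd s y <= lgd s x" "lgd s x <= 0"
proof -
 define S where "S = rho s"
 have rS: "rho z < S" if "0 <= z" "z < s" for z unfolding S_def using that s by (intro rho_strict_mono) auto
 have S0: "0 < S" unfolding S_def using s xy tip_bounds by (intro rho_pos) auto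
 have SM: "S <= rho tip" unfolding S_def using s xy by (intro rho_mono) auto
 define g where "g = (%z. (qq z / 2) * (rho z / (S - rho z)))"
 have "g x <= g y"
 proof (rule DERIV_nonneg_imp_nondecreasing[OF xy(2)])
  fix z assume z: "x <= z" "z <= y"
  have z': "0 < z" "z < s" "z < pi" "z <= tip" using z xy s tip_bounds by auto
  define Y where "Y = ycot z ^ 2"
  define c where "c = ycot z"
  have c0: "c > 0" unfolding c_def using z' by (intro ycot_pos) auto
  define q' where "q' = (3 + 1 / c^2) / 2 * (- (1 + c^2) / 2)"
  have dq: "(qq has_real_derivative q') (at z)"
  proof -
   have "((%x. (3 * ycot x - 1 / ycot x) / 2) has_real_derivative
     (3 * (- (1 + c^2) / 2) - (0 * ycot z - 1 * (- (1 + c^2) / 2)) / (ycot z * ycot z)) / 2) (at z)"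
    using ycot_deriv[of z] z' c0 unfolding c_def
    by (intro DERIV_cdivide DERIV_diff DERIV_cmult DERIV_divide DERIV_const) auto
   moreover have "(3 * (- (1 + c^2) / 2) - (0 * ycot z - 1 * (- (1 + c^2) / 2)) / (ycot z * ycot z)) / 2 = q'"
   proof -
    have "(3 * D - (0 * c - 1 * D) / (c * c)) / 2 = (3 + 1 / c^2) / 2 * D" for D :: real
     by (simp add: power2_eq_square distrib_right add_divide_distrib)
    from this[of "- (1 + c^2) / 2"] show ?thesis unfolding q'_def c_def .
   qed
   ultimately show ?thesis unfolding qq_def[abs_def] by simp
  qed
  have dr: "(rho has_real_derivative (qq z * rho z / 2)) (at z)" using z' by (intro rho_deriv) auto
  have Sr: "0 < S - rho z" using rS[of z] z' by simp
  have r0: "0 < rho z" using z' by (intro rho_pos) auto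
  have dS: "((%z. S - rho z) has_real_derivative (0 - qq z * rho z / 2)) (at z)"
   by (intro DERIV_diff DERIV_const dr)
  have dd: "((%z. rho z / (S - rho z)) has_real_derivative ((qq z * rho z / 2) * (S - rho z) - rho z * (0 - qq z * rho z / 2)) / ((S - rho z) * (S - rho z))) (at z)"
   by (rule DERIV_divide[OF dr dS]) (use Sr in simp)
  have "(g has_real_derivative (q'/2 * (rho z / (S - rho z)) + ((qq z * rho z / 2) * (S - rho z) - rho z * (0 - qq z * rho z / 2)) / ((S - rho z) * (S - rho z)) * (qq z / 2))) (at z)"
   unfolding g_def by (rule DERIV_mult[OF DERIV_cdivide[OF dq] dd])
  moreover have "q'/2 * (rho z / (S - rho z)) + ((qq z * rho z / 2) * (S - rho z) - rho z * (0 - qq z * rho z / 2)) / ((S - rho z) * (S - rho z)) * (qq z / 2) \<ge> 0"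
  proof -
   have f: "a/2 * (r / D) + ((q * r / 2) * D - r * (0 - q * r / 2)) / (D * D) * (q / 2) = r / (2 * (D * D)) * (a * D + q^2 / 2 * (D + r))"
    if "D > 0" for a r D q :: real using that by (simp add: field_simps power2_eq_square)
   have k: "- q' * (S - rho z) <= qq z ^ 2 / 2 * S"
   proof -
    have "rho z / rho tip <= rho z / S" using SM S0 r0 by (intro divide_left_mono) auto
    hence "1 - rho z / S <= 1 - rho z / rho tip" by simp
    hence "2 * (3 * Y + 1) * (1 + Y) * (1 - rho z / S) <= 2 * (3 * Y + 1) * (1 + Y) * (1 - rho z / rho tip)"
     by (intro mult_left_mono) (auto simp: Y_def)
    also have "... <= (3 * Y - 1)^2" unfolding Y_def by (rule rho_defect[OF z'(1) z'(4)])
    finally have a: "2 * (3 * Y + 1) * (1 + Y) * (1 - rho z / S) <= (3 * Y - 1)^2" .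
    have Yc: "Y = c^2" by (simp add: Y_def c_def)
    have q1: "- q' = (3 * Y + 1) * (1 + Y) / (4 * Y)" unfolding q'_def Yc using c0 by (simp add: field_simps)
    have q2: "qq z ^ 2 / 2 = (3 * Y - 1)^2 / (8 * Y)"
    proof -
     have "qq z = (3 * c^2 - 1) / (2 * c)" unfolding qq_def c_def[symmetric] using c0 by (simp add: field_simps power2_eq_square)
     thus ?thesis unfolding Yc by (simp add: power_divide power_mult_distrib)
    qed
    have "(2 * (3 * Y + 1) * (1 + Y) * (1 - rho z / S)) * (S / (8 * Y)) <= (3 * Y - 1)^2 * (S / (8 * Y))"
     using a S0 Yc c0 by (intro mult_right_mono) auto
    moreover have "(2 * (3 * Y + 1) * (1 + Y) * (1 - rho z / S)) * (S / (8 * Y)) = - q' * (S - rho z)"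
    proof -
     have "(2 * A * B * (1 - r / S)) * (S / (8 * Y)) = A * B / (4 * Y) * (S - r)" for A B r :: real
     proof -
      have "(1 - r / S) * S = S - r" using S0 by (simp add: field_simps)
      moreover have "(2 * A * B * (1 - r / S)) * (S / (8 * Y)) = A * B / (4 * Y) * ((1 - r / S) * S)" by simp
      ultimately show ?thesis by metis
     qed
     thus ?thesis unfolding q1 .
    qed
    ultimately show ?thesis unfolding q2 by simp
   qed
   have "0 <= q' * (S - rho z) + qq z ^ 2 / 2 * ((S - rho z) + rho z)" using k by simp
   thus ?thesis unfolding f[OF Sr] using Sr r0 by (intro mult_nonneg_nonneg) auto
  qed
  ultimately show "\<exists>d. (g has_real_derivative d) (at z) \<and> 0 <= d" by blast
 qed
 moreover have "lgd s z = - g z" for z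
 proof -
  have "a / (r - S) = - (a / (S - r))" for a r :: real by (metis minus_diff_eq minus_divide_right)
  thus ?thesis unfolding lgd_def g_def S_def[symmetric] by simp
 qed
 moreover have "0 <= g x" unfolding g_def
  using rS[of x] rho_nonneg[of x] qq_nonneg[of x] xy s tip_bounds by (intro mult_nonneg_nonneg divide_nonneg_nonneg) auto
 ultimately show "lgd s y <= lgd s x" "lgd s x <= 0" by auto
qed

lemma lgd_bound: assumes "s \<in> {0..tip}" "0 < x" "x <= tip" "x ~= s" shows "abs (lgd s x) <= 4400 / abs (s - x)"
proof (cases "x = tip")
 case True
 have "qq tip = 0" unfolding qq_def ycot_tip by (simp add: real_div_sqrt)
 thus ?thesis using True by (simp add: lgd_def)
next
 case False
 hence xt: "x < tip" using assms by simp
 have r: "0 < rho x" using assms tip_bounds by (intro rho_pos) auto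
 have rs: "rho x ~= rho s" using rho_inj[of x s] assms by auto
 have D: "abs (s - x) * mu x * (2*tip - s - x) / 2200 <= abs (rho s - rho x)" using assms by (intro rho_diff_lower) auto
 have m: "0 < mu x" using r assms by (simp add: mu_def)
 have w: "0 < 2*tip - s - x" using assms xt by auto
 have L: "0 < abs (s - x) * mu x * (2*tip - s - x) / 2200" using m w assms by simp
 have q: "qq x * rho x <= 4 * (mu x * (tip - x))"
 proof -
  have "qq x * rsq x <= 4 * (x^2 * (tip - x))" using drsq_bounds(2)[of x] qq_drsq[of x] assms tip_bounds by auto
  hence "qq x * (rho x * rho x) <= 4 * (x^2 * (tip - x))" using rho_sq[of x] assms tip_bounds by (simp add: power2_eq_square)
  hence "qq x * rho x <= 4 * (x^2 * (tip - x)) / rho x" using r by (simp add: pos_le_divide_eq mult.assoc)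
  thus ?thesis by (simp add: mu_def)
 qed
 have qn: "0 <= qq x" using qq_nonneg[of x] assms by auto
 have "abs (lgd s x) = (qq x * rho x / 2) / abs (rho s - rho x)"
 proof -
  have "abs (q / 2 * (r / (r - S))) = (q * r / 2) / abs (S - r)" if "0 <= q" "0 < r" for q r S :: real
   using that by (simp only: abs_mult abs_divide abs_minus_commute[of S r]) simp
  from this[OF qn r, of "rho s"] show ?thesis unfolding lgd_def .
 qed
 also have "... <= (4 * (mu x * (tip - x)) / 2) / (abs (s - x) * mu x * (2*tip - s - x) / 2200)"
  using q D L qn r m xt by (intro frac_le) auto
 also have "... = 4400 / abs (s - x) * ((tip - x) / (2*tip - s - x))"
 proof -
  have "(4 * (m * t) / 2) / (d * m * w / 2200) = 4400 / d * (t / w)" if "m > 0" for m d w t :: real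
   using that by simp
  from this[OF m] show ?thesis .
 qed
 also have "... <= 4400 / abs (s - x) * 1" using w xt assms by (intro mult_left_mono) (auto simp: divide_le_eq)
 finally show ?thesis by simp
qed

lemma lgd_deriv: assumes "0 < x" "x < pi" "rho x ~= rho s" shows "((%x. ln \<bar>rho s - rho x\<bar>) has_real_derivative lgd s x) (at x)"
proof -
 have d: "((%x. rho x - rho s) has_real_derivative (qq x * rho x / 2 - 0)) (at x)"
  by (intro DERIV_diff DERIV_const rho_deriv assms)
 have "((%x. ln \<bar>rho x - rho s\<bar>) has_real_derivative lgd s x) (at x)"
 proof (cases "rho s < rho x")
  case True
  have "((%x. ln (rho x - rho s)) has_real_derivative (1 / (rho x - rho s) * (qq x * rho x / 2 - 0))) (at x)"
   by (rule DERIV_chain2[OF DERIV_ln_divide d]) (use True in simp)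
  hence d1: "((%x. ln (rho x - rho s)) has_real_derivative lgd s x) (at x)"
  proof -
   have "1 / (r - S) * (q * r / 2 - 0) = (q / 2) * (r / (r - S))" for S r q :: real by simp
   thus ?thesis using \<open>((%x. ln (rho x - rho s)) has_real_derivative (1 / (rho x - rho s) * (qq x * rho x / 2 - 0))) (at x)\<close>
    unfolding lgd_def by metis
  qed
  have "eventually (%z. rho z > rho s) (nhds x)"
   using order_tendstoD(1)[OF isCont_rho[of x, unfolded isCont_def tendsto_at_iff_tendsto_nhds] True] .
  hence ev: "eventually (%z. ln (rho z - rho s) = ln \<bar>rho z - rho s\<bar>) (nhds x)" by eventually_elim simp
  show ?thesis using DERIV_cong_ev[OF refl ev refl] d1 by blast
 next
  case False
  hence lt: "rho x < rho s" using assms by simp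
  have d': "((%x. rho s - rho x) has_real_derivative (0 - qq x * rho x / 2)) (at x)"
   by (intro DERIV_diff DERIV_const rho_deriv assms)
  have "((%x. ln (rho s - rho x)) has_real_derivative (1 / (rho s - rho x) * (0 - qq x * rho x / 2))) (at x)"
   by (rule DERIV_chain2[OF DERIV_ln_divide d']) (use lt in simp)
  moreover have "1 / (rho s - rho x) * (0 - qq x * rho x / 2) = lgd s x"
  proof -
   have "1 / (S - r) * (0 - q * r / 2) = (q / 2) * (r / (r - S))" if "r < S" for S r q :: real using that by (simp add: divide_simps) (simp add: algebra_simps)
   from this[OF lt] show ?thesis by (simp add: lgd_def)
  qed
  ultimately have d1: "((%x. ln (rho s - rho x)) has_real_derivative lgd s x) (at x)" by simp
  have "eventually (%z. rho z < rho s) (nhds x)"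
   using order_tendstoD(2)[OF isCont_rho[of x, unfolded isCont_def tendsto_at_iff_tendsto_nhds] lt] .
  hence ev: "eventually (%z. ln (rho s - rho z) = ln \<bar>rho z - rho s\<bar>) (nhds x)" by eventually_elim simp
  show ?thesis using DERIV_cong_ev[OF refl ev refl] d1 by blast
 qed
 thus ?thesis by (simp add: abs_minus_commute)
qed

text \<open>Moving two points apart symmetrically lowers the sum of the values of a concave
  function, and by at most the displacement times the variation of its derivative.\<close>
lemma concave_spread:
 fixes \<phi> g :: "real => real"
 assumes d: "\<And>z. l <= z ==> z <= u ==> (\<phi> has_real_derivative g z) (at z)"
  and anti: "\<And>z z'. l <= z ==> z <= z' ==> z' <= u ==> g z' <= g z"
  and x: "l <= x" "x <= y" "y <= u" "x - l = u - y" "x - l <= \<delta>"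
 shows "\<phi> l + \<phi> u - \<phi> x - \<phi> y <= 0" "- (\<delta> * (g l - g u)) <= \<phi> l + \<phi> u - \<phi> x - \<phi> y"
proof -
 have "\<phi> l + \<phi> u - \<phi> x - \<phi> y <= 0 \<and> - (\<delta> * (g l - g u)) <= \<phi> l + \<phi> u - \<phi> x - \<phi> y"
 proof (cases "l = x")
  case True
  have "g u <= g l" using anti[of l u] x by auto
  moreover have "0 <= \<delta>" using x by simp
  ultimately show ?thesis using True x by simp
 next
  case False
  hence lx: "l < x" "y < u" using x by auto
  obtain z1 where z1: "l < z1" "z1 < x" "\<phi> x - \<phi> l = (x - l) * g z1"
   using MVT2[OF lx(1), of \<phi> g] d x by auto
  obtain z2 where z2: "y < z2" "z2 < u" "\<phi> u - \<phi> y = (u - y) * g z2"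
   using MVT2[OF lx(2), of \<phi> g] d x by auto
  have e: "\<phi> l + \<phi> u - \<phi> x - \<phi> y = - ((x - l) * (g z1 - g z2))"
  proof -
   have "(u - y) * g z2 = (x - l) * g z2" unfolding x(4) ..
   moreover have "(x - l) * (g z1 - g z2) = (x - l) * g z1 - (x - l) * g z2" by (rule right_diff_distrib)
   ultimately show ?thesis using z1(3) z2(3) by linarith
  qed
  have "g z2 <= g z1" "g z1 <= g l" "g u <= g z2" using anti z1 z2 x by auto
  hence "0 <= (x - l) * (g z1 - g z2)" "(x - l) * (g z1 - g z2) <= \<delta> * (g l - g u)"
   using lx x by (auto intro!: mult_mono)
  thus ?thesis unfolding e by simp
 qed
 thus "\<phi> l + \<phi> u - \<phi> x - \<phi> y <= 0" "- (\<delta> * (g l - g u)) <= \<phi> l + \<phi> u - \<phi> x - \<phi> y" by auto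
qed

text \<open>The left side is the total length of disjoint intervals inside
  \<open>{A..B}\<close>.\<close>
lemma disjoint_intervals_sum:
 fixes a b :: "'i => real"
 assumes fin: "finite M" and AB: "A <= B"
  and r: "\<And>i. i \<in> M ==> A <= b i \<and> b i <= a i \<and> a i <= B"
  and dj: "\<And>i j. i \<in> M ==> j \<in> M ==> i ~= j ==> a j <= b i \<or> a i <= b j"
 shows "(\<Sum>i\<in>M. a i - b i) <= B - A"
proof -
 have "(\<Sum>i\<in>M. a i - b i) = (\<Sum>i\<in>M. measure lborel {b i..<a i})"
  by (rule sum.cong) (use r in auto)
 also have "... = measure lborel (\<Union>i\<in>M. {b i..<a i})"
 proof (rule measure_finite_Union[symmetric])
  show "disjoint_family_on (%i. {b i..<a i}) M"
   unfolding disjoint_family_on_def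
  proof (intro ballI impI)
   fix i j assume "i \<in> M" "j \<in> M" "i ~= j"
   from dj[OF this] show "{b i..<a i} \<inter> {b j..<a j} = {}" by auto
  qed
 qed (use fin r in \<open>auto simp: emeasure_lborel_Ico\<close>)
 also have "... <= measure lborel {A..B}"
 proof (rule measure_mono_fmeasurable)
  show "(\<Union>i\<in>M. {b i..<a i}) \<subseteq> {A..B}" using r by force
  show "(\<Union>i\<in>M. {b i..<a i}) \<in> sets lborel" using fin by (intro sets.finite_UN) auto
  show "{A..B} \<in> fmeasurable lborel" by (auto intro: fmeasurable_compact)
 qed
 also have "... = B - A" using AB by simp
 finally show ?thesis .
qed

section \<open>Matched pairs\<close>

definition pairs :: "nat => (nat \<times> nat) set" where "pairs n = {(j,k). matched n j k}"

lemma pairs_bound: "(j,k) \<in> pairs n ==> j <= n div 2 \<and> k <= n div 2"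
 by (auto simp: pairs_def matched_def inner_node_def outer_node_def)

lemma finite_pairs: "finite (pairs n)"
 by (rule finite_subset[of _ "{..n div 2} \<times> {..n div 2}"]) (auto dest: pairs_bound)

definition hl :: "nat => nat \<times> nat => real" where
 "hl n = (%(j,k). min (adj n j) (adj n k))"
definition hu :: "nat => nat \<times> nat => real" where
 "hu n = (%(j,k). max (adj n j) (adj n k))"

lemma hull_facts: assumes "(j,k) \<in> pairs n"
 defines "x \<equiv> min (raw n j) (raw n k)" and "y \<equiv> max (raw n j) (raw n k)"
 shows "hl n (j,k) <= x" "x <= y" "y <= hu n (j,k)" "x - hl n (j,k) = hu n (j,k) - y" "x - hl n (j,k) <= gap n"
  "raw n j - gap n <= hl n (j,k)" "hu n (j,k) <= raw n j + gap n"
  "raw n k - gap n <= hl n (j,k)" "hu n (j,k) <= raw n k + gap n"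
  "gap n / 2 <= hl n (j,k)" "hu n (j,k) <= tip - gap n / 2" "hl n (j,k) < hu n (j,k)"
proof -
 have m: "matched n j k" using assms by (auto simp: pairs_def)
 have d: "abs (raw n j - raw n k) < gap n" using m by (auto simp: matched_def)
 have g: "gap n > 0" by (rule gap_pos)
 note am = adjusted_matched[OF m]
 note mt = matched_tip[OF m]
 show "gap n / 2 <= hl n (j,k)" "hu n (j,k) <= tip - gap n / 2" using mt by (auto simp: hl_def hu_def)
 have "(side n j k = 1 \<and> raw n k <= raw n j) \<or> (side n j k = -1 \<and> raw n j < raw n k)" by (auto simp: side_def)
 thus "hl n (j,k) <= x" "x <= y" "y <= hu n (j,k)" "x - hl n (j,k) = hu n (j,k) - y" "x - hl n (j,k) <= gap n"
  "raw n j - gap n <= hl n (j,k)" "hu n (j,k) <= raw n j + gap n"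
  "raw n k - gap n <= hl n (j,k)" "hu n (j,k) <= raw n k + gap n" "hl n (j,k) < hu n (j,k)"
  unfolding hl_def hu_def x_def y_def prod.case am using d g by (auto simp: min_def max_def)
qed

lemma hulls_ordered: assumes "P \<in> pairs n" "Q \<in> pairs n" "P ~= Q" shows "hu n P + gap n <= hl n Q \<or> hu n Q + gap n <= hl n P"
proof -
 obtain j k j' k' where pq: "P = (j,k)" "Q = (j',k')" by (cases P, cases Q)
 have m: "matched n j k" "matched n j' k'" using assms pq by (auto simp: pairs_def)
 have "j ~= j'" using m matched_unique(1) assms(3) pq by auto
 hence "3 * gap n <= abs (raw n j - raw n j')" using m by (intro raw_inner_sep) (auto simp: matched_def)
 moreover note hull_facts(6,7)[OF assms(1)[unfolded pq]] hull_facts(6,7)[OF assms(2)[unfolded pq]]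
 ultimately show ?thesis unfolding pq by linarith
qed

text \<open>The change of the sum of \<open>\<phi>\<close> over a pair under the
  adjustment.\<close>
definition spread :: "nat => (real => real) => nat \<times> nat => real" where
 "spread n \<phi> = (%(j,k). \<phi> (adj n j) + \<phi> (adj n k) - \<phi> (raw n j) - \<phi> (raw n k))"

lemma spread_concave:
 assumes P: "P \<in> pairs n" and d: "\<And>z. hl n P <= z ==> z <= hu n P ==> (\<phi> has_real_derivative g z) (at z)"
  and anti: "\<And>z z'. hl n P <= z ==> z <= z' ==> z' <= hu n P ==> g z' <= g z"
 shows "spread n \<phi> P <= 0" "- (gap n * (g (hl n P) - g (hu n P))) <= spread n \<phi> P"
proof -
 obtain j k where jk: "P = (j,k)" by (cases P)
 note hf = hull_facts[OF P[unfolded jk]]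
 have e: "spread n \<phi> P = \<phi> (hl n P) + \<phi> (hu n P) - \<phi> (min (raw n j) (raw n k)) - \<phi> (max (raw n j) (raw n k))"
  unfolding jk spread_def hl_def hu_def by (auto simp: min_def max_def)
 show "spread n \<phi> P <= 0" "- (gap n * (g (hl n P) - g (hu n P))) <= spread n \<phi> P"
  unfolding e[unfolded jk] jk
  by (rule concave_spread[OF d[unfolded jk] anti[unfolded jk] hf(1-5)]; assumption)+
qed

text \<open>The derivative is monotone across all hulls, so its variations over the separate hulls
  telescope: the total loss does not grow with the number of pairs.\<close>
lemma spread_sum_lower:
 assumes M: "M \<subseteq> pairs n" and AB: "A <= B"
  and d: "\<And>P z. P \<in> M ==> hl n P <= z ==> z <= hu n P ==> (\<phi> has_real_derivative g z) (at z)"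
  and anti: "\<And>P Q z z'. P \<in> M ==> Q \<in> M ==> hl n P <= z ==> z <= z' ==> z' <= hu n Q ==> g z' <= g z"
  and bd: "\<And>P. P \<in> M ==> A <= g (hu n P) \<and> g (hl n P) <= B"
 shows "(\<Sum>P\<in>M. spread n \<phi> P) <= 0" "- (gap n * (B - A)) <= (\<Sum>P\<in>M. spread n \<phi> P)"
proof -
 have fin: "finite M" using M finite_pairs by (rule finite_subset)
 have lu: "hl n P < hu n P" if "P \<in> M" for P using hull_facts(12) that M by (cases P) blast
 have s: "spread n \<phi> P <= 0" "- (gap n * (g (hl n P) - g (hu n P))) <= spread n \<phi> P" if "P \<in> M" for P
  using spread_concave[of P n \<phi> g] d[OF that] anti[OF that that] that M by blast+
 show "(\<Sum>P\<in>M. spread n \<phi> P) <= 0" using s(1) by (rule sum_nonpos)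
 have "(\<Sum>P\<in>M. g (hl n P) - g (hu n P)) <= B - A"
 proof (rule disjoint_intervals_sum[OF fin AB])
  fix P assume P: "P \<in> M"
  show "A <= g (hu n P) \<and> g (hu n P) <= g (hl n P) \<and> g (hl n P) <= B"
   using bd[OF P] anti[OF P P, of "hl n P" "hu n P"] lu[OF P] by auto
 next
  fix P Q assume PQ: "P \<in> M" "Q \<in> M" "P ~= Q"
  have "hu n P + gap n <= hl n Q \<or> hu n Q + gap n <= hl n P" using hulls_ordered[of P n Q] PQ M by blast
  thus "g (hl n Q) <= g (hu n P) \<or> g (hl n P) <= g (hu n Q)"
   using anti[OF PQ(1,2), of "hu n P" "hl n Q"] anti[OF PQ(2,1), of "hu n Q" "hl n P"] lu[OF PQ(1)] lu[OF PQ(2)] gap_pos[of n] by linarith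
 qed
 hence "gap n * (\<Sum>P\<in>M. g (hl n P) - g (hu n P)) <= gap n * (B - A)" using gap_pos[of n] by (intro mult_left_mono) auto
 moreover have "(\<Sum>P\<in>M. - (gap n * (g (hl n P) - g (hu n P)))) <= (\<Sum>P\<in>M. spread n \<phi> P)" using s(2) by (rule sum_mono)
 ultimately show "- (gap n * (B - A)) <= (\<Sum>P\<in>M. spread n \<phi> P)" by (simp add: sum_negf sum_distrib_left)
qed

lemma spread_log_nonpos:
 assumes P: "P \<in> pairs n" and s: "s \<in> {0..tip}" and out: "s < hl n P \<or> hu n P < s"
 shows "spread n (%x. ln \<bar>rho s - rho x\<bar>) P <= 0"
proof -
 obtain j k where jk: "P = (j,k)" by (cases P)
 have hf: "gap n / 2 <= hl n P" "hu n P <= tip - gap n / 2" using hull_facts(10,11)[OF P[unfolded jk]] by (auto simp: jk)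
 have g: "gap n > 0" by (rule gap_pos)
 show ?thesis
 proof (rule spread_concave(1)[OF P])
  fix z assume z: "hl n P <= z" "z <= hu n P"
  have "rho z ~= rho s" using rho_inj[of z s] z out hf s g by auto
  thus "((%x. ln \<bar>rho s - rho x\<bar>) has_real_derivative lgd s z) (at z)"
   using z hf g tip_bounds by (intro lgd_deriv) auto
 next
  fix z z' assume z: "hl n P <= z" and z': "z <= z'" "z' <= hu n P"
  show "lgd s z' <= lgd s z"
   using out lgd_antimono_right(1)[of s z z'] lgd_antimono_left(1)[of s z z'] z z' hf s g by auto
 qed
qed

lemma spread_log_sum:
 assumes M: "M \<subseteq> pairs n" and s: "s \<in> {0..tip}"
  and far: "\<And>P. P \<in> M ==> s + gap n / 2 <= hl n P \<or> hu n P + gap n / 2 <= s"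
 shows "- 17600 <= (\<Sum>P\<in>M. spread n (%x. ln \<bar>rho s - rho x\<bar>) P)"
proof -
 define \<phi> where "\<phi> = (%x. ln \<bar>rho s - rho x\<bar>)"
 have g: "gap n > 0" by (rule gap_pos)
 have fin: "finite M" using M finite_pairs by (rule finite_subset)
 have hf: "gap n / 2 <= hl n P" "hu n P <= tip - gap n / 2" "hl n P < hu n P" if "P \<in> M" for P
  using hull_facts(10,11,12) that M by (cases P, blast)+
 define M1 where "M1 = {P \<in> M. s + gap n / 2 <= hl n P}"
 define M2 where "M2 = M - M1"
 have M2: "hu n P + gap n / 2 <= s" if "P \<in> M2" for P using far[of P] that by (auto simp: M1_def M2_def)
 have c: "4400 / abs (s - x) <= 8800 / gap n" if "gap n / 2 <= abs (s - x)" for x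
 proof -
  have "4400 / abs (s - x) <= 4400 / (gap n / 2)" using that g by (intro divide_left_mono mult_pos_pos) auto
  thus ?thesis by simp
 qed
 have der: "(\<phi> has_real_derivative lgd s z) (at z)" if "P \<in> M" "hl n P <= z" "z <= hu n P" for P z
 proof -
  have "z ~= s" using far[OF that(1)] that g by auto
  hence "rho z ~= rho s" using rho_inj[of z s] that hf[OF that(1)] s g by auto
  thus ?thesis unfolding \<phi>_def using that hf[OF that(1)] g tip_bounds by (intro lgd_deriv) auto
 qed
 have "- (gap n * (8800 / gap n - 0)) <= (\<Sum>P\<in>M1. spread n \<phi> P)"
 proof (rule spread_sum_lower(2)[where g = "lgd s"])
  show "M1 \<subseteq> pairs n" using M by (auto simp: M1_def)
  show "0 <= 8800 / gap n" using g by simp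
  show "\<And>P z. P \<in> M1 ==> hl n P <= z ==> z <= hu n P ==> (\<phi> has_real_derivative lgd s z) (at z)"
   using der by (auto simp: M1_def)
  show "lgd s z' <= lgd s z" if "P \<in> M1" "Q \<in> M1" "hl n P <= z" "z <= z'" "z' <= hu n Q" for P Q z z'
   using that hf[of P] hf[of Q] s g by (intro lgd_antimono_right(1)) (auto simp: M1_def)
  fix P assume P: "P \<in> M1"
  have PM: "P \<in> M" "s + gap n / 2 <= hl n P" using P by (auto simp: M1_def)
  have "abs (lgd s (hl n P)) <= 4400 / abs (s - hl n P)" using PM hf[OF PM(1)] s g by (intro lgd_bound) auto
  also have "... <= 8800 / gap n" by (rule c) (use PM(2) in linarith)
  finally have "lgd s (hl n P) <= 8800 / gap n" by simp
  moreover have "0 <= lgd s (hu n P)" using PM hf[OF PM(1)] s g by (intro lgd_antimono_right(2)[of s "hu n P"]) auto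
  ultimately show "0 <= lgd s (hu n P) \<and> lgd s (hl n P) <= 8800 / gap n" by simp
 qed
 moreover have "- (gap n * (0 - - 8800 / gap n)) <= (\<Sum>P\<in>M2. spread n \<phi> P)"
 proof (rule spread_sum_lower(2)[where g = "lgd s"])
  show "M2 \<subseteq> pairs n" using M by (auto simp: M2_def)
  show "- 8800 / gap n <= 0" using g by simp
  show "\<And>P z. P \<in> M2 ==> hl n P <= z ==> z <= hu n P ==> (\<phi> has_real_derivative lgd s z) (at z)"
   using der by (auto simp: M2_def)
  show "lgd s z' <= lgd s z" if "P \<in> M2" "Q \<in> M2" "hl n P <= z" "z <= z'" "z' <= hu n Q" for P Q z z'
   using that hf[of P] hf[of Q] M2[of Q] s g by (intro lgd_antimono_left(1)) (auto simp: M2_def)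
  fix P assume P: "P \<in> M2"
  have PM: "P \<in> M" "hu n P + gap n / 2 <= s" using P M2 by (auto simp: M2_def)
  have "abs (lgd s (hu n P)) <= 4400 / abs (s - hu n P)" using PM hf[OF PM(1)] s g by (intro lgd_bound) auto
  also have "... <= 8800 / gap n" by (rule c) (use PM(2) in linarith)
  finally have "- 8800 / gap n <= lgd s (hu n P)" by simp
  moreover have "lgd s (hl n P) <= 0" using PM hf[OF PM(1)] s g by (intro lgd_antimono_left(2)[of s _ "hl n P"]) auto
  ultimately show "- 8800 / gap n <= lgd s (hu n P) \<and> lgd s (hl n P) <= 0" by simp
 qed
 moreover have "(\<Sum>P\<in>M. spread n \<phi> P) = (\<Sum>P\<in>M1. spread n \<phi> P) + (\<Sum>P\<in>M2. spread n \<phi> P)"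
  unfolding M2_def using fin by (subst sum.subset_diff[of M1 M]) (auto simp: M1_def)
 ultimately show ?thesis using g unfolding \<phi>_def[symmetric] by simp
qed

text \<open>The kernel of the mirror images is not concave, but it is a difference of the two
  concave functions \<open>\<alpha>\<close> and \<open>\<beta>\<close> with derivatives of order
  \<open>1 / x\<close>.\<close>
lemma spread_mirror_sum: assumes S: "0 <= S"
 shows "abs (\<Sum>P\<in>pairs n. spread n (%x. ln (sqrt (S^2 + rho x ^ 2))) P) <= 6"
proof -
 have g: "gap n > 0" by (rule gap_pos)
 have hf: "gap n / 2 <= hl n P" "hu n P <= tip - gap n / 2" "hl n P < hu n P" if "P \<in> pairs n" for P
  using hull_facts(10,11,12) that by (cases P, blast)+
 define \<alpha> where "\<alpha> = (%x. ln (rsq x) / 2)"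
 define \<beta> where "\<beta> = (%x. (ln (rsq x) - ln (S^2 + rsq x)) / 2)"
 have da: "(\<alpha> has_real_derivative qq x / 2) (at x)" if "0 < x" "x < pi" for x
 proof -
  have "(\<alpha> has_real_derivative (1 / rsq x * drsq x) / 2) (at x)"
   unfolding \<alpha>_def by (intro DERIV_cdivide DERIV_chain2[OF DERIV_ln_divide rsq_deriv] rsq_pos that)
  thus ?thesis using qq_drsq[OF that] rsq_pos[OF that] by simp
 qed
 have pos2: "0 < S^2 + rsq x" if "0 < x" "x < pi" for x using rsq_pos[OF that] by (simp add: add_nonneg_pos)
 have db: "(\<beta> has_real_derivative (qq x / 2) * (S^2 / (S^2 + rsq x))) (at x)" if "0 < x" "x < pi" for x
 proof -
  have "((%x. S^2 + rsq x) has_real_derivative (0 + drsq x)) (at x)" by (intro DERIV_add DERIV_const rsq_deriv)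
  hence "(\<beta> has_real_derivative (1 / rsq x * drsq x - 1 / (S^2 + rsq x) * (0 + drsq x)) / 2) (at x)"
   unfolding \<beta>_def by (intro DERIV_cdivide DERIV_diff DERIV_chain2[OF DERIV_ln_divide rsq_deriv] DERIV_chain2[OF DERIV_ln_divide] rsq_pos that pos2)
  moreover have "(1 / r * (q * r) - 1 / (A + r) * (0 + q * r)) / 2 = (q / 2) * (A / (A + r))" if "r > 0" "A + r > 0" for r q A :: real
   using that by (simp add: divide_simps) (simp add: algebra_simps)
  ultimately show ?thesis using qq_drsq[OF that] rsq_pos[OF that] pos2[OF that] by metis
 qed
 have qb: "0 <= qq (hu n P) / 2 \<and> qq (hl n P) / 2 <= 3 / gap n" if "P \<in> pairs n" for P
 proof -
  have "qq (hl n P) <= 3 / hl n P" using hf[OF that] g by (intro qq_upper) auto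
  also have "... <= 3 / (gap n / 2)" using hf[OF that] g by (intro divide_left_mono) auto
  finally show ?thesis using qq_nonneg[of "hu n P"] hf[OF that] g by auto
 qed
 have sa: "(\<Sum>P\<in>pairs n. spread n \<alpha> P) <= 0" "- (gap n * (3 / gap n - 0)) <= (\<Sum>P\<in>pairs n. spread n \<alpha> P)"
 proof -
  have 1: "(\<alpha> has_real_derivative qq z / 2) (at z)" if "P \<in> pairs n" "hl n P <= z" "z <= hu n P" for P z
   using that hf[OF that(1)] g tip_bounds by (intro da) auto
  have 2: "qq z' / 2 <= qq z / 2" if "P \<in> pairs n" "Q \<in> pairs n" "hl n P <= z" "z <= z'" "z' <= hu n Q" for P Q z z'
   using qq_antimono[of z z'] that hf[OF that(1)] hf[OF that(2)] g by auto
  have 3: "0 <= 3 / gap n" using g by simp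
  show "(\<Sum>P\<in>pairs n. spread n \<alpha> P) <= 0" "- (gap n * (3 / gap n - 0)) <= (\<Sum>P\<in>pairs n. spread n \<alpha> P)"
   by (rule spread_sum_lower[OF subset_refl 3 1 2 qb]; assumption)+
 qed
 have rm: "rsq x <= rsq y" if "0 <= x" "x <= y" "y <= tip" for x y using rsq_strict_mono[of x y] that by (cases "x = y") auto
 have sb: "(\<Sum>P\<in>pairs n. spread n \<beta> P) <= 0" "- (gap n * (3 / gap n - 0)) <= (\<Sum>P\<in>pairs n. spread n \<beta> P)"
 proof -
  have 1: "(\<beta> has_real_derivative (qq z / 2) * (S^2 / (S^2 + rsq z))) (at z)" if "P \<in> pairs n" "hl n P <= z" "z <= hu n P" for P z
   using that hf[OF that(1)] g tip_bounds by (intro db) auto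
  have f: "0 <= S^2 / (S^2 + rsq z)" "S^2 / (S^2 + rsq z) <= 1" if "0 < z" "z < pi" for z
   using pos2[OF that] rsq_pos[OF that] by (auto simp: divide_le_eq)
  have 2: "(qq z' / 2) * (S^2 / (S^2 + rsq z')) <= (qq z / 2) * (S^2 / (S^2 + rsq z))" if "P \<in> pairs n" "Q \<in> pairs n" "hl n P <= z" "z <= z'" "z' <= hu n Q" for P Q z z'
  proof -
   have z: "0 < z" "z <= z'" "z' <= tip" "z < pi" "z' < pi" using that hf[OF that(1)] hf[OF that(2)] g tip_bounds by auto
   have "S^2 / (S^2 + rsq z') <= S^2 / (S^2 + rsq z)"
    using rm[of z z'] z pos2[of z] pos2[of z'] by (intro divide_left_mono mult_pos_pos) auto
   thus ?thesis using qq_antimono[of z z'] qq_nonneg[of z] f[of z'] z by (intro mult_mono) auto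
  qed
  have 3: "0 <= 3 / gap n" using g by simp
  have 4: "0 <= (qq (hu n P) / 2) * (S^2 / (S^2 + rsq (hu n P))) \<and> (qq (hl n P) / 2) * (S^2 / (S^2 + rsq (hl n P))) <= 3 / gap n" if "P \<in> pairs n" for P
  proof
   have u: "0 < hu n P" "hu n P < pi" and l: "0 < hl n P" "hl n P < pi" "hl n P <= tip" using hf[OF that] g tip_bounds by auto
   show "0 <= (qq (hu n P) / 2) * (S^2 / (S^2 + rsq (hu n P)))" using qb[OF that] f[OF u] by (intro mult_nonneg_nonneg) auto
   have "(qq (hl n P) / 2) * (S^2 / (S^2 + rsq (hl n P))) <= (qq (hl n P) / 2) * 1"
    using f[OF l(1,2)] qq_nonneg[OF l(1,3)] by (intro mult_left_mono) auto
   also have "(qq (hl n P) / 2) * 1 <= 3 / gap n" using qb[OF that] by simp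
   finally show "(qq (hl n P) / 2) * (S^2 / (S^2 + rsq (hl n P))) <= 3 / gap n" .
  qed
  show "(\<Sum>P\<in>pairs n. spread n \<beta> P) <= 0" "- (gap n * (3 / gap n - 0)) <= (\<Sum>P\<in>pairs n. spread n \<beta> P)"
   by (rule spread_sum_lower[OF subset_refl 3 1 2 4]; assumption)+
 qed
 have "spread n (%x. ln (sqrt (S^2 + rho x ^ 2))) P = spread n \<alpha> P - spread n \<beta> P" if "P \<in> pairs n" for P
 proof -
  obtain j k where jk: "P = (j,k)" by (cases P)
  have m: "matched n j k" using that jk by (auto simp: pairs_def)
  have e: "ln (sqrt (S^2 + rho x ^ 2)) = \<alpha> x - \<beta> x" if "0 < x" "x <= tip" for x
  proof -
   have "rho x ^ 2 = rsq x" using that tip_bounds by (intro rho_sq) auto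
   moreover have "0 < S^2 + rsq x" using pos2[of x] that tip_bounds by auto
   ultimately show ?thesis by (simp add: \<alpha>_def \<beta>_def ln_sqrt diff_divide_distrib)
  qed
  show ?thesis using matched_tip[OF m] g unfolding jk spread_def by (simp add: e)
 qed
 hence "(\<Sum>P\<in>pairs n. spread n (%x. ln (sqrt (S^2 + rho x ^ 2))) P) = (\<Sum>P\<in>pairs n. spread n \<alpha> P) - (\<Sum>P\<in>pairs n. spread n \<beta> P)"
  by (simp add: sum_subtractf)
 thus ?thesis using sa sb g by simp
qed

section \<open>The nodal product of the adjusted points\<close>

definition wst :: "nat => real => real" where
 "wst n s = (\<Prod>k\<le>n. norm (arm s - fej n k))"

text \<open>The contribution of the lower arm.\<close>
definition mir :: "nat => real => real" where
 "mir n s = (\<Prod>k\<in>mirrored n. sqrt (rho s ^ 2 + rho (adj n k) ^ 2))"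

lemma lo_le: "lo_idx n <= 1" by (simp add: lo_idx)

lemma rho_ge_0: "s \<in> {0..tip} ==> 0 <= rho s" using rho_nonneg[of s] tip_bounds by auto

lemma wst_split: assumes s: "s \<in> {0..tip}"
 shows "wst n s = (\<Prod>k\<le>n div 2. \<bar>rho s - rho (adj n k)\<bar>) * mir n s"
proof -
 have "wst n s = (\<Prod>k\<le>n div 2. norm (arm s - fej n k)) * (\<Prod>k\<in>mirrored n. norm (arm s - fej n (2 * (n div 2) + 1 - k)))"
  unfolding wst_def by (rule prod_split_index)
 moreover have "(\<Prod>k\<le>n div 2. norm (arm s - fej n k)) = (\<Prod>k\<le>n div 2. \<bar>rho s - rho (adj n k)\<bar>)"
  using s adjusted_range by (intro prod.cong refl) (auto simp: adjusted_fejer_upper intro!: norm_arm_diff rho_ge_0)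
 moreover have "(\<Prod>k\<in>mirrored n. norm (arm s - fej n (2 * (n div 2) + 1 - k))) = mir n s"
  unfolding mir_def by (intro prod.cong refl) (simp only: adjusted_fejer_lower norm_arm_cnj_diff atLeastAtMost_iff)
 ultimately show ?thesis by simp
qed

lemma node_prod_split: assumes s: "s \<in> {0..tip}"
 shows "node_prod n s = (\<Prod>k\<le>n div 2. \<bar>rho s - rho (raw n k)\<bar>) * (\<Prod>k\<in>mirrored n. sqrt (rho s ^ 2 + rho (raw n k) ^ 2))"
proof -
 have t: "0 <= thu n k" "thu n k <= pi" if "k <= n div 2" for k
  using theta_upper_range(1)[OF that] theta_upper_less_pi[OF that] by auto
 have "(\<Prod>k\<le>n div 2. norm (arm s - psi0 (cis (thu n k)))) = (\<Prod>k\<le>n div 2. \<bar>rho s - rho (raw n k)\<bar>)"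
 proof (intro prod.cong refl)
  fix k assume "k \<in> {..n div 2}"
  hence k: "k <= n div 2" by simp
  show "norm (arm s - psi0 (cis (thu n k))) = abs (rho s - rho (raw n k))"
   unfolding psi0_arm(1)[OF t[OF k]] rho_raw[OF k] using s t[OF k] by (intro norm_arm_diff rho_ge_0 rho_nonneg) auto
 qed
 moreover have "(\<Prod>k\<in>mirrored n. norm (arm s - psi0 (cis (- thu n k)))) = (\<Prod>k\<in>mirrored n. sqrt (rho s ^ 2 + rho (raw n k) ^ 2))"
 proof (intro prod.cong refl)
  fix k assume "k \<in> mirrored n"
  hence k: "k <= n div 2" by simp
  show "norm (arm s - psi0 (cis (- thu n k))) = sqrt (rho s ^ 2 + rho (raw n k) ^ 2)"
   unfolding psi0_arm(2)[OF t[OF k]] rho_raw[OF k] by (rule norm_arm_cnj_diff)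
 qed
 ultimately show ?thesis unfolding node_prod_def prod_theta_split[of "%t. norm (arm s - psi0 (cis t))"] by simp
qed

definition frees :: "nat => nat set" where "frees n = {k. k <= n div 2 \<and> free n k}"

lemma pairs_facts: assumes "P \<in> pairs n"
 shows "fst P <= n div 2" "snd P <= n div 2" "inner_node n (fst P)" "outer_node n (snd P)" "matched n (fst P) (snd P)"
  "\<not> free n (fst P)" "\<not> free n (snd P)" "lo_idx n <= fst P" "lo_idx n <= snd P"
proof -
 have m: "matched n (fst P) (snd P)" using assms by (auto simp: pairs_def)
 show "matched n (fst P) (snd P)" "inner_node n (fst P)" "outer_node n (snd P)" "fst P <= n div 2" "snd P <= n div 2"
  using m by (auto simp: matched_def inner_node_def outer_node_def)
 show f: "\<not> free n (fst P)" "\<not> free n (snd P)" using m by (auto simp: free_def)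
 have "fst P ~= 0" "snd P ~= 0" if "even n" using f adjusted_0(2)[OF that] by metis+
 thus "lo_idx n <= fst P" "lo_idx n <= snd P" by (auto simp: lo_idx)
qed

lemma inj_fst_pairs: "inj_on fst (pairs n)" and inj_snd_pairs: "inj_on snd (pairs n)"
 using matched_unique by (auto simp: inj_on_def pairs_def)

lemma nodes_decomp: "{..n div 2} = frees n \<union> fst ` pairs n \<union> snd ` pairs n"
proof
 show "{..n div 2} \<subseteq> frees n \<union> fst ` pairs n \<union> snd ` pairs n"
 proof
  fix k assume k: "k \<in> {..n div 2}"
  show "k \<in> frees n \<union> fst ` pairs n \<union> snd ` pairs n"
  proof (cases "free n k")
   case False
   then obtain j where "matched n j k \<or> matched n k j" by (auto simp: free_def)
   thus ?thesis by (force simp: pairs_def image_iff)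
  qed (use k in \<open>auto simp: frees_def\<close>)
 qed
 show "frees n \<union> fst ` pairs n \<union> snd ` pairs n \<subseteq> {..n div 2}"
  using pairs_facts(1,2) by (auto simp: frees_def)
qed

lemma prod_nodes: fixes f :: "nat => real"
 assumes M: "M \<subseteq> pairs n" and F: "F \<subseteq> frees n"
 shows "(\<Prod>k\<in>F \<union> fst ` M \<union> snd ` M. f k) = (\<Prod>k\<in>F. f k) * (\<Prod>P\<in>M. f (fst P) * f (snd P))"
proof -
 have fin: "finite M" "finite F"
 proof -
  show "finite M" using M finite_pairs by (rule finite_subset)
  have "F \<subseteq> {..n div 2}" using F by (auto simp: frees_def)
  thus "finite F" by (rule finite_subset) simp
 qed
 have d1: "F \<inter> fst ` M = {}" "(F \<union> fst ` M) \<inter> snd ` M = {}"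
 proof -
  have 1: "k ~= fst Q" if "k \<in> F" "Q \<in> M" for k Q using pairs_facts(6)[of Q n] that M F by (auto simp: frees_def)
  have 2: "k ~= snd Q" if "k \<in> F" "Q \<in> M" for k Q using pairs_facts(7)[of Q n] that M F by (auto simp: frees_def)
  have 3: "fst P ~= snd Q" if "P \<in> M" "Q \<in> M" for P Q
   using pairs_facts(3)[of P n] pairs_facts(4)[of Q n] that M not_inner_outer[of n "fst P"] by (metis subsetD)
  show "F \<inter> fst ` M = {}" using 1 by blast
  show "(F \<union> fst ` M) \<inter> snd ` M = {}" using 2 3 by blast
 qed
 have "(\<Prod>k\<in>F \<union> fst ` M \<union> snd ` M. f k) = (\<Prod>k\<in>F. f k) * (\<Prod>k\<in>fst ` M. f k) * (\<Prod>k\<in>snd ` M. f k)"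
  using fin d1 by (simp add: prod.union_disjoint)
 also have "(\<Prod>k\<in>fst ` M. f k) = (\<Prod>P\<in>M. f (fst P))" by (subst prod.reindex) (auto intro: inj_on_subset[OF inj_fst_pairs M])
 also have "(\<Prod>k\<in>snd ` M. f k) = (\<Prod>P\<in>M. f (snd P))" by (subst prod.reindex) (auto intro: inj_on_subset[OF inj_snd_pairs M])
 finally show ?thesis by (simp add: prod.distrib mult.assoc)
qed

lemma compare_nodes: fixes f :: "real => real"
 assumes M: "M \<subseteq> pairs n" and F: "F \<subseteq> frees n"
  and pos: "\<And>P. P \<in> M ==> 0 < f (adj n (fst P)) \<and> 0 < f (adj n (snd P)) \<and> 0 < f (raw n (fst P)) \<and> 0 < f (raw n (snd P))"
 shows "(\<Prod>k\<in>F \<union> fst ` M \<union> snd ` M. f (adj n k)) =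
  exp (\<Sum>P\<in>M. spread n (%x. ln (f x)) P) * (\<Prod>k\<in>F \<union> fst ` M \<union> snd ` M. f (raw n k))"
proof -
 have fin: "finite M" using M finite_pairs by (rule finite_subset)
 have "(\<Prod>k\<in>F. f (adj n k)) = (\<Prod>k\<in>F. f (raw n k))"
  using F by (intro prod.cong refl) (auto simp: frees_def adjusted_free)
 moreover have "(\<Prod>P\<in>M. f (adj n (fst P)) * f (adj n (snd P))) =
   (\<Prod>P\<in>M. exp (spread n (%x. ln (f x)) P) * (f (raw n (fst P)) * f (raw n (snd P))))"
 proof (intro prod.cong refl)
  fix P assume P: "P \<in> M"
  have "spread n (%x. ln (f x)) P = ln (f (adj n (fst P))) + ln (f (adj n (snd P))) - ln (f (raw n (fst P))) - ln (f (raw n (snd P)))"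
   by (simp add: spread_def case_prod_beta)
  thus "f (adj n (fst P)) * f (adj n (snd P)) = exp (spread n (%x. ln (f x)) P) * (f (raw n (fst P)) * f (raw n (snd P)))"
   using pos[OF P] by (simp add: exp_add exp_diff)
 qed
 moreover have "exp (\<Sum>P\<in>M. spread n (%x. ln (f x)) P) = (\<Prod>P\<in>M. exp (spread n (%x. ln (f x)) P))"
  by (rule exp_sum[OF fin])
 ultimately show ?thesis unfolding prod_nodes[OF M F] prod.distrib[of "%P. exp (spread n (%x. ln (f x)) P)"] by simp
qed

lemma mirror_compare: fixes n :: nat assumes s: "s \<in> {0..tip}"
 defines "R \<equiv> (\<Prod>k\<in>mirrored n. sqrt (rho s ^ 2 + rho (raw n k) ^ 2))"
 shows "exp (-6) * R <= mir n s" "mir n s <= exp 6 * R" "0 <= R"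
proof -
 define F where "F = frees n \<inter> {lo_idx n..}"
 have I: "mirrored n = F \<union> fst ` pairs n \<union> snd ` pairs n"
 proof -
  have "mirrored n = {..n div 2} \<inter> {lo_idx n..}" by auto
  also have "... = (frees n \<inter> {lo_idx n..}) \<union> (fst ` pairs n \<inter> {lo_idx n..}) \<union> (snd ` pairs n \<inter> {lo_idx n..})"
   unfolding nodes_decomp by blast
  also have "fst ` pairs n \<inter> {lo_idx n..} = fst ` pairs n" using pairs_facts(8) by force
  also have "snd ` pairs n \<inter> {lo_idx n..} = snd ` pairs n" using pairs_facts(9) by force
  finally show ?thesis unfolding F_def .
 qed
 have pos: "0 < sqrt (rho s ^ 2 + rho x ^ 2)" if "0 < x" "x <= tip" for x
  using rho_pos[of x] that tip_bounds by (auto intro: add_nonneg_pos)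
 have g: "gap n > 0" by (rule gap_pos)
 have "mir n s = exp (\<Sum>P\<in>pairs n. spread n (%x. ln (sqrt (rho s ^ 2 + rho x ^ 2))) P) * R"
  unfolding mir_def R_def I
 proof (rule compare_nodes[OF subset_refl])
  show "F \<subseteq> frees n" by (simp add: F_def)
  fix P assume P: "P \<in> pairs n"
  note mt = matched_tip[OF pairs_facts(5)[OF P]]
  show "0 < sqrt ((rho s)\<^sup>2 + (rho (adj n (fst P)))\<^sup>2) \<and> 0 < sqrt ((rho s)\<^sup>2 + (rho (adj n (snd P)))\<^sup>2) \<and>
     0 < sqrt ((rho s)\<^sup>2 + (rho (raw n (fst P)))\<^sup>2) \<and> 0 < sqrt ((rho s)\<^sup>2 + (rho (raw n (snd P)))\<^sup>2)"
   using mt g by (intro conjI pos) linarith+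
 qed
 moreover show R: "0 <= R" unfolding R_def by (intro prod_nonneg) simp
 moreover have "abs (\<Sum>P\<in>pairs n. spread n (%x. ln (sqrt (rho s ^ 2 + rho x ^ 2))) P) <= 6"
  by (rule spread_mirror_sum[OF rho_ge_0[OF s]])
 ultimately show "exp (-6) * R <= mir n s" "mir n s <= exp 6 * R" by (auto intro!: mult_right_mono)
qed

lemma mir_nonneg: "0 <= mir n s" unfolding mir_def by (intro prod_nonneg) simp

lemma outside_hull: assumes P: "P \<in> pairs n" and s: "s \<in> {0..tip}" and out: "s < hl n P \<or> hu n P < s"
 shows "0 < abs (rho s - rho (adj n (fst P))) \<and> 0 < abs (rho s - rho (adj n (snd P)))
  \<and> 0 < abs (rho s - rho (raw n (fst P))) \<and> 0 < abs (rho s - rho (raw n (snd P)))"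
proof -
 have g: "gap n > 0" by (rule gap_pos)
 have P': "(fst P, snd P) \<in> pairs n" using P by simp
 note hf = hull_facts[OF P']
 have e: "hl n P = hl n (fst P, snd P)" "hu n P = hu n (fst P, snd P)" by simp_all
 have q: "0 < abs (rho s - rho x)" if "hl n P <= x" "x <= hu n P" for x
 proof -
  have "x ~= s" "x \<in> {0..tip}" using that out hf(10,11) g unfolding e by auto
  thus ?thesis using rho_inj[OF _ s, of x] by auto
 qed
 have "hl n P <= adj n (fst P)" "hl n P <= adj n (snd P)" "adj n (fst P) <= hu n P" "adj n (snd P) <= hu n P"
  by (auto simp: hl_def hu_def case_prod_beta)
 moreover have "hl n P <= raw n (fst P)" "hl n P <= raw n (snd P)" "raw n (fst P) <= hu n P" "raw n (snd P) <= hu n P"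
  using hf(1,2,3) unfolding e by auto
 ultimately show ?thesis using q by blast
qed

text \<open>Outside the hulls the adjustment only decreases the product; at distance \<open>gap n
  / 2\<close> from them it costs no more than a constant factor.\<close>
lemma compare_abs:
 assumes M: "M \<subseteq> pairs n" and F: "F \<subseteq> frees n" and s: "s \<in> {0..tip}"
 defines "Q \<equiv> %r. (\<Prod>k\<in>F \<union> fst ` M \<union> snd ` M. \<bar>rho s - rho (r n k)\<bar>)"
 shows "(\<And>P. P \<in> M ==> s < hl n P \<or> hu n P < s) ==> Q adj <= Q raw"
  and "(\<And>P. P \<in> M ==> s + gap n / 2 <= hl n P \<or> hu n P + gap n / 2 <= s) ==> exp (-17600) * Q raw <= Q adj"
proof -
 have g: "gap n > 0" by (rule gap_pos)
 have Q0: "0 <= Q raw" unfolding Q_def by (intro prod_nonneg) simp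
 have e: "Q adj = exp (\<Sum>P\<in>M. spread n (%x. ln \<bar>rho s - rho x\<bar>) P) * Q raw"
  if "\<And>P. P \<in> M ==> s < hl n P \<or> hu n P < s"
  unfolding Q_def by (rule compare_nodes[OF M F]) (use outside_hull s that M in blast)
 show "Q adj <= Q raw" if o: "\<And>P. P \<in> M ==> s < hl n P \<or> hu n P < s"
 proof -
  have "(\<Sum>P\<in>M. spread n (%x. ln \<bar>rho s - rho x\<bar>) P) <= 0"
   by (rule sum_nonpos) (use spread_log_nonpos s o M in blast)
  hence "exp (\<Sum>P\<in>M. spread n (%x. ln \<bar>rho s - rho x\<bar>) P) <= 1" by simp
  hence "exp (\<Sum>P\<in>M. spread n (%x. ln \<bar>rho s - rho x\<bar>) P) * Q raw <= 1 * Q raw" using Q0 by (rule mult_right_mono)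
  moreover note e[OF o]
  ultimately show ?thesis by simp
 qed
 show "exp (-17600) * Q raw <= Q adj" if o: "\<And>P. P \<in> M ==> s + gap n / 2 <= hl n P \<or> hu n P + gap n / 2 <= s"
 proof -
  have "s < hl n P \<or> hu n P < s" if "P \<in> M" for P using o[OF that] g by linarith
  from e[OF this] have e': "Q adj = exp (\<Sum>P\<in>M. spread n (%x. ln \<bar>rho s - rho x\<bar>) P) * Q raw" .
  have "- 17600 <= (\<Sum>P\<in>M. spread n (%x. ln \<bar>rho s - rho x\<bar>) P)" by (rule spread_log_sum[OF M s o])
  hence "exp (- 17600) <= exp (\<Sum>P\<in>M. spread n (%x. ln \<bar>rho s - rho x\<bar>) P)" by simp
  thus ?thesis unfolding e' using Q0 by (rule mult_right_mono)
 qed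
qed

lemma wst_upper_out: assumes s: "s \<in> {0..tip}" and o: "\<And>P. P \<in> pairs n ==> s < hl n P \<or> hu n P < s"
 shows "wst n s <= exp 6 * node_prod n s"
proof -
 have "wst n s <= (\<Prod>k\<le>n div 2. \<bar>rho s - rho (raw n k)\<bar>) * (exp 6 * (\<Prod>k\<in>mirrored n. sqrt (rho s ^ 2 + rho (raw n k) ^ 2)))"
  unfolding wst_split[OF s]
 proof (rule mult_mono)
  show "(\<Prod>k\<le>n div 2. \<bar>rho s - rho (adj n k)\<bar>) <= (\<Prod>k\<le>n div 2. \<bar>rho s - rho (raw n k)\<bar>)"
   unfolding nodes_decomp by (rule compare_abs(1)[OF subset_refl subset_refl s o])
 qed (use mirror_compare(2)[OF s] mir_nonneg in \<open>auto intro: prod_nonneg\<close>)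
 thus ?thesis unfolding node_prod_split[OF s] by (simp add: mult_ac)
qed

lemma wst_lower_far: assumes s: "s \<in> {0..tip}"
  and o: "\<And>P. P \<in> pairs n ==> s + gap n / 2 <= hl n P \<or> hu n P + gap n / 2 <= s"
 shows "exp (-17606) * node_prod n s <= wst n s"
proof -
 have "(exp (-17600) * (\<Prod>k\<le>n div 2. \<bar>rho s - rho (raw n k)\<bar>)) * (exp (-6) * (\<Prod>k\<in>mirrored n. sqrt (rho s ^ 2 + rho (raw n k) ^ 2))) <= wst n s"
  unfolding wst_split[OF s]
 proof (rule mult_mono)
  show "exp (-17600) * (\<Prod>k\<le>n div 2. \<bar>rho s - rho (raw n k)\<bar>) <= (\<Prod>k\<le>n div 2. \<bar>rho s - rho (adj n k)\<bar>)"
   unfolding nodes_decomp by (rule compare_abs(2)[OF subset_refl subset_refl s o])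
 qed (use mirror_compare(1,3)[OF s] in \<open>auto intro: prod_nonneg\<close>)
 moreover have "exp (-17606) = exp (-17600) * exp (-6 :: real)" by (simp add: exp_add[symmetric])
 ultimately show ?thesis unfolding node_prod_split[OF s] by (simp add: mult_ac)
qed

lemma near_bounds:
 assumes g: "0 < g" and s: "g / 2 <= s" "s <= tip - g / 2" and x: "g / 2 <= x" "x <= tip - g / 2" "abs (s - x) <= 2 * g"
 shows "abs (rho s - rho x) <= 864 * (abs (s - x) * (mu s * (tip - s)))" "abs (s - x) * (mu s * (tip - s)) <= 2200 * abs (rho s - rho x)"
  "x <= 5 * s"
proof -
 have s0: "0 < s" "s < tip" "0 < x" "x < tip" using assms by auto
 have r: "0 < rho s" "0 < rho x" using rho_pos s0 tip_bounds by auto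
 have m: "0 < mu s" using r s0 by (simp add: mu_def)
 show x5: "x <= 5 * s" using assms by linarith
 have t5: "tip - x <= 5 * (tip - s)"
 proof -
  have "s - x <= 2 * g" "g / 2 <= tip - s" using x(3) s(2) by linarith+
  hence "s - x <= 4 * (tip - s)" by (simp add: algebra_simps)
  thus ?thesis by (simp add: algebra_simps)
 qed
 have "abs (rho s - rho x) * (rho s + rho x) <= 4 * (abs (s - x) * (s + x)^2 * (2*tip - s - x))" using s0 by (intro rho_diff_upper) auto
 also have "... <= 4 * (abs (s - x) * (6 * s)^2 * (6 * (tip - s)))"
  using x5 t5 s0 by (intro mult_left_mono mult_mono power_mono) auto
 also have "... = 864 * (abs (s - x) * s^2 * (tip - s))"
 proof -
  have "4 * (d * (6 * s)^2 * (6 * t)) = 864 * (d * s^2 * t)" for d t :: real by (simp add: power_mult_distrib)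
  thus ?thesis .
 qed
 finally have "abs (rho s - rho x) * (rho s + rho x) <= 864 * (abs (s - x) * s^2 * (tip - s))" .
 moreover have "abs (rho s - rho x) * rho s <= abs (rho s - rho x) * (rho s + rho x)" using r by (intro mult_left_mono) auto
 ultimately have "abs (rho s - rho x) * rho s <= 864 * (abs (s - x) * s^2 * (tip - s))" by linarith
 hence "abs (rho s - rho x) <= 864 * (abs (s - x) * s^2 * (tip - s)) / rho s" using r by (simp add: pos_le_divide_eq)
 thus "abs (rho s - rho x) <= 864 * (abs (s - x) * (mu s * (tip - s)))" by (simp add: mu_def)
 have "abs (x - s) * mu s * (2*tip - x - s) / 2200 <= abs (rho x - rho s)" using s0 by (intro rho_diff_lower) auto
 moreover have "abs (x - s) * mu s * (tip - s) <= abs (x - s) * mu s * (2*tip - x - s)" using m s0 by (intro mult_left_mono) auto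
 ultimately show "abs (s - x) * (mu s * (tip - s)) <= 2200 * abs (rho s - rho x)" by (simp add: abs_minus_commute mult.assoc)
qed

lemma remove_pair: fixes f :: "nat => real" assumes P: "P \<in> pairs n"
 defines "I \<equiv> frees n \<union> fst ` (pairs n - {P}) \<union> snd ` (pairs n - {P})"
 shows "(\<Prod>k\<le>n div 2. f k) = f (fst P) * f (snd P) * (\<Prod>k\<in>I. f k)"
  "(\<Prod>k\<in>{..n div 2} - {fst P}. f k) = f (snd P) * (\<Prod>k\<in>I. f k)"
  "(\<Prod>k\<in>{..n div 2} - {snd P}. f k) = f (fst P) * (\<Prod>k\<in>I. f k)"
proof -
 have ne: "fst P ~= snd P" using pairs_facts(3,4)[OF P] not_inner_outer by metis
 have I: "I = {..n div 2} - {fst P, snd P}"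
 proof -
  have 1: "fst ` (pairs n - {P}) = fst ` pairs n - {fst P}" using inj_on_image_set_diff[OF inj_fst_pairs, of "pairs n" "{P}"] P by auto
  have 2: "snd ` (pairs n - {P}) = snd ` pairs n - {snd P}" using inj_on_image_set_diff[OF inj_snd_pairs, of "pairs n" "{P}"] P by auto
  have 3: "fst P \<notin> frees n" "snd P \<notin> frees n" using pairs_facts(6,7)[OF P] by (auto simp: frees_def)
  have 4: "snd P \<notin> fst ` pairs n" "fst P \<notin> snd ` pairs n"
   using pairs_facts(3,4) P not_inner_outer by (metis imageE)+
  show ?thesis unfolding I_def 1 2 nodes_decomp using 3 4 by auto
 qed
 have m: "fst P \<in> {..n div 2}" "snd P \<in> {..n div 2}" using pairs_facts(1,2)[OF P] by auto
 have a: "(\<Prod>k\<in>{..n div 2} - {fst P}. f k) = f (snd P) * (\<Prod>k\<in>{..n div 2} - {fst P} - {snd P}. f k)"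
  using m ne by (intro prod.remove) auto
 have b: "(\<Prod>k\<in>{..n div 2} - {snd P}. f k) = f (fst P) * (\<Prod>k\<in>{..n div 2} - {snd P} - {fst P}. f k)"
  using m ne by (intro prod.remove) auto
 have i: "{..n div 2} - {fst P} - {snd P} = I" "{..n div 2} - {snd P} - {fst P} = I" using I by auto
 show "(\<Prod>k\<in>{..n div 2} - {fst P}. f k) = f (snd P) * (\<Prod>k\<in>I. f k)" using a i by simp
 show "(\<Prod>k\<in>{..n div 2} - {snd P}. f k) = f (fst P) * (\<Prod>k\<in>I. f k)" using b i by simp
 have "(\<Prod>k\<le>n div 2. f k) = f (fst P) * (\<Prod>k\<in>{..n div 2} - {fst P}. f k)" using m by (intro prod.remove) auto
 thus "(\<Prod>k\<le>n div 2. f k) = f (fst P) * f (snd P) * (\<Prod>k\<in>I. f k)" using a i by simp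
qed

lemma other_hulls: assumes "P \<in> pairs n" "Q \<in> pairs n - {P}" "hl n P <= s" "s <= hu n P"
 shows "s + gap n / 2 <= hl n Q \<or> hu n Q + gap n / 2 <= s"
 using hulls_ordered[of P n Q] assms gap_pos[of n] by auto

lemma in_hull: assumes P: "P \<in> pairs n" and s: "hl n P <= s" "s <= hu n P"
 shows "gap n / 2 <= s" "s <= tip - gap n / 2" "abs (s - raw n (fst P)) <= gap n" "abs (s - raw n (snd P)) <= gap n"
  "abs (s - adj n (fst P)) <= 2 * gap n" "abs (s - adj n (snd P)) <= 2 * gap n"
  "gap n / 2 <= raw n (fst P)" "raw n (fst P) <= tip - gap n / 2" "gap n / 2 <= raw n (snd P)" "raw n (snd P) <= tip - gap n / 2"
proof -
 have g: "gap n > 0" by (rule gap_pos)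
 have P': "(fst P, snd P) \<in> pairs n" using P by simp
 have e: "hl n P = hl n (fst P, snd P)" "hu n P = hu n (fst P, snd P)" by simp_all
 note hf = hull_facts[OF P', folded e]
 note m = matched_tip[OF pairs_facts(5)[OF P]] matched_close[OF pairs_facts(5)[OF P]]
 show "gap n / 2 <= s" "s <= tip - gap n / 2" "abs (s - raw n (fst P)) <= gap n" "abs (s - raw n (snd P)) <= gap n"
  using hf(6-11) s by auto
 thus "abs (s - adj n (fst P)) <= 2 * gap n" "abs (s - adj n (snd P)) <= 2 * gap n"
  using m(9,10) by linarith+
 show "gap n / 2 <= raw n (fst P)" "raw n (fst P) <= tip - gap n / 2" "gap n / 2 <= raw n (snd P)" "raw n (snd P) <= tip - gap n / 2"
  using m(1-4) g by linarith+
qed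

text \<open>Inside a hull the comparison holds for all other pairs, and the two lattice factors
  vanish to first order at \<open>raw n (fst P)\<close> and \<open>raw n (snd P)\<close>. The
  outer one does so with slope of order \<open>s^2\<close>, since \<open>K\<close>
  contracts.\<close>
lemma wst_hull: assumes P: "P \<in> pairs n" and s: "hl n P <= s" "s <= hu n P" "s ~= raw n (fst P)" "s ~= raw n (snd P)"
 shows "wst n s <= exp 6 * 25600 * (864 * 4400)^2 * 160 * s^2"
proof -
 have g: "gap n > 0" by (rule gap_pos)
 note ih = in_hull[OF P s(1,2)]
 note mt = matched_tip[OF pairs_facts(5)[OF P]]
 define a b a' b' N where ab: "a = raw n (fst P)" "b = raw n (snd P)" "a' = adj n (fst P)" "b' = adj n (snd P)" "N = real n + 1"
 have s01: "s \<in> {0..tip}" "0 < s" "s < tip" using ih g by auto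
 define I where "I = frees n \<union> fst ` (pairs n - {P}) \<union> snd ` (pairs n - {P})"
 define Q where "Q = (%r. (\<Prod>k\<in>I. \<bar>rho s - rho (r n k)\<bar>))"
 define R where "R = (\<Prod>k\<in>mirrored n. sqrt (rho s ^ 2 + rho (raw n k) ^ 2))"
 have Q: "Q adj <= Q raw" unfolding Q_def I_def
 proof (rule compare_abs(1)[OF _ _ s01(1)])
  fix Pa assume "Pa \<in> pairs n - {P}"
  thus "s < hl n Pa \<or> hu n Pa < s" using other_hulls[OF P _ s(1,2), of Pa] g by linarith
 qed auto
 have Q0: "0 <= Q adj" unfolding Q_def by (intro prod_nonneg) simp
 have w: "wst n s = abs (rho s - rho a') * abs (rho s - rho b') * Q adj * mir n s"
  unfolding wst_split[OF s01(1)] remove_pair(1)[OF P] ab Q_def I_def ..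
 have np: "node_prod n s = abs (rho s - rho a) * abs (rho s - rho b) * Q raw * R"
  unfolding node_prod_split[OF s01(1)] remove_pair(1)[OF P] ab Q_def I_def R_def ..
 define E where "E = mu s * (tip - s)"
 have E: "0 < E" unfolding E_def mu_def using s01 rho_pos[of s] tip_bounds by simp
 have u: "abs (rho s - rho x) <= 864 * (2 * gap n * E)" "abs (s - y) * E <= 2200 * abs (rho s - rho y)"
  if "gap n / 2 <= x" "x <= tip - gap n / 2" "abs (s - x) <= 2 * gap n" "gap n / 2 <= y" "y <= tip - gap n / 2" "abs (s - y) <= 2 * gap n" for x y
 proof -
  have "abs (rho s - rho x) <= 864 * (abs (s - x) * E)" unfolding E_def by (rule near_bounds(1)[OF g ih(1,2) that(1-3)])
  also have "... <= 864 * (2 * gap n * E)" using that E by (intro mult_left_mono mult_right_mono) auto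
  finally show "abs (rho s - rho x) <= 864 * (2 * gap n * E)" .
  show "abs (s - y) * E <= 2200 * abs (rho s - rho y)" unfolding E_def by (rule near_bounds(2)[OF g ih(1,2) that(4-6)])
 qed
 have cr: "abs (rho s - rho x) * abs (s - y) <= 864 * 4400 * gap n * abs (rho s - rho y)"
  if "gap n / 2 <= x" "x <= tip - gap n / 2" "abs (s - x) <= 2 * gap n" "gap n / 2 <= y" "y <= tip - gap n / 2" "abs (s - y) <= 2 * gap n" for x y
 proof -
  have "abs (rho s - rho x) * abs (s - y) <= 864 * (2 * gap n * E) * abs (s - y)" using u(1)[OF that] by (intro mult_right_mono) auto
  also have "... = 864 * 2 * gap n * (abs (s - y) * E)" by simp
  also have "... <= 864 * 2 * gap n * (2200 * abs (rho s - rho y))" using u(2)[OF that] g by (intro mult_left_mono) auto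
  finally show ?thesis by simp
 qed
 have c1: "abs (rho s - rho a') * abs (s - a) <= 864 * 4400 * gap n * abs (rho s - rho a)"
  and c2: "abs (rho s - rho b') * abs (s - b) <= 864 * 4400 * gap n * abs (rho s - rho b)"
  unfolding ab using ih mt g by (intro cr; linarith)+
 have "wst n s * (abs (s - a) * abs (s - b)) = (abs (rho s - rho a') * abs (s - a)) * (abs (rho s - rho b') * abs (s - b)) * (Q adj * mir n s)"
  unfolding w by (simp add: mult_ac)
 also have "... <= (864 * 4400 * gap n * abs (rho s - rho a)) * (864 * 4400 * gap n * abs (rho s - rho b)) * (Q raw * (exp 6 * R))"
 proof -
  have m: "Q adj * mir n s <= Q raw * (exp 6 * R)"
   by (rule mult_mono[OF Q]) (use mirror_compare(2)[OF s01(1), of n] mir_nonneg Q Q0 in \<open>auto simp: R_def\<close>)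
  have m2: "(abs (rho s - rho a') * abs (s - a)) * (abs (rho s - rho b') * abs (s - b)) <= (864 * 4400 * gap n * abs (rho s - rho a)) * (864 * 4400 * gap n * abs (rho s - rho b))"
   by (rule mult_mono[OF c1 c2]) (use g in \<open>auto intro!: mult_nonneg_nonneg\<close>)
  show ?thesis
   by (rule mult_mono[OF m2 m]) (use g mir_nonneg[of n s] Q0 in \<open>auto intro!: mult_nonneg_nonneg\<close>)
 qed
 also have "... = (864 * 4400 * gap n)^2 * exp 6 * node_prod n s" unfolding np by (simp add: power2_eq_square mult_ac)
 also have "... <= (864 * 4400 * gap n)^2 * exp 6 * (25600 * (DD n s * DD n (K s)))"
  by (intro mult_left_mono node_prod_upper s01) auto
 also have "... <= (864 * 4400 * gap n)^2 * exp 6 * (25600 * ((N / 2 * abs (s - a)) * (N / 2 * (2 * (abs (s - b) * (6 * s)^2)))))"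
 proof -
  have A: "DD n s <= N / 2 * abs (s - a)" unfolding ab using DD_upper[of n s "fst P"] raw_inner[OF pairs_facts(3)[OF P]] by simp
  note of = outer_facts[OF pairs_facts(4)[OF P]]
  have "DD n (K s) <= N / 2 * abs (K s - K b)" unfolding ab of(3) by (rule DD_upper)
  also have "abs (K s - K b) <= 2 * (abs (s - b) * (s + b)^2)" unfolding ab using of s01 by (intro K_diff(2)) auto
  also have "(s + b)^2 <= (6 * s)^2"
  proof -
   have "abs (s - b) <= 2 * gap n" using ih(4) g unfolding ab by linarith
   from near_bounds(3)[OF g ih(1,2) _ _ this] have "b <= 5 * s" using ih unfolding ab by blast
   thus ?thesis using s01 of unfolding ab by (intro power_mono) auto
  qed
  finally have B: "DD n (K s) <= N / 2 * (2 * (abs (s - b) * (6 * s)^2))" unfolding ab by (simp add: mult_left_mono)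
  show ?thesis by (intro mult_left_mono mult_mono A B DD_bounds) (auto simp: ab)
 qed
 also have "... = exp 6 * 25600 * (864 * 4400)^2 * 18 * (gap n * N)^2 * s^2 * (abs (s - a) * abs (s - b))"
  by (simp add: power2_eq_square)
 finally have "wst n s * (abs (s - a) * abs (s - b)) <= exp 6 * 25600 * (864 * 4400)^2 * 18 * (gap n * N)^2 * s^2 * (abs (s - a) * abs (s - b))" .
 moreover have "0 < abs (s - a) * abs (s - b)" using s unfolding ab by simp
 ultimately have "wst n s <= exp 6 * 25600 * (864 * 4400)^2 * 18 * (gap n * N)^2 * s^2" by (rule mult_right_le_imp_le)
 also have "... <= exp 6 * 25600 * (864 * 4400)^2 * 18 * (80/9) * s^2"
 proof -
  have "tip ^ 2 <= 2.1 ^ 2" using tip_bounds by (intro power_mono) auto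
  hence "(gap n * N)^2 <= 80/9" unfolding ab gap_N by (simp add: power2_eq_square)
  thus ?thesis by (intro mult_right_mono mult_left_mono) auto
 qed
 finally show ?thesis by simp
qed

lemma wst_upper: "\<exists>C>0. \<forall>n s. 0 < s \<and> s < tip \<and> s \<notin> raw n ` {..n div 2} --> wst n s <= C * (DD n (K s) + s^2) \<and> wst n s <= C"
proof -
 define C where "C = exp 6 * 25600 * (864 * 4400)^2 * (160::real)"
 have C: "0 < C" by (simp add: C_def)
 have *: "wst n s <= C * (DD n (K s) + s^2)" if s: "0 < s" "s < tip" "s \<notin> raw n ` {..n div 2}" for n s
 proof (cases "\<exists>P\<in>pairs n. hl n P <= s \<and> s <= hu n P")
  case True
  then obtain P where P: "P \<in> pairs n" "hl n P <= s" "s <= hu n P" by blast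
  have "s ~= raw n (fst P)" "s ~= raw n (snd P)" using s(3) pairs_facts(1,2)[OF P(1)] by auto
  from wst_hull[OF P this] have "wst n s <= C * s^2" by (simp add: C_def)
  also have "... <= C * (DD n (K s) + s^2)" using C DD_bounds[of n "K s"] by (intro mult_left_mono) auto
  finally show ?thesis .
 next
  case False
  have "wst n s <= exp 6 * node_prod n s" using s False by (intro wst_upper_out) force+
  also have "... <= exp 6 * (25600 * (DD n s * DD n (K s)))" using s by (intro mult_left_mono node_prod_upper) auto
  also have "... <= exp 6 * (25600 * (1 * DD n (K s)))" using DD_bounds by (intro mult_left_mono mult_right_mono) auto
  also have "... = (exp 6 * 25600) * DD n (K s)" by simp
  also have "... <= C * (DD n (K s) + s^2)" using DD_bounds[of n "K s"] by (intro mult_mono) (auto simp: C_def)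
  finally show ?thesis .
 qed
 have **: "wst n s <= 6 * C" if s: "0 < s" "s < tip" "s \<notin> raw n ` {..n div 2}" for n s
 proof -
  have "s^2 <= 2.1^2" using s tip_bounds by (intro power_mono) auto
  hence "DD n (K s) + s^2 <= 6" using DD_bounds(2)[of n "K s"] by (simp add: power2_eq_square)
  hence "C * (DD n (K s) + s^2) <= C * 6" using C by (intro mult_left_mono) auto
  thus ?thesis using *[OF s] by simp
 qed
 have "wst n s <= 6 * C * (DD n (K s) + s^2)" if s: "0 < s" "s < tip" "s \<notin> raw n ` {..n div 2}" for n s
 proof -
  have "0 <= DD n (K s) + s^2" using DD_bounds(1)[of n "K s"] by simp
  hence "0 <= C * (DD n (K s) + s^2)" using C by simp
  thus ?thesis using *[OF s] by linarith
 qed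
 thus ?thesis using C ** by (intro exI[of _ "6 * C"]) auto
qed

section \<open>The derivative of the nodal product\<close>

text \<open>The product of the distances to all nodes except the \<open>i\<close>-th; at the node
  itself it is the absolute derivative of the nodal polynomial.\<close>
definition vv :: "nat => nat => real => real" where
 "vv n i s = (\<Prod>k\<in>{..n div 2} - {i}. \<bar>rho s - rho (adj n k)\<bar>) * mir n s"

text \<open>An inner node \<open>x\<close> close to a folded outer node \<open>b\<close> has a
  small derivative of the nodal product, because \<open>K x\<close> is close to the lattice. The
  term for \<open>b\<close> bounds this effect; the cut-off at \<open>gap n\<close> lets the same
  sum serve outer nodes and matched pairs.\<close>
definition HH :: "nat => real => real" where
 "HH n x = (\<Sum>k | outer_node n k. 3 * gap n / (raw n k ^ 2 * max \<bar>x - raw n k\<bar> (gap n)))"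

lemma finite_outer: "finite {k. outer_node n k}"
 by (rule finite_subset[of _ "{..n div 2}"]) (auto simp: outer_node_def)

lemma HH_term: assumes "outer_node n k" shows "3 * gap n / (raw n k ^ 2 * max \<bar>x - raw n k\<bar> (gap n)) <= HH n x"
 unfolding HH_def using assms finite_outer gap_pos[of n]
 by (intro member_le_sum) (auto intro!: divide_nonneg_nonneg mult_nonneg_nonneg simp: le_max_iff_disj)

lemma HH_nonneg: "0 <= HH n x"
 unfolding HH_def using gap_pos[of n]
 by (intro sum_nonneg divide_nonneg_nonneg mult_nonneg_nonneg) (auto simp: le_max_iff_disj)

lemma vv_wst: assumes "s \<in> {0..tip}" "i <= n div 2"
 shows "wst n s = abs (rho s - rho (adj n i)) * vv n i s"
 unfolding wst_split[OF assms(1)] vv_def using assms(2) by (subst prod.remove[of _ i]) (auto simp: mult.assoc)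

lemma vv_nonneg: "0 <= vv n i s" unfolding vv_def by (intro mult_nonneg_nonneg prod_nonneg mir_nonneg) simp

lemma continuous_on_vv: "continuous_on A (vv n i)"
 unfolding vv_def mir_def by (intro continuous_intros continuous_on_rho)

lemma continuous_on_DD: "continuous_on A (DD n)"
 unfolding DD_def[abs_def] by (cases "even n") (auto intro!: continuous_intros)

lemma continuous_on_DDK: "continuous_on {0..tip} (%s. DD n (K s))"
proof (rule continuous_on_compose2[OF continuous_on_DD[of UNIV] continuous_on_K])
qed auto

text \<open>Bounds at the nodes are limits of bounds at points where the nodal product does not
  vanish.\<close>
lemma limit_le: fixes f g :: "real => real"
 assumes f: "continuous_on {0..tip} f" and g: "continuous_on {0..tip} g" and p: "0 < p" "p <= tip" and d: "0 < d"
  and le: "\<And>s. 0 < s ==> p - d < s ==> s < p ==> f s <= g s"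
 shows "f p <= g p"
proof -
 define a where "a = max 0 (p - d)"
 have a: "a < p" "0 <= a" using p d by (auto simp: a_def)
 have nt: "\<not> trivial_limit (at p within {a<..<p})"
  unfolding trivial_limit_within using islimpt_greaterThanLessThan2[OF a(1)] by simp
 have sub: "{a<..<p} \<subseteq> {0..tip}" using a p by auto
 have pin: "p \<in> {0..tip}" using p by simp
 have "(f \<longlongrightarrow> f p) (at p within {a<..<p})" "(g \<longlongrightarrow> g p) (at p within {a<..<p})"
  using f g pin sub by (auto simp: continuous_on_def intro: tendsto_within_subset)
 moreover have "eventually (%s. f s <= g s) (at p within {a<..<p})"
  unfolding eventually_at_filter using le a by (intro always_eventually) (auto simp: a_def)
 ultimately show ?thesis using tendsto_le[OF nt] by blast
qed

lemma free_far: assumes i: "i <= n div 2" "free n i" and P: "P \<in> pairs n" and s: "abs (s - raw n i) <= gap n"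
 shows "s + gap n / 2 <= hl n P \<or> hu n P + gap n / 2 <= s"
proof -
 have g: "gap n > 0" by (rule gap_pos)
 have P': "(fst P, snd P) \<in> pairs n" using P by simp
 have e: "hl n P = hl n (fst P, snd P)" "hu n P = hu n (fst P, snd P)" by simp_all
 note hf = hull_facts(6-9)[OF P', folded e]
 have "3 * gap n <= abs (raw n i - raw n (fst P)) \<or> 3 * gap n <= abs (raw n i - raw n (snd P))"
 proof (cases "inner_node n i")
  case True
  have "i ~= fst P" using i pairs_facts(6)[OF P] by auto
  thus ?thesis using raw_inner_sep[OF True pairs_facts(3)[OF P]] by simp
 next
  case False
  hence "outer_node n i" using inner_or_outer i by blast
  moreover have "i ~= snd P" using i pairs_facts(7)[OF P] by auto
  ultimately show ?thesis using raw_outer_sep[OF _ pairs_facts(4)[OF P]] by simp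
 qed
 thus ?thesis using hf s g by linarith
qed

lemma lo_raw: assumes "i <= n div 2" "lo_idx n <= i" shows "3/2 * gap n <= raw n i"
 using inner_or_outer[OF assms(1)] theta_upper_range(3)[OF assms] outer_facts(4)[of n i] gap_pi[of n] raw_inner[of n i] by auto

lemma vv_near_free:
 assumes i: "i <= n div 2" "lo_idx n <= i" "free n i" and s: "0 < s" "s < tip" "abs (s - raw n i) <= gap n / 2"
 shows "exp (-17606) / 14112 * (DD n s * DD n (K s)) <= abs (rho s - rho (raw n i)) * vv n i s"
  "abs (rho s - rho (raw n i)) * vv n i s <= exp 6 * 25600 * (DD n s * DD n (K s))"
proof -
 have g: "gap n > 0" by (rule gap_pos)
 have s01: "s \<in> {0..tip}" using s by simp
 have pr: "adj n i = raw n i" using i by (intro adjusted_free)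
 have far: "s + gap n / 2 <= hl n P \<or> hu n P + gap n / 2 <= s" if "P \<in> pairs n" for P
  using free_far[OF i(1,3) that, of s] s g by simp
 have "gap n <= s" using lo_raw[OF i(1,2)] s by linarith
 hence "gap n * NN n <= s * NN n" by (intro mult_right_mono) auto
 hence "1 <= NN n * s" using tip_bounds unfolding gap_N by (simp add: mult.commute)
 hence "DD n s * DD n (K s) / 14112 <= node_prod n s" by (rule node_prod_lower[OF s(1,2)])
 hence "exp (-17606) * (DD n s * DD n (K s) / 14112) <= exp (-17606) * node_prod n s" by (intro mult_left_mono) auto
 also have "... <= wst n s" by (rule wst_lower_far[OF s01 far])
 finally show "exp (-17606) / 14112 * (DD n s * DD n (K s)) <= abs (rho s - rho (raw n i)) * vv n i s"
  unfolding vv_wst[OF s01 i(1)] pr by simp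
 have "s < hl n P \<or> hu n P < s" if "P \<in> pairs n" for P using far[OF that] g by linarith
 hence "wst n s <= exp 6 * node_prod n s" by (rule wst_upper_out[OF s01])
 also have "... <= exp 6 * (25600 * (DD n s * DD n (K s)))" by (intro mult_left_mono node_prod_upper s) auto
 finally show "abs (rho s - rho (raw n i)) * vv n i s <= exp 6 * 25600 * (DD n s * DD n (K s))"
  unfolding vv_wst[OF s01 i(1)] pr by simp
qed

lemma rho_slope: assumes "s \<in> {0..tip}" "p \<in> {0..tip}" "\<bar>rho s - rho p\<bar> * v \<ge> \<bar>s - p\<bar> * w" "s ~= p" "0 <= v"
 shows "w * (rho s + rho p) <= v * (4 * ((s + p)^2 * (2*tip - s - p)))"
proof -
 have "abs (s - p) * (w * (rho s + rho p)) <= abs (rho s - rho p) * v * (rho s + rho p)"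
  using mult_right_mono[OF assms(3), of "rho s + rho p"] rho_ge_0[OF assms(1)] rho_ge_0[OF assms(2)] by (simp add: mult_ac)
 also have "... = v * (abs (rho s - rho p) * (rho s + rho p))" by simp
 also have "... <= v * (4 * (abs (s - p) * (s + p)^2 * (2*tip - s - p)))" by (intro mult_left_mono rho_diff_upper assms)
 finally have "abs (s - p) * (w * (rho s + rho p)) <= abs (s - p) * (v * (4 * ((s + p)^2 * (2*tip - s - p))))" by (simp add: mult_ac)
 thus ?thesis using assms(4) by simp
qed

definition cc :: real where "cc = exp (-17606) / 14112"
lemma cc_pos: "0 < cc" by (simp add: cc_def)

text \<open>Near the node the factor \<open>DD n s\<close> is linear and cancels against
  \<open>rho s - rho p\<close>; \<open>DD n (K p)\<close> remains. At the tip the two sides of the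
  arc meet, and both factors are linear.\<close>
lemma vv_inner_lower:
 assumes i: "inner_node n i" "lo_idx n <= i" "free n i" and p: "p = raw n i"
 shows "cc * NN n * DD n (K p) * rho p <= 64 * (vv n i p * (p^2 * (tip - p)))"
  "p = tip ==> cc * NN n^2 * rho p <= 31104 * (vv n i p * p^2)"
proof -
 have i1: "i <= n div 2" using i by (simp add: inner_node_def)
 have g: "gap n > 0" by (rule gap_pos)
 have pp: "3/2 * gap n <= p" "p <= tip" "0 < p" using lo_raw[OF i1 i(2)] raw_range[OF i1] g p by auto
 have a: "cc * (NN n / 4 * DD n (K s)) * (rho s + rho p) <= vv n i s * (4 * ((s + p)^2 * (2*tip - s - p)))"
  if s: "0 < s" "p - gap n / 2 < s" "s < p" for s
 proof -
  have s': "s < tip" "abs (s - raw n i) <= gap n / 2" using s pp p by auto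
  have "abs (s - thu n i) <= pi / NN n" using s' g unfolding gap_pi raw_inner[OF i(1)] by linarith
  hence "NN n / 4 * abs (s - thu n i) <= DD n s" by (rule DD_lower)
  hence "cc * (NN n / 4 * abs (s - p) * DD n (K s)) <= cc * (DD n s * DD n (K s))"
   using DD_bounds(1)[of n "K s"] cc_pos unfolding p raw_inner[OF i(1)] by (intro mult_left_mono mult_right_mono) auto
  also have "... <= abs (rho s - rho p) * vv n i s" unfolding cc_def p by (rule vv_near_free(1)[OF i1 i(2,3) s(1) s'])
  finally have "abs (s - p) * (cc * (NN n / 4 * DD n (K s))) <= abs (rho s - rho p) * vv n i s" by (simp add: mult_ac)
  thus ?thesis using s pp by (intro rho_slope vv_nonneg) auto
 qed
 have "cc * (NN n / 4 * DD n (K p)) * (rho p + rho p) <= vv n i p * (4 * ((p + p)^2 * (2*tip - p - p)))"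
  by (rule limit_le[where d = "gap n / 2", OF _ _ pp(3,2) _ a])
    (use g in \<open>auto intro!: continuous_intros continuous_on_DDK continuous_on_rho continuous_on_vv\<close>)
 moreover have e: "c * (N / 4 * D) * (r + r) = (c * N * D * r) / 2" "v * (4 * ((p + p)^2 * (2*tip - p - p))) = 32 * (v * (p^2 * (tip - p)))" for c N D r v :: real
  by (simp_all add: power2_eq_square algebra_simps)
 ultimately have "(cc * NN n * DD n (K p) * rho p) / 2 <= 32 * (vv n i p * (p^2 * (tip - p)))" by (simp only: e)
 thus "cc * NN n * DD n (K p) * rho p <= 64 * (vv n i p * (p^2 * (tip - p)))" by linarith
 assume t: "p = tip"
 have b: "cc * (NN n / 4 * (NN n / 4 * ((s + p)^2 / 648))) * (rho s + rho p) <= vv n i s * (4 * (s + p)^2)"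
  if s: "0 < s" "p - gap n / 2 < s" "s < p" for s
 proof -
  have Kp: "K p = thu n i" using t p raw_inner[OF i(1)] by simp
  have pin: "p \<in> {0..tip}" "s \<in> {0..tip}" using s pp by auto
  have k1: "abs (K s - K p) <= abs (s - p)" "abs (s - p) * (s + p)^2 / 648 <= abs (K s - K p)"
   by (rule K_diff(1)[OF pin]) (rule K_diff(3)[OF pin])
  have "NN n / 4 * abs (K s - thu n i) <= DD n (K s)"
   using k1(1) s g unfolding Kp by (intro DD_lower) (simp add: gap_pi)
  moreover have "NN n / 4 * ((p - s) * (s + p)^2 / 648) <= NN n / 4 * abs (K s - thu n i)"
   using k1(2) s unfolding Kp by (intro mult_left_mono) auto
  ultimately have D: "NN n / 4 * ((p - s) * (s + p)^2 / 648) <= DD n (K s)" by linarith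
  have r: "0 <= rho s + rho p" using rho_ge_0[of s] rho_ge_0[of p] s pp by auto
  have "cc * (NN n / 4 * (NN n / 4 * ((p - s) * (s + p)^2 / 648))) * (rho s + rho p) <= cc * (NN n / 4 * DD n (K s)) * (rho s + rho p)"
   using D cc_pos r by (intro mult_right_mono mult_left_mono) auto
  also have "... <= vv n i s * (4 * ((s + p)^2 * (2*tip - s - p)))" by (rule a[OF s])
  also have "2*tip - s - p = p - s" using t by simp
  finally have "(p - s) * (cc * (NN n / 4 * (NN n / 4 * ((s + p)^2 / 648))) * (rho s + rho p)) <= (p - s) * (vv n i s * (4 * (s + p)^2))"
   by (simp add: mult_ac)
  thus ?thesis using s by simp
 qed
 have "cc * (NN n / 4 * (NN n / 4 * ((p + p)^2 / 648))) * (rho p + rho p) <= vv n i p * (4 * (p + p)^2)"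
  by (rule limit_le[where d = "gap n / 2", OF _ _ pp(3,2) _ b])
    (use g in \<open>auto intro!: continuous_intros continuous_on_rho continuous_on_vv\<close>)
 moreover have e2: "c * (N / 4 * (N / 4 * ((p + p)^2 / 648))) * (r + r) = p^2 * (c * N^2 * r) / 1296" "v * (4 * (p + p)^2) = 16 * (v * p^2)" for c N r v :: real
  by (simp_all add: power2_eq_square)
 ultimately have "p^2 * (cc * NN n^2 * rho p) / 1296 <= 16 * (vv n i p * p^2)" by (simp only: e2)
 hence "p^2 * (cc * NN n^2 * rho p) <= 20736 * (vv n i p * p^2)" by linarith
 moreover have "1 * (cc * NN n^2 * rho p) <= p^2 * (cc * NN n^2 * rho p)"
  using rho_ge_0[of p] pp cc_pos t tip_bounds by (intro mult_right_mono) auto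
 moreover have "0 <= vv n i p * p^2" using vv_nonneg by simp
 ultimately show "cc * NN n^2 * rho p <= 31104 * (vv n i p * p^2)" by linarith
qed

lemma vv_outer_lower:
 assumes i: "outer_node n i" "free n i" and p: "p = raw n i"
 shows "cc * NN n * DD n p * rho p <= 10368 * (vv n i p * (tip - p))"
proof -
 have i1: "i <= n div 2" using i by (simp add: outer_node_def)
 have lo: "lo_idx n <= i" using i adjusted_0(3) not_inner_outer by (auto simp: lo_idx not_less_eq_eq) (metis One_nat_def Suc_leI not_gr_zero)
 have g: "gap n > 0" by (rule gap_pos)
 note of = outer_facts[OF i(1), folded p]
 have pp: "p <= tip" "0 < p" using of g by auto
 have a: "cc * (NN n / 4 * DD n s / 648) * (rho s + rho p) <= vv n i s * (4 * (2*tip - s - p))"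
  if s: "0 < s" "p - gap n / 2 < s" "s < p" for s
 proof -
  have s': "s < tip" "abs (s - raw n i) <= gap n / 2" using s pp p by auto
  have pin: "p \<in> {0..tip}" "s \<in> {0..tip}" using s pp by auto
  have k1: "abs (K s - K p) <= abs (s - p)" "abs (s - p) * (s + p)^2 / 648 <= abs (K s - K p)"
   by (rule K_diff(1)[OF pin]) (rule K_diff(3)[OF pin])
  have "NN n / 4 * abs (K s - thu n i) <= DD n (K s)"
   using k1(1) s g unfolding of(3) by (intro DD_lower) (simp add: gap_pi)
  moreover have "NN n / 4 * (abs (s - p) * (s + p)^2 / 648) <= NN n / 4 * abs (K s - thu n i)"
   using k1(2) s unfolding of(3) by (intro mult_left_mono) auto
  ultimately have D: "NN n / 4 * (abs (s - p) * (s + p)^2 / 648) <= DD n (K s)" by linarith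
  have "cc * (DD n s * (NN n / 4 * (abs (s - p) * (s + p)^2 / 648))) <= cc * (DD n s * DD n (K s))"
   using D cc_pos DD_bounds(1)[of n s] by (intro mult_left_mono) auto
  also have "... <= abs (rho s - rho p) * vv n i s" unfolding cc_def p by (rule vv_near_free(1)[OF i1 lo i(2) s(1) s'])
  finally have "abs (s - p) * (cc * (DD n s * (NN n / 4 * ((s + p)^2 / 648)))) <= abs (rho s - rho p) * vv n i s" by (simp add: mult_ac)
  hence "cc * (DD n s * (NN n / 4 * ((s + p)^2 / 648))) * (rho s + rho p) <= vv n i s * (4 * ((s + p)^2 * (2*tip - s - p)))"
   using s pp by (intro rho_slope vv_nonneg) auto
  moreover have e: "c * (D * (M * (Q / 648))) * r = Q * (c * (M * D / 648) * r)" "v * (4 * (Q * w)) = Q * (v * (4 * w))" for c D M Q r v w :: real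
   by simp_all
  ultimately have "(s + p)^2 * (cc * (NN n / 4 * DD n s / 648) * (rho s + rho p)) <= (s + p)^2 * (vv n i s * (4 * (2*tip - s - p)))"
   by (simp only: e)
  moreover have "0 < (s + p)^2" using s pp by simp
  ultimately show ?thesis by (rule mult_left_le_imp_le)
 qed
 have "cc * (NN n / 4 * DD n p / 648) * (rho p + rho p) <= vv n i p * (4 * (2*tip - p - p))"
  by (rule limit_le[where d = "gap n / 2", OF _ _ pp(2,1) _ a])
    (use g in \<open>auto intro!: continuous_intros continuous_on_DD continuous_on_rho continuous_on_vv\<close>)
 moreover have e: "c * (N / 4 * D / 648) * (r + r) = (c * N * D * r) / 1296" "v * (4 * (2*tip - p - p)) = 8 * (v * (tip - p))" for c N D r v :: real
  by (simp_all add: algebra_simps)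
 ultimately have "(cc * NN n * DD n p * rho p) / 1296 <= 8 * (vv n i p * (tip - p))" by (simp only: e)
 thus ?thesis by linarith
qed

text \<open>An adjusted node is no zero of the unadjusted product, which can therefore be
  evaluated there directly.\<close>
lemma vv_matched_lower:
 assumes P: "P \<in> pairs n" and i: "i = fst P \<or> i = snd P" and p: "p = adj n i"
 shows "cc * NN n * p^2 <= 864^2 * 2200 * 648 * 16 * (vv n i p * (mu p * (tip - p)))"
proof -
 have g: "gap n > 0" by (rule gap_pos)
 have hp: "hl n P <= p" "p <= hu n P" using i p by (auto simp: hl_def hu_def case_prod_beta)
 note ih = in_hull[OF P hp]
 note mt = matched_tip[OF pairs_facts(5)[OF P]]
 note mc = matched_close[OF pairs_facts(5)[OF P]]
 define a b q N where ab: "a = raw n (fst P)" "b = raw n (snd P)" "q = adj n (if i = fst P then snd P else fst P)" "N = real n + 1"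
 have ne: "fst P ~= snd P" using pairs_facts(3,4)[OF P] not_inner_outer by metis
 have pab: "p ~= a" "p ~= b" "gap n <= abs (p - q)" "abs (p - q) <= 2 * gap n" "gap n / 2 <= q" "q <= tip - gap n / 2"
 proof -
  show "p ~= a" using i p mc(3,4,5) g unfolding ab by auto
  show "p ~= b" using i p mc(3,4,6) g unfolding ab by auto
  show "gap n <= abs (p - q)" using i p mc(7) ne unfolding ab by (auto simp: abs_minus_commute)
  show "abs (p - q) <= 2 * gap n" using i ih(5,6) ne unfolding ab by auto
  show "gap n / 2 <= q" "q <= tip - gap n / 2" using i ne mt unfolding ab by auto
 qed
 have s01: "p \<in> {0..tip}" "0 < p" "p < tip" using ih g by auto
 define I where "I = frees n \<union> fst ` (pairs n - {P}) \<union> snd ` (pairs n - {P})"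
 define Q where "Q = (%r. (\<Prod>k\<in>I. \<bar>rho p - rho (r n k)\<bar>))"
 define R where "R = (\<Prod>k\<in>mirrored n. sqrt (rho p ^ 2 + rho (raw n k) ^ 2))"
 have Q: "exp (-17600) * Q raw <= Q adj" unfolding Q_def I_def
  by (rule compare_abs(2)[OF _ _ s01(1)]) (use other_hulls[OF P _ hp] in auto)
 have Q0: "0 <= Q raw" unfolding Q_def by (intro prod_nonneg) simp
 have v: "vv n i p = abs (rho p - rho q) * Q adj * mir n p"
  unfolding vv_def Q_def I_def ab using i ne remove_pair(2,3)[OF P] by (auto simp: remove_pair(2,3)[OF P])
 have np: "node_prod n p = abs (rho p - rho a) * abs (rho p - rho b) * Q raw * R"
  unfolding node_prod_split[OF s01(1)] remove_pair(1)[OF P] ab Q_def I_def R_def ..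
 define E where "E = mu p * (tip - p)"
 have E: "0 < E" unfolding E_def mu_def using s01 rho_pos[of p] tip_bounds by simp
 have u1: "abs (rho p - rho a) <= 864 * (abs (p - a) * E)" and u2: "abs (rho p - rho b) <= 864 * (abs (p - b) * E)"
  unfolding E_def ab using ih g by (intro near_bounds(1)[OF g]; linarith)+
 have "gap n * E <= abs (p - q) * E" using pab E by (intro mult_right_mono) auto
 also have "... <= 2200 * abs (rho p - rho q)" unfolding E_def using ih pab by (intro near_bounds(2)[OF g]) auto
 finally have u3: "gap n * E <= 2200 * abs (rho p - rho q)" .
 have D: "cc * ((N/4 * abs (p - a)) * (N/4 * (abs (p - b) * p^2 / 648))) <= exp (-17606) * node_prod n p"
 proof -
  have A: "N/4 * abs (p - a) <= DD n p" unfolding ab raw_inner[OF pairs_facts(3)[OF P]]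
   using ih(3) g unfolding raw_inner[OF pairs_facts(3)[OF P]] by (intro DD_lower) (simp add: gap_pi)
  note of = outer_facts[OF pairs_facts(4)[OF P]]
  have pin: "b \<in> {0..tip}" "p \<in> {0..tip}" unfolding ab using of s01 by auto
  have kd: "abs (K p - K b) <= abs (p - b)" "abs (p - b) * (p + b)^2 / 648 <= abs (K p - K b)"
   by (rule K_diff(1)[OF pin]) (rule K_diff(3)[OF pin])
  have "N/4 * abs (K p - K b) <= DD n (K p)" unfolding ab of(3)
   using kd(1) ih(4) g unfolding ab of(3) by (intro DD_lower) (simp add: gap_pi)
  moreover have "abs (p - b) * p^2 / 648 <= abs (p - b) * (p + b)^2 / 648"
   using s01 of unfolding ab by (intro divide_right_mono mult_left_mono power_mono) auto
  hence "N/4 * (abs (p - b) * p^2 / 648) <= N/4 * abs (K p - K b)" using kd(2) unfolding ab by (intro mult_left_mono) auto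
  ultimately have B: "N/4 * (abs (p - b) * p^2 / 648) <= DD n (K p)" by linarith
  have "gap n / 2 * NN n <= p * NN n" using ih by (intro mult_right_mono) auto
  hence "1 <= NN n * p" using tip_bounds gap_N[of n] by (simp add: mult.commute)
  from node_prod_lower[OF s01(2,3) this] have np: "DD n p * DD n (K p) / 14112 <= node_prod n p" .
  have "(N/4 * abs (p - a)) * (N/4 * (abs (p - b) * p^2 / 648)) <= DD n p * DD n (K p)"
   by (rule mult_mono[OF A B DD_bounds(1)]) (simp add: ab)
  hence "cc * ((N/4 * abs (p - a)) * (N/4 * (abs (p - b) * p^2 / 648))) <= cc * (DD n p * DD n (K p))"
   using cc_pos by (intro mult_left_mono) auto
  also have "... = exp (-17606) * (DD n p * DD n (K p) / 14112)" by (simp add: cc_def)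
  also have "... <= exp (-17606) * node_prod n p" using np by (intro mult_left_mono) auto
  finally show ?thesis .
 qed
 have e6: "exp (-17606) = exp (-17600) * exp (-6 :: real)" by (simp add: exp_add[symmetric])
 have R0: "0 <= R" and Rm: "exp (-6) * R <= mir n p" using mirror_compare(1,3)[OF s01(1), of n] unfolding R_def by auto
 have "exp (-17606) * node_prod n p = (abs (rho p - rho a) * abs (rho p - rho b)) * ((exp (-17600) * Q raw) * (exp (-6) * R))"
  unfolding np e6 by (simp add: mult_ac)
 also have "... <= ((864 * (abs (p - a) * E)) * (864 * (abs (p - b) * E))) * (Q adj * mir n p)"
 proof (rule mult_mono)
  show "abs (rho p - rho a) * abs (rho p - rho b) <= (864 * (abs (p - a) * E)) * (864 * (abs (p - b) * E))"
   by (rule mult_mono[OF u1 u2]) (use E in auto)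
  have "0 <= Q adj" unfolding Q_def by (intro prod_nonneg) simp
  thus "(exp (-17600) * Q raw) * (exp (-6) * R) <= Q adj * mir n p"
   by (intro mult_mono[OF Q Rm]) (use R0 in auto)
 qed (use E Q0 R0 in auto)
 finally have X: "cc * ((N/4 * abs (p - a)) * (N/4 * (abs (p - b) * p^2 / 648))) <= ((864 * (abs (p - a) * E)) * (864 * (abs (p - b) * E))) * (Q adj * mir n p)"
  using D by linarith
 have "(abs (p - a) * abs (p - b)) * (cc * N^2 * p^2 / (16 * 648)) <= (abs (p - a) * abs (p - b)) * (864^2 * E^2 * (Q adj * mir n p))"
 proof -
  have e: "c * ((N/4 * x) * (N/4 * (y * z / 648))) = (x * y) * (c * N^2 * z / (16 * 648))"
   "((864 * (x * E)) * (864 * (y * E))) * z = (x * y) * (864^2 * E^2 * z)" for c x y z :: real by (simp_all add: power2_eq_square)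
  show ?thesis using X by (simp only: e)
 qed
 moreover have "0 < abs (p - a) * abs (p - b)" using pab by simp
 ultimately have Y: "cc * N^2 * p^2 / (16 * 648) <= 864^2 * E^2 * (Q adj * mir n p)" by (rule mult_left_le_imp_le)
 have z: "0 <= Q adj * mir n p" unfolding Q_def by (intro mult_nonneg_nonneg prod_nonneg mir_nonneg) simp
 have "gap n * (cc * N^2 * p^2 / (16 * 648)) <= gap n * (864^2 * E^2 * (Q adj * mir n p))" using Y g by (intro mult_left_mono) auto
 also have "... = (864^2 * E * (Q adj * mir n p)) * (gap n * E)" by (simp add: power2_eq_square)
 also have "... <= (864^2 * E * (Q adj * mir n p)) * (2200 * abs (rho p - rho q))" using u3 z E by (intro mult_left_mono) auto
 also have "... = 864^2 * 2200 * (vv n i p * E)" unfolding v by simp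
 finally have "(gap n * N) * (cc * N * p^2) <= 864^2 * 2200 * 648 * 16 * (vv n i p * E)" by (simp add: power2_eq_square mult_ac)
 moreover have "1 * (cc * N * p^2) <= (gap n * N) * (cc * N * p^2)" unfolding ab gap_N using tip_bounds cc_pos by (intro mult_right_mono) auto
 ultimately show ?thesis unfolding ab E_def by linarith
qed

lemma nearest_lattice: assumes "0 <= x" "x < pi"
 obtains k where "k <= n div 2" "abs (x - thu n k) <= pi / NN n"
proof -
 define N where "N = real n + 1"
 have N: "N > 0" by (simp add: N_def)
 define e :: real where "e = (if even n then 1/2 else 0)"
 define h where "h = 2 * pi / N"
 have h: "h > 0" using N by (simp add: h_def)
 have hN: "h * N = 2 * pi" using N by (simp add: h_def)
 define k where "k = nat \<lfloor>x / h + e\<rfloor>"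
 have nn: "0 <= x / h + e" using assms h by (simp add: e_def)
 hence k: "real k <= x / h + e" "x / h + e < real k + 1" unfolding k_def by linarith+
 have th: "thu n k = (real k + 1/2 - e) * h"
  unfolding theta_upper_def h_def e_def N_def[symmetric] using N by (simp add: algebra_simps add_divide_distrib)
 have xh: "x / h * h = x" using h by simp
 have "(x / h - (real k + 1/2 - e)) * h = x - thu n k" unfolding th left_diff_distrib xh ..
 moreover have "abs (x / h - (real k + 1/2 - e)) <= 1/2" using k by linarith
 hence "abs (x / h - (real k + 1/2 - e)) * h <= 1/2 * h" using h by (intro mult_right_mono) auto
 moreover have "abs ((x / h - (real k + 1/2 - e)) * h) = abs (x / h - (real k + 1/2 - e)) * h" using h by (simp add: abs_mult)
 ultimately have "abs (x - thu n k) <= h / 2" by simp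
 moreover have "h / 2 = pi / NN n" by (simp add: h_def N_def[symmetric])
 ultimately have 2: "abs (x - thu n k) <= pi / NN n" by simp
 have "x < N / 2 * h" using assms hN by (simp add: mult.commute)
 hence "x / h < N / 2" using h by (simp add: pos_divide_less_eq)
 hence kN: "real k < N / 2 + e" using k by linarith
 have "k <= n div 2"
 proof (cases "even n")
  case True
  then obtain b where b: "n = 2 * b" by blast
  have "real k < real b + 1" using kN b by (simp add: N_def e_def add_divide_distrib)
  thus ?thesis using b by simp
 next
  case False
  then obtain b where b: "n = 2 * b + 1" by (rule oddE)
  have "real k < real b + 1" using kN b by (simp add: N_def e_def add_divide_distrib)
  thus ?thesis using b by simp
 qed
 thus ?thesis using 2 that by blast
qed

text \<open>A lower bound for the derivative \<open>v\<close> at the node \<open>p\<close>, in the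
  form in which the slope of \<open>rho\<close> cancels later.\<close>
definition Vok :: "real => nat => real => real => bool" where
 "Vok C n v p \<longleftrightarrow> 1 <= C * (v * mu p * ((tip - p) * HH n p / NN n + 1 / NN n^2))"

lemma Vok_intro:
 assumes v: "0 <= v" and p: "0 < p" "p <= tip" and C: "0 <= c" "c <= C"
  and e: "1 <= c * (v * mu p * ((tip - p) * HH n p / NN n)) \<or> 1 <= c * (v * mu p / NN n^2)"
 shows "Vok C n v p"
proof -
 have m: "0 <= mu p" using rho_ge_0[of p] p by (simp add: mu_def)
 have a: "0 <= (tip - p) * HH n p / NN n" using p HH_nonneg by simp
 define A where "A = v * mu p"
 have A: "0 <= A" using v m by (simp add: A_def)
 have "1 <= c * (A * ((tip - p) * HH n p / NN n + 1 / NN n^2))"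
 proof (rule disjE[OF e[folded A_def]])
  assume "1 <= c * (A * ((tip - p) * HH n p / NN n))"
  also have "... <= c * (A * ((tip - p) * HH n p / NN n + 1 / NN n^2))" using C A by (intro mult_left_mono) auto
  finally show ?thesis .
 next
  assume "1 <= c * (A / NN n^2)"
  also have "... = c * (A * (1 / NN n^2))" by simp
  also have "... <= c * (A * ((tip - p) * HH n p / NN n + 1 / NN n^2))" using C A a by (intro mult_left_mono) auto
  finally show ?thesis .
 qed
 also have "... <= C * (A * ((tip - p) * HH n p / NN n + 1 / NN n^2))"
  using C A a by (intro mult_right_mono mult_nonneg_nonneg) auto
 finally show ?thesis unfolding Vok_def A_def .
qed

lemma mult_rho: assumes "0 < p" "p <= tip" "a * rho p <= b" shows "a * p^2 <= b * mu p" "a <= b / rho p"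
proof -
 have r: "0 < rho p" using assms tip_bounds by (intro rho_pos) auto
 show b: "a <= b / rho p" using assms r by (simp add: pos_le_divide_eq)
 have "a * p^2 <= b / rho p * p^2" using b by (intro mult_right_mono) auto
 thus "a * p^2 <= b * mu p" by (simp add: mu_def)
qed

text \<open>The lattice point next to \<open>K p\<close> (for inner \<open>p\<close>) or next to
  \<open>p\<close> (for outer \<open>p\<close>) may lie on the other side of the tip. Then
  \<open>p\<close> itself is close to the tip, and the second term of \<open>Vok\<close> absorbs
  the loss.\<close>
lemma vv_bound: "\<exists>C>0. \<forall>n\<ge>2. \<forall>i\<in>mirrored n. Vok C n (vv n i (adj n i)) (adj n i)"
proof -
 define Cm :: real where "Cm = 864^2 * 2200 * 648 * 16"
 define C where "C = (64 * 1296 + 31104 + 41472 + 3 * Cm) / cc"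
 have Cm: "Cm > 0" by (simp add: Cm_def)
 have C: "C > 0" unfolding C_def using cc_pos Cm by simp
 have Cc: "x / cc <= C" "0 <= x / cc" if "0 <= x" "x <= 64 * 1296 + 31104 + 41472 + 3 * Cm" for x
  using that cc_pos unfolding C_def by (auto intro: divide_right_mono)
 have "Vok C n (vv n i p) p" if n: "n \<ge> 2" and i: "lo_idx n <= i" "i <= n div 2" and p: "p = adj n i" for n i p
 proof -
  define N where "N = real n + 1"
  have N: "N \<ge> 3" using n by (simp add: N_def)
  have g: "gap n > 0" by (rule gap_pos)
  have gN: "gap n * N = tip" unfolding N_def by (rule gap_N)
  have p0: "0 < p" "p <= tip" using adjusted_range[OF i(2)] i g unfolding p by auto
  have m: "0 < mu p" using p0 rho_pos[of p] tip_bounds by (simp add: mu_def)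
  define v where "v = vv n i p"
  have v: "0 <= v" unfolding v_def by (rule vv_nonneg)
  define H where "H = HH n p"
  have H0: "0 <= H" unfolding H_def by (rule HH_nonneg)
  note Vi = Vok_intro[OF v p0, of _ C n, folded H_def N_def]
  define sg where "sg = tip - p"
  have sg: "0 <= sg" using p0 by (simp add: sg_def)
  show ?thesis
  proof (cases "free n i")
   case False
   then obtain P where P: "P \<in> pairs n" "i = fst P \<or> i = snd P" by (auto simp: free_def pairs_def)
   have "cc * N * p^2 <= Cm * (v * (mu p * sg))"
    unfolding Cm_def v_def N_def sg_def by (rule vv_matched_lower[OF P p])
   moreover have "1 <= p^2 * (3 * H)"
   proof -
    define b where "b = raw n (snd P)"
    note of = outer_facts[OF pairs_facts(4)[OF P(1)], folded b_def]
    have pb: "abs (p - b) <= gap n"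
     using P(2) matched_close[OF pairs_facts(5)[OF P(1)]] unfolding p b_def by auto
    have "gap n / 2 <= p" using adjusted_range(3)[OF i(2,1)] p by simp
    hence "b <= 3 * p" using pb by linarith
    hence "b^2 <= (3 * p)^2" using of by (intro power_mono) auto
    hence bp: "b^2 <= 9 * p^2" by (simp add: power_mult_distrib)
    have b0: "0 < b" using of g by linarith
    have "3 * gap n / (b^2 * max \<bar>p - b\<bar> (gap n)) <= H"
     unfolding H_def b_def by (rule HH_term[OF pairs_facts(4)[OF P(1)]])
    moreover have "max \<bar>p - b\<bar> (gap n) = gap n" using pb by simp
    ultimately have "3 / b^2 <= H" using g by simp
    hence "3 <= H * b^2" using b0 by (simp add: divide_le_eq)
    also have "... <= H * (9 * p^2)" using bp H0 by (intro mult_left_mono) auto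
    finally show ?thesis by (simp add: mult_ac)
   qed
   hence "cc * N * 1 <= cc * N * (p^2 * (3 * H))" using cc_pos N by (intro mult_left_mono) auto
   ultimately have "cc * N <= (Cm * (v * (mu p * sg))) * (3 * H)"
    using mult_right_mono[of "cc * N * p^2" "Cm * (v * (mu p * sg))" "3 * H"] H0 by (simp add: mult_ac)
   hence "1 <= (Cm * (v * (mu p * sg))) * (3 * H) / (cc * N)" using cc_pos N by (simp add: le_divide_eq)
   hence "1 <= (3 * Cm / cc) * (v * mu p * (sg * H / N))" by (simp add: mult_ac)
   thus ?thesis unfolding v_def[symmetric] using Cc[of "3 * Cm"] Cm unfolding sg_def by (intro Vi) auto
  next
   case True
   have pr: "p = raw n i" unfolding p by (rule adjusted_free[OF i(2) True])
   consider (inn) "inner_node n i" | (out) "outer_node n i" using inner_or_outer i by blast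
   thus ?thesis
   proof cases
    case inn
    show ?thesis
    proof (cases "p = tip")
     case True
     have "cc * N^2 * rho p <= 31104 * (v * p^2)" unfolding N_def v_def
      by (rule vv_inner_lower(2)[OF inn i(1) \<open>free n i\<close> pr True])
     from mult_rho(2)[OF p0 this] have "cc * N^2 <= 31104 * (v * mu p)" by (simp add: mu_def)
     hence "1 <= 31104 * (v * mu p) / (cc * N^2)" using cc_pos N by (simp add: le_divide_eq)
     hence "1 <= (31104 / cc) * (v * mu p / N^2)" by simp
     thus ?thesis unfolding v_def[symmetric] using Cc[of 31104] Cm by (intro Vi) auto
    next
     case False
     hence sg0: "0 < sg" using p0 by (simp add: sg_def)
     have Kp: "tip <= K p" "K p < pi" using K(1)[of p] K_strict_antimono[of 0 p] p0 by auto
     obtain k where k: "k <= n div 2" "abs (K p - thu n k) <= pi / NN n"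
      using nearest_lattice[of "K p" n] Kp tip_bounds by (metis less_imp_le order_trans)
     have D: "N / 4 * abs (K p - thu n k) <= DD n (K p)" unfolding N_def by (rule DD_lower[OF k(2)])
     have main: "cc * N * DD n (K p) * rho p <= 64 * (v * (p^2 * sg))" unfolding N_def v_def sg_def
      by (rule vv_inner_lower(1)[OF inn i(1) \<open>free n i\<close> pr])
     from mult_rho(2)[OF p0 main] have main: "cc * N * DD n (K p) <= 64 * (v * mu p * sg)" by (simp add: mu_def mult_ac)
     have DN: "1 / 1296 <= DD n (K p) * H \<or> 1 / 1296 <= DD n (K p) / (N * sg)"
     proof (cases "outer_node n k")
      case True
      define b where "b = raw n k"
      note of = outer_facts[OF True, folded b_def]
      have pb: "gap n <= abs (p - b)" using \<open>free n i\<close> inn True unfolding free_def matched_def pr b_def by (meson not_less)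
      have "3 * gap n / (b^2 * max \<bar>p - b\<bar> (gap n)) <= H" unfolding H_def b_def by (rule HH_term[OF True])
      moreover have "max \<bar>p - b\<bar> (gap n) = \<bar>p - b\<bar>" using pb by simp
      ultimately have Hb: "3 * gap n / (b^2 * abs (p - b)) <= H" by simp
      have b0: "0 < b" using of g by linarith
      have pin: "b \<in> {0..tip}" "p \<in> {0..tip}" using of p0 by auto
      have "abs (p - b) * b^2 / 648 <= abs (p - b) * (p + b)^2 / 648" using p0 b0 by (intro divide_right_mono mult_left_mono power_mono) auto
      also have "... <= abs (K p - K b)" by (rule K_diff(3)[OF pin])
      finally have "N / 4 * (abs (p - b) * b^2 / 648) <= N / 4 * abs (K p - thu n k)" unfolding of(3) using N by (intro mult_left_mono) auto
      hence "N / 4 * (abs (p - b) * b^2 / 648) <= DD n (K p)" using D by linarith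
      hence "(N / 4 * (abs (p - b) * b^2 / 648)) * (3 * gap n / (b^2 * abs (p - b))) <= DD n (K p) * H"
       using Hb DD_bounds(1)[of n "K p"] g by (intro mult_mono) (auto intro!: divide_nonneg_nonneg)
      moreover have "(N / 4 * (abs (p - b) * b^2 / 648)) * (3 * gap n / (b^2 * abs (p - b))) = 3 * (gap n * N) / 2592"
       using pb b0 g by (simp add: field_simps)
      ultimately show ?thesis unfolding gN using tip_bounds by linarith
     next
      case False
      hence "thu n k <= tip" using k by (auto simp: outer_node_def)
      have pin: "tip \<in> {0..tip}" "p \<in> {0..tip}" using p0 tip_bounds by auto
      have "2^2 <= (p + tip)^2" using p0 tip_bounds by (intro power_mono) auto
      hence "sg * 4 / 648 <= abs (p - tip) * (p + tip)^2 / 648" unfolding sg_def using p0 by (intro divide_right_mono mult_mono) auto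
      also have "... <= abs (K p - K tip)" by (rule K_diff(3)[OF pin])
      also have "... <= abs (K p - thu n k)" using \<open>thu n k <= tip\<close> Kp by simp
      finally have "N / 4 * (sg * 4 / 648) <= N / 4 * abs (K p - thu n k)" using N by (intro mult_left_mono) auto
      hence "N * sg / 648 <= DD n (K p)" using D by linarith
      hence "(N * sg / 648) / (N * sg) <= DD n (K p) / (N * sg)" using N sg0 by (intro divide_right_mono) auto
      moreover have "(a / 648) / a = 1/648" if "0 < a" for a :: real using that by simp
      from this[of "N * sg"] have "(N * sg / 648) / (N * sg) = 1/648" using N sg0 by simp
      ultimately have "1/648 <= DD n (K p) / (N * sg)" by linarith
      thus ?thesis by linarith
     qed
     have cN: "0 < cc * N" using cc_pos N by simp
     from DN show ?thesis
     proof
      assume a: "1 / 1296 <= DD n (K p) * H"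
      have "cc * N * (1 / 1296) <= cc * N * (DD n (K p) * H)" using a cN by (intro mult_left_mono) auto
      also have "... = (cc * N * DD n (K p)) * H" by simp
      also have "... <= (64 * (v * mu p * sg)) * H" using main H0 by (rule mult_right_mono)
      finally have "cc * N <= 64 * 1296 * (v * mu p * (sg * H))" by simp
      hence "1 <= 64 * 1296 * (v * mu p * (sg * H)) / (cc * N)" using cN by (simp add: le_divide_eq)
      hence "1 <= (64 * 1296 / cc) * (v * mu p * (sg * H / N))" by simp
      thus ?thesis unfolding v_def[symmetric] using Cc[of "64 * 1296"] Cm unfolding sg_def by (intro Vi) auto
     next
      assume a: "1 / 1296 <= DD n (K p) / (N * sg)"
      hence "N * sg / 1296 <= DD n (K p)" using N sg0 by (simp add: le_divide_eq)
      hence "cc * N * (N * sg / 1296) <= cc * N * DD n (K p)" using cN by (intro mult_left_mono) auto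
      also note main
      finally have "sg * (cc * N^2) <= sg * (64 * 1296 * (v * mu p))" by (simp add: power2_eq_square mult_ac)
      hence "cc * N^2 <= 64 * 1296 * (v * mu p)" using sg0 by (rule mult_left_le_imp_le)
      hence "1 <= 64 * 1296 * (v * mu p) / (cc * N^2)" using cc_pos N by (simp add: le_divide_eq)
      hence "1 <= (64 * 1296 / cc) * (v * mu p / N^2)" by simp
      thus ?thesis unfolding v_def[symmetric] using Cc[of "64 * 1296"] Cm by (intro Vi) auto
     qed
    qed
   next
    case out
    note of = outer_facts[OF out, folded pr]
    have sg0: "0 < sg" using of by (simp add: sg_def)
    have "cc * N * DD n p * rho p <= 10368 * (v * sg)" unfolding N_def v_def sg_def
     by (rule vv_outer_lower[OF out True pr])
    from mult_rho(1)[OF p0 this] have main: "cc * N * DD n p * p^2 <= 10368 * (v * mu p * sg)" by (simp add: mult_ac)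
    obtain k where k: "k <= n div 2" "abs (p - thu n k) <= pi / NN n"
     using nearest_lattice[of p n] p0 tip_bounds by (metis less_imp_le order_le_less_trans)
    have D: "N / 4 * abs (p - thu n k) <= DD n p" unfolding N_def by (rule DD_lower[OF k(2)])
    show ?thesis
    proof (cases "inner_node n k")
     case True
     have "gap n <= abs (raw n k - raw n i)" using \<open>free n i\<close> out True unfolding free_def matched_def by (meson not_less)
     hence "gap n <= abs (p - thu n k)" unfolding pr raw_inner[OF True] by (simp add: abs_minus_commute)
     hence "N / 4 * gap n <= N / 4 * abs (p - thu n k)" using N by (intro mult_left_mono) auto
     hence "1/2 <= DD n p" using D gN tip_bounds by (simp add: mult.commute)
     hence "cc * N * (1/2) * p^2 <= cc * N * DD n p * p^2" using cc_pos N by (intro mult_right_mono mult_left_mono) auto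
     hence a: "cc * N * p^2 <= 20736 * (v * mu p * sg)" using main by linarith
     have "3 * gap n / (p^2 * max \<bar>p - p\<bar> (gap n)) <= H" unfolding H_def using HH_term[OF out, of p] unfolding pr[symmetric] .
     hence "3 / p^2 <= H" using g by simp
     hence "1 <= H * p^2" using p0 by (simp add: divide_le_eq)
     hence "cc * N * 1 <= cc * N * (H * p^2)" using cc_pos N by (intro mult_left_mono) auto
     also have "... = (cc * N * p^2) * H" by simp
     also have "... <= (20736 * (v * mu p * sg)) * H" using a H0 by (rule mult_right_mono)
     finally have "1 <= (20736 * (v * mu p * sg)) * H / (cc * N)" using cc_pos N by (simp add: le_divide_eq)
     hence "1 <= (20736 / cc) * (v * mu p * (sg * H / N))" by simp
     thus ?thesis unfolding v_def[symmetric] using Cc[of 20736] Cm unfolding sg_def by (intro Vi) auto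
    next
     case False
     hence t: "tip < thu n k" using k by (auto simp: inner_node_def)
     have "pi / NN n <= pi / 3" using n by (intro divide_left_mono) auto
     hence "thu n k - p <= pi / 3" using k by linarith
     hence "1 <= p" using t pi_gt3 by (simp add: tip_def)
     hence p1: "1 <= p^2" by (simp add: one_le_power)
     have "N / 4 * sg <= N / 4 * abs (p - thu n k)" using t N by (intro mult_left_mono) (auto simp: sg_def)
     hence "N / 4 * sg <= DD n p" using D by linarith
     hence "cc * N * (N / 4 * sg) * 1 <= cc * N * DD n p * p^2" using cc_pos N p1 sg0 DD_bounds(1)[of n p] by (intro mult_mono mult_left_mono) auto
     hence "cc * N * (N / 4 * sg) <= 10368 * (v * mu p * sg)" using main by linarith
     hence "sg * (cc * N^2) <= sg * (41472 * (v * mu p))" by (simp add: power2_eq_square mult_ac)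
     hence "cc * N^2 <= 41472 * (v * mu p)" using sg0 by (rule mult_left_le_imp_le)
     hence "1 <= 41472 * (v * mu p) / (cc * N^2)" using cc_pos N by (simp add: le_divide_eq)
     hence "1 <= (41472 / cc) * (v * mu p / N^2)" by simp
     thus ?thesis unfolding v_def[symmetric] using Cc[of 41472] Cm by (intro Vi) auto
    qed
   qed
  qed
 qed
 thus ?thesis using C by (intro exI[of _ C]) auto
qed

text \<open>Values of \<open>(X^(n+1) - 1) / (X - 1)\<close> at 1 and -1.\<close>
lemma theta_products: assumes n: "even n"
 shows "(\<Prod>k\<in>{1..n div 2}. (2 * sin (thu n k / 2))^2) = real n + 1"
  "(\<Prod>k\<in>{1..n div 2}. 2 * cos (thu n k / 2)) = 1"
proof -
 define Fx where "Fx = (%X. (\<Prod>k\<in>{1..n div 2}. (X - cis (thu n k)) * (X - cis (- thu n k))))"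
 have f: "(X - 1) * Fx X = X ^ (n + 1) - 1" for X :: complex
 proof -
  have "X ^ (n + 1) - 1 = (\<Prod>k\<le>n. X - cis (theta n k))" using prod_theta[where n = n and X = X] n by (simp add: sgnN_def)
  also have "... = (\<Prod>k\<le>n div 2. X - cis (thu n k)) * (\<Prod>k\<in>mirrored n. X - cis (- thu n k))"
   by (rule prod_theta_split)
  also have "... = (X - 1) * Fx X"
  proof -
   have "(\<Prod>k\<le>n div 2. X - cis (thu n k)) = (X - 1) * (\<Prod>k\<in>{1..n div 2}. X - cis (thu n k))"
    using prod_upper_split[where n = n and g = "%k. X - cis (thu n k)"] n by (simp add: theta_upper_0 lo_idx)
   thus ?thesis unfolding Fx_def prod.distrib using n by (simp add: lo_idx mult.assoc)
  qed
  finally show ?thesis by simp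
 qed
 have F1: "Fx 1 = of_nat (n + 1)"
 proof -
  have "Fx X = (\<Sum>i<n+1. X ^ i)" if "X ~= 1" for X
  proof -
   have "(X - 1) * Fx X = (X - 1) * (\<Sum>i<n+1. X ^ i)" unfolding f by (rule power_diff_1_eq)
   thus ?thesis using that by simp
  qed
  hence e: "\<forall>\<^sub>F X in at 1. Fx X = (\<Sum>i<n+1. X ^ i)" by (auto simp: eventually_at_filter)
  have "(Fx \<longlongrightarrow> Fx 1) (at 1)" unfolding Fx_def by (intro tendsto_intros)
  hence "((%X. \<Sum>i<n+1. X ^ i) \<longlongrightarrow> Fx 1) (at 1)" by (rule Lim_transform_eventually) (rule e)
  moreover have "((%X::complex. \<Sum>i<n+1. X ^ i) \<longlongrightarrow> (\<Sum>i<n+1. 1 ^ i)) (at 1)" by (intro tendsto_intros)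
  ultimately have "Fx 1 = (\<Sum>i<n+1. 1 ^ i)" by (rule tendsto_unique[rotated]) simp
  thus ?thesis by simp
 qed
 have F2: "Fx (-1) = 1"
 proof -
  have "(-1::complex) ^ (n + 1) = -1" using n by simp
  thus ?thesis using f[of "-1"] by simp
 qed
 have r: "0 <= sin (thu n k / 2)" "0 < cos (thu n k / 2)" if "k \<in> {1..n div 2}" for k
 proof -
  have "0 <= thu n k" "thu n k < pi" using theta_upper_range(1)[of k n] theta_upper_less_pi[of k n] that by auto
  thus "0 <= sin (thu n k / 2)" "0 < cos (thu n k / 2)" by (auto intro!: sin_ge_zero cos_gt_zero_pi)
 qed
 have n1: "norm (1 - cis t) = 2 * abs (sin (t/2))" for t using norm_cis_diff_1[of t] by (simp add: norm_minus_commute)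
 have n2: "norm (-1 - cis t) = 2 * abs (cos (t/2))" for t
 proof -
  have "cis (t + pi) = - cis t" by (simp add: complex_eq_iff)
  hence "norm (-1 - cis t) = norm (cis (t + pi) - 1)" by (simp add: norm_minus_commute add.commute)
  also have "... = 2 * abs (sin (t/2 + pi/2))" unfolding norm_cis_diff_1 by (simp add: add_divide_distrib)
  finally show ?thesis by (simp add: sin_add)
 qed
 have "norm (Fx 1) = (\<Prod>k\<in>{1..n div 2}. (2 * sin (thu n k / 2))^2)"
  unfolding Fx_def prod_norm[symmetric] norm_mult n1 using r by (intro prod.cong refl) (auto simp: power2_eq_square)
 thus "(\<Prod>k\<in>{1..n div 2}. (2 * sin (thu n k / 2))^2) = real n + 1" unfolding F1 norm_of_nat by simp
 have "norm (Fx (-1)) = (\<Prod>k\<in>{1..n div 2}. (2 * cos (thu n k / 2))^2)"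
  unfolding Fx_def prod_norm[symmetric] norm_mult n2 using r by (intro prod.cong refl) (auto simp: power2_eq_square)
 hence "(\<Prod>k\<in>{1..n div 2}. 2 * cos (thu n k / 2))^2 = 1" unfolding F2 by (simp add: prod_power_distrib)
 moreover have "0 <= (\<Prod>k\<in>{1..n div 2}. 2 * cos (thu n k / 2))" using r by (intro prod_nonneg) (auto intro: less_imp_le)
 ultimately show "(\<Prod>k\<in>{1..n div 2}. 2 * cos (thu n k / 2)) = 1" by (auto simp: power2_eq_1_iff)
qed

text \<open>At the corner the comparison with \<open>DD\<close> factors fails, but the distances
  to it are explicit: \<open>rsq = (2 sin)^3 * (2 cos)\<close> in the half angle.\<close>
lemma vv_corner: assumes n: "even n" shows "exp (-12) * sqrt (NN n^3) <= vv n 0 0"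
proof -
 have t: "0 <= thu n k" "thu n k <= pi" if "k \<in> {1..n div 2}" for k
  using theta_upper_range(1)[of k n] theta_upper_less_pi[of k n] that by auto
 define R where "R = (\<Prod>k\<in>{1..n div 2}. sqrt (rho 0 ^ 2 + rho (raw n k) ^ 2))"
 have R: "R = (\<Prod>k\<in>{1..n div 2}. sqrt (rsq (thu n k)))"
  unfolding R_def using t by (intro prod.cong refl) (auto simp: rho_raw rho_sq)
 have "R^2 = (\<Prod>k\<in>{1..n div 2}. rsq (thu n k))"
  unfolding R prod_power_distrib using t rsq_nonneg by (intro prod.cong refl) auto
 also have "... = (\<Prod>k\<in>{1..n div 2}. (2 * sin (thu n k / 2))^3 * (2 * cos (thu n k / 2)))"
  by (intro prod.cong refl) (simp add: rsq_def power_mult_distrib)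
 also have "... = (\<Prod>k\<in>{1..n div 2}. 2 * sin (thu n k / 2))^3"
  unfolding prod.distrib[of "%k. (2 * sin (thu n k / 2))^3"] theta_products(2)[OF n] prod_power_distrib mult_1_right ..
 also have "(\<Prod>k\<in>{1..n div 2}. 2 * sin (thu n k / 2)) = sqrt (real n + 1)"
 proof (rule real_sqrt_unique[symmetric])
  show "(\<Prod>k\<in>{1..n div 2}. 2 * sin (thu n k / 2))^2 = real n + 1"
   using theta_products(1)[OF n] by (simp add: prod_power_distrib)
  show "0 <= (\<Prod>k\<in>{1..n div 2}. 2 * sin (thu n k / 2))"
  proof (intro prod_nonneg ballI)
   fix k assume "k \<in> {1..n div 2}"
   from t[OF this] show "0 <= 2 * sin (thu n k / 2)" by (auto intro!: sin_ge_zero)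
  qed
 qed
 finally have R2: "R^2 = sqrt (NN n^3)" by (simp add: real_sqrt_power)
 have R0: "0 <= R" unfolding R_def by (intro prod_nonneg) simp
 have lo: "lo_idx n = 1" using n by (simp add: lo_idx)
 have m: "exp (-6) * R <= mir n 0" using mirror_compare(1)[of 0 n] tip_bounds unfolding R_def lo by auto
 have "vv n 0 0 = mir n 0 ^ 2"
 proof -
  have "{..n div 2} - {0} = {1..n div 2}" by auto
  moreover have "abs (rho 0 - rho (adj n k)) = sqrt (rho 0 ^ 2 + rho (adj n k) ^ 2)" for k by simp
  ultimately show ?thesis unfolding vv_def mir_def lo power2_eq_square by simp
 qed
 moreover have "(exp (-6) * R)^2 <= mir n 0 ^ 2" using m R0 by (intro power_mono) auto
 moreover have "(exp (-6) * R)^2 = exp (-12) * R^2" by (simp add: power_mult_distrib exp_double[symmetric])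
 ultimately show ?thesis unfolding R2 by simp
qed

section \<open>Sums over separated points\<close>

text \<open>Dividing the distance to \<open>y\<close> by \<open>e\<close> and rounding down
  numbers the points on each side of \<open>y\<close> injectively.\<close>
lemma sep_sum: fixes q :: "'a => real" and \<phi> :: "nat => real"
 assumes fin: "finite A" and e: "0 < e" and sep: "\<And>i j. i \<in> A ==> j \<in> A ==> i ~= j ==> e <= abs (q i - q j)"
  and M: "\<And>i. i \<in> A ==> \<bar>y - q i\<bar> <= e * real M"
  and f: "\<And>i t. i \<in> A ==> e * real t <= abs (y - q i) ==> f i <= \<phi> t" and nn: "\<And>t. 0 <= \<phi> t"
 shows "(\<Sum>i\<in>A. f i) <= 2 * (\<Sum>t\<le>M. \<phi> t)"
proof -
 define t where "t = (%i. nat \<lfloor>\<bar>y - q i\<bar> / e\<rfloor>)"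
 have t: "real (t i) <= abs (y - q i) / e" "abs (y - q i) / e < real (t i) + 1" for i
 proof -
  have "0 <= abs (y - q i) / e" using e by simp
  thus "real (t i) <= abs (y - q i) / e" "abs (y - q i) / e < real (t i) + 1" unfolding t_def by linarith+
 qed
 have part: "(\<Sum>i\<in>B. f i) <= (\<Sum>t\<le>M. \<phi> t)" if B: "B \<subseteq> A" "(\<forall>i\<in>B. q i <= y) \<or> (\<forall>i\<in>B. y <= q i)" for B
 proof -
  have inj: "inj_on t B"
  proof (rule inj_onI, rule ccontr)
   fix i j assume ij: "i \<in> B" "j \<in> B" "t i = t j" "i ~= j"
   have "\<bar>\<bar>y - q i\<bar> / e - \<bar>y - q j\<bar> / e\<bar> < 1" using t[of i] t[of j] ij(3) by linarith
   hence "\<bar>(\<bar>y - q i\<bar> - \<bar>y - q j\<bar>) / e\<bar> < 1" by (simp add: diff_divide_distrib)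
   hence "\<bar>\<bar>y - q i\<bar> - \<bar>y - q j\<bar>\<bar> < e" using e by (simp add: abs_divide)
   moreover have "\<bar>\<bar>y - q i\<bar> - \<bar>y - q j\<bar>\<bar> = \<bar>q i - q j\<bar>" using B(2) ij by force
   ultimately show False using sep[of i j] ij B(1) by force
  qed
  have "(\<Sum>i\<in>B. f i) <= (\<Sum>i\<in>B. \<phi> (t i))"
  proof (rule sum_mono)
   fix i assume "i \<in> B"
   hence "i \<in> A" using B by blast
   moreover have "e * real (t i) <= abs (y - q i)" using t(1)[of i] e by (simp add: le_divide_eq mult.commute)
   ultimately show "f i <= \<phi> (t i)" by (rule f)
  qed
  also have "... = (\<Sum>s\<in>t ` B. \<phi> s)" using inj by (simp add: sum.reindex)
  also have "... <= (\<Sum>t\<le>M. \<phi> t)"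
  proof (rule sum_mono2)
   show "t ` B \<subseteq> {..M}"
   proof
    fix s assume "s \<in> t ` B"
    then obtain i where i: "i \<in> B" "s = t i" by blast
    have "abs (y - q i) / e <= real M" using M[of i] i B e by (auto simp: divide_le_eq mult.commute)
    hence "real (t i) <= real M" using t(1)[of i] by linarith
    thus "s \<in> {..M}" using i by simp
   qed
  qed (use nn in auto)
  finally show ?thesis .
 qed
 have "(\<Sum>i\<in>A. f i) = (\<Sum>i\<in>{i\<in>A. q i <= y}. f i) + (\<Sum>i\<in>A - {i\<in>A. q i <= y}. f i)"
  using fin by (subst sum.subset_diff[of "{i\<in>A. q i <= y}" A]) auto
 moreover have "(\<Sum>i\<in>{i\<in>A. q i <= y}. f i) <= (\<Sum>t\<le>M. \<phi> t)" by (rule part) auto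
 moreover have "(\<Sum>i\<in>A - {i\<in>A. q i <= y}. f i) <= (\<Sum>t\<le>M. \<phi> t)" by (rule part) auto
 ultimately show ?thesis by linarith
qed

lemma harmonic_le: "(\<Sum>t\<le>M. 1 / (real t + 1)) <= 1 + ln (real M + 1)"
proof (induction M)
 case (Suc M)
 have "ln ((real M + 1) / (real M + 2)) <= (real M + 1) / (real M + 2) - 1" by (rule ln_le_minus_one) simp
 also have "... = - (1 / (real M + 2))" by (simp add: field_simps)
 finally have "1 / (real M + 2) <= ln (real M + 2) - ln (real M + 1)" by (simp add: ln_divide_pos)
 thus ?case using Suc by (simp add: add_ac)
qed simp

lemma inverse_squares_le: "(\<Sum>t\<le>M. 1 / (real t + 1)^2) <= 2 - 1 / (real M + 1)"
proof (induction M)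
 case (Suc M)
 have "1 / (x + 1)^2 <= 1 / x - 1 / (x + 1)" if "x > 0" for x :: real
 proof -
  have "1 / x - 1 / (x + 1) = 1 / (x * (x + 1))" using that by (simp add: field_simps)
  moreover have "1 / ((x + 1) * (x + 1)) <= 1 / (x * (x + 1))" using that by (intro divide_left_mono mult_right_mono mult_pos_pos) auto
  ultimately show ?thesis by (simp add: power2_eq_square)
 qed
 from this[of "real M + 1"] show ?case using Suc by (simp add: add_ac)
qed simp

definition LL :: "nat => real" where "LL n = 1 + ln (real n + 2)"

lemma LL_ge: "1 <= LL n" by (simp add: LL_def)

lemma sep_log_sum: fixes q :: "'a => real"
 assumes fin: "finite A" and e: "0 < e" and sep: "\<And>i j. i \<in> A ==> j \<in> A ==> i ~= j ==> e <= abs (q i - q j)"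
  and M: "\<And>i. i \<in> A ==> \<bar>y - q i\<bar> <= e * NN n"
 shows "(\<Sum>i\<in>A. 1 / max \<bar>y - q i\<bar> (e / 2)) <= 6 / e * LL n" "(\<Sum>i\<in>A. 1 / (max \<bar>y - q i\<bar> (e / 2))^2) <= 36 / e^2"
proof -
 have a: "e * (real t + 1) / 3 <= max x (e / 2)" if "e * real t <= x" for t x
 proof (cases t)
  case 0 thus ?thesis using e by simp
 next
  case (Suc t')
  have "e * 1 <= e * real t" using Suc e by (intro mult_left_mono) auto
  hence "e * (real t + 1) / 3 <= e * real t" using e by (simp add: distrib_left)
  thus ?thesis using that by simp
 qed
 have M': "abs (y - q i) <= e * real (n + 1)" if "i \<in> A" for i using M[OF that] by (simp add: add.commute)
 have p: "0 < e * (real t + 1) / 3" for t using e by simp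
 have "(\<Sum>i\<in>A. 1 / max \<bar>y - q i\<bar> (e / 2)) <= 2 * (\<Sum>t\<le>n+1. 1 / (e * (real t + 1) / 3))"
 proof (rule sep_sum[OF fin e sep M'])
  fix i t assume it: "i \<in> A" "e * real t <= abs (y - q i)"
  show "1 / max \<bar>y - q i\<bar> (e / 2) <= 1 / (e * (real t + 1) / 3)"
   using a[OF it(2)] p[of t] e by (intro divide_left_mono mult_pos_pos) (auto simp: less_max_iff_disj)
 next
  fix t show "0 <= 1 / (e * (real t + 1) / 3)" using p[of t] by simp
 qed
 also have "... = 6 / e * (\<Sum>t\<le>n+1. 1 / (real t + 1))"
 proof -
  have "1 / (e * (real t + 1) / 3) = 3 / e * (1 / (real t + 1))" for t using e by simp
  thus ?thesis by (simp only: sum_distrib_left[symmetric])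
 qed
 also have "... <= 6 / e * LL n" using harmonic_le[of "n+1"] e by (intro mult_left_mono) (auto simp: LL_def add_ac)
 finally show "(\<Sum>i\<in>A. 1 / max \<bar>y - q i\<bar> (e / 2)) <= 6 / e * LL n" .
 have "(\<Sum>i\<in>A. 1 / (max \<bar>y - q i\<bar> (e / 2))^2) <= 2 * (\<Sum>t\<le>n+1. 1 / (e * (real t + 1) / 3)^2)"
 proof (rule sep_sum[OF fin e sep M'])
  fix i t assume "i \<in> A" "e * real t <= abs (y - q i)"
  have "(e * (real t + 1) / 3)^2 <= (max \<bar>y - q i\<bar> (e / 2))^2" using a[OF \<open>e * real t <= \<bar>y - q i\<bar>\<close>] p[of t] by (intro power_mono) auto
  thus "1 / (max \<bar>y - q i\<bar> (e / 2))^2 <= 1 / (e * (real t + 1) / 3)^2"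
   using p[of t] e by (intro divide_left_mono mult_pos_pos zero_less_power) (auto simp: less_max_iff_disj)
 qed auto
 also have "... = 18 / e^2 * (\<Sum>t\<le>n+1. 1 / (real t + 1)^2)"
 proof -
  have "1 / (e * (real t + 1) / 3)^2 = 9 / e^2 * (1 / (real t + 1)^2)" for t by (simp add: power_divide power_mult_distrib)
  thus ?thesis by (simp only: sum_distrib_left[symmetric])
 qed
 also have "... <= 18 / e^2 * 2"
 proof -
  have "0 <= 1 / (real (n+1) + 1)" by simp
  hence "(\<Sum>t\<le>n+1. 1 / (real t + 1)^2) <= 2" using inverse_squares_le[of "n+1"] by linarith
  thus ?thesis by (intro mult_left_mono) auto
 qed
 finally show "(\<Sum>i\<in>A. 1 / (max \<bar>y - q i\<bar> (e / 2))^2) <= 36 / e^2" by simp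
qed

definition generic :: "nat => real => bool" where
 "generic n s \<longleftrightarrow> 0 < s \<and> s < tip \<and> s \<notin> raw n ` {..n div 2} \<and> s \<notin> adj n ` {..n div 2}"

definition dn :: "nat => real => nat => real" where "dn n s k = max \<bar>s - adj n k\<bar> (gap n / 2)"

lemma wst_nonneg: "0 <= wst n s" unfolding wst_def by (intro prod_nonneg) simp

text \<open>For outer nodes comparable to or larger than \<open>s\<close> the term is at most of
  order \<open>gap n / abs (K s - thu n l)\<close>, and for the smaller ones of order \<open>gap n
  / (pi - thu n l)\<close>; both are lattice sums. Only the lattice point next to \<open>K
  s\<close> is dangerous, and there the nodal product is small by
  \<open>wst_upper\<close>.\<close>
lemma outer_sum_bound: "\<exists>C>0. \<forall>n s. generic n s --> wst n s * HH n s <= C * LL n"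
proof -
 obtain C where C: "C > 0" and W: "\<And>n s. 0 < s ==> s < tip ==> s \<notin> raw n ` {..n div 2} ==> wst n s <= C * (DD n (K s) + s^2) \<and> wst n s <= C"
  using wst_upper by blast
 have "wst n s * HH n s <= 832 * C * LL n" if gen: "generic n s" for n s
 proof -
  have s: "0 < s" "s < tip" using gen by (auto simp: generic_def)
  have w: "wst n s <= C * (DD n (K s) + s^2)" "wst n s <= C" using W[OF s] gen by (auto simp: generic_def)
  define g N where gN: "g = gap n" "N = real n + 1"
  have g: "g > 0" unfolding gN by (rule gap_pos)
  have gNt: "g * N = tip" unfolding gN by (rule gap_N)
  define Ou where "Ou = {l. outer_node n l}"
  have trm: "wst n s * (3 * g / (raw n l ^ 2 * max \<bar>s - raw n l\<bar> g)) <= 104 * C * g * (1 / max \<bar>K s - thu n l\<bar> (3 * g / 2) + 1 / max \<bar>pi - thu n l\<bar> (3 * g / 2))"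
   if l: "l \<in> Ou" for l
  proof -
   define b where "b = raw n l"
   have lo: "outer_node n l" using l by (simp add: Ou_def)
   note of = outer_facts[OF lo, folded b_def]
   have b0: "0 < b" using of g gN by simp
   have pin: "b \<in> {0..tip}" "s \<in> {0..tip}" "0 \<in> {0..tip}" using of s tip_bounds by auto
   define th where "th = thu n l"
   define X where "X = 1 / max \<bar>K s - th\<bar> (3 * g / 2)"
   define Y where "Y = 1 / max \<bar>pi - th\<bar> (3 * g / 2)"
   have XY: "0 <= X" "0 <= Y" unfolding X_def Y_def using g by (auto simp: le_max_iff_disj)
   have lm: "l <= n div 2" using lo by (simp add: outer_node_def)
   have thpi: "3 * g / 2 <= pi - th" using theta_upper_range(2)[OF lm] gap_pi[of n] unfolding th_def gN by linarith
   define tm where "tm = 3 * g / (b^2 * max \<bar>s - b\<bar> g)"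
   have tm0: "0 <= tm" unfolding tm_def using g by (intro divide_nonneg_nonneg mult_nonneg_nonneg) (auto simp: le_max_iff_disj)
   have mx: "0 < max \<bar>s - b\<bar> g" using g by simp
   have "wst n s * tm <= 104 * C * g * (X + Y)"
   proof (cases "s <= 2 * b")
    case False
    have "b^2 * b <= b^2 * max \<bar>s - b\<bar> g" using False by (intro mult_left_mono) auto
    hence "tm <= 3 * g / (b^2 * b)" unfolding tm_def using b0 g by (intro divide_left_mono mult_pos_pos) auto
    also have "... <= 6 * g * (1 / (pi - th))"
    proof -
     have "abs (K 0 - K b) <= 2 * (abs (0 - b) * (0 + b)^2)" by (rule K_diff(2)[OF pin(1,3)])
     hence "pi - th <= 2 * (b^2 * b)" unfolding of(3) th_def using b0 by (simp add: mult.commute)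
     hence "6 * g / (2 * (b^2 * b)) <= 6 * g / (pi - th)" using thpi g b0 by (intro divide_left_mono) auto
     moreover have "6 * g / (2 * (b^2 * b)) = 3 * g / (b^2 * b)" "6 * g / (pi - th) = 6 * g * (1 / (pi - th))" by simp_all
     ultimately show ?thesis by linarith
    qed
    also have "1 / (pi - th) = Y" unfolding Y_def using thpi g by simp
    finally have "wst n s * tm <= C * (6 * g * Y)" using w(2) tm0 C XY wst_nonneg by (intro mult_mono) auto
    also have "... <= C * (104 * g * (X + Y))" using C g XY by (intro mult_left_mono mult_mono) auto
    finally show ?thesis by (simp add: mult_ac)
   next
    case True
    have "abs (K s - K b) <= 2 * (abs (s - b) * (s + b)^2)" by (rule K_diff(2)[OF pin(1,2)])
    also have "... <= 2 * (abs (s - b) * (3 * b)^2)" using True s b0 by (intro mult_left_mono power_mono) auto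
    finally have kd: "abs (K s - th) <= 18 * (b^2 * abs (s - b))" unfolding of(3) th_def by (simp add: power_mult_distrib mult_ac)
    also have "... <= 18 * (b^2 * max \<bar>s - b\<bar> g)" by (intro mult_left_mono) auto
    finally have kd2: "\<bar>K s - th\<bar> <= 18 * (b^2 * max \<bar>s - b\<bar> g)" .
    have ktm: "abs (K s - th) * tm <= 54 * g"
    proof -
     have "\<bar>K s - th\<bar> * tm <= 18 * (b^2 * max \<bar>s - b\<bar> g) * tm" using kd2 tm0 by (rule mult_right_mono)
     also have "... = 54 * g" unfolding tm_def using b0 mx by (simp add: field_simps)
     finally show ?thesis .
    qed
    show ?thesis
    proof (cases "3 * g / 2 <= abs (K s - th)")
     case far: True
     have X: "X = 1 / abs (K s - th)" unfolding X_def using far by simp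
     have k0: "0 < abs (K s - th)" using far g by linarith
     have "tm <= 54 * g / abs (K s - th)" using ktm k0 by (simp only: pos_le_divide_eq[OF k0] mult.commute)
     hence "tm <= 54 * g * X" unfolding X by simp
     hence "wst n s * tm <= C * (54 * g * X)" using w(2) tm0 C XY wst_nonneg by (intro mult_mono) auto
     also have "... <= C * (104 * g * (X + Y))" using C g XY by (intro mult_left_mono mult_mono) auto
     finally show ?thesis by (simp add: mult_ac)
    next
     case near: False
     have X: "g * X = 2/3" unfolding X_def using near g by simp
     have "s^2 <= (2 * b)^2" using True s by (intro power_mono) auto
     hence "s^2 * tm <= (2 * b)^2 * tm" using tm0 by (rule mult_right_mono)
     also have "... <= (2 * b)^2 * (3 * g / (b^2 * g))" unfolding tm_def using g b0 mx by (intro mult_left_mono divide_left_mono mult_pos_pos) auto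
     also have "... = 12" using g b0 by (simp add: power_mult_distrib)
     finally have s2: "s^2 * tm <= 12" .
     have "DD n (K s) * tm <= (N / 2 * abs (K s - th)) * tm" using DD_upper[of n "K s" l] tm0 unfolding gN th_def by (intro mult_right_mono) auto
     also have "... = N / 2 * (abs (K s - th) * tm)" by simp
     also have "... <= N / 2 * (54 * g)" using ktm by (intro mult_left_mono) (auto simp: gN)
     also have "... = 27 * (g * N)" by simp
     also have "... <= 57" unfolding gNt using tip_bounds by linarith
     finally have "DD n (K s) * tm <= 57" .
     hence "C * (DD n (K s) + s^2) * tm <= C * 69" using s2 C by (simp add: distrib_right mult.assoc)
     moreover have "wst n s * tm <= C * (DD n (K s) + s^2) * tm" using w(1) tm0 by (rule mult_right_mono)
     ultimately have "wst n s * tm <= C * 69" by linarith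
     also have "... <= C * (104 * (g * X))" unfolding X using C by (intro mult_left_mono) auto
     also have "... <= C * (104 * (g * (X + Y)))" using C g XY by (intro mult_left_mono) auto
     finally show ?thesis by (simp add: mult_ac)
    qed
   qed
   thus ?thesis unfolding tm_def X_def Y_def b_def th_def .
  qed
  have fin: "finite Ou" unfolding Ou_def by (rule finite_outer)
  have thsep: "3 * g <= abs (thu n i - thu n j)" if "i ~= j" for i j
  proof -
   have "1 <= abs (real i - real j)" using that by (cases "i < j") auto
   hence "3 * g * 1 <= 3 * g * abs (real i - real j)" using g by (intro mult_left_mono) auto
   also have "... = abs (thu n i - thu n j)" unfolding theta_upper_diff gN[symmetric] using g by (simp add: abs_mult)
   finally show ?thesis by simp
  qed
  have g3: "0 < 3 * g" using g by simp
  have rng: "abs (y - thu n i) <= 3 * g * NN n" if "0 <= y" "y <= pi" "i \<in> Ou" for y i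
  proof -
   have "i <= n div 2" using that by (simp add: Ou_def outer_node_def)
   hence "0 <= thu n i" "thu n i <= pi" using theta_upper_range(1) theta_upper_less_pi[of i n] by auto
   hence "abs (y - thu n i) <= pi" using that by linarith
   also have "... <= 2 * pi" by simp
   also have "... = 3 * (g * N)" unfolding gNt tip_def by simp
   finally show ?thesis unfolding gN by simp
  qed
  have Kr: "0 <= K s" "K s <= pi" using K(1,2)[of s] s tip_bounds by auto
  have S1: "(\<Sum>l\<in>Ou. 1 / max \<bar>K s - thu n l\<bar> (3 * g / 2)) <= 6 / (3 * g) * LL n"
   by (rule sep_log_sum(1)[OF fin g3 thsep rng[OF Kr]])
  have S2: "(\<Sum>l\<in>Ou. 1 / max \<bar>pi - thu n l\<bar> (3 * g / 2)) <= 6 / (3 * g) * LL n"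
   by (rule sep_log_sum(1)[OF fin g3 thsep rng]) auto
  have "wst n s * HH n s = (\<Sum>l\<in>Ou. wst n s * (3 * g / (raw n l ^ 2 * max \<bar>s - raw n l\<bar> g)))"
   unfolding HH_def gN Ou_def by (rule sum_distrib_left)
  also have "... <= (\<Sum>l\<in>Ou. 104 * C * g * (1 / max \<bar>K s - thu n l\<bar> (3 * g / 2) + 1 / max \<bar>pi - thu n l\<bar> (3 * g / 2)))"
   by (rule sum_mono) (rule trm)
  also have "... = 104 * C * g * ((\<Sum>l\<in>Ou. 1 / max \<bar>K s - thu n l\<bar> (3 * g / 2)) + (\<Sum>l\<in>Ou. 1 / max \<bar>pi - thu n l\<bar> (3 * g / 2)))"
   by (simp only: sum_distrib_left[symmetric] sum.distrib)
  also have "... <= 104 * C * g * (6 / (3 * g) * LL n + 6 / (3 * g) * LL n)" using S1 S2 C g by (intro mult_left_mono add_mono) auto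
  also have "... = 416 * C * LL n" using g by simp
  also have "... <= 832 * C * LL n" using C LL_ge[of n] by (intro mult_right_mono) auto
  finally show ?thesis .
 qed
 thus ?thesis using C by (intro exI[of _ "832 * C"]) auto
qed

lemma adjusted_sums: assumes y: "y \<in> {0..tip}"
 shows "(\<Sum>k\<in>mirrored n. 1 / dn n y k) <= 6 / gap n * LL n" "(\<Sum>k\<in>mirrored n. 1 / (dn n y k)^2) <= 36 / gap n ^ 2"
proof -
 have r: "abs (y - adj n i) <= gap n * NN n" if "i \<in> mirrored n" for i
  unfolding gap_N using adjusted_range(1,2)[of i n] that y by auto
 have s: "gap n <= abs (adj n i - adj n j)" if "i \<in> mirrored n" "j \<in> mirrored n" "i ~= j" for i j
  using adjusted_sep[of i n j] that by auto
 show "(\<Sum>k\<in>mirrored n. 1 / dn n y k) <= 6 / gap n * LL n" "(\<Sum>k\<in>mirrored n. 1 / (dn n y k)^2) <= 36 / gap n ^ 2"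
  unfolding dn_def by (rule sep_log_sum[OF _ gap_pos s r]; simp)+
qed

text \<open>By \<open>1 / (x * d) = (1/x + 1/d) / (x + d)\<close> each double sum over inner and
  outer nodes splits into a logarithmic sum over the adjusted nodes and the sum \<open>HH n
  s\<close>.\<close>
lemma double_sum_bound: assumes s: "s \<in> {0..tip}"
 shows "(\<Sum>k\<in>mirrored n. HH n (adj n k) / (NN n * dn n s k)) <= 12 * LL n * HH n s"
proof -
 define g N where gN: "g = gap n" "N = real n + 1"
 have g: "g > 0" unfolding gN by (rule gap_pos)
 have N: "N > 0" unfolding gN by simp
 have gNt: "g * N = tip" unfolding gN by (rule gap_N)
 define A where "A = mirrored n"
 define Ou where "Ou = {l. outer_node n l}"
 define x where "x = (%k l. max \<bar>adj n k - raw n l\<bar> g)"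
 define D where "D = (%l. max \<bar>s - raw n l\<bar> g)"
 have one: "3 * g / (raw n l ^ 2 * x k l) / (N * dn n s k) <= 3 * g / (raw n l ^ 2 * D l) * (1 / N * (1 / dn n (raw n l) k + 1 / dn n s k))"
  if l: "l \<in> Ou" for k l
 proof -
  have xp: "0 < x k l" "0 < dn n s k" "0 < D l" "0 < dn n (raw n l) k" unfolding x_def dn_def D_def using g gN by (auto simp: less_max_iff_disj)
  have b: "0 < raw n l ^ 2" using outer_facts(4)[of n l] l g gN by (auto simp: Ou_def)
  have a1: "abs (adj n k - raw n l) <= x k l" "g <= x k l" by (auto simp: x_def)
  have a2: "abs (s - adj n k) <= dn n s k" by (auto simp: dn_def)
  have "D l <= x k l + dn n s k" unfolding D_def using a1 a2 xp by (intro max.boundedI) linarith+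
  hence "1 / (x k l * dn n s k) <= 1 / D l * (1 / x k l + 1 / dn n s k)"
  proof -
   assume a: "D l <= x k l + dn n s k"
   have "1 / (x k l * dn n s k) = 1 / (x k l + dn n s k) * (1 / x k l + 1 / dn n s k)" using xp by (simp add: field_simps)
   also have "... <= 1 / D l * (1 / x k l + 1 / dn n s k)" using a xp by (intro mult_right_mono divide_left_mono mult_pos_pos) auto
   finally show ?thesis .
  qed
  also have "... <= 1 / D l * (1 / dn n (raw n l) k + 1 / dn n s k)"
  proof -
   have "dn n (raw n l) k <= x k l" unfolding dn_def gN(1)[symmetric] using a1 g by (intro max.boundedI) linarith+
   thus ?thesis using xp by (intro mult_left_mono add_mono divide_left_mono mult_pos_pos) auto
  qed
  finally have Hm: "3 * g / (raw n l ^ 2 * N) * (1 / (x k l * dn n s k)) <= 3 * g / (raw n l ^ 2 * N) * (1 / D l * (1 / dn n (raw n l) k + 1 / dn n s k))"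
   using g N b by (intro mult_left_mono) auto
  have e: "c / (y * z) / (N * d) = c / (y * N) * (1 / (z * d))" "c / (y * z) * (1 / N * d) = c / (y * N) * (1 / z * d)" for c y z d :: real by simp_all
  show ?thesis unfolding e by (rule Hm)
 qed
 have Hs: "HH n y / c = (\<Sum>l\<in>Ou. 3 * g / (raw n l ^ 2 * max \<bar>y - raw n l\<bar> g) / c)" for y c
  unfolding HH_def Ou_def gN by (rule sum_divide_distrib)
 have "(\<Sum>k\<in>A. HH n (adj n k) / (N * dn n s k)) = (\<Sum>k\<in>A. \<Sum>l\<in>Ou. 3 * g / (raw n l ^ 2 * x k l) / (N * dn n s k))"
  unfolding Hs x_def ..
 also have "... <= (\<Sum>k\<in>A. \<Sum>l\<in>Ou. 3 * g / (raw n l ^ 2 * D l) * (1 / N * (1 / dn n (raw n l) k + 1 / dn n s k)))"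
  by (intro sum_mono one)
 also have "... = (\<Sum>l\<in>Ou. \<Sum>k\<in>A. 3 * g / (raw n l ^ 2 * D l) * (1 / N * (1 / dn n (raw n l) k + 1 / dn n s k)))" by (rule sum.swap)
 also have "... = (\<Sum>l\<in>Ou. 3 * g / (raw n l ^ 2 * D l) * (1 / N * ((\<Sum>k\<in>A. 1 / dn n (raw n l) k) + (\<Sum>k\<in>A. 1 / dn n s k))))"
  by (simp only: sum_distrib_left[symmetric] sum.distrib)
 also have "... <= (\<Sum>l\<in>Ou. 3 * g / (raw n l ^ 2 * D l) * (12 * LL n))"
 proof (intro sum_mono mult_left_mono)
  fix l assume l: "l \<in> Ou"
  have "raw n l \<in> {0..tip}" using outer_facts(1,2)[of n l] l by (auto simp: Ou_def)
  from adjusted_sums(1)[OF this, of n] adjusted_sums(1)[OF s, of n]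
  have "1 / N * ((\<Sum>k\<in>A. 1 / dn n (raw n l) k) + (\<Sum>k\<in>A. 1 / dn n s k)) <= 1 / N * (6 / g * LL n + 6 / g * LL n)"
   unfolding A_def gN by (intro mult_left_mono add_mono) auto
  also have "... = 12 * LL n / (g * N)" by simp
  also have "... <= 12 * LL n / 1" unfolding gNt using tip_bounds LL_ge[of n] by (intro divide_left_mono) auto
  finally show "1 / N * ((\<Sum>k\<in>A. 1 / dn n (raw n l) k) + (\<Sum>k\<in>A. 1 / dn n s k)) <= 12 * LL n" by simp
  show "0 <= 3 * g / (raw n l ^ 2 * D l)" unfolding D_def using g by (intro divide_nonneg_nonneg mult_nonneg_nonneg) (auto simp: le_max_iff_disj)
 qed
 also have "... = HH n s * (12 * LL n)" unfolding HH_def Ou_def D_def gN by (rule sum_distrib_right[symmetric])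
 finally show ?thesis unfolding A_def gN by (simp add: mult_ac)
qed

lemma lagrange_term_real:
 fixes v m sg H N d D C c :: real
 assumes V: "1 <= C * (v * m * (sg * H / N + 1 / N^2))" and D: "0 < D" and a: "m * sg * d <= c * D" and b: "m * d^2 <= c * D"
  and nn: "0 < C" "0 <= v" "0 <= H" "0 < N" "0 < d"
 shows "1 / (D * v) <= C * c * (H / (N * d) + 1 / (N^2 * d^2))"
proof -
 have v: "0 < v" using V nn by (cases "v = 0") auto
 have a': "m * sg / D <= c / d" using a D nn by (simp add: divide_le_eq le_divide_eq mult_ac)
 have b': "m / D <= c / d^2" using b D nn by (simp add: divide_le_eq le_divide_eq mult_ac)
 have "1 / (D * v) <= C * (v * m * (sg * H / N + 1 / N^2)) / (D * v)" using V D v by (intro divide_right_mono) auto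
 also have "... = C * (m * sg / D * (H / N) + m / D * (1 / N^2))" using v D by (simp add: field_simps)
 also have "... <= C * (c / d * (H / N) + c / d^2 * (1 / N^2))" using a' b' nn by (intro mult_left_mono add_mono mult_right_mono) auto
 also have "... = C * c * (H / (N * d) + 1 / (N^2 * d^2))" by (simp add: distrib_left mult_ac)
 finally show ?thesis .
qed

lemma total_bound: "\<exists>C>0. \<forall>n s. n \<ge> 2 --> generic n s -->
  (\<Sum>k\<in>{k\<in>mirrored n. gap n / 2 <= abs (s - adj n k)}. wst n s / (abs (rho s - rho (adj n k)) * vv n k (adj n k)))
  <= C * (LL n)^2 \<and>
  (\<Sum>k\<in>mirrored n. wst n s / (sqrt (rho s ^ 2 + rho (adj n k) ^ 2) * vv n k (adj n k))) <= C * (LL n)^2 \<and>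
  (even n --> gap n / 2 <= s --> wst n s / (rho s * vv n 0 0) <= C * (LL n)^2)"
proof -
 obtain C1 where C1: "C1 > 0" and V: "\<And>n i. n \<ge> 2 ==> i \<in> mirrored n ==> Vok C1 n (vv n i (adj n i)) (adj n i)"
  using vv_bound by blast
 obtain C2 where C2: "C2 > 0" and T: "\<And>n s. generic n s ==> wst n s * HH n s <= C2 * LL n" using outer_sum_bound by blast
 obtain C3 where C3: "C3 > 0" and W: "\<And>n s. 0 < s ==> s < tip ==> s \<notin> raw n ` {..n div 2} ==> wst n s <= C3"
  using wst_upper by blast
 define C where "C = C1 * 2200 * (12 * C2 + 36 * C3) + C3 * exp 12 * 5"
 have C: "C > 0" unfolding C_def using C1 C2 C3 by (intro add_pos_pos mult_pos_pos) auto
 have Ca: "C1 * 2200 * (12 * C2 + 36 * C3) <= C" "C3 * exp 12 * 5 <= C" unfolding C_def using C1 C2 C3 by auto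
 have main: "(\<Sum>k\<in>{k\<in>mirrored n. gap n / 2 <= abs (s - adj n k)}. wst n s / (abs (rho s - rho (adj n k)) * vv n k (adj n k))) <= C * (LL n)^2"
   "(\<Sum>k\<in>mirrored n. wst n s / (sqrt (rho s ^ 2 + rho (adj n k) ^ 2) * vv n k (adj n k))) <= C * (LL n)^2"
   "even n ==> gap n / 2 <= s ==> wst n s / (rho s * vv n 0 0) <= C * (LL n)^2"
  if n: "n \<ge> 2" and gen: "generic n s" for n s
 proof -
  have s: "0 < s" "s < tip" "s \<in> {0..tip}" using gen by (auto simp: generic_def)
  have w: "wst n s <= C3" "0 <= wst n s" using W[OF s(1,2)] gen wst_nonneg by (auto simp: generic_def)
  define g N where gN: "g = gap n" "N = real n + 1"
  have g: "g > 0" unfolding gN by (rule gap_pos)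
  have N: "N > 0" unfolding gN by simp
  have gNt: "g * N = tip" unfolding gN by (rule gap_N)
  have L2: "1 <= (LL n)^2" using LL_ge[of n] by (simp add: one_le_power)
  define A where "A = mirrored n"
  define \<tau> where "\<tau> = (%k. HH n (adj n k) / (N * dn n s k) + 1 / (N^2 * (dn n s k)^2))"
  have dp: "0 < dn n s k" for k unfolding dn_def using g gN by (auto simp: less_max_iff_disj)
  have tau0: "0 <= \<tau> k" for k unfolding \<tau>_def using HH_nonneg N dp[of k] by (intro add_nonneg_nonneg divide_nonneg_nonneg mult_nonneg_nonneg) (auto intro: less_imp_le)
  have key: "1 / (E * vv n k (adj n k)) <= C1 * 2200 * \<tau> k"
   if k: "k \<in> A" and E: "0 < E" "mu (adj n k) * (tip - adj n k) * dn n s k <= 2200 * E" "mu (adj n k) * (dn n s k)^2 <= 2200 * E" for k E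
   unfolding \<tau>_def gN
   by (rule lagrange_term_real[OF V[OF n, unfolded Vok_def] E C1 vv_nonneg HH_nonneg _ dp]) (use k in \<open>auto simp: A_def\<close>)
  have pk: "0 < adj n k" "adj n k <= tip" "g / 2 <= adj n k" "0 < mu (adj n k)" "0 < rho (adj n k)" if "k \<in> A" for k
  proof -
   show p: "g / 2 <= adj n k" "adj n k <= tip" using adjusted_range(2,3)[of k n] that by (auto simp: A_def gN)
   thus p0: "0 < adj n k" using g by linarith
   show "0 < rho (adj n k)" using p0 p tip_bounds by (intro rho_pos) auto
   thus "0 < mu (adj n k)" using p0 by (simp add: mu_def)
  qed
  have far: "mu p * (tip - p) * abs (s - p) <= 2200 * abs (rho s - rho p)" "mu p * abs (s - p)^2 <= 2200 * abs (rho s - rho p)"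
   if p: "0 < p" "p <= tip" for p
  proof -
   have m: "0 <= mu p" using p rho_ge_0[of p] by (simp add: mu_def)
   have r: "abs (s - p) * mu p * (2*tip - s - p) / 2200 <= abs (rho s - rho p)" by (rule rho_diff_lower[OF s(3) p])
   have "abs (s - p) * mu p * (tip - p) <= abs (s - p) * mu p * (2*tip - s - p)" using m s by (intro mult_left_mono) auto
   thus "mu p * (tip - p) * abs (s - p) <= 2200 * abs (rho s - rho p)" using r by (simp add: mult_ac)
   have "abs (s - p) * mu p * abs (s - p) <= abs (s - p) * mu p * (2*tip - s - p)" using m s p by (intro mult_left_mono) auto
   thus "mu p * abs (s - p)^2 <= 2200 * abs (rho s - rho p)" using r by (simp add: mult_ac power2_eq_square)
  qed
  have up: "wst n s / (abs (rho s - rho (adj n k)) * vv n k (adj n k)) <= wst n s * (C1 * 2200 * \<tau> k)"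
   if k: "k \<in> {k\<in>A. gap n / 2 <= abs (s - adj n k)}" for k
  proof -
   have kA: "k \<in> A" using k by simp
   have d: "dn n s k = abs (s - adj n k)" unfolding dn_def using k by simp
   have "adj n k ~= s" using k g gN by auto
   hence E: "0 < abs (rho s - rho (adj n k))" using rho_inj[of "adj n k" s] pk[OF kA] s by auto
   have "1 / (abs (rho s - rho (adj n k)) * vv n k (adj n k)) <= C1 * 2200 * \<tau> k"
    by (rule key[OF kA E]) (use far pk[OF kA] in \<open>auto simp only: d\<close>)
   from mult_left_mono[OF this w(2)] show ?thesis by simp
  qed
  have low: "wst n s / (sqrt (rho s ^ 2 + rho (adj n k) ^ 2) * vv n k (adj n k)) <= wst n s * (C1 * 2200 * \<tau> k)"
   if k: "k \<in> A" for k
  proof -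
   define p where "p = adj n k"
   note pk = pk[OF k, folded p_def]
   define E where "E = sqrt (rho s ^ 2 + rho p ^ 2)"
   have E1: "rho p <= E" unfolding E_def by (rule real_le_rsqrt) simp
   have "0 <= rho s * rho p" "0 <= rho p * rho s" using pk rho_ge_0[OF s(3)] by simp_all
   hence "(rho s - rho p)^2 <= rho s ^ 2 + rho p ^ 2" by (simp add: power2_diff)
   hence E2: "abs (rho s - rho p) <= E" unfolding E_def by (intro real_le_rsqrt) simp
   have E0: "0 < E" using E1 pk by linarith
   have ab: "mu p * (tip - p) * dn n s k <= 2200 * E \<and> mu p * (dn n s k)^2 <= 2200 * E"
   proof (cases "p <= abs (s - p)")
    case True
    have d: "dn n s k = abs (s - p)" unfolding dn_def p_def[symmetric] gN(1)[symmetric] using True pk by simp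
    have "mu p * (tip - p) * abs (s - p) <= 2200 * abs (rho s - rho p)" "mu p * abs (s - p)^2 <= 2200 * abs (rho s - rho p)"
     using far pk by auto
    thus ?thesis unfolding d using E2 by (intro conjI; linarith)
   next
    case False
    have d: "dn n s k <= p" unfolding dn_def p_def[symmetric] gN(1)[symmetric] using False pk by simp
    have mp: "mu p * p <= 24 * rho p"
    proof -
     have "p^3 / 24 <= rsq p" using pk by (intro rsq_bounds) auto
     hence "p^2 * p <= 24 * rho p * rho p" using rho_sq[of p] pk tip_bounds by (simp add: power2_eq_square power3_eq_cube)
     hence "p^2 * p / rho p <= 24 * rho p" using pk by (simp add: divide_le_eq)
     thus ?thesis by (simp add: mu_def)
    qed
    have "mu p * (tip - p) * dn n s k <= mu p * (tip - p) * p" using d pk by (intro mult_left_mono) auto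
    also have "... = (mu p * p) * (tip - p)" by simp
    also have "... <= (24 * rho p) * 3" by (rule mult_mono[OF mp]) (use pk tip_bounds in auto)
    also have "... <= 2200 * E" using E1 pk by linarith
    finally have 1: "mu p * (tip - p) * dn n s k <= 2200 * E" .
    have "mu p * (dn n s k)^2 <= mu p * p^2" using d pk dp[of k] by (intro mult_left_mono power_mono) auto
    also have "... = (mu p * p) * p" by (simp add: power2_eq_square)
    also have "... <= (24 * rho p) * 3" by (rule mult_mono[OF mp]) (use pk tip_bounds in auto)
    also have "... <= 2200 * E" using E1 pk by linarith
    finally show ?thesis using 1 by simp
   qed
   have "1 / (E * vv n k p) <= C1 * 2200 * \<tau> k" unfolding p_def by (rule key[OF k E0]) (use ab in \<open>auto simp: p_def\<close>)
   from mult_left_mono[OF this w(2)] show ?thesis unfolding E_def p_def by simp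
  qed
  have tot: "(\<Sum>k\<in>A. wst n s * (C1 * 2200 * \<tau> k)) <= C * (LL n)^2"
  proof -
   have "(\<Sum>k\<in>A. 1 / (N^2 * (dn n s k)^2)) = 1 / N^2 * (\<Sum>k\<in>A. 1 / (dn n s k)^2)" by (simp add: sum_distrib_left)
   also have "... <= 1 / N^2 * (36 / g^2)" using adjusted_sums(2)[OF s(3), of n] unfolding A_def gN by (intro mult_left_mono) auto
   also have "... = 36 / (g * N)^2" by (simp add: power_mult_distrib)
   also have "... <= 36 / 1" unfolding gNt using tip_bounds by (intro divide_left_mono) (auto simp: one_le_power)
   finally have b: "(\<Sum>k\<in>A. 1 / (N^2 * (dn n s k)^2)) <= 36" by simp
   have "(\<Sum>k\<in>A. \<tau> k) <= 12 * LL n * HH n s + 36"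
    unfolding \<tau>_def sum.distrib using double_sum_bound[OF s(3), of n] b unfolding A_def gN by (intro add_mono) auto
   hence "wst n s * (\<Sum>k\<in>A. \<tau> k) <= wst n s * (12 * LL n * HH n s + 36)" using w(2) by (rule mult_left_mono)
   also have "... = 12 * LL n * (wst n s * HH n s) + 36 * wst n s" by (simp add: distrib_left mult_ac)
   also have "... <= 12 * LL n * (C2 * LL n) + 36 * C3" using T[OF gen] w(1) LL_ge[of n] by (intro add_mono mult_left_mono) auto
   also have "... <= 12 * C2 * (LL n)^2 + 36 * C3 * (LL n)^2" using L2 C3 by (intro add_mono) (auto simp: power2_eq_square)
   finally have "C1 * 2200 * (wst n s * (\<Sum>k\<in>A. \<tau> k)) <= C1 * 2200 * (12 * C2 * (LL n)^2 + 36 * C3 * (LL n)^2)" using C1 by (intro mult_left_mono) auto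
   also have "... = (C1 * 2200 * (12 * C2 + 36 * C3)) * (LL n)^2" by (simp add: distrib_right distrib_left mult_ac)
   also have "... <= C * (LL n)^2" using Ca by (intro mult_right_mono) auto
   finally have "C1 * 2200 * (wst n s * (\<Sum>k\<in>A. \<tau> k)) <= C * (LL n)^2" .
   moreover have "(\<Sum>k\<in>A. wst n s * (C1 * 2200 * \<tau> k)) = C1 * 2200 * (wst n s * (\<Sum>k\<in>A. \<tau> k))"
    unfolding sum_distrib_left by (intro sum.cong refl) simp
   ultimately show ?thesis by simp
  qed
  have finA: "finite A" by (simp add: A_def)
  have "(\<Sum>k\<in>{k\<in>A. gap n / 2 <= abs (s - adj n k)}. wst n s / (abs (rho s - rho (adj n k)) * vv n k (adj n k)))
    <= (\<Sum>k\<in>{k\<in>A. gap n / 2 <= abs (s - adj n k)}. wst n s * (C1 * 2200 * \<tau> k))" by (rule sum_mono[OF up])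
  also have "... <= (\<Sum>k\<in>A. wst n s * (C1 * 2200 * \<tau> k))" using finA tau0 w C1 by (intro sum_mono2) auto
  finally show "(\<Sum>k\<in>{k\<in>mirrored n. gap n / 2 <= abs (s - adj n k)}. wst n s / (abs (rho s - rho (adj n k)) * vv n k (adj n k))) <= C * (LL n)^2"
   using tot unfolding A_def by linarith
  have "(\<Sum>k\<in>A. wst n s / (sqrt (rho s ^ 2 + rho (adj n k) ^ 2) * vv n k (adj n k))) <= (\<Sum>k\<in>A. wst n s * (C1 * 2200 * \<tau> k))" by (rule sum_mono[OF low])
  thus "(\<Sum>k\<in>mirrored n. wst n s / (sqrt (rho s ^ 2 + rho (adj n k) ^ 2) * vv n k (adj n k))) <= C * (LL n)^2"
   using tot unfolding A_def by linarith
  assume ev: "even n" and sg: "gap n / 2 <= s"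
  have v0: "exp (-12) * sqrt (N^3) <= vv n 0 0" unfolding gN by (rule vv_corner[OF ev])
  have "sqrt (s^3 / 24) <= rho s" unfolding rho_def using rsq_bounds(1)[OF s(3)] by (rule real_sqrt_le_mono)
  hence "sqrt (s^3 / 24) * (exp (-12) * sqrt (N^3)) <= rho s * vv n 0 0"
   using v0 rho_ge_0[OF s(3)] s N by (intro mult_mono mult_nonneg_nonneg) auto
  moreover have "exp (-12) / 5 <= sqrt (s^3 / 24) * (exp (-12) * sqrt (N^3))"
  proof -
   have "g / 2 * N <= s * N" using sg N unfolding gN by (intro mult_right_mono) auto
   hence "1 <= s * N" using gNt tip_bounds by linarith
   hence "1 <= (s * N)^3" by (rule one_le_power)
   hence "(1/5)^2 <= s^3 / 24 * N^3" by (simp add: power_mult_distrib power2_eq_square)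
   hence "1/5 <= sqrt (s^3 / 24 * N^3)" by (rule real_le_rsqrt)
   hence "exp (-12) * (1/5) <= exp (-12) * (sqrt (s^3 / 24) * sqrt (N^3))" unfolding real_sqrt_mult by (intro mult_left_mono) auto
   thus ?thesis by (simp add: mult_ac)
  qed
  ultimately have "exp (-12) / 5 <= rho s * vv n 0 0" by linarith
  hence "wst n s / (rho s * vv n 0 0) <= C3 / (exp (-12) / 5)" using w C3 by (intro frac_le) auto
  also have "... = C3 * exp 12 * 5" by (simp add: exp_minus field_simps)
  also have "... <= C * 1" using Ca by simp
  also have "... <= C * (LL n)^2" using L2 C by (intro mult_left_mono) auto
  finally show "wst n s / (rho s * vv n 0 0) <= C * (LL n)^2" .
 qed
 show ?thesis using main C by (intro exI[of _ C]) blast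
qed

section \<open>Lagrange interpolation\<close>

definition lag :: "nat => (nat => complex) => nat => complex => complex" where
 "lag n z k x = (\<Prod>j\<in>{..n} - {k}. (x - z j) / (z k - z j))"

definition lag_poly :: "nat => (nat => complex) => nat => complex poly" where
 "lag_poly n z k = (\<Prod>j\<in>{..n} - {k}. smult (1 / (z k - z j)) [:- z j, 1:])"

lemma poly_lag_poly: "poly (lag_poly n z k) x = lag n z k x"
 unfolding lag_poly_def lag_def poly_prod by (intro prod.cong refl) (simp add: diff_divide_distrib add.commute)

lemma degree_lag_poly: assumes "k <= n" shows "degree (lag_poly n z k) <= n"
proof -
 have "degree (lag_poly n z k) <= sum (degree \<circ> (%j. smult (1 / (z k - z j)) [:- z j, 1:])) ({..n} - {k})"
  unfolding lag_poly_def by (rule degree_prod_sum_le) simp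
 also have "... <= (\<Sum>j\<in>{..n} - {k}. 1)" by (rule sum_mono) (auto intro: order_trans[OF degree_smult_le])
 also have "... = n" using assms by (simp add: card_Diff_singleton)
 finally show ?thesis .
qed

lemma lag_node: assumes "inj_on z {..n}" "j <= n" "k <= n" shows "lag n z k (z j) = (if j = k then 1 else 0)"
proof (cases "j = k")
 case True
 have "z k - z i ~= 0" if "i \<in> {..n} - {k}" for i using assms that by (auto simp: inj_on_def)
 thus ?thesis using True unfolding lag_def by (auto intro!: prod.neutral)
next
 case False
 thus ?thesis unfolding lag_def using assms by (auto intro!: prod_zero)
qed

lemma interp_unique: assumes "inj_on z {..n}" "degree p <= n" "degree q <= n" "\<And>k. k <= n ==> poly p (z k) = poly q (z k)"
 shows "p = (q :: complex poly)"
proof (rule poly_eqI_degree[where A = "z ` {..n}"])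
 show "\<And>x. x \<in> z ` {..n} ==> poly p x = poly q x" using assms by auto
 show "degree p < card (z ` {..n})" "degree q < card (z ` {..n})" using assms by (auto simp: card_image)
qed

lemma interp_poly_eq: assumes inj: "inj_on z {..n}"
 shows "interp_poly n z f = (\<Sum>k\<le>n. smult (f (z k)) (lag_poly n z k))"
proof -
 define q where "q = (\<Sum>k\<le>n. smult (f (z k)) (lag_poly n z k))"
 have d: "degree q <= n" unfolding q_def
  by (intro degree_sum_le) (auto intro: order_trans[OF degree_smult_le] degree_lag_poly)
 have v: "poly q (z j) = f (z j)" if "j <= n" for j
 proof -
  have "poly q (z j) = (\<Sum>k\<le>n. f (z k) * lag n z k (z j))" by (simp add: q_def poly_sum poly_lag_poly)
  also have "... = (\<Sum>k\<le>n. if j = k then f (z k) else 0)" using inj that by (intro sum.cong refl) (auto simp: lag_node)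
  also have "... = f (z j)" using that by simp
  finally show ?thesis .
 qed
 show ?thesis unfolding interp_poly_def q_def[symmetric]
 proof (rule the_equality)
  show "degree q <= n \<and> (\<forall>k\<le>n. poly q (z k) = f (z k))" using d v by simp
  fix p assume "degree p <= n \<and> (\<forall>k\<le>n. poly p (z k) = f (z k))"
  thus "p = q" using d v by (intro interp_unique[OF inj]) auto
 qed
qed

lemma poly_interp: assumes inj: "inj_on z {..n}"
 shows "poly (interp_poly n z f) x = (\<Sum>k\<le>n. f (z k) * lag n z k x)"
 unfolding interp_poly_eq[OF inj] by (simp add: poly_sum poly_lag_poly)

lemma sum_lag: assumes inj: "inj_on z {..n}" shows "(\<Sum>k\<le>n. lag n z k x) = 1"
proof -
 have "interp_poly n z (%_. 1) = 1" unfolding interp_poly_def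
  by (rule the_equality) (auto intro: interp_unique[OF inj])
 thus ?thesis using poly_interp[OF inj, of "%_. 1" x] by simp
qed

lemma sup_norm_bound: assumes X: "compact X" "x \<in> X" and f: "continuous_on X f" shows "norm (f x) <= sup_norm X f"
proof -
 have "compact ((%x. norm (f x)) ` X)" using f X by (intro compact_continuous_image continuous_intros) auto
 hence "bdd_above ((%x. norm (f x)) ` X)" by (intro bounded_imp_bdd_above compact_imp_bounded)
 thus ?thesis unfolding sup_norm_def using X by (intro cSUP_upper) auto
qed

lemma interp_bound: assumes X: "compact X" "X ~= {}" and inj: "inj_on z {..n}" and zX: "z ` {..n} \<subseteq> X"
  and B: "\<And>x. x \<in> X ==> (\<Sum>k\<le>n. norm (lag n z k x)) <= B" and f: "continuous_on X f" "sup_norm X f <= 1"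
 shows "sup_norm X (poly (interp_poly n z f)) <= B"
 unfolding sup_norm_def
proof (rule cSUP_least[OF X(2)])
 fix x assume x: "x \<in> X"
 have "norm (poly (interp_poly n z f) x) <= (\<Sum>k\<le>n. norm (f (z k) * lag n z k x))"
  unfolding poly_interp[OF inj] by (rule norm_sum)
 also have "... <= (\<Sum>k\<le>n. norm (lag n z k x))"
 proof (rule sum_mono)
  fix k assume "k \<in> {..n}"
  hence "norm (f (z k)) <= 1" using sup_norm_bound[OF X(1) _ f(1), of "z k"] zX f(2) by fastforce
  thus "norm (f (z k) * lag n z k x) <= norm (lag n z k x)" by (simp add: norm_mult mult_left_le_one_le)
 qed
 also have "... <= B" by (rule B[OF x])
 finally show "norm (poly (interp_poly n z f) x) <= B" .
qed

lemma lebesgue_upper: assumes X: "compact X" "X ~= {}" and inj: "inj_on z {..n}" and zX: "z ` {..n} \<subseteq> X"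
  and B: "\<And>x. x \<in> X ==> (\<Sum>k\<le>n. norm (lag n z k x)) <= B"
 shows "lebesgue_constant X n z <= B"
 unfolding lebesgue_constant_def
proof (rule cSUP_least)
 have "sup_norm X (%_. 0) = 0" using X by (simp add: sup_norm_def)
 thus "{f. continuous_on X f \<and> sup_norm X f <= 1} ~= {}" by (auto intro!: exI[of _ "%_. 0"])
qed (use interp_bound[OF X inj zX B] in auto)

text \<open>The signs that make all terms positive at \<open>x0\<close> are prescribed at finitely
  many nodes and extended to the whole set without increasing the norm.\<close>
lemma lebesgue_lower: assumes X: "compact X" "x0 \<in> X" and inj: "inj_on z {..n}" and zX: "z ` {..n} \<subseteq> X"
  and B: "\<And>x. x \<in> X ==> (\<Sum>k\<le>n. norm (lag n z k x)) <= B"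
 shows "(\<Sum>k\<le>n. norm (lag n z k x0)) <= lebesgue_constant X n z"
proof -
 have Xn: "X ~= {}" using X by auto
 define S where "S = z ` {..n}"
 define F where "F = (%y. cnj (sgn (lag n z (inv_into {..n} z y) x0)))"
 have finS: "finite S" by (simp add: S_def)
 have SX: "closedin (top_of_set X) S" using finS zX unfolding S_def[symmetric] by (intro closed_subset finite_imp_closed) auto
 have cF: "continuous_on S F" using finS by (rule continuous_on_finite)
 have FC: "F ` S \<subseteq> cball 0 1" by (auto simp: F_def norm_sgn)
 obtain f where f: "continuous_on X f" "f ` X \<subseteq> cball 0 1" "\<And>y. y \<in> S ==> f y = F y"
  using Dugundji[OF convex_cball _ SX cF FC] by (auto simp: image_subset_iff)
 have s1: "sup_norm X f <= 1" unfolding sup_norm_def using f(2) Xn by (intro cSUP_least) auto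
 have fk: "f (z k) * lag n z k x0 = of_real (norm (lag n z k x0))" if "k <= n" for k
 proof -
  have "f (z k) = F (z k)" by (rule f(3)) (use that in \<open>auto simp: S_def\<close>)
  also have "... = cnj (sgn (lag n z k x0))" unfolding F_def using inj that by (simp add: inv_into_f_f)
  finally have e: "f (z k) = cnj (sgn (lag n z k x0))" .
  have "cnj (sgn w) * w = of_real (norm w)" for w :: complex
  proof (cases "w = 0")
   case False
   have "cnj (sgn w) * w = cnj w * w / of_real (norm w)" by (simp add: sgn_eq)
   also have "cnj w * w = of_real (norm w) ^ 2" by (metis complex_norm_square mult.commute of_real_power)
   finally show ?thesis using False by (simp add: power2_eq_square)
  qed simp
  thus ?thesis unfolding e .
 qed
 have "poly (interp_poly n z f) x0 = of_real (\<Sum>k\<le>n. norm (lag n z k x0))"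
  unfolding poly_interp[OF inj] using fk by simp
 hence "(\<Sum>k\<le>n. norm (lag n z k x0)) = norm (poly (interp_poly n z f) x0)" by (simp add: sum_nonneg del: of_real_sum)
 also have "... <= sup_norm X (poly (interp_poly n z f))" by (intro sup_norm_bound X continuous_intros)
 also have "... <= lebesgue_constant X n z" unfolding lebesgue_constant_def
 proof (rule cSUP_upper)
  show "f \<in> {f. continuous_on X f \<and> sup_norm X f <= 1}" using f(1) s1 by simp
  show "bdd_above ((%f. sup_norm X (poly (interp_poly n z f))) ` {f. continuous_on X f \<and> sup_norm X f <= 1})"
   using interp_bound[OF X(1) Xn inj zX B] by (intro bdd_aboveI[of _ B]) auto
 qed
 finally show ?thesis .
qed

lemma norm_lag: "norm (lag n z k x) = (\<Prod>j\<in>{..n} - {k}. norm (x - z j)) / (\<Prod>j\<in>{..n} - {k}. norm (z k - z j))"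
 unfolding lag_def by (simp add: prod_norm[symmetric] norm_divide prod_dividef)

section \<open>The Lebesgue function\<close>

definition Lam :: "nat => complex => real" where "Lam n x = (\<Sum>k\<le>n. norm (lag n (fej n) k x))"

text \<open>The index of the complex conjugate node.\<close>
definition partner :: "nat => nat => nat" where
 "partner n j = (if j < lo_idx n then j else 2 * (n div 2) + 1 - j)"

lemma partner: assumes "j <= n" shows "partner n j <= n" "partner n (partner n j) = j"
 "fej n (partner n j) = cnj (fej n j)"
proof -
 have m: "2 * (n div 2) + 1 = (if even n then n + 1 else n)" by auto
 show "partner n j <= n" "partner n (partner n j) = j" using assms unfolding partner_def m lo_idx by auto
 have c0: "cnj (arm 0) = arm 0" by (simp add: arm_def)
 show "fej n (partner n j) = cnj (fej n j)"
 proof (cases "j < lo_idx n")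
  case True
  hence "even n" "j = 0" by (auto simp: lo_idx split: if_splits)
  thus ?thesis using True adjusted_0(1)[of n] c0 by (simp add: partner_def adjusted_fejer_upper)
 next
  case False
  hence lo: "lo_idx n <= j" by simp
  have p: "partner n j = 2 * (n div 2) + 1 - j" using False by (simp add: partner_def)
  show ?thesis
  proof (cases "j <= n div 2")
   case True
   show ?thesis unfolding p using adjusted_fejer_lower[OF True lo] adjusted_fejer_upper[OF True] by simp
  next
   case False
   then obtain i where i: "i <= n div 2" "lo_idx n <= i" "j = 2 * (n div 2) + 1 - i" using lower_index[of n j] assms by auto
   have "2 * (n div 2) + 1 - j = i" using i(1,3) by simp
   hence pj: "partner n j = i" using p by simp
   have "fej n j = cnj (arm (adj n i))" unfolding i(3) by (rule adjusted_fejer_lower[OF i(1,2)])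
   thus ?thesis unfolding pj adjusted_fejer_upper[OF i(1)] by simp
  qed
 qed
qed

lemma partner_prod: fixes g :: "complex => real" assumes "k <= n"
 shows "(\<Prod>j\<in>{..n} - {partner n k}. g (fej n j)) = (\<Prod>j\<in>{..n} - {k}. g (cnj (fej n j)))"
proof (rule prod.reindex_bij_witness[where i = "partner n" and j = "partner n"])
 fix a assume a: "a \<in> {..n} - {partner n k}"
 hence a': "a <= n" "a ~= partner n k" by auto
 show "partner n (partner n a) = a" using partner a' by simp
 show "partner n a \<in> {..n} - {k}" using partner[of a n] a' by auto
 show "g (cnj (fej n (partner n a))) = g (fej n a)" using partner a' by simp
next
 fix b assume b: "b \<in> {..n} - {k}"
 hence b': "b <= n" "b ~= k" by auto
 show "partner n (partner n b) = b" using partner b' by simp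
 show "partner n b \<in> {..n} - {partner n k}" using partner[of b n] partner[OF assms] b' by auto
qed

lemma norm_lag_partner: assumes "k <= n"
 shows "norm (lag n (fej n) (partner n k) (cnj x)) = norm (lag n (fej n) k x)"
proof -
 have c: "norm (cnj a - cnj b) = norm (a - b)" for a b by (metis complex_cnj_diff complex_mod_cnj)
 show ?thesis unfolding norm_lag partner(3)[OF assms]
  using partner_prod[OF assms, of "%y. norm (cnj x - y)"] partner_prod[OF assms, of "%y. norm (cnj (fej n k) - y)"] by (simp add: c)
qed

lemma Lam_cnj: "Lam n (cnj x) = Lam n x"
 unfolding Lam_def
proof (rule sum.reindex_bij_witness[where i = "partner n" and j = "partner n"])
 fix a assume "a \<in> {..n}"
 hence a: "a <= n" by simp
 show "partner n (partner n a) = a" "partner n a \<in> {..n}" using partner[OF a] by auto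
 show "norm (lag n (fej n) (partner n a) x) = norm (lag n (fej n) a (cnj x))"
  using norm_lag_partner[OF a, of "cnj x"] by simp
next
 fix b assume "b \<in> {..n}"
 hence b: "b <= n" by simp
 show "partner n (partner n b) = b" "partner n b \<in> {..n}" using partner[OF b] by auto
qed

lemma prod_others: assumes k: "k <= n div 2" and t: "t \<in> {0..tip}"
 shows "(\<Prod>j\<in>{..n} - {k}. norm (arm t - fej n j)) = vv n k t"
proof -
 define g where "g = (%j. if j = k then 1 else norm (arm t - fej n j))"
 have "(\<Prod>j\<in>{..n} - {k}. norm (arm t - fej n j)) = (\<Prod>j\<le>n. g j)"
  unfolding g_def by (rule prod.mono_neutral_cong_left) auto
 also have "... = (\<Prod>j\<le>n div 2. g j) * (\<Prod>j\<in>mirrored n. g (2 * (n div 2) + 1 - j))" by (rule prod_split_index)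
 also have "(\<Prod>j\<le>n div 2. g j) = (\<Prod>j\<in>{..n div 2} - {k}. \<bar>rho t - rho (adj n j)\<bar>)"
 proof (rule prod.mono_neutral_cong_right)
  fix j assume "j \<in> {..n div 2} - {k}"
  hence j: "j <= n div 2" "j ~= k" by auto
  have "adj n j \<in> {0..tip}" using adjusted_range[OF j(1)] by simp
  thus "g j = abs (rho t - rho (adj n j))" unfolding g_def adjusted_fejer_upper[OF j(1)]
   using j t by (simp add: norm_arm_diff rho_ge_0)
 qed (auto simp: g_def)
 also have "(\<Prod>j\<in>mirrored n. g (2 * (n div 2) + 1 - j)) = mir n t" unfolding mir_def
 proof (intro prod.cong refl)
  fix j assume j: "j \<in> mirrored n"
  hence "2 * (n div 2) + 1 - j ~= k" using k by auto
  hence "g (2 * (n div 2) + 1 - j) = norm (arm t - fej n (2 * (n div 2) + 1 - j))" by (simp only: g_def if_False)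
  also have "... = sqrt (rho t ^ 2 + rho (adj n j) ^ 2)"
   using j by (simp only: adjusted_fejer_lower norm_arm_cnj_diff atLeastAtMost_iff)
  finally show "g (2 * (n div 2) + 1 - j) = sqrt (rho t ^ 2 + rho (adj n j) ^ 2)" .
 qed
 finally show ?thesis unfolding vv_def .
qed

lemma norm_lag_upper: assumes k: "k <= n div 2" and t: "t \<in> {0..tip}"
 shows "norm (lag n (fej n) k (arm t)) = vv n k t / vv n k (adj n k)"
proof -
 have "adj n k \<in> {0..tip}" using adjusted_range[OF k] by simp
 thus ?thesis unfolding norm_lag prod_others[OF k t] adjusted_fejer_upper[OF k] by (simp add: prod_others[OF k])
qed

lemma norm_lag_lower: assumes i: "i \<in> mirrored n" and t: "t \<in> {0..tip}"
 shows "norm (lag n (fej n) (2 * (n div 2) + 1 - i) (arm t)) = wst n t / (sqrt (rho t ^ 2 + rho (adj n i) ^ 2) * vv n i (adj n i))"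
proof -
 have i1: "i <= n div 2" "i <= n" "lo_idx n <= i" using i by auto
 define \<kappa> where "\<kappa> = 2 * (n div 2) + 1 - i"
 have kp: "\<kappa> = partner n i" using i unfolding \<kappa>_def partner_def by auto
 have kn: "\<kappa> <= n" unfolding kp by (rule partner(1)[OF i1(2)])
 have z: "fej n \<kappa> = cnj (arm (adj n i))" unfolding \<kappa>_def by (rule adjusted_fejer_lower[OF i1(1,3)])
 have pin: "adj n i \<in> {0..tip}" "0 < adj n i" using adjusted_range[OF i1(1)] i1 gap_pos[of n] by auto
 define E where "E = sqrt (rho t ^ 2 + rho (adj n i) ^ 2)"
 have E: "norm (arm t - fej n \<kappa>) = E" unfolding z E_def by (rule norm_arm_cnj_diff)
 have "0 < rho (adj n i)" using pin tip_bounds by (intro rho_pos) auto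
 hence E0: "0 < E" unfolding E_def by (simp add: add_nonneg_pos)
 have w: "wst n t = E * (\<Prod>j\<in>{..n} - {\<kappa>}. norm (arm t - fej n j))"
  unfolding wst_def E[symmetric] using kn by (intro prod.remove) auto
 have c: "norm (cnj a - cnj b) = norm (a - b)" for a b by (metis complex_cnj_diff complex_mod_cnj)
 have "(\<Prod>j\<in>{..n} - {\<kappa>}. norm (fej n \<kappa> - fej n j)) = vv n i (adj n i)"
  unfolding kp z[unfolded kp] partner_prod[OF i1(2), of "%y. norm (cnj (arm (adj n i)) - y)"] c by (rule prod_others[OF i1(1) pin(1)])
 thus ?thesis unfolding norm_lag \<kappa>_def[symmetric] E_def[symmetric] w using E0 by simp
qed

text \<open>The products over both arms were split already; the exponential carries the splitting
  over to sums.\<close>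
lemma Lam_split: "Lam n x = (\<Sum>k\<le>n div 2. norm (lag n (fej n) k x)) + (\<Sum>k\<in>mirrored n. norm (lag n (fej n) (2 * (n div 2) + 1 - k) x))"
proof -
 define h where "h = (%k. norm (lag n (fej n) k x))"
 have "exp (\<Sum>k\<le>n. h k) = (\<Prod>k\<le>n. exp (h k))" by (rule exp_sum) simp
 also have "... = (\<Prod>k\<le>n div 2. exp (h k)) * (\<Prod>k\<in>mirrored n. exp (h (2 * (n div 2) + 1 - k)))" by (rule prod_split_index)
 also have "... = exp ((\<Sum>k\<le>n div 2. h k) + (\<Sum>k\<in>mirrored n. h (2 * (n div 2) + 1 - k)))"
  by (simp add: exp_add exp_sum)
 finally show ?thesis unfolding Lam_def h_def by simp
qed

lemma continuous_on_arm: "continuous_on A arm"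
 unfolding arm_def[abs_def] by (intro continuous_intros continuous_on_rho)

lemma continuous_on_Lam: "continuous_on A (%s. Lam n (arm s))"
proof -
 have "continuous_on UNIV (%x. norm (poly (lag_poly n (fej n) k) x))" for k by (intro continuous_intros)
 hence "continuous_on UNIV (%x. norm (lag n (fej n) k x))" for k unfolding poly_lag_poly .
 hence "continuous_on UNIV (Lam n)" unfolding Lam_def[abs_def] by (intro continuous_on_sum)
 thus ?thesis by (rule continuous_on_compose2[OF _ continuous_on_arm]) simp
qed

text \<open>At most one node is closer to \<open>s\<close> than \<open>gap n / 2\<close>. Its
  fundamental polynomial is controlled by the others, because all of them add up to 1.\<close>
lemma Lam_generic: "\<exists>C>0. \<forall>n s. n \<ge> 2 --> generic n s --> Lam n (arm s) <= C * (LL n)^2"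
proof -
 obtain C where C: "C > 0" and T: "\<And>n s. n \<ge> 2 ==> generic n s ==>
  (\<Sum>k\<in>{k\<in>mirrored n. gap n / 2 <= abs (s - adj n k)}. wst n s / (abs (rho s - rho (adj n k)) * vv n k (adj n k)))
  <= C * (LL n)^2 \<and>
  (\<Sum>k\<in>mirrored n. wst n s / (sqrt (rho s ^ 2 + rho (adj n k) ^ 2) * vv n k (adj n k))) <= C * (LL n)^2 \<and>
  (even n --> gap n / 2 <= s --> wst n s / (rho s * vv n 0 0) <= C * (LL n)^2)"
  using total_bound by blast
 have "Lam n (arm s) <= (1 + 6 * C) * (LL n)^2" if n: "n \<ge> 2" and gen: "generic n s" for n s
 proof -
  have s: "0 < s" "s < tip" "s \<in> {0..tip}" "\<And>k. k <= n div 2 ==> s ~= adj n k" using gen by (auto simp: generic_def)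
  note T = T[OF n gen]
  define z where "z = fej n"
  have inj: "inj_on z {..n}" unfolding z_def by (rule adjusted_fejer_inj)
  define u where "u = (%k. norm (lag n z k (arm s)))"
  define B where "B = C * (LL n)^2"
  have L2: "1 <= (LL n)^2" using LL_ge[of n] by (simp add: one_le_power)
  have B0: "0 <= B" using C by (simp add: B_def)
  have ueq: "u k = wst n s / (abs (rho s - rho (adj n k)) * vv n k (adj n k))" if k: "k <= n div 2" for k
  proof -
   have "adj n k \<in> {0..tip}" using adjusted_range[OF k] by simp
   hence "rho s ~= rho (adj n k)" using rho_inj[of s "adj n k"] s(3) s(4)[OF k] by auto
   thus ?thesis unfolding u_def z_def norm_lag_upper[OF k s(3)] vv_wst[OF s(3) k] by simp
  qed
  have u0: "0 <= u k" for k by (simp add: u_def)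
  define Nr where "Nr = {k. k <= n div 2 \<and> \<bar>s - adj n k\<bar> < gap n / 2}"
  define Fa where "Fa = {k\<in>mirrored n. gap n / 2 <= abs (s - adj n k)}"
  have far: "(\<Sum>k\<in>{..n div 2} - Nr. u k) <= 2 * B"
  proof -
   have fa: "(\<Sum>k\<in>Fa. u k) <= B"
   proof -
    have "(\<Sum>k\<in>Fa. u k) = (\<Sum>k\<in>Fa. wst n s / (abs (rho s - rho (adj n k)) * vv n k (adj n k)))"
     by (intro sum.cong refl ueq) (auto simp: Fa_def)
    thus ?thesis using T unfolding Fa_def B_def by simp
   qed
   have ss: "{..n div 2} - Nr \<subseteq> Fa \<union> (if even n \<and> gap n / 2 <= s then {0} else {})"
   proof
    fix k assume k: "k \<in> {..n div 2} - Nr"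
    hence k1: "k <= n div 2" "gap n / 2 <= abs (s - adj n k)" by (auto simp: Nr_def)
    show "k \<in> Fa \<union> (if even n \<and> gap n / 2 <= s then {0} else {})"
    proof (cases "lo_idx n <= k")
     case True thus ?thesis using k1 by (simp add: Fa_def)
    next
     case False
     hence "even n" "k = 0" by (auto simp: lo_idx split: if_splits)
     moreover have "gap n / 2 <= s" using k1(2) adjusted_0(1)[of n] calculation s by simp
     ultimately show ?thesis by simp
    qed
   qed
   have "(\<Sum>k\<in>{..n div 2} - Nr. u k) <= (\<Sum>k\<in>Fa \<union> (if even n \<and> gap n / 2 <= s then {0} else {}). u k)"
    by (rule sum_mono2[OF _ ss]) (auto simp: Fa_def u0)
   also have "... <= (\<Sum>k\<in>Fa. u k) + (\<Sum>k\<in>(if even n \<and> gap n / 2 <= s then {0} else {}). u k)"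
    by (subst sum_Un) (auto simp: Fa_def intro!: sum_nonneg u0)
   also have "(\<Sum>k\<in>(if even n \<and> gap n / 2 <= s then {0} else {}). u k) <= B"
   proof (cases "even n \<and> gap n / 2 <= s")
    case True
    have "u 0 = wst n s / (rho s * vv n 0 0)" using ueq[of 0] True adjusted_0(1)[of n] rho_ge_0[OF s(3)] by simp
    thus ?thesis using True T by (simp add: B_def)
   qed (use B0 in auto)
   finally show ?thesis using fa by linarith
  qed
  have low: "(\<Sum>k\<in>mirrored n. norm (lag n z (2 * (n div 2) + 1 - k) (arm s))) <= B"
  proof -
   have "(\<Sum>k\<in>mirrored n. norm (lag n z (2 * (n div 2) + 1 - k) (arm s))) =
     (\<Sum>k\<in>mirrored n. wst n s / (sqrt (rho s ^ 2 + rho (adj n k) ^ 2) * vv n k (adj n k)))"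
    unfolding z_def by (intro sum.cong refl norm_lag_lower s(3))
   thus ?thesis using T unfolding B_def by simp
  qed
  have sp: "Lam n (arm s) = (\<Sum>k\<in>Nr. u k) + (\<Sum>k\<in>{..n div 2} - Nr. u k) + (\<Sum>k\<in>mirrored n. norm (lag n z (2 * (n div 2) + 1 - k) (arm s)))"
  proof -
   have "(\<Sum>k\<le>n div 2. u k) = (\<Sum>k\<in>{..n div 2} - Nr. u k) + (\<Sum>k\<in>Nr. u k)"
    by (rule sum.subset_diff) (auto simp: Nr_def)
   thus ?thesis unfolding Lam_split z_def[symmetric] u_def by simp
  qed
  have near: "(\<Sum>k\<in>Nr. u k) <= 1 + 3 * B"
  proof (cases "Nr = {}")
   case False
   then obtain i where i: "i \<in> Nr" by blast
   have "k = i" if "k \<in> Nr" for k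
   proof (rule ccontr)
    assume "k ~= i"
    hence "gap n <= abs (adj n k - adj n i)" using that i by (intro adjusted_sep) (auto simp: Nr_def)
    moreover have "abs (s - adj n k) < gap n / 2" "abs (s - adj n i) < gap n / 2" using that i by (auto simp: Nr_def)
    ultimately show False by linarith
   qed
   hence Ni: "Nr = {i}" using i by blast
   have iN: "i \<in> {..n}" using i by (auto simp: Nr_def)
   have "Lam n (arm s) = u i + (\<Sum>k\<in>{..n} - {i}. u k)" unfolding Lam_def u_def z_def using iN by (intro sum.remove) auto
   hence rest: "(\<Sum>k\<in>{..n} - {i}. u k) <= 3 * B" using sp Ni far low by simp
   have "(\<Sum>k\<le>n. lag n z k (arm s)) = lag n z i (arm s) + (\<Sum>k\<in>{..n} - {i}. lag n z k (arm s))" using iN by (intro sum.remove) auto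
   hence "lag n z i (arm s) = 1 - (\<Sum>k\<in>{..n} - {i}. lag n z k (arm s))" unfolding sum_lag[OF inj] by (simp add: eq_diff_eq)
   hence "u i <= 1 + norm (\<Sum>k\<in>{..n} - {i}. lag n z k (arm s))" unfolding u_def using norm_triangle_ineq4[of 1 "\<Sum>k\<in>{..n} - {i}. lag n z k (arm s)"] by simp
   also have "norm (\<Sum>k\<in>{..n} - {i}. lag n z k (arm s)) <= (\<Sum>k\<in>{..n} - {i}. u k)" unfolding u_def by (rule norm_sum)
   finally show ?thesis using rest Ni by simp
  qed (use B0 in simp)
  have "Lam n (arm s) <= 1 + 6 * B" using sp near far low by linarith
  also have "... <= (1 + 6 * C) * (LL n)^2" unfolding B_def distrib_right using L2 by simp
  finally show ?thesis .
 qed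
 thus ?thesis using C by (intro exI[of _ "1 + 6 * C"]) auto
qed

lemma Lam_upper: "\<exists>C>0. \<forall>n\<ge>2. \<forall>x\<in>gamma0. Lam n x <= C * (LL n)^2"
proof -
 obtain C where C: "C > 0" and G: "\<And>n s. n \<ge> 2 ==> generic n s ==> Lam n (arm s) <= C * (LL n)^2" using Lam_generic by blast
 have *: "Lam n (arm s) <= C * (LL n)^2" if n: "n \<ge> 2" and s: "s \<in> {0..tip}" for n s
 proof (rule ccontr)
  assume "\<not> ?thesis"
  hence e: "0 < Lam n (arm s) - C * (LL n)^2" by simp
  obtain d where d: "d > 0" "\<And>t. t \<in> {0..tip} ==> dist t s < d ==> dist (Lam n (arm t)) (Lam n (arm s)) < Lam n (arm s) - C * (LL n)^2"
   using continuous_on_Lam[of "{0..tip}" n] s e unfolding continuous_on_iff by meson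
  define a b where "a = max 0 (s - d)" and "b = min tip (s + d)"
  have ab: "a < b" using s d tip_bounds by (auto simp: a_def b_def)
  have "infinite ({a<..<b} - (raw n ` {..n div 2} \<union> adj n ` {..n div 2}))"
   using ab by (intro Diff_infinite_finite) auto
  then obtain t where t: "t \<in> {a<..<b}" "t \<notin> raw n ` {..n div 2} \<union> adj n ` {..n div 2}" by (metis Diff_iff ex_in_conv finite.emptyI)
  have "generic n t" using t by (auto simp: generic_def a_def b_def)
  hence 1: "Lam n (arm t) <= C * (LL n)^2" by (rule G[OF n])
  have "dist (Lam n (arm t)) (Lam n (arm s)) < Lam n (arm s) - C * (LL n)^2"
   by (rule d(2)) (use t in \<open>auto simp: a_def b_def dist_real_def\<close>)
  thus False using 1 by (simp add: dist_real_def)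
 qed
 have "Lam n x <= C * (LL n)^2" if n: "n \<ge> 2" and x: "x \<in> gamma0" for n x
  using x *[OF n] unfolding gamma0_arm by (auto simp: Lam_cnj)
 thus ?thesis using C by blast
qed

section \<open>The lower bound\<close>

lemma K_mono_inv: assumes "x \<in> {0..tip}" "y \<in> {0..tip}" "K x <= K y" shows "y <= x"
 using K_strict_antimono[of x y] assms by force

lemma lattice_above: assumes "thu n 0 <= x"
 obtains j where "x < thu n j" "thu n j <= x + 3 * gap n"
proof -
 define h where "h = 3 * gap n"
 have h: "h > 0" using gap_pos[of n] by (simp add: h_def)
 define j where "j = nat \<lfloor>(x - thu n 0) / h\<rfloor> + 1"
 have "0 <= (x - thu n 0) / h" using assms h by simp
 hence j: "real j <= (x - thu n 0) / h + 1" "(x - thu n 0) / h < real j" unfolding j_def by linarith+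
 have th: "thu n j = thu n 0 + h * real j" using theta_upper_diff[of n j 0] by (simp add: h_def)
 have e: "(x - thu n 0) / h * h = x - thu n 0" using h by simp
 have "(x - thu n 0) / h * h < real j * h" using j(2) h by (rule mult_strict_right_mono)
 moreover have "real j * h <= ((x - thu n 0) / h + 1) * h" using j(1) h by (intro mult_right_mono) auto
 hence "real j * h <= x - thu n 0 + h" unfolding distrib_right e by simp
 ultimately have "x < thu n j" "thu n j <= x + 3 * gap n" unfolding th h_def[symmetric] e by (simp_all add: mult.commute)
 thus ?thesis by (rule that)
qed

lemma index_bound: assumes "thu n j < pi" shows "j <= n div 2"
proof -
 have "2 * real j * pi < NN n * pi \<or> (odd n \<and> (2 * real j + 1) * pi < NN n * pi)"
  using assms by (auto simp: theta_upper_def divide_less_eq mult.commute split: if_splits)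
 hence "2 * real j < real n + 1 \<or> (odd n \<and> 2 * real j + 1 < real n + 1)" by (auto simp: mult_less_cancel_right)
 thus ?thesis by (cases "even n") (auto elim!: evenE oddE)
qed

lemma vv_inner_upper:
 assumes i: "inner_node n i" "lo_idx n <= i" "free n i" and p: "p = raw n i" "p < tip"
 shows "vv n i p * (mu p * (tip - p)) <= exp 6 * 25600 * 550 * (NN n * DD n (K p))"
proof -
 have i1: "i <= n div 2" using i by (simp add: inner_node_def)
 have g: "gap n > 0" by (rule gap_pos)
 have pp: "p <= tip" "0 < p" using lo_raw[OF i1 i(2)] raw_range[OF i1] g p by auto
 have m: "0 < mu p" using pp rho_pos[of p] tip_bounds by (simp add: mu_def)
 define CU :: real where "CU = exp 6 * 25600"
 have a: "vv n i s * (mu p * (2*tip - s - p) / 2200) <= CU * (NN n / 2 * DD n (K s))"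
  if s: "0 < s" "p - gap n / 2 < s" "s < p" for s
 proof -
  have s': "s < tip" "abs (s - raw n i) <= gap n / 2" using s pp p by auto
  have D: "DD n s <= NN n / 2 * abs (s - p)" unfolding p(1) raw_inner[OF i(1)] by (rule DD_upper)
  have "abs (s - p) * mu p * (2*tip - s - p) / 2200 <= abs (rho s - rho p)" using s pp by (intro rho_diff_lower) auto
  hence "abs (s - p) * mu p * (2*tip - s - p) / 2200 * vv n i s <= abs (rho s - rho p) * vv n i s" by (intro mult_right_mono vv_nonneg)
  also have "... <= CU * (DD n s * DD n (K s))" unfolding CU_def p(1) by (rule vv_near_free(2)[OF i1 i(2,3) s(1) s'])
  also have "... <= CU * ((NN n / 2 * abs (s - p)) * DD n (K s))" using D DD_bounds(1)[of n "K s"] by (intro mult_left_mono mult_right_mono) (auto simp: CU_def)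
  finally have X: "abs (s - p) * mu p * (2*tip - s - p) / 2200 * vv n i s <= CU * ((NN n / 2 * abs (s - p)) * DD n (K s))" .
  have "d * e * f / 2200 * v = d * (v * (e * f / 2200))" "c * ((x * d) * y) = d * (c * (x * y))" for d e f v c x y :: real by simp_all
  hence "abs (s - p) * (vv n i s * (mu p * (2*tip - s - p) / 2200)) <= abs (s - p) * (CU * (NN n / 2 * DD n (K s)))" using X by metis
  moreover have "0 < abs (s - p)" using s by simp
  ultimately show ?thesis by (rule mult_left_le_imp_le)
 qed
 have "vv n i p * (mu p * (2*tip - p - p) / 2200) <= CU * (NN n / 2 * DD n (K p))"
  by (rule limit_le[where d = "gap n / 2", OF _ _ pp(2,1) _ a])
    (use g in \<open>auto intro!: continuous_intros continuous_on_DDK continuous_on_vv\<close>)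
 moreover have "v * (e * (2*tip - p - p) / 2200) = v * (e * (tip - p)) / 1100" "c * (N / 2 * D) = c * (N * D) / 2" for v e c N D :: real
 proof -
  have "2*tip - p - p = 2 * (tip - p)" by simp
  thus "v * (e * (2*tip - p - p) / 2200) = v * (e * (tip - p)) / 1100" by simp
 qed simp
 ultimately have "vv n i p * (mu p * (tip - p)) / 1100 <= CU * (NN n * DD n (K p)) / 2" by metis
 thus ?thesis unfolding CU_def by linarith
qed

text \<open>Take an angle \<open>s\<close> of order \<open>1 / q\<close>, half way between inner
  lattice points, with \<open>K s\<close> half way between outer ones. The folded outer nodes
  \<open>bk 1, bk 2, ...\<close> to the left of \<open>s\<close> are at distance of order \<open>i
  * h / s^2\<close> from it, and between two of them there is room for more than \<open>q\<close>
  inner nodes. The derivative at the \<open>m\<close>-th inner node to the right of \<open>bk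
  i\<close> carries the factor \<open>DD n (K p)\<close> of order \<open>m * s^2\<close>, so that
  its fundamental polynomial has size \<open>1 / (i * m)\<close> at \<open>s\<close>.\<close>
lemma Lam_lower_core:
 "\<exists>c>0. \<forall>n q. 4000 <= q --> real q ^ 4 <= real n + 1 -->
  (\<exists>s\<in>{0..tip}. c * (\<Sum>i\<in>{1..q}. 1 / real i)^2 <= Lam n (arm s))"
proof -
 define CV :: real where "CV = exp 6 * 25600 * 550"
 define c :: real where "c = cc / 2 / (CV * 8 * 3 * 36 * 36 * 164 * 50 * 2)"
 have CV: "CV > 0" by (simp add: CV_def)
 have c: "c > 0" unfolding c_def using cc_pos CV by simp
 have "\<exists>s\<in>{0..tip}. c * (\<Sum>i\<in>{1..q}. 1 / real i)^2 <= Lam n (arm s)"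
  if q: "4000 <= q" and qN: "real q ^ 4 <= real n + 1" for n q
 proof -
  define N where "N = real n + 1"
  define h where "h = 3 * gap n"
  have g: "gap n > 0" by (rule gap_pos)
  have h: "h > 0" using g by (simp add: h_def)
  have hN: "h * N = 2 * pi" using gap_N[of n] unfolding h_def N_def tip_def by simp
  have N1: "N \<ge> 1" by (simp add: N_def)
  define Q where "Q = real q"
  have Q: "4000 <= Q" using q by (simp add: Q_def)
  have hQ': "h * Q^4 <= 13/2"
  proof -
   have "h * Q^4 <= h * N" using qN h unfolding Q_def N_def by (intro mult_left_mono) auto
   also have "... <= 13/2" unfolding hN using pi_approx by simp
   finally show ?thesis .
  qed
  hence hQ: "h * Q^4 <= 7" by linarith
  define \<beta> where "\<beta> = 10 / Q"
  have b: "0 < \<beta>" "\<beta> <= 1/400" using Q by (auto simp: \<beta>_def divide_le_eq)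
  have bQ: "\<beta> * Q = 10" using Q by (simp add: \<beta>_def)
  have hq: "h * Q^3 <= 7 / Q" using hQ Q by (simp add: le_divide_eq eval_nat_numeral mult_ac)
  have hq1: "2 * Q * h <= \<beta> / 4"
  proof -
   have "Q * 4000^2 <= Q * Q^2" using Q by (intro mult_left_mono power_mono) auto
   hence "h * (Q * 4000^2) <= h * Q^3" using h by (intro mult_left_mono) (auto simp: power3_eq_cube power2_eq_square)
   hence "h * Q * 16000000 <= 7 / Q" using hq by simp
   moreover have "0 <= 1 / Q" using Q by simp
   moreover have "7 / Q = 7 * (1 / Q)" "\<beta> / 4 = 5/2 * (1 / Q)" by (simp_all add: \<beta>_def)
   moreover have "2 * Q * h = 2 * (h * Q)" by simp
   ultimately show ?thesis by linarith
  qed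
  have h1: "h <= \<beta> / 4"
  proof -
   have "1 * h <= 2 * Q * h" using Q h by (intro mult_right_mono) auto
   thus ?thesis using hq1 by simp
  qed
  have t2: "2 * \<beta> < tip" "\<beta> < tip" "3 * \<beta> < tip" using b tip_bounds by linarith+
  \<comment> \<open>the angles between \<open>K (2 * \<beta>)\<close> and \<open>K \<beta>\<close> contain more than \<open>q\<close> lattice points: their length is of order \<open>q^-3\<close>\<close>
  have Kb: "tip < K (2 * \<beta>)" using K_strict_antimono[of "2 * \<beta>" tip] t2 b by simp
  have th0: "0 <= thu n 0" "thu n 0 <= h / 2"
  proof -
   have "h / 2 = pi / NN n" using gap_pi[of n] by (simp add: h_def)
   moreover show "0 <= thu n 0" by (simp add: theta_upper_def)
   moreover have "thu n 0 <= pi / NN n" by (simp add: theta_upper_def)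
   ultimately show "thu n 0 <= h / 2" by linarith
  qed
  have "thu n 0 <= K (2 * \<beta>)" using th0 h1 b Kb tip_bounds by linarith
  then obtain k0 where k0: "K (2 * \<beta>) < thu n k0" "thu n k0 <= K (2 * \<beta>) + h"
   using lattice_above[of n "K (2 * \<beta>)"] unfolding h_def by blast
  have thk: "thu n (k + i) = thu n k + real i * h" for k i
   using theta_upper_diff[of n "k + i" k] by (simp add: h_def mult.commute)
  have top: "thu n (k0 + (q + 1)) <= K \<beta>"
  proof -
   have "abs (2 * \<beta> - \<beta>) * (2 * \<beta> + \<beta>)^2 / 648 <= abs (K (2 * \<beta>) - K \<beta>)" using t2 b by (intro K_diff(3)) auto
   moreover have "K (2 * \<beta>) < K \<beta>" using t2 b by (intro K_strict_antimono) auto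
   moreover have "abs (2 * \<beta> - \<beta>) * (2 * \<beta> + \<beta>)^2 / 648 = \<beta>^3 / 72" using b by (simp add: power2_eq_square power3_eq_cube)
   ultimately have "\<beta>^3 / 72 <= K \<beta> - K (2 * \<beta>)" by simp
   moreover have "(real q + 2) * h <= \<beta>^3 / 72"
   proof -
    have "(Q + 2) * h * Q^3 <= (2 * Q) * h * Q^3" using Q h by (intro mult_right_mono) auto
    also have "... = 2 * (h * Q^4)" by (simp add: eval_nat_numeral)
    also have "... <= 1000 / 72" using hQ' by linarith
    also have "... = (\<beta> * Q)^3 / 72" unfolding bQ by simp
    also have "... = \<beta>^3 / 72 * Q^3" by (simp add: power_mult_distrib)
    finally show ?thesis using Q unfolding Q_def by (simp only: mult_le_cancel_right) simp
   qed
   ultimately show ?thesis unfolding thk using k0(2) by (simp add: distrib_right)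
  qed
  define bk where "bk = (%i. raw n (k0 + i))"
  have outer: "outer_node n (k0 + i)" and bks: "\<beta> <= bk i" "bk i <= 2 * \<beta>" "K (bk i) = thu n (k0 + i)" if i: "i <= q + 1" for i
  proof -
   have up: "thu n (k0 + i) <= K \<beta>" using top i h unfolding thk by (smt (verit) mult_right_mono of_nat_mono)
   have lo: "K (2 * \<beta>) <= thu n (k0 + i)" unfolding thk using k0(1) h by (smt (verit) mult_nonneg_nonneg of_nat_0_le_iff)
   have "K \<beta> < pi" using K_strict_antimono[of 0 \<beta>] b t2 by simp
   thus o: "outer_node n (k0 + i)" using index_bound[of n "k0 + i"] up lo Kb by (auto simp: outer_node_def)
   note of = outer_facts[OF o]
   show Kbk: "K (bk i) = thu n (k0 + i)" unfolding bk_def by (rule of(3))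
   have r: "bk i \<in> {0..tip}" "\<beta> \<in> {0..tip}" "2 * \<beta> \<in> {0..tip}" using of(1,2) b t2 by (auto simp: bk_def)
   show "\<beta> <= bk i" by (rule K_mono_inv) (use r Kbk up in auto)
   show "bk i <= 2 * \<beta>" by (rule K_mono_inv) (use r Kbk lo in auto)
  qed
  have bk_gap: "bk (Suc i) + (real q + 2) * h <= bk i" if i: "i <= q" for i
  proof -
   have r: "bk i \<in> {0..tip}" "bk (Suc i) \<in> {0..tip}" using bks[of i] bks[of "Suc i"] i b t2 by auto
   have K1: "K (bk (Suc i)) = K (bk i) + h" using bks(3)[of i] bks(3)[of "Suc i"] i thk[of "k0 + i" 1] by simp
   hence le: "bk (Suc i) <= bk i" using K_mono_inv[OF r] h by simp
   have "abs (K (bk i) - K (bk (Suc i))) <= 2 * (abs (bk i - bk (Suc i)) * (bk i + bk (Suc i))^2)" by (rule K_diff(2)[OF r(2,1)])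
   hence "h <= 2 * ((bk i - bk (Suc i)) * (bk i + bk (Suc i))^2)" using K1 le h by simp
   also have "... <= 2 * ((bk i - bk (Suc i)) * (4 * \<beta>)^2)" using le bks[of i] bks[of "Suc i"] i b by (intro mult_left_mono power_mono) auto
   finally have "h * Q^2 <= 2 * ((bk i - bk (Suc i)) * (4 * \<beta>)^2) * Q^2" by (rule mult_right_mono) simp
   also have "... = 32 * (bk i - bk (Suc i)) * (\<beta> * Q)^2" by (simp add: power_mult_distrib)
   finally have "h * Q^2 <= 32 * (bk i - bk (Suc i)) * (\<beta> * Q)^2" .
   hence "h * Q^2 <= 3200 * (bk i - bk (Suc i))" unfolding bQ by simp
   moreover have "3200 * ((Q + 2) * h) <= h * Q^2"
   proof -
    have "4000 * Q <= Q * Q" using Q by (intro mult_right_mono) auto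
    moreover have "3200 * (Q + 2) <= 4000 * Q" using Q by simp
    ultimately have "3200 * (Q + 2) <= Q^2" unfolding power2_eq_square by linarith
    from mult_left_mono[OF this, of h] show ?thesis using h by (simp add: mult_ac)
   qed
   moreover have "b + d <= a" if "x <= 3200 * (a - b)" "3200 * d <= x" for a b d x :: real using that by argo
   ultimately show ?thesis unfolding Q_def by blast
  qed
  have bk_mono: "bk j + (real q + 2) * h <= bk i" if "i < j" "j <= q + 1" for i j
   using that
  proof (induction j)
   case (Suc j)
   have "0 <= (real q + 2) * h" using h by simp
   thus ?case using bk_gap[of j] Suc by (cases "i = j") auto
  qed simp
  \<comment> \<open>\<open>y\<close> is half way between two outer angles; \<open>s\<close> is the inner midpoint next to \<open>J y\<close>, and moving there changes \<open>K\<close> by much less than \<open>h\<close>\<close>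
  define y where "y = thu n k0 + h / 2"
  have y: "tip <= y" "y <= pi"
  proof -
   have "y <= thu n (k0 + 1)" unfolding thk y_def using h by simp
   also have "... <= pi" using theta_upper_less_pi[of "k0 + 1" n] outer[of 1] by (auto simp: outer_node_def intro: less_imp_le)
   finally show "y <= pi" .
   show "tip <= y" using k0(1) Kb h unfolding y_def by linarith
  qed
  define t where "t = J y"
  note Jt = J[OF y, folded t_def]
  have t: "bk 1 <= t" "t <= bk 0"
  proof -
   have r: "bk 0 \<in> {0..tip}" "bk 1 \<in> {0..tip}" "t \<in> {0..tip}" using bks[of 0] bks[of 1] b t2 Jt by auto
   show "bk 1 <= t" by (rule K_mono_inv) (use r Jt(3) bks(3)[of 1] thk[of k0 1] h in \<open>auto simp: y_def\<close>)
   show "t <= bk 0" by (rule K_mono_inv) (use r Jt(3) bks(3)[of 0] h in \<open>auto simp: y_def\<close>)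
  qed
  have tb: "\<beta> <= t" "t <= 2 * \<beta>" using t bks[of 0] bks[of 1] by auto
  have "thu n 0 <= t - h" using th0 h1 tb b by linarith
  then obtain j0 where j0: "t - h < thu n j0" "thu n j0 <= t"
   using lattice_above[of n "t - h"] unfolding h_def by auto
  define s where "s = thu n j0 + h / 2"
  have st: "abs (s - t) <= h / 2" using j0 unfolding s_def by linarith
  have sb0: "\<beta> / 2 <= s" "s <= 3 * \<beta>" "0 < s" "s < tip" using st tb h1 b t2 by linarith+
  hence sb: "\<beta> / 2 <= s" "s <= 3 * \<beta>" "0 < s" "s < tip" "s \<in> {0..tip}" by auto
  have mid: "h / 2 <= abs (s - thu n j)" for j
  proof -
   have e: "s - thu n j = h * (real j0 - real j + 1/2)" unfolding s_def using theta_upper_diff[of n j0 j] by (simp add: h_def algebra_simps)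
   have "1/2 <= abs (real j0 - real j + 1/2)"
   proof (cases "j <= j0")
    case False
    hence "real j0 + 1 <= real j" by simp
    thus ?thesis by linarith
   qed simp
   hence "h * (1/2) <= h * abs (real j0 - real j + 1/2)" using h by (intro mult_left_mono) auto
   thus ?thesis unfolding e using h by (simp add: abs_mult)
  qed
  have D1: "DD n s = 1"
  proof -
   have "NN n * (s - thu n j0) / 2 = (h * N) / 4" unfolding s_def N_def by simp
   thus ?thesis unfolding DD_shift[of n s j0] hN by simp
  qed
  have D2: "1/2 <= DD n (K s)"
  proof -
   have "abs (K s - K t) <= 2 * (abs (s - t) * (s + t)^2)" using sb tb t2 b by (intro K_diff(2)) auto
   also have "... <= 2 * (h / 2 * (5 * \<beta>)^2)" using st sb tb b h by (intro mult_left_mono mult_mono power_mono) auto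
   also have "... <= 2 * (h / 2 * (1/8))"
   proof -
    have "(5 * \<beta>)^2 <= (1/80)^2" using b by (intro power_mono) auto
    hence "(5 * \<beta>)^2 <= 1/8" by (simp add: power2_eq_square)
    thus ?thesis using h by (intro mult_left_mono) auto
   qed
   finally have Ks: "abs (K s - y) <= h / 8" unfolding Jt(3) by simp
   obtain k where k: "3/8 * h <= abs (K s - thu n k)" "abs (K s - thu n k) <= h / 2"
   proof (cases "K s <= y")
    case True
    have "3/8 * h <= abs (K s - thu n k0)" "abs (K s - thu n k0) <= h / 2" using Ks True h unfolding y_def by linarith+
    thus ?thesis by (rule that)
   next
    case False
    have "3/8 * h <= abs (K s - thu n (k0 + 1))" "abs (K s - thu n (k0 + 1)) <= h / 2" using Ks False h unfolding y_def thk by simp_all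
    thus ?thesis by (rule that)
   qed
   have "abs (K s - thu n k) <= pi / NN n" using k(2) unfolding gap_pi h_def by simp
   hence "NN n / 4 * abs (K s - thu n k) <= DD n (K s)" by (rule DD_lower)
   moreover have "N / 4 * (3/8 * h) <= N / 4 * abs (K s - thu n k)" using k(1) N1 by (intro mult_left_mono) auto
   moreover have "N / 4 * (3/8 * h) = 3/32 * (h * N)" by simp
   ultimately have "3/32 * (2 * pi) <= DD n (K s)" unfolding hN[symmetric] N_def by linarith
   thus ?thesis using pi_gt3 by linarith
  qed
  have W: "cc / 2 <= wst n s"
  proof -
   have far: "s + gap n / 2 <= hl n P \<or> hu n P + gap n / 2 <= s" if "P \<in> pairs n" for P
   proof -
    have P': "(fst P, snd P) \<in> pairs n" using that by simp
    have "raw n (fst P) = thu n (fst P)" by (rule raw_inner[OF pairs_facts(3)[OF that]])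
    hence "thu n (fst P) - gap n <= hl n P" "hu n P <= thu n (fst P) + gap n"
     using hull_facts(6,7)[OF P'] by simp_all
    thus ?thesis using mid[of "fst P"] unfolding h_def by linarith
   qed
   have "1 <= NN n * s"
   proof -
    have "1 * h <= 2 * s" using sb h1 b by simp
    hence "N * h <= N * (2 * s)" using N1 by (intro mult_left_mono) auto
    thus ?thesis using hN pi_gt3 unfolding N_def by (simp add: mult.commute)
   qed
   from node_prod_lower[OF sb(3,4) this] have "1 * (1/2) / 14112 <= node_prod n s" using D2 unfolding D1 by simp
   hence "exp (-17606) * (1 * (1/2) / 14112) <= exp (-17606) * node_prod n s" by (intro mult_left_mono) auto
   also have "... <= wst n s" by (rule wst_lower_far[OF sb(5) far])
   finally show ?thesis by (simp add: cc_def)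
  qed
  \<comment> \<open>\<open>jj i + m\<close> is the index of the \<open>m\<close>-th inner node after the first one to the right of \<open>bk i\<close>\<close>
  have "\<exists>j. bk i < thu n j \<and> thu n j <= bk i + h" if "i \<in> {1..q}" for i
  proof -
   have "thu n 0 <= bk i" using bks(1)[of i] that th0 h1 b by auto
   from lattice_above[OF this] show ?thesis unfolding h_def by metis
  qed
  then obtain jj where jj: "\<And>i. i \<in> {1..q} ==> bk i < thu n (jj i) \<and> thu n (jj i) <= bk i + h" by metis
  define id where "id = (%(i,m). jj i + m)"
  have node: "inner_node n (jj i + m)" "free n (jj i + m)" "lo_idx n <= jj i + m"
    "bk i + real m * h < thu n (jj i + m)" "thu n (jj i + m) <= bk i + (real m + 1) * h"
    "thu n (jj i + m) <= 3 * \<beta>"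
   if i: "i \<in> {1..q}" and m: "m \<in> {1..q}" for i m
  proof -
   have i': "i <= q + 1" "i - 1 <= q + 1" "i - 1 < i" using i by auto
   show w: "bk i + real m * h < thu n (jj i + m)" "thu n (jj i + m) <= bk i + (real m + 1) * h"
    unfolding thk using jj[OF i] by (auto simp: distrib_right)
   have "(real m + 1) * h <= (real q + 1) * h" using m h by (intro mult_right_mono) auto
   hence w2: "thu n (jj i + m) <= bk i + (real q + 1) * h" using w by linarith
   have "(real q + 1) * h <= 2 * Q * h" using Q h unfolding Q_def by (intro mult_right_mono) auto
   thus w3: "thu n (jj i + m) <= 3 * \<beta>" using w2 hq1 bks(2)[OF i'(1)] b by linarith
   hence lt: "thu n (jj i + m) < tip" using t2 by linarith
   show inn: "inner_node n (jj i + m)" using index_bound[of n "jj i + m"] lt tip_bounds by (auto simp: inner_node_def)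
   show "lo_idx n <= jj i + m" using m lo_le[of n] by auto
   have mh: "h <= real m * h" using m h by simp
   have sep: "gap n <= abs (thu n (jj i + m) - raw n l)" if l: "outer_node n l" for l
   proof -
    note of = outer_facts[OF l]
    have r: "raw n l \<in> {0..tip}" "bk i \<in> {0..tip}" "bk (i - 1) \<in> {0..tip}" using of(1,2) bks[OF i'(1)] bks[OF i'(2)] b t2 by auto
    show ?thesis
    proof (cases "k0 + i <= l")
     case True
     have "thu n (k0 + i) <= thu n l" using True theta_upper_diff[of n l "k0 + i"] g by (smt (verit) mult_nonneg_nonneg of_nat_mono)
     hence "K (bk i) <= K (raw n l)" unfolding of(3) bks(3)[OF i'(1)] .
     from K_mono_inv[OF r(2,1) this] have "raw n l <= bk i" .
     thus ?thesis using w(1) mh h unfolding h_def by linarith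
    next
     case False
     hence "l <= k0 + (i - 1)" using i by auto
     hence "thu n l <= thu n (k0 + (i - 1))" using theta_upper_diff[of n "k0 + (i - 1)" l] g by (smt (verit) mult_nonneg_nonneg of_nat_mono)
     hence "K (raw n l) <= K (bk (i - 1))" unfolding of(3) bks(3)[OF i'(2)] .
     from K_mono_inv[OF r(1,3) this] have "bk (i - 1) <= raw n l" .
     moreover have "bk i + (real q + 2) * h <= bk (i - 1)" by (rule bk_mono[OF i'(3,1)])
     ultimately have "thu n (jj i + m) + h <= raw n l" using w2 by (simp add: distrib_right)
     thus ?thesis using h unfolding h_def by linarith
    qed
   qed
   show "free n (jj i + m)"
   proof (unfold free_def, intro allI conjI notI)
    fix l assume "matched n l (jj i + m)"
    thus False using inn not_inner_outer by (auto simp: matched_def)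
   next
    fix l assume "matched n (jj i + m) l"
    hence "outer_node n l" "abs (raw n (jj i + m) - raw n l) < gap n" by (auto simp: matched_def)
    thus False using sep[of l] raw_inner[OF inn] by simp
   qed
  qed
  have inj: "inj_on id ({1..q} \<times> {1..q})"
  proof (rule inj_onI, clarify)
   fix i m i' m' assume a: "i \<in> {1..q}" "m \<in> {1..q}" "i' \<in> {1..q}" "m' \<in> {1..q}" "id (i, m) = id (i', m')"
   hence e: "jj i + m = jj i' + m'" by (simp add: id_def)
   have sub: "(real m + 1) * h <= (real q + 2) * h" "(real m' + 1) * h <= (real q + 2) * h" "0 <= real m * h" "0 <= real m' * h"
    using a h by (auto intro!: mult_right_mono)
   note n1 = node(4,5)[OF a(1,2)] and n2 = node(4,5)[OF a(3,4)]
   have "\<not> i < i'" using bk_mono[of i i'] a n1 n2 sub unfolding e by auto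
   moreover have "\<not> i' < i" using bk_mono[of i' i] a n1 n2 sub unfolding e by auto
   ultimately have "i = i'" by simp
   thus "i = i' \<and> m = m'" using e by simp
  qed
  have trm: "c / (real i * real m) <= norm (lag n (fej n) (jj i + m) (arm s))"
   if i: "i \<in> {1..q}" and m: "m \<in> {1..q}" for i m
  proof -
   define j where "j = jj i + m"
   define p where "p = thu n j"
   note nd = node[OF i m, folded j_def, folded p_def]
   have i': "i <= q + 1" using i by simp
   have j1: "j <= n div 2" using nd(1) by (simp add: inner_node_def)
   have pr: "p = raw n j" unfolding p_def raw_inner[OF nd(1)] ..
   have pa: "adj n j = p" unfolding pr by (rule adjusted_free[OF j1 nd(2)])
   have im: "1 <= real i" "1 <= real m" "real m <= Q" "real i <= Q" using i m by (auto simp: Q_def)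
   have mh: "0 <= real m * h" using h by simp
   have pb: "\<beta> <= p" "p <= 3 * \<beta>" "0 < p" "p < tip" using nd(4,6) bks(1)[OF i'] mh b t2 by auto
   have pin: "p \<in> {0..tip}" "bk i \<in> {0..tip}" "t \<in> {0..tip}" using pb bks[OF i'] tb b t2 by auto
   have rp: "0 < rho p" using pb tip_bounds by (intro rho_pos) auto
   \<comment> \<open>the contraction of \<open>K\<close> turns \<open>i\<close> outer steps into a distance of order \<open>i * h / \<beta>^2\<close>, which dominates the \<open>m + 1\<close> inner steps\<close>
   have dist: "abs (s - p) * \<beta>^2 <= 164 * (real i * h)"
   proof -
    have "abs (K t - K (bk i)) <= real i * h"
    proof -
     have "K t - K (bk i) = h / 2 - real i * h" unfolding Jt(3) y_def bks(3)[OF i'] thk by simp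
     moreover have "1 * h <= real i * h" using im h by (intro mult_right_mono) auto
     ultimately show ?thesis using h by simp
    qed
    moreover have "abs (t - bk i) * (t + bk i)^2 / 648 <= abs (K t - K (bk i))" by (rule K_diff(3)[OF pin(2,3)])
    moreover have "abs (t - bk i) * (2 * \<beta>)^2 / 648 <= abs (t - bk i) * (t + bk i)^2 / 648"
     using tb bks[OF i'] b by (intro divide_right_mono mult_left_mono power_mono) auto
    ultimately have 1: "abs (t - bk i) * \<beta>^2 <= 162 * (real i * h)" by (simp add: power_mult_distrib)
    have 2: "abs (s - t) * \<beta>^2 + abs (bk i - p) * \<beta>^2 <= 2 * (real i * h)"
    proof -
     have "abs (s - t) + abs (bk i - p) <= h / 2 + (real m + 1) * h" using st nd(4,5) mh by linarith
     also have "... = (real m + 3/2) * h" by (simp add: distrib_right)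
     also have "... <= (2 * Q) * h" using im Q h by (intro mult_right_mono) auto
     finally have "(abs (s - t) + abs (bk i - p)) * \<beta>^2 <= (2 * Q) * h * \<beta>^2" by (intro mult_right_mono) auto
     also have "... = 2 * h * \<beta> * (\<beta> * Q)" by (simp add: power2_eq_square)
     also have "... = 20 * h * \<beta>" unfolding bQ by simp
     also have "... <= 20 * h * (1/400)" using b h by (intro mult_left_mono) auto
     also have "... <= 2 * (1 * h)" using h by simp
     also have "... <= 2 * (real i * h)" using im h by (intro mult_left_mono mult_right_mono) auto
     finally show ?thesis by (simp add: distrib_right)
    qed
    have "abs (s - p) * \<beta>^2 <= (abs (s - t) + abs (t - bk i) + abs (bk i - p)) * \<beta>^2" by (intro mult_right_mono) auto
    thus ?thesis using 1 2 by (simp add: distrib_right)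
   qed
   \<comment> \<open>the outer angle of \<open>p\<close> misses the lattice by at most order \<open>m * h * \<beta>^2\<close>\<close>
   have vup: "vv n j p * mu p <= CV * (N^2 * ((real m + 1) * h) * (6 * \<beta>)^2)"
   proof -
    have "vv n j p * mu p * 1 <= vv n j p * mu p * (tip - p)"
     using pb b tip_bounds rp vv_nonneg by (intro mult_left_mono mult_nonneg_nonneg) (auto simp: mu_def)
    also have "... <= CV * (N * DD n (K p))" using vv_inner_upper[OF nd(1,3,2) pr pb(4)] unfolding CV_def N_def by (simp add: mult.assoc)
    also have "... <= CV * (N * (N * ((real m + 1) * h * (6 * \<beta>)^2)))"
    proof -
     have "DD n (K p) <= N / 2 * abs (K p - K (bk i))" unfolding bks(3)[OF i'] N_def by (rule DD_upper)
     also have "... <= N / 2 * (2 * (abs (p - bk i) * (p + bk i)^2))" using N1 by (intro mult_left_mono K_diff(2)[OF pin(2,1)]) auto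
     also have "... = N * (abs (p - bk i) * (p + bk i)^2)" by simp
     also have "... <= N * ((real m + 1) * h * (6 * \<beta>)^2)"
      using nd(4,5) mh N1 pb bks[OF i'] b by (intro mult_left_mono mult_mono power_mono) auto
     finally show ?thesis using CV N1 by (intro mult_left_mono) auto
    qed
    finally show ?thesis by (simp add: power2_eq_square mult_ac)
   qed
   have r1: "abs (rho s - rho p) * rho p <= 8 * 3 * (abs (s - p) * (6 * \<beta>)^2)"
   proof -
    have "abs (rho s - rho p) * rho p <= abs (rho s - rho p) * (rho s + rho p)" using rho_ge_0[OF sb(5)] by (intro mult_left_mono) auto
    also have "... <= 4 * (abs (s - p) * (s + p)^2 * (2*tip - s - p))" by (rule rho_diff_upper[OF sb(5) pin(1)])
    also have "... <= 4 * (abs (s - p) * (6 * \<beta>)^2 * 6)" using sb pb tip_bounds b by (intro mult_left_mono mult_mono power_mono) auto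
    finally show ?thesis by simp
   qed
   have "abs (rho s - rho p) * vv n j p * p^2 = (abs (rho s - rho p) * rho p) * (vv n j p * mu p)" unfolding mu_def using rp by simp
   also have "... <= (8 * 3 * (abs (s - p) * (6 * \<beta>)^2)) * (CV * (N^2 * ((real m + 1) * h) * (6 * \<beta>)^2))"
    by (rule mult_mono[OF r1 vup]) (use rp vv_nonneg in \<open>auto simp: mu_def intro!: mult_nonneg_nonneg divide_nonneg_nonneg\<close>)
   also have "... = (CV * 8 * 3 * 36 * 36) * (abs (s - p) * \<beta>^2) * (N^2 * ((real m + 1) * h)) * \<beta>^2" by (simp add: power_mult_distrib)
   also have "... <= (CV * 8 * 3 * 36 * 36) * (164 * (real i * h)) * (N^2 * ((real m + 1) * h)) * \<beta>^2"
    using dist CV h by (intro mult_right_mono mult_left_mono) auto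
   also have "... = (CV * 8 * 3 * 36 * 36 * 164) * (h * N)^2 * (real i * (real m + 1)) * \<beta>^2" by (simp add: power2_eq_square)
   also have "... <= (CV * 8 * 3 * 36 * 36 * 164) * 50 * (real i * (2 * real m)) * \<beta>^2"
   proof -
    have "(2 * pi)^2 <= 7^2" using pi_approx by (intro power_mono) auto
    hence "(h * N)^2 <= 50" unfolding hN by simp
    thus ?thesis using CV im by (intro mult_right_mono mult_mono mult_left_mono) auto
   qed
   finally have "abs (rho s - rho p) * vv n j p * p^2 <= (CV * 8 * 3 * 36 * 36 * 164 * 50 * 2) * (real i * real m) * \<beta>^2" by (simp add: mult_ac)
   also have "... <= (CV * 8 * 3 * 36 * 36 * 164 * 50 * 2) * (real i * real m) * p^2"
    using pb b CV im by (intro mult_left_mono power_mono mult_nonneg_nonneg) auto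
   finally have den: "abs (rho s - rho p) * vv n j p <= (CV * 8 * 3 * 36 * 36 * 164 * 50 * 2) * (real i * real m)"
    using pb by (simp only: mult_le_cancel_right) simp
   have ps: "p ~= s" using mid[of j] h unfolding p_def by auto
   have E: "0 < abs (rho s - rho p)" using rho_inj[OF pin(1) sb(5)] ps by auto
   have w: "wst n s = abs (rho s - rho p) * vv n j s" using vv_wst[OF sb(5) j1] unfolding pa .
   have vp: "0 < vv n j p"
   proof -
    have e: "vv n j p = (\<Prod>l\<in>{..n} - {j}. norm (fej n j - fej n l))"
     using prod_others[OF j1 pin(1)] adjusted_fejer_upper[OF j1] pa by simp
    have "j <= n" using j1 div_le_dividend[of n 2] by linarith
    hence "fej n j ~= fej n l" if "l \<in> {..n} - {j}" for l
     using inj_onD[OF adjusted_fejer_inj[of n], of j l] that j1 by auto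
    thus ?thesis unfolding e by (intro prod_pos) simp
   qed
   have "c / (real i * real m) = cc / 2 / ((CV * 8 * 3 * 36 * 36 * 164 * 50 * 2) * (real i * real m))" by (simp add: c_def)
   also have "... <= cc / 2 / (abs (rho s - rho p) * vv n j p)" using den E vp cc_pos CV im by (intro divide_left_mono mult_pos_pos) auto
   also have "... <= wst n s / (abs (rho s - rho p) * vv n j p)" using W E vp by (intro divide_right_mono) auto
   also have "... = vv n j s / vv n j p" unfolding w using E by simp
   also have "... = norm (lag n (fej n) j (arm s))" unfolding norm_lag_upper[OF j1 sb(5)] pa ..
   finally show ?thesis unfolding j_def .
  qed
  have "c * (\<Sum>i\<in>{1..q}. 1 / real i)^2 = (\<Sum>i\<in>{1..q}. \<Sum>m\<in>{1..q}. c / (real i * real m))"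
   unfolding power2_eq_square sum_product by (simp add: sum_distrib_left)
  also have "... = (\<Sum>(i,m)\<in>{1..q} \<times> {1..q}. c / (real i * real m))" by (rule sum.cartesian_product)
  also have "... <= (\<Sum>x\<in>{1..q} \<times> {1..q}. norm (lag n (fej n) (id x) (arm s)))"
   using trm by (intro sum_mono) (auto simp: id_def)
  also have "... = (\<Sum>j\<in>id ` ({1..q} \<times> {1..q}). norm (lag n (fej n) j (arm s)))" using inj by (simp add: sum.reindex)
  also have "... <= Lam n (arm s)" unfolding Lam_def
  proof (rule sum_mono2)
   show "id ` ({1..q} \<times> {1..q}) \<subseteq> {..n}"
   proof
    fix j assume "j \<in> id ` ({1..q} \<times> {1..q})"
    then obtain i m where "i \<in> {1..q}" "m \<in> {1..q}" "j = jj i + m" by (auto simp: id_def)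
    thus "j \<in> {..n}" using node(1)[of i m] by (auto simp: inner_node_def)
   qed
  qed auto
  finally show ?thesis using sb(5) by blast
 qed
 thus ?thesis using c by blast
qed

section \<open>The two-sided estimate\<close>

lemma harmonic_ge: "ln (real q + 1) <= (\<Sum>i\<in>{1..q}. 1 / real i)"
proof (induction q)
 case (Suc q)
 have "ln ((real q + 2) / (real q + 1)) <= (real q + 2) / (real q + 1) - 1" by (rule ln_le_minus_one) simp
 also have "... = 1 / (real q + 1)" by (simp add: field_simps)
 finally have "ln (real q + 2) - ln (real q + 1) <= 1 / (real q + 1)" by (simp add: ln_divide_pos)
 thus ?case using Suc by (simp add: add_ac)
qed simp

lemma compact_gamma0: "compact gamma0"
proof -
 have c: "compact (arm ` {0..tip})" by (rule compact_continuous_image[OF continuous_on_arm]) simp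
 have "continuous_on (arm ` {0..tip}) cnj" by (intro continuous_intros)
 from compact_Un[OF c compact_continuous_image[OF this c]] show ?thesis unfolding gamma0_arm .
qed

lemma Lam_ge_1: "1 <= Lam n x"
proof -
 have "1 = norm (\<Sum>k\<le>n. lag n (fej n) k x)" unfolding sum_lag[OF adjusted_fejer_inj] by simp
 also have "... <= Lam n x" unfolding Lam_def by (rule norm_sum)
 finally show ?thesis .
qed

lemma fourth_root: fixes N :: real assumes "0 <= N"
 obtains q :: nat where "real q ^ 4 <= N" "N <= (real q + 1) ^ 4"
proof -
 define r where "r = sqrt (sqrt N)"
 have "r ^ 4 = (r^2)^2" by simp
 hence r: "0 <= r" "r ^ 4 = N" using assms by (simp_all add: r_def)
 define q where "q = nat \<lfloor>r\<rfloor>"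
 have q: "real q <= r" "r <= real q + 1" unfolding q_def using r(1) by linarith+
 have "real q ^ 4 <= r ^ 4" "r ^ 4 <= (real q + 1) ^ 4" using q r by (auto intro: power_mono)
 thus ?thesis using that r by simp
qed

lemma LL_upper: assumes "n \<ge> 2" shows "(LL n)^2 <= 16 * (ln (real n))^2"
proof -
 have n: "2 <= real n" using assms by simp
 have "ln (1/2::real) <= 1/2 - 1" by (rule ln_le_minus_one) simp
 hence "1/2 <= ln (2::real)" by (simp add: ln_divide_pos)
 moreover have "ln 2 <= ln (real n)" using n by simp
 ultimately have 1: "1 <= 2 * ln (real n)" by linarith
 have "2 * real n <= real n * real n" using n by (intro mult_right_mono) auto
 hence "real n + 2 <= real n ^ 2" using n unfolding power2_eq_square by linarith
 hence "ln (real n + 2) <= ln (real n ^ 2)" using n by simp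
 also have "... = 2 * ln (real n)" using n by (simp add: ln_realpow)
 finally have "LL n <= 4 * ln (real n)" using 1 by (simp add: LL_def)
 moreover have "0 <= LL n" using LL_ge[of n] by linarith
 ultimately have "(LL n)^2 <= (4 * ln (real n))^2" by (intro power_mono)
 thus ?thesis by (simp add: power_mult_distrib)
qed

theorem theorem3:
  shows "(\<forall>n. inj_on (adjusted_fejer n) {..n} \<and> adjusted_fejer n ` {..n} \<subseteq> gamma0) \<and>
    (\<exists>c1 c2 :: real. c1 > 0 \<and> c2 > 0 \<and>
       (\<forall>n::nat. n \<ge> 2 \<longrightarrow>
          c1 * (ln (real n))\<^sup>2 \<le> lebesgue_constant gamma0 n (adjusted_fejer n) \<and>
          lebesgue_constant gamma0 n (adjusted_fejer n) \<le> c2 * (ln (real n))\<^sup>2))"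
proof
 show "\<forall>n. inj_on (fej n) {..n} \<and> fej n ` {..n} \<subseteq> gamma0"
  using adjusted_fejer_inj adjusted_fejer_subset by blast
 obtain C where C: "C > 0" and U: "\<And>n x. n \<ge> 2 ==> x \<in> gamma0 ==> Lam n x <= C * (LL n)^2" using Lam_upper by blast
 obtain c where c: "c > 0" and Lo: "\<And>n q. 4000 <= q ==> real q ^ 4 <= real n + 1 ==>
   \<exists>s\<in>{0..tip}. c * (\<Sum>i\<in>{1..q}. 1 / real i)^2 <= Lam n (arm s)" using Lam_lower_core by blast
 have armg: "arm s \<in> gamma0" if "s \<in> {0..tip}" for s using that unfolding gamma0_arm by blast
 have g0: "gamma0 ~= {}" using armg[of 0] tip_bounds by auto
 have up: "lebesgue_constant gamma0 n (fej n) <= C * (LL n)^2" if "n \<ge> 2" for n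
  by (rule lebesgue_upper[OF compact_gamma0 g0 adjusted_fejer_inj adjusted_fejer_subset])
    (use U[OF that] in \<open>simp add: Lam_def\<close>)
 have low: "Lam n x <= lebesgue_constant gamma0 n (fej n)" if "n \<ge> 2" "x \<in> gamma0" for n x
  unfolding Lam_def
  by (rule lebesgue_lower[OF compact_gamma0 that(2) adjusted_fejer_inj adjusted_fejer_subset])
    (use U[OF that(1)] in \<open>simp add: Lam_def\<close>)
 define D :: real where "D = 4 * ln 4001"
 have D: "D > 0" by (simp add: D_def)
 define c1 where "c1 = min (c / 16) (1 / D^2)"
 have c1: "c1 > 0" "c1 <= c / 16" "c1 <= 1 / D^2" using c D by (auto simp: c1_def)
 have lower: "c1 * (ln (real n))^2 <= lebesgue_constant gamma0 n (fej n)" if n: "n \<ge> 2" for n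
 proof -
  obtain q where q: "real q ^ 4 <= real n + 1" "real n + 1 <= (real q + 1)^4" using fourth_root[of "real n + 1"] by auto
  have n0: "0 <= ln (real n)" using n by simp
  have "ln (real n) <= ln (real n + 1)" using n by simp
  also have "... <= ln ((real q + 1)^4)" using q(2) by simp
  also have "... = 4 * ln (real q + 1)" by (simp add: ln_realpow)
  finally have l: "ln (real n) <= 4 * ln (real q + 1)" .
  show ?thesis
  proof (cases "4000 <= q")
   case True
   obtain s where s: "s \<in> {0..tip}" "c * (\<Sum>i\<in>{1..q}. 1 / real i)^2 <= Lam n (arm s)" using Lo[OF True q(1)] by blast
   have "(ln (real n))^2 <= (4 * ln (real q + 1))^2" using l n0 by (intro power_mono)
   hence "(ln (real n))^2 <= 16 * (ln (real q + 1))^2" by (simp add: power_mult_distrib)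
   also have "(ln (real q + 1))^2 <= (\<Sum>i\<in>{1..q}. 1 / real i)^2" by (intro power_mono harmonic_ge) simp
   finally have "c / 16 * (ln (real n))^2 <= c / 16 * (16 * (\<Sum>i\<in>{1..q}. 1 / real i)^2)" using c by (intro mult_left_mono) auto
   moreover have "c1 * (ln (real n))^2 <= c / 16 * (ln (real n))^2" using c1 by (intro mult_right_mono) auto
   ultimately have "c1 * (ln (real n))^2 <= c * (\<Sum>i\<in>{1..q}. 1 / real i)^2" by linarith
   also have "... <= lebesgue_constant gamma0 n (fej n)" using s low[OF n armg[OF s(1)]] by linarith
   finally show ?thesis .
  next
   case False
   hence "real q + 1 <= 4001" by simp
   hence "ln (real q + 1) <= ln 4001" by simp
   hence "ln (real n) <= D" using l unfolding D_def by linarith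
   hence "(ln (real n))^2 <= D^2" using n0 by (rule power_mono)
   hence "c1 * (ln (real n))^2 <= 1 / D^2 * D^2" using c1 by (intro mult_mono) auto
   also have "... = 1" using D by simp
   also have "1 <= lebesgue_constant gamma0 n (fej n)"
    using Lam_ge_1[of n "arm 0"] low[OF n armg[of 0]] tip_bounds by simp
   finally show ?thesis .
  qed
 qed
 have "lebesgue_constant gamma0 n (fej n) <= 16 * C * (ln (real n))^2" if n: "n \<ge> 2" for n
 proof -
  have "C * (LL n)^2 <= C * (16 * (ln (real n))^2)" using C LL_upper[OF n] by (intro mult_left_mono) auto
  thus ?thesis using up[OF n] by simp
 qed
 thus "\<exists>c1 c2 :: real. c1 > 0 \<and> c2 > 0 \<and>
    (\<forall>n::nat. n \<ge> 2 -->
     c1 * (ln (real n))\<^sup>2 <= lebesgue_constant gamma0 n (fej n) \<and>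
     lebesgue_constant gamma0 n (fej n) <= c2 * (ln (real n))\<^sup>2)"
  using c1(1) C lower by (intro exI[of _ c1] exI[of _ "16 * C"]) auto
qed

end
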